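(* Fix a positive integer $m$ and let $\mathcal{C}=\{C_{(\pi,f_0,s)}\}$ be the hidden shift circuit family. Then for each $C_{(\pi,f_0,s)}\in\mathcal{C}$, the path-sum 1-qubit measurement simulation algorithm simulates $C_{(\pi,f_0,s)}$ on input $|00\cdots0\rangle$ in time $\mathrm{poly}(|C_{(\pi,f_0,s)}|)$, where $|C|$ denotes the volume of $C$.
   Context: **Hidden shift circuits.** $m$ is a fixed positive integer. $C^{(k)}Z$ denotes the $Z$ gate with $k$ controls. Let $\pi\in\mathcal{S}_n$, acting on $\mathbb{F}_2^n$ by permuting bits, $f_0:\mathbb{F}_2^n\to\mathbb{F}_2$, and $s=s_1s_2\in\mathbb{F}_2^{2n}$ with $s_1,s_2\in\mathbb{F}_2^n$. A hidden shift circuit $C_{(\pi,f_0,s)}$ is any circuit on $2n$ qubits of the form: $H$ on every qubit, then $O_G$, then $H$ on every qubit, then $O_F$, then $H$ on every qubit, where $O_G:|x,y\rangle\mapsto(-1)^{\langle x+s_1,\pi(y+s_2)\rangle+f_0(y+s_2)}|x,y\rangle$ and $O_F:|x,y\rangle\mapsto(-1)^{\langle x,\pi(y)\rangle+f_0(\pi^{-1}(x))}|x,y\rangle$ ($x,y\in\mathbb{F}_2^n$) are implemented over the gate set $\{X,\mathrm{SWAP},Z,CZ,\dots,C^{(m)}Z\}$ (in particular $\deg f_0\le m+1$). The volume $|C|$ of a circuit is (number of qubits)$\times$(number of gates). Its output on $|0\cdots0\rangle$ is $|s\rangle$. **Path sums.** For a finite set $V$ of indeterminates, $I_V\subseteq\mathbb{F}_2[V]$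 is generated by $v^2-v$, $v\in V$; elements of $\mathbb{F}_2[V]/I_V$ are represented by multilinear polynomials, and $\mathrm{Var}$ is the set of occurring variables. A path sum is an expression $A=s_A\sum_{V_A}(-1)^{P_A}|O_A\rangle\langle I_A|$ with $V_A$ a finite set of indeterminates, $s_A\in\mathbb{C}$, and $P_A$ and the entries of the tuples $O_A=(O_{A,1},\dots,O_{A,p})$, $I_A=(I_{A,1},\dots,I_{A,q})$ in $\mathbb{F}_2[V_A]/I_{V_A}$; its signature is $q\to p$. $eval(A)=s_A\sum_{v\in\mathbb{F}_2^{V_A}}(-1)^{P_A(v)}|O_A(v)\rangle\langle I_A(v)|$. With variable sets made disjoint: for $A:p\to q$, $B:r\to p$, $A\circ B=\frac{s_As_B}{2^p}\sum_{V_A\cup V_B\cup\{y_1,\dots,y_p\}}(-1)^{P_A+P_B+\sum_iy_i(O_{B,i}+I_{A,i})}|O_A\rangle\langle I_B|$ with fresh $y_i$; $A\otimes B=s_As_B\sum_{V_A\cup V_B}(-1)^{P_A+P_B}|O_AO_B\rangle\langle I_AI_B|$; $I_k=\sum_{\{y_1,\dots,y_k\}}(-1)^0|y_1,\dots,y_k\rangle\langle y_1,\dots,y_k|$; $A^\dagger=s_A^*\sum_{V_A}(-1)^{P_A}|I_A\rangle\langle O_A|$. Basis states $|x\rangle$, $\langle x|$ and $|1\rangle\langle1|$ are path sums with empty variable set. Gates are interpreted by $[\![H]\!]=\frac1{\sqrt2}\sum_{\{x,y\}}(-1)^{xy}|y\rangle\langle x|$, $[\![X]\!]=\sum_{\{x\}}|x+1\rangle\langle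 x|$, $[\![\mathrm{SWAP}]\!]=\sum_{\{x,y\}}|y,x\rangle\langle x,y|$, $[\![C^{(k)}Z]\!]=\sum_{\{x_1,\dots,x_k,y\}}(-1)^{yx_1\cdots x_k}|x_1,\dots,x_k,y\rangle\langle x_1,\dots,x_k,y|$, and $[\![C]\!]$ is obtained by composing and tensoring gate interpretations. **Rewrite system** $\rightarrow$ (union of three rules): (Elim) if $x\in V\setminus\mathrm{Var}(P,O,I)$: $s\sum_V(-1)^P|O\rangle\langle I|\rightarrow2s\sum_{V\setminus\{x\}}(-1)^P|O\rangle\langle I|$. (Z) if $z\in V\setminus\mathrm{Var}(R,O,I)$: $s\sum_V(-1)^{z+R}|O\rangle\langle I|\rightarrow0\sum_\emptyset(-1)^0|0,\dots,0\rangle\langle0,\dots,0|$ (same signature). (HH) if $x,y\in V$ distinct, $x\notin\mathrm{Var}(Q,R,O,I)$, $y\notin\mathrm{Var}(Q)$, $|\mathrm{Var}(Q)|\le1$: $s\sum_V(-1)^{x(y+Q)+R}|O\rangle\langle I|\rightarrow(s\sum_{V\setminus\{x\}}(-1)^R|O\rangle\langle I|)[y\leftarrow Q]$, substituting $Q$ for $y$ in all polynomials. **1-qubit measurement simulation algorithm.** Input: a circuit $C$ on $N$ qubits, $x\in\mathbb{F}_2^N$, and $i\in\{1,\dots,N\}$. Set $g:=[\![C]\!]\circ|x_1,\dots,x_N\rangle$ and $f:=g^\dagger\circ(I_{i-1}\otimes|1\rangle\langle1|\otimes I_{N-i})\circ g$. While $f\rightarrow f'$ for some $f'$, replace $f$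 by such an $f'$ (an arbitrary choice). Return $eval(f)$ (the probability that measuring qubit $i$ of $C|x\rangle$ gives $1$). Simulating a hidden shift circuit $C_{(\pi,f_0,s)}$ with this algorithm means running it on $(C_{(\pi,f_0,s)},0\cdots0,i)$ for each qubit index $i$ to build the shift $s$ bit by bit. *)

theory Defs
  imports
    Complex_Main
    "HOL-Library.Z2"
    "HOL-Library.FuncSet"
    "HOL-Library.Monad_Syntax"
    "HOL-Computational_Algebra.Polynomial"
    "HOL-Combinatorics.Permutations"
begin

section \<open>Multilinear polynomials over the field with two elements\<close>

text \<open>
  Indeterminates are natural numbers.  An element of \<open>F_2[V]/I_V\<close> is identified with its
  multilinear representative, i.e. with the set of its monomials; a monomial is the set of its
  variables.  So \<open>{}\<close> is the polynomial 0 and \<open>{{}}\<close> is the polynomial 1.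
\<close>

type_synonym mpoly2 = "nat set set"

definition pvar :: "nat \<Rightarrow> mpoly2" where
  "pvar x = {{x}}"

definition pconst :: "bit \<Rightarrow> mpoly2" where
  "pconst b = (if b = 1 then {{}} else {})"

definition padd :: "mpoly2 \<Rightarrow> mpoly2 \<Rightarrow> mpoly2" where
  "padd p q = sym_diff p q"

text \<open>The product of two monomials is their union because \<open>v^2 = v\<close>; coefficients are counted modulo 2.\<close>

definition pmul :: "mpoly2 \<Rightarrow> mpoly2 \<Rightarrow> mpoly2" where
  "pmul p q = {u. odd (card {(a, b). a \<in> p \<and> b \<in> q \<and> a \<union> b = u})}"

definition psum_list :: "mpoly2 list \<Rightarrow> mpoly2" where
  "psum_list ps = foldr padd ps {}"

text \<open>Writing \<open>P = P0 + y * P1\<close> with \<open>y\<close> in neither \<open>P0\<close> nor \<open>P1\<close>, the substitution yields \<open>P0 + Q * P1\<close>.\<close>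

definition psubst :: "nat \<Rightarrow> mpoly2 \<Rightarrow> mpoly2 \<Rightarrow> mpoly2" where
  "psubst y Q P = padd {u \<in> P. y \<notin> u} (pmul Q ((\<lambda>u. u - {y}) ` {u \<in> P. y \<in> u}))"

definition Vars :: "mpoly2 list \<Rightarrow> nat set" where
  "Vars ps = \<Union> (\<Union> (set ps))"

definition peval :: "mpoly2 \<Rightarrow> (nat \<Rightarrow> bit) \<Rightarrow> bit" where
  "peval p v = (\<Sum>u\<in>p. \<Prod>x\<in>u. v x)"

definition sgn2 :: "bit \<Rightarrow> complex" where
  "sgn2 b = (if b = 1 then -1 else 1)"

section \<open>Path sums\<close>

text \<open>
  The type parameters are the types of variable sets and of polynomials: path sums proper use
  sets, the programs further below use lists.
\<close>

datatype ('v, 'p) psum =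
  PSum (vars: 'v) (scal: complex) (phase: 'p) (outs: "'p list") (ins: "'p list")

type_synonym path_sum = "(nat set, mpoly2) psum"

text \<open>The matrix entry of the denoted operator in column \<open>a\<close> and row \<open>b\<close>.\<close>

definition eval :: "path_sum \<Rightarrow> bit list \<Rightarrow> bit list \<Rightarrow> complex" where
  "eval A a b =
     scal A * (\<Sum>v\<in>vars A \<rightarrow>\<^sub>E UNIV.
       if map (\<lambda>p. peval p v) (outs A) = b \<and> map (\<lambda>p. peval p v) (ins A) = a
       then sgn2 (peval (phase A) v) else 0)"

text \<open>Variable sets are made disjoint by shifting.\<close>

definition fresh :: "nat set \<Rightarrow> nat" where
  "fresh V = Max (insert 0 (Suc ` V))"

definition shift :: "nat \<Rightarrow> path_sum \<Rightarrow> path_sum" where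
  "shift k = map_psum ((`) ((+) k)) ((`) ((`) ((+) k)))"

definition compose :: "path_sum \<Rightarrow> path_sum \<Rightarrow> path_sum" (infixr \<open>\<odot>\<close> 70) where
  "A \<odot> B =
     (let a = fresh (vars A); B' = shift a B; p = length (ins A);
          ys = map (\<lambda>i. a + fresh (vars B) + i) [0..<p]
      in PSum (vars A \<union> vars B' \<union> set ys) (scal A * scal B / 2 ^ p)
           (padd (phase A) (padd (phase B')
             (psum_list (map2 (\<lambda>y. pmul (pvar y)) ys (map2 padd (outs B') (ins A))))))
           (outs A) (ins B'))"

definition tensor :: "path_sum \<Rightarrow> path_sum \<Rightarrow> path_sum" (infixr \<open>\<otimes>\<close> 75) where
  "A \<otimes> B =
     (let B' = shift (fresh (vars A)) B
      in PSum (vars A \<union> vars B') (scal A * scal B) (padd (phase A) (phase B'))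
           (outs A @ outs B') (ins A @ ins B'))"

definition ident :: "nat \<Rightarrow> path_sum" where
  "ident k = PSum {0..<k} 1 {} (map pvar [0..<k]) (map pvar [0..<k])"

definition dagger :: "path_sum \<Rightarrow> path_sum" where
  "dagger A = PSum (vars A) (cnj (scal A)) (phase A) (ins A) (outs A)"

definition ket :: "bit list \<Rightarrow> path_sum" where
  "ket x = PSum {} 1 {} (map pconst x) []"

definition proj1 :: path_sum where
  "proj1 = PSum {} 1 {} [pconst 1] [pconst 1]"

section \<open>Circuits\<close>

text \<open>Qubits are numbered from 0.  \<open>CZGate cs q\<close> is \<open>C^(k)Z\<close> with \<open>k = length cs\<close> controls; \<open>k = 0\<close> is \<open>Z\<close>.\<close>

datatype gate = HGate nat | XGate nat | SwapGate nat nat | CZGate "nat list" nat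

type_synonym circuit = "gate list"

fun wires :: "gate \<Rightarrow> nat list" where
  "wires (HGate q) = [q]"
| "wires (XGate q) = [q]"
| "wires (SwapGate q r) = [q, r]"
| "wires (CZGate cs q) = cs @ [q]"

definition circuit_on :: "nat \<Rightarrow> circuit \<Rightarrow> bool" where
  "circuit_on N C \<longleftrightarrow> (\<forall>g\<in>set C. distinct (wires g) \<and> set (wires g) \<subseteq> {..<N})"

definition volume :: "nat \<Rightarrow> circuit \<Rightarrow> nat" where
  "volume N C = N * length C"

fun gate_psum :: "gate \<Rightarrow> path_sum" where
  "gate_psum (HGate q) = PSum {0, 1} (1 / sqrt 2) (pmul (pvar 0) (pvar 1)) [pvar 1] [pvar 0]"
| "gate_psum (XGate q) = PSum {0} 1 {} [padd (pvar 0) (pconst 1)] [pvar 0]"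
| "gate_psum (SwapGate q r) = PSum {0, 1} 1 {} [pvar 1, pvar 0] [pvar 0, pvar 1]"
| "gate_psum (CZGate cs q) =
     (let k = length cs in PSum {0..<k+1} 1 {{0..<k+1}} (map pvar [0..<k+1]) (map pvar [0..<k+1]))"

text \<open>
  A gate is tensored with identities on the wires it does not touch; the first wires of
  \<open>A \<otimes> ident (N - length ws)\<close> are then placed at the positions \<open>ws\<close> and the others, in order, at
  the remaining positions.
\<close>

definition place :: "nat \<Rightarrow> nat list \<Rightarrow> path_sum \<Rightarrow> path_sum" where
  "place N ws A =
     (let T = A \<otimes> ident (N - length ws);
          pos = ws @ filter (\<lambda>j. j \<notin> set ws) [0..<N];
          arrange = (\<lambda>ps. map (\<lambda>j. the (map_of (zip pos ps) j)) [0..<N])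
      in PSum (vars T) (scal T) (phase T) (arrange (outs T)) (arrange (ins T)))"

definition interp :: "nat \<Rightarrow> circuit \<Rightarrow> path_sum" where
  "interp N C = foldl (\<lambda>A g. place N (wires g) (gate_psum g) \<odot> A) (ident N) C"

section \<open>The rewrite system\<close>

text \<open>\<open>Pow V\<close> is the set of monomials over \<open>V\<close>, so \<open>Q \<subseteq> Pow V\<close> says that \<open>Q\<close> is a polynomial over \<open>V\<close>.\<close>

inductive rw :: "path_sum \<Rightarrow> path_sum \<Rightarrow> bool" (infix \<open>\<leadsto>\<close> 50) where
  Elim: "PSum V s P Os Is \<leadsto> PSum (V - {x}) (2 * s) P Os Is"
    if "x \<in> V" "x \<notin> Vars (P # Os @ Is)"
| Z: "PSum V s (padd (pvar z) R) Os Is \<leadsto> PSum {} 0 {} (map (\<lambda>_. {}) Os) (map (\<lambda>_. {}) Is)"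
    if "z \<in> V" "R \<subseteq> Pow V" "z \<notin> Vars (R # Os @ Is)"
| HH: "PSum V s (padd (pmul (pvar x) (padd (pvar y) Q)) R) Os Is \<leadsto>
       PSum (V - {x}) s (psubst y Q R) (map (psubst y Q) Os) (map (psubst y Q) Is)"
    if "x \<in> V" "y \<in> V" "x \<noteq> y" "Q \<subseteq> Pow V" "R \<subseteq> Pow V"
       "x \<notin> Vars (Q # R # Os @ Is)" "y \<notin> Vars [Q]" "card (Vars [Q]) \<le> 1"

section \<open>Hidden shift circuits\<close>

definition ip :: "bit list \<Rightarrow> bit list \<Rightarrow> bit" where
  "ip x y = sum_list (map2 (*) x y)"

definition vadd :: "bit list \<Rightarrow> bit list \<Rightarrow> bit list" where
  "vadd = map2 (+)"

definition G_phase :: "nat \<Rightarrow> (nat \<Rightarrow> nat) \<Rightarrow> (bit list \<Rightarrow> bit) \<Rightarrow> bit list \<Rightarrow> bit list \<Rightarrow> bit" where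
  "G_phase n \<pi> f0 s z =
     (let x = take n z; y = drop n z; s1 = take n s; s2 = drop n s
      in ip (vadd x s1) (permute_list \<pi> (vadd y s2)) + f0 (vadd y s2))"

definition F_phase :: "nat \<Rightarrow> (nat \<Rightarrow> nat) \<Rightarrow> (bit list \<Rightarrow> bit) \<Rightarrow> bit list \<Rightarrow> bit" where
  "F_phase n \<pi> f0 z =
     (let x = take n z; y = drop n z
      in ip x (permute_list \<pi> y) + f0 (permute_list (inv \<pi>) x))"

fun oracle_gate :: "nat \<Rightarrow> gate \<Rightarrow> bool" where
  "oracle_gate m (HGate q) \<longleftrightarrow> False"
| "oracle_gate m (XGate q) \<longleftrightarrow> True"
| "oracle_gate m (SwapGate q r) \<longleftrightarrow> True"
| "oracle_gate m (CZGate cs q) \<longleftrightarrow> length cs \<le> m"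

text \<open>\<open>C\<close> implements the operator mapping \<open>|z>\<close> to \<open>(-1)^(\<phi> z) |z>\<close>.\<close>

definition implements_phase :: "nat \<Rightarrow> nat \<Rightarrow> (bit list \<Rightarrow> bit) \<Rightarrow> circuit \<Rightarrow> bool" where
  "implements_phase m N \<phi> C \<longleftrightarrow>
     circuit_on N C \<and> (\<forall>g\<in>set C. oracle_gate m g) \<and>
     (\<forall>z z'. length z = N \<longrightarrow> length z' = N \<longrightarrow>
        eval (interp N C) z z' = (if z' = z then sgn2 (\<phi> z) else 0))"

definition H_layer :: "nat \<Rightarrow> circuit \<Rightarrow> bool" where
  "H_layer N C \<longleftrightarrow> (\<exists>qs. distinct qs \<and> set qs = {..<N} \<and> C = map HGate qs)"

definition hidden_shift_circuit ::
    "nat \<Rightarrow> nat \<Rightarrow> (nat \<Rightarrow> nat) \<Rightarrow> (bit list \<Rightarrow> bit) \<Rightarrow> bit list \<Rightarrow> circuit \<Rightarrow> bool" where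
  "hidden_shift_circuit m n \<pi> f0 s C \<longleftrightarrow>
     \<pi> permutes {..<n} \<and> length s = 2 * n \<and>
     (\<exists>L1 CG L2 CF L3. C = L1 @ CG @ L2 @ CF @ L3 \<and>
        H_layer (2 * n) L1 \<and> H_layer (2 * n) L2 \<and> H_layer (2 * n) L3 \<and>
        implements_phase m (2 * n) (G_phase n \<pi> f0 s) CG \<and>
        implements_phase m (2 * n) (F_phase n \<pi> f0) CF)"

section \<open>The measurement path sum\<close>

definition output_psum :: "nat \<Rightarrow> circuit \<Rightarrow> bit list \<Rightarrow> path_sum" where
  "output_psum N C x = interp N C \<odot> ket x"

definition measurement_psum :: "nat \<Rightarrow> circuit \<Rightarrow> bit list \<Rightarrow> nat \<Rightarrow> path_sum" where
  "measurement_psum N C x i =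
     (let g = output_psum N C x
      in dagger g \<odot> (ident i \<otimes> proj1 \<otimes> ident (N - i - 1)) \<odot> g)"

section \<open>Step-counting programs\<close>

text \<open>
  The steps of the algorithm are implemented by list programs.  Monomials are
  duplicate-free lists of variables, polynomials are lists of pairwise distinct monomials.  Every
  call of a program costs one step; as usual for the unit-cost model, constructors and single
  arithmetic operations or comparisons on variable names, bits and scalars are free.
\<close>

datatype 'a timed = Timed (result: 'a) (time: nat)

definition ret :: "'a \<Rightarrow> 'a timed" where
  "ret x = Timed x 0"

definition tick :: "unit timed" where
  "tick = Timed () 1"

definition bind_timed :: "'a timed \<Rightarrow> ('a \<Rightarrow> 'b timed) \<Rightarrow> 'b timed" where
  "bind_timed m f = Timed (result (f (result m))) (time m + time (f (result m)))"

adhoc_overloading Monad_Syntax.bind \<rightleftharpoons> bind_timed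

lemma result_simps [simp]:
  "result (ret x) = x" "result (bind_timed m f) = result (f (result m))"
  by (simp_all add: ret_def bind_timed_def)

lemma time_simps [simp]:
  "time (ret x) = 0" "time tick = 1" "time (bind_timed m f) = time m + time (f (result m))"
  by (simp_all add: ret_def tick_def bind_timed_def)

type_synonym lpoly = "nat list list"
type_synonym lpath_sum = "(nat list, lpoly) psum"

subsection \<open>Lists\<close>

fun t_map :: "('a \<Rightarrow> 'b timed) \<Rightarrow> 'a list \<Rightarrow> 'b list timed" where
  "t_map f [] = do { tick; ret [] }"
| "t_map f (x # xs) = do { tick; y \<leftarrow> f x; ys \<leftarrow> t_map f xs; ret (y # ys) }"

fun t_map2 :: "('a \<Rightarrow> 'b \<Rightarrow> 'c timed) \<Rightarrow> 'a list \<Rightarrow> 'b list \<Rightarrow> 'c list timed" where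
  "t_map2 f (x # xs) (y # ys) = do { tick; z \<leftarrow> f x y; zs \<leftarrow> t_map2 f xs ys; ret (z # zs) }"
| "t_map2 f _ _ = do { tick; ret [] }"

fun t_append :: "'a list \<Rightarrow> 'a list \<Rightarrow> 'a list timed" where
  "t_append [] ys = do { tick; ret ys }"
| "t_append (x # xs) ys = do { tick; zs \<leftarrow> t_append xs ys; ret (x # zs) }"

fun t_concat :: "'a list list \<Rightarrow> 'a list timed" where
  "t_concat [] = do { tick; ret [] }"
| "t_concat (xs # xss) = do { tick; ys \<leftarrow> t_concat xss; t_append xs ys }"

fun t_length :: "'a list \<Rightarrow> nat timed" where
  "t_length [] = do { tick; ret 0 }"
| "t_length (x # xs) = do { tick; n \<leftarrow> t_length xs; ret (Suc n) }"

text \<open>\<open>[k, k + 1, \<dots>]\<close> of length \<open>n\<close>\<close>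

fun t_upto :: "nat \<Rightarrow> nat \<Rightarrow> nat list timed" where
  "t_upto k 0 = do { tick; ret [] }"
| "t_upto k (Suc n) = do { tick; xs \<leftarrow> t_upto (Suc k) n; ret (k # xs) }"

fun t_mem :: "nat \<Rightarrow> nat list \<Rightarrow> bool timed" where
  "t_mem x [] = do { tick; ret False }"
| "t_mem x (y # ys) = do { tick; if x = y then ret True else t_mem x ys }"

fun t_remove :: "nat \<Rightarrow> nat list \<Rightarrow> nat list timed" where
  "t_remove x [] = do { tick; ret [] }"
| "t_remove x (y # ys) = do { tick; zs \<leftarrow> t_remove x ys; ret (if x = y then zs else y # zs) }"

fun t_diff :: "nat list \<Rightarrow> nat list \<Rightarrow> nat list timed" where
  "t_diff [] ys = do { tick; ret [] }"
| "t_diff (x # xs) ys =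
     do { tick; b \<leftarrow> t_mem x ys; zs \<leftarrow> t_diff xs ys; ret (if b then zs else x # zs) }"

fun t_subset :: "nat list \<Rightarrow> nat list \<Rightarrow> bool timed" where
  "t_subset [] ys = do { tick; ret True }"
| "t_subset (x # xs) ys = do { tick; b \<leftarrow> t_mem x ys; if b then t_subset xs ys else ret False }"

fun t_fresh :: "nat list \<Rightarrow> nat timed" where
  "t_fresh [] = do { tick; ret 0 }"
| "t_fresh (x # xs) = do { tick; k \<leftarrow> t_fresh xs; ret (max (Suc x) k) }"

fun t_lookup :: "nat list \<Rightarrow> 'a list \<Rightarrow> nat \<Rightarrow> 'a option timed" where
  "t_lookup (k # ks) (v # vs) j = do { tick; if k = j then ret (Some v) else t_lookup ks vs j }"
| "t_lookup _ _ j = do { tick; ret None }"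

subsection \<open>Polynomials\<close>

definition t_mono_eq :: "nat list \<Rightarrow> nat list \<Rightarrow> bool timed" where
  "t_mono_eq u w = do { tick; a \<leftarrow> t_subset u w; b \<leftarrow> t_subset w u; ret (a \<and> b) }"

text \<open>Addition of a single monomial\<close>

fun t_toggle :: "nat list \<Rightarrow> lpoly \<Rightarrow> lpoly timed" where
  "t_toggle u [] = do { tick; ret [u] }"
| "t_toggle u (w # p) =
     do { tick; b \<leftarrow> t_mono_eq u w; if b then ret p else do { q \<leftarrow> t_toggle u p; ret (w # q) } }"

fun t_padd :: "lpoly \<Rightarrow> lpoly \<Rightarrow> lpoly timed" where
  "t_padd [] q = do { tick; ret q }"
| "t_padd (u # p) q = do { tick; r \<leftarrow> t_padd p q; t_toggle u r }"

fun t_psum_list :: "lpoly list \<Rightarrow> lpoly timed" where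
  "t_psum_list [] = do { tick; ret [] }"
| "t_psum_list (p # ps) = do { tick; q \<leftarrow> t_psum_list ps; t_padd p q }"

fun t_union :: "nat list \<Rightarrow> nat list \<Rightarrow> nat list timed" where
  "t_union [] w = do { tick; ret w }"
| "t_union (x # u) w =
     do { tick; b \<leftarrow> t_mem x w; r \<leftarrow> t_union u w; ret (if b then r else x # r) }"

fun t_mono_mul :: "nat list \<Rightarrow> lpoly \<Rightarrow> lpoly timed" where
  "t_mono_mul u [] = do { tick; ret [] }"
| "t_mono_mul u (w # p) = do { tick; r \<leftarrow> t_mono_mul u p; uw \<leftarrow> t_union u w; t_toggle uw r }"

fun t_pmul :: "lpoly \<Rightarrow> lpoly \<Rightarrow> lpoly timed" where
  "t_pmul [] q = do { tick; ret [] }"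
| "t_pmul (u # p) q = do { tick; r \<leftarrow> t_pmul p q; uq \<leftarrow> t_mono_mul u q; t_padd uq r }"

fun t_psubst :: "nat \<Rightarrow> lpoly \<Rightarrow> lpoly \<Rightarrow> lpoly timed" where
  "t_psubst y Q [] = do { tick; ret [] }"
| "t_psubst y Q (u # p) =
     do { tick; r \<leftarrow> t_psubst y Q p; b \<leftarrow> t_mem y u;
          if b then do { u' \<leftarrow> t_remove y u; q \<leftarrow> t_mono_mul u' Q; t_padd q r }
          else t_toggle u r }"

text \<open>\<open>P = x * D + R\<close> with \<open>x\<close> in neither \<open>D\<close> nor \<open>R\<close>\<close>

fun t_split :: "nat \<Rightarrow> lpoly \<Rightarrow> (lpoly \<times> lpoly) timed" where
  "t_split x [] = do { tick; ret ([], []) }"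
| "t_split x (u # p) =
     do { tick; DR \<leftarrow> t_split x p; b \<leftarrow> t_mem x u;
          if b then do { u' \<leftarrow> t_remove x u; ret (u' # fst DR, snd DR) }
          else ret (fst DR, u # snd DR) }"

subsection \<open>Path sums\<close>

definition t_shift_poly :: "nat \<Rightarrow> lpoly \<Rightarrow> lpoly timed" where
  "t_shift_poly k p = do { tick; t_map (t_map (\<lambda>x. ret (k + x))) p }"

definition t_shift :: "nat \<Rightarrow> lpath_sum \<Rightarrow> lpath_sum timed" where
  "t_shift k A =
     do { tick; V \<leftarrow> t_map (\<lambda>x. ret (k + x)) (vars A); P \<leftarrow> t_shift_poly k (phase A);
          Os \<leftarrow> t_map (t_shift_poly k) (outs A); Is \<leftarrow> t_map (t_shift_poly k) (ins A);
          ret (PSum V (scal A) P Os Is) }"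

fun t_halve :: "complex \<Rightarrow> 'a list \<Rightarrow> complex timed" where
  "t_halve s [] = do { tick; ret s }"
| "t_halve s (x # xs) = do { tick; t_halve (s / 2) xs }"

definition t_compose :: "lpath_sum \<Rightarrow> lpath_sum \<Rightarrow> lpath_sum timed" where
  "t_compose A B =
     do { tick; a \<leftarrow> t_fresh (vars A); b \<leftarrow> t_fresh (vars B); B' \<leftarrow> t_shift a B;
          p \<leftarrow> t_length (ins A); ys \<leftarrow> t_upto (a + b) p;
          ds \<leftarrow> t_map2 t_padd (outs B') (ins A);
          ls \<leftarrow> t_map2 (\<lambda>y. t_pmul [[y]]) ys ds;
          L \<leftarrow> t_psum_list ls; PL \<leftarrow> t_padd (phase B') L; P \<leftarrow> t_padd (phase A) PL;
          VL \<leftarrow> t_append (vars B') ys; V \<leftarrow> t_append (vars A) VL;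
          s \<leftarrow> t_halve (scal A * scal B) ys;
          ret (PSum V s P (outs A) (ins B')) }"

definition t_tensor :: "lpath_sum \<Rightarrow> lpath_sum \<Rightarrow> lpath_sum timed" where
  "t_tensor A B =
     do { tick; a \<leftarrow> t_fresh (vars A); B' \<leftarrow> t_shift a B;
          V \<leftarrow> t_append (vars A) (vars B'); P \<leftarrow> t_padd (phase A) (phase B');
          Os \<leftarrow> t_append (outs A) (outs B'); Is \<leftarrow> t_append (ins A) (ins B');
          ret (PSum V (scal A * scal B) P Os Is) }"

definition t_ident :: "nat \<Rightarrow> lpath_sum timed" where
  "t_ident k =
     do { tick; V \<leftarrow> t_upto 0 k; ps \<leftarrow> t_map (\<lambda>x. ret [[x]]) V; ret (PSum V 1 [] ps ps) }"

definition t_dagger :: "lpath_sum \<Rightarrow> lpath_sum timed" where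
  "t_dagger A = do { tick; ret (PSum (vars A) (cnj (scal A)) (phase A) (ins A) (outs A)) }"

definition t_ket :: "bit list \<Rightarrow> lpath_sum timed" where
  "t_ket x = do { tick; ps \<leftarrow> t_map (\<lambda>b. ret (if b = 1 then [[]] else [])) x; ret (PSum [] 1 [] ps []) }"

fun t_wires :: "gate \<Rightarrow> nat list timed" where
  "t_wires (HGate q) = do { tick; ret [q] }"
| "t_wires (XGate q) = do { tick; ret [q] }"
| "t_wires (SwapGate q r) = do { tick; ret [q, r] }"
| "t_wires (CZGate cs q) = do { tick; t_append cs [q] }"

fun t_gate_psum :: "gate \<Rightarrow> lpath_sum timed" where
  "t_gate_psum (HGate q) = do { tick; ret (PSum [0, 1] (1 / sqrt 2) [[0, 1]] [[[1]]] [[[0]]]) }"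
| "t_gate_psum (XGate q) = do { tick; ret (PSum [0] 1 [] [[[0], []]] [[[0]]]) }"
| "t_gate_psum (SwapGate q r) =
     do { tick; ret (PSum [0, 1] 1 [] [[[1]], [[0]]] [[[0]], [[1]]]) }"
| "t_gate_psum (CZGate cs q) =
     do { tick; k \<leftarrow> t_length cs; V \<leftarrow> t_upto 0 (k + 1); ps \<leftarrow> t_map (\<lambda>x. ret [[x]]) V;
          ret (PSum V 1 [V] ps ps) }"

definition t_arrange :: "nat \<Rightarrow> nat list \<Rightarrow> lpoly list \<Rightarrow> lpoly list timed" where
  "t_arrange N pos ps =
     do { tick; js \<leftarrow> t_upto 0 N;
          t_map (\<lambda>j. do { r \<leftarrow> t_lookup pos ps j; ret (the r) }) js }"

definition t_place :: "nat \<Rightarrow> nat list \<Rightarrow> lpath_sum \<Rightarrow> lpath_sum timed" where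
  "t_place N ws A =
     do { tick; k \<leftarrow> t_length ws; J \<leftarrow> t_ident (N - k); T \<leftarrow> t_tensor A J;
          js \<leftarrow> t_upto 0 N; rest \<leftarrow> t_diff js ws; pos \<leftarrow> t_append ws rest;
          Os \<leftarrow> t_arrange N pos (outs T); Is \<leftarrow> t_arrange N pos (ins T);
          ret (PSum (vars T) (scal T) (phase T) Os Is) }"

fun t_interp_from :: "nat \<Rightarrow> lpath_sum \<Rightarrow> circuit \<Rightarrow> lpath_sum timed" where
  "t_interp_from N A [] = do { tick; ret A }"
| "t_interp_from N A (g # C) =
     do { tick; G \<leftarrow> t_gate_psum g; ws \<leftarrow> t_wires g; G' \<leftarrow> t_place N ws G;
          A' \<leftarrow> t_compose G' A; t_interp_from N A' C }"

definition t_measurement_psum :: "nat \<Rightarrow> circuit \<Rightarrow> bit list \<Rightarrow> nat \<Rightarrow> lpath_sum timed" where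
  "t_measurement_psum N C x i =
     do { tick; J \<leftarrow> t_ident N; U \<leftarrow> t_interp_from N J C; k \<leftarrow> t_ket x; g \<leftarrow> t_compose U k;
          g' \<leftarrow> t_dagger g; J1 \<leftarrow> t_ident i; J2 \<leftarrow> t_ident (N - i - 1);
          M2 \<leftarrow> t_tensor (PSum [] 1 [] [[[]]] [[[]]]) J2; M \<leftarrow> t_tensor J1 M2;
          Mg \<leftarrow> t_compose M g; t_compose g' Mg }"

subsection \<open>Rewriting\<close>

fun t_occurs :: "nat \<Rightarrow> lpoly list \<Rightarrow> bool timed" where
  "t_occurs x [] = do { tick; ret False }"
| "t_occurs x (p # ps) =
     do { tick; vs \<leftarrow> t_concat p; b \<leftarrow> t_mem x vs; if b then ret True else t_occurs x ps }"

fun t_all_eq :: "nat \<Rightarrow> nat list \<Rightarrow> bool timed" where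
  "t_all_eq x [] = do { tick; ret True }"
| "t_all_eq x (y # ys) = do { tick; if x = y then t_all_eq x ys else ret False }"

text \<open>
  The reduct by (HH), if any, of a path sum with phase \<open>x * D + R\<close> in which the monomial \<open>u\<close> of \<open>D\<close>
  takes the part of \<open>y\<close>
\<close>

definition t_HH :: "lpath_sum \<Rightarrow> nat \<Rightarrow> lpoly \<Rightarrow> lpoly \<Rightarrow> nat list \<Rightarrow> lpath_sum list timed" where
  "t_HH A x D R u =
     do { tick;
       case u of [y] \<Rightarrow>
         do { Q \<leftarrow> t_toggle [y] D; vs \<leftarrow> t_concat Q; b \<leftarrow> t_mem y vs;
              c \<leftarrow> (case vs of [] \<Rightarrow> ret True | v # vs' \<Rightarrow> t_all_eq v vs');
              if \<not> b \<and> c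
              then do { V \<leftarrow> t_remove x (vars A); P \<leftarrow> t_psubst y Q R;
                        Os \<leftarrow> t_map (t_psubst y Q) (outs A); Is \<leftarrow> t_map (t_psubst y Q) (ins A);
                        ret [PSum V (scal A) P Os Is] }
              else ret [] }
       | _ \<Rightarrow> ret [] }"

text \<open>All reducts by the rules with the given variable in the part of \<open>x\<close> or \<open>z\<close>\<close>

definition t_reducts_at :: "lpath_sum \<Rightarrow> nat \<Rightarrow> lpath_sum list timed" where
  "t_reducts_at A x =
     do { tick; b \<leftarrow> t_occurs x (outs A); c \<leftarrow> t_occurs x (ins A);
       if b \<or> c then ret []
       else do { DR \<leftarrow> t_split x (phase A);
         case fst DR of
           [] \<Rightarrow> do { V \<leftarrow> t_remove x (vars A);
                    ret [PSum V (2 * scal A) (phase A) (outs A) (ins A)] }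
         | [[]] \<Rightarrow> do { Os \<leftarrow> t_map (\<lambda>_. ret []) (outs A); Is \<leftarrow> t_map (\<lambda>_. ret []) (ins A);
                      ret [PSum [] 0 [] Os Is] }
         | _ \<Rightarrow> do { rss \<leftarrow> t_map (t_HH A x (fst DR) (snd DR)) (fst DR); t_concat rss } } }"

definition t_reducts :: "lpath_sum \<Rightarrow> lpath_sum list timed" where
  "t_reducts A = do { tick; rss \<leftarrow> t_map (t_reducts_at A) (vars A); t_concat rss }"

subsection \<open>Evaluation by brute force\<close>

text \<open>An assignment is given by the list of variables with value 1.\<close>

fun t_peval :: "nat list \<Rightarrow> lpoly \<Rightarrow> bit timed" where
  "t_peval T [] = do { tick; ret 0 }"
| "t_peval T (u # p) =
     do { tick; b \<leftarrow> t_subset u T; r \<leftarrow> t_peval T p; ret (if b then 1 + r else r) }"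

fun t_sum_paths :: "lpoly \<Rightarrow> nat list \<Rightarrow> nat list \<Rightarrow> complex timed" where
  "t_sum_paths P T [] = do { tick; b \<leftarrow> t_peval T P; ret (sgn2 b) }"
| "t_sum_paths P T (v # vs) =
     do { tick; a \<leftarrow> t_sum_paths P T vs; b \<leftarrow> t_sum_paths P (v # T) vs; ret (a + b) }"

text \<open>For path sums without inputs and outputs\<close>

definition t_eval :: "lpath_sum \<Rightarrow> complex timed" where
  "t_eval A = do { tick; c \<leftarrow> t_sum_paths (phase A) [] (vars A); ret (scal A * c) }"

section \<open>Runs of the simulation algorithm\<close>

definition represents_set :: "nat list \<Rightarrow> nat set \<Rightarrow> bool" where
  "represents_set xs X \<longleftrightarrow> distinct xs \<and> set xs = X"

definition represents_poly :: "lpoly \<Rightarrow> mpoly2 \<Rightarrow> bool" where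
  "represents_poly p P \<longleftrightarrow> distinct (map set p) \<and> (\<forall>u\<in>set p. distinct u) \<and> set ` set p = P"

abbreviation represents :: "lpath_sum \<Rightarrow> path_sum \<Rightarrow> bool" where
  "represents \<equiv> rel_psum represents_set represents_poly"

text \<open>
  \<open>loop_run f r t\<close>: from \<open>f\<close> on, the rewriting loop can, for some choice of rewrites, return \<open>r\<close>
  after \<open>t\<close> steps.  Each test of the loop condition is charged the time for computing
  all reducts of the current path sum, whichever of them is chosen.
\<close>

inductive loop_run :: "path_sum \<Rightarrow> complex \<Rightarrow> nat \<Rightarrow> bool" where
  finish: "loop_run f (eval f [] []) (time (t_reducts A) + time (t_eval A))"
    if "represents A f" "\<nexists>f'. f \<leadsto> f'"
| rewrite: "loop_run f r (time (t_reducts A) + t)"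
    if "represents A f" "f \<leadsto> f'" "loop_run f' r t"

definition measurement_run :: "nat \<Rightarrow> circuit \<Rightarrow> bit list \<Rightarrow> nat \<Rightarrow> complex \<Rightarrow> nat \<Rightarrow> bool" where
  "measurement_run N C x i r t \<longleftrightarrow>
     (\<exists>t'. loop_run (measurement_psum N C x i) r t' \<and> t = time (t_measurement_psum N C x i) + t')"

section \<open>Adequacy of the programs\<close>

text \<open>
  On every path sum that can occur in a run, the programs compute what their names say; see
  \<open>t_measurement_psum_correct\<close>, \<open>t_reducts_correct\<close> and \<open>t_eval_correct\<close>, whose hypothesis of
  well-formedness is discharged by \<open>well_formed_measurement_psum\<close> and \<open>well_formed_rw\<close>.
\<close>

definition well_formed :: "path_sum \<Rightarrow> bool" where
  "well_formed A \<longleftrightarrow> finite (vars A) \<and> (\<forall>p\<in>set (phase A # outs A @ ins A). p \<subseteq> Pow (vars A))"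

subsection \<open>Algebra of polynomials\<close>

lemma bit_add_self [simp]: "(b::bit) + b = 0" by (cases b) auto

lemma sum_padd:
  fixes f :: "nat set \<Rightarrow> bit"
  assumes "finite A" "finite B"
  shows "sum f (padd A B) = sum f A + sum f B"
proof -
  have a: "sum f A = sum f (A \<inter> B) + sum f (A - B)" using assms(1) by (rule sum.Int_Diff)
  have b: "sum f B = sum f (A \<inter> B) + sum f (B - A)" using sum.Int_Diff[OF assms(2), of f A] by (simp add: Int_commute)
  have "sum f (padd A B) = sum f (A - B) + sum f (B - A)"
    unfolding padd_def using assms by (intro sum.union_disjoint) auto
  then show ?thesis unfolding a b by (cases "sum f (A \<inter> B)"; cases "sum f (A - B)"; cases "sum f (B - A)") auto
qed

lemma of_nat_bit: "(of_nat n :: bit) = of_bool (odd n)"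
  by (induction n) auto

lemma pmul_iff:
  assumes "finite p" "finite q"
  shows "of_bool (u \<in> pmul p q) = (\<Sum>a\<in>p. \<Sum>b\<in>q. of_bool (a \<union> b = u) :: bit)"
proof -
  have "(\<Sum>a\<in>p. \<Sum>b\<in>q. of_bool (a \<union> b = u) :: bit) = (\<Sum>c\<in>p \<times> q. of_bool (fst c \<union> snd c = u))"
    by (simp add: sum.cartesian_product case_prod_beta)
  also have "\<dots> = of_nat (card ((p \<times> q) \<inter> {c. fst c \<union> snd c = u}))"
    using assms by (simp add: of_bool_def sum.If_cases)
  also have "(p \<times> q) \<inter> {c. fst c \<union> snd c = u} = {(a, b). a \<in> p \<and> b \<in> q \<and> a \<union> b = u}" by auto
  finally show ?thesis by (simp add: pmul_def of_nat_bit)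
qed

lemma padd_iff: "of_bool (u \<in> padd p q) = (of_bool (u \<in> p) + of_bool (u \<in> q) :: bit)"
  by (auto simp: padd_def)

lemma poly_eqI: "(\<And>u. of_bool (u \<in> p) = (of_bool (u \<in> q) :: bit)) \<Longrightarrow> p = q"
  by (intro set_eqI) (metis of_bool_eq_iff)

lemma finite_padd [simp]: "finite p \<Longrightarrow> finite q \<Longrightarrow> finite (padd p q)"
  by (simp add: padd_def)

lemma pmul_subset: "pmul p q \<subseteq> (\<lambda>(a, b). a \<union> b) ` (p \<times> q)"
proof
  fix u assume "u \<in> pmul p q"
  then have "{(a, b). a \<in> p \<and> b \<in> q \<and> a \<union> b = u} \<noteq> {}"
    unfolding pmul_def by (metis (mono_tags, lifting) card.empty mem_Collect_eq even_zero)
  then show "u \<in> (\<lambda>(a, b). a \<union> b) ` (p \<times> q)" by auto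
qed

lemma finite_pmul [simp]: "finite p \<Longrightarrow> finite q \<Longrightarrow> finite (pmul p q)"
  by (rule finite_subset[OF pmul_subset]) auto

lemma padd_commute: "padd p q = padd q p" by (auto simp: padd_def)
lemma padd_assoc: "padd (padd p q) r = padd p (padd q r)" by (auto simp: padd_def)
lemma padd_left_commute: "padd p (padd q r) = padd q (padd p r)" by (auto simp: padd_def)
lemma padd_0 [simp]: "padd {} p = p" "padd p {} = p" by (auto simp: padd_def)

lemma pmul_commute: "pmul p q = pmul q p"
proof -
  have "bij_betw prod.swap {(a, b). a \<in> p \<and> b \<in> q \<and> a \<union> b = u} {(a, b). a \<in> q \<and> b \<in> p \<and> a \<union> b = u}" for u
    by (rule bij_betwI[where g = prod.swap]) auto
  then show ?thesis unfolding pmul_def using bij_betw_same_card by (intro Collect_cong arg_cong[where f = odd]) blast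
qed

lemma pmul_padd:
  assumes "finite p" "finite q" "finite r"
  shows "pmul (padd p q) r = padd (pmul p r) (pmul q r)"
  by (rule poly_eqI) (simp add: padd_iff pmul_iff assms sum_padd)

lemma pmul_0 [simp]: "pmul {} p = {}" "pmul p {} = {}" by (auto simp: pmul_def)

lemma pmul_single: "pmul {u} {w} = {u \<union> w}"
  by (rule poly_eqI) (auto simp: pmul_iff)

lemma peval_padd: "finite p \<Longrightarrow> finite q \<Longrightarrow> peval (padd p q) v = peval p v + peval q v"
  unfolding peval_def by (rule sum_padd)

lemma prod_Un_bit: "finite a \<Longrightarrow> finite b \<Longrightarrow> (\<Prod>x\<in>a \<union> b. v x) = (\<Prod>x\<in>a. v x) * (\<Prod>x\<in>b. (v x :: bit))"
proof (induction a rule: finite_induct)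
  case (insert x a)
  have "v x * v x = v x" by (cases "v x") auto
  with insert show ?case
    by (cases "x \<in> b") (auto simp: insert_absorb prod.insert_if prod.remove mult.assoc mult.left_commute)
qed simp

lemma peval_pmul:
  assumes "finite p" "finite q" "\<And>u. u \<in> p \<union> q \<Longrightarrow> finite u"
  shows "peval (pmul p q) v = peval p v * peval q v"
proof -
  let ?U = "(\<lambda>(a, b). a \<union> b) ` (p \<times> q)"
  have fin: "finite ?U" using assms by auto
  have "peval (pmul p q) v = (\<Sum>u\<in>?U. of_bool (u \<in> pmul p q) * (\<Prod>x\<in>u. v x))"
    unfolding peval_def using pmul_subset[of p q] fin
    by (intro sum.mono_neutral_cong_left) auto
  also have "\<dots> = (\<Sum>u\<in>?U. \<Sum>a\<in>p. \<Sum>b\<in>q. of_bool (a \<union> b = u) * (\<Prod>x\<in>u. v x))"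
    by (simp only: pmul_iff[OF assms(1,2)] sum_distrib_right)
  also have "\<dots> = (\<Sum>a\<in>p. \<Sum>b\<in>q. \<Sum>u\<in>?U. of_bool (a \<union> b = u) * (\<Prod>x\<in>u. v x))"
    by (subst sum.swap, rule sum.cong[OF refl], rule sum.swap)
  also have "\<dots> = (\<Sum>a\<in>p. \<Sum>b\<in>q. (\<Prod>x\<in>a. v x) * (\<Prod>x\<in>b. v x))"
  proof (intro sum.cong refl)
    fix a b assume ab: "a \<in> p" "b \<in> q"
    have "(\<Sum>u\<in>?U. of_bool (a \<union> b = u) * (\<Prod>x\<in>u. v x)) = (\<Sum>u\<in>?U. if u = a \<union> b then (\<Prod>x\<in>u. v x) else 0)"
      by (intro sum.cong) auto
    also have "\<dots> = (\<Prod>x\<in>a \<union> b. v x)" using fin ab by (subst sum.delta) (auto simp: image_iff)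
    also have "\<dots> = (\<Prod>x\<in>a. v x) * (\<Prod>x\<in>b. v x)" using ab assms by (intro prod_Un_bit) auto
    finally show "(\<Sum>u\<in>?U. of_bool (a \<union> b = u) * (\<Prod>x\<in>u. v x)) = (\<Prod>x\<in>a. v x) * (\<Prod>x\<in>b. v x)" .
  qed
  finally show ?thesis by (simp only: peval_def sum_product)
qed

lemma peval_psubst:
  assumes "finite P" "finite Q" "\<And>u. u \<in> P \<union> Q \<Longrightarrow> finite u"
  shows "peval (psubst y Q P) v = peval P (v(y := peval Q v))"
proof -
  let ?w = "v(y := peval Q v)"
  let ?A = "{u \<in> P. y \<notin> u}" and ?B = "{u \<in> P. y \<in> u}"
  have inj: "inj_on (\<lambda>u. u - {y}) ?B" by (auto simp: inj_on_def)
  have "peval P ?w = peval ?A ?w + peval ?B ?w"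
    unfolding peval_def using assms(1)
    by (subst sum.union_disjoint[symmetric]) (auto intro: sum.cong)
  also have "peval ?A ?w = peval ?A v"
    unfolding peval_def by (intro sum.cong prod.cong) auto
  also have "peval ?B ?w = (\<Sum>u\<in>?B. peval Q v * (\<Prod>x\<in>u - {y}. v x))"
    unfolding peval_def[of _ ?w] using assms(3)
    by (intro sum.cong refl, subst prod.remove[where x = y]) auto
  also have "\<dots> = peval Q v * peval ((\<lambda>u. u - {y}) ` ?B) v"
    by (simp only: peval_def sum.reindex[OF inj] sum_distrib_left o_def)
  also have "\<dots> = peval (pmul Q ((\<lambda>u. u - {y}) ` ?B)) v"
    using assms by (subst peval_pmul) auto
  finally have "peval P ?w = peval ?A v + peval (pmul Q ((\<lambda>u. u - {y}) ` ?B)) v" .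
  moreover have "finite ?A" "finite (pmul Q ((\<lambda>u. u - {y}) ` ?B))" using assms by auto
  ultimately show ?thesis by (simp only: psubst_def peval_padd)
qed

subsection \<open>Lists and polynomials\<close>

lemma represents_set_simp: "represents_set xs X \<longleftrightarrow> distinct xs \<and> X = set xs" by (auto simp: represents_set_def)

lemma result_map: "(\<And>x. x \<in> set xs \<Longrightarrow> result (f x) = g x) \<Longrightarrow> result (t_map f xs) = map g xs"
  by (induction xs) auto

lemma list_all2_t_map:
  "list_all2 R xs ys \<Longrightarrow> (\<And>x y. R x y \<Longrightarrow> S (result (f x)) (g y)) \<Longrightarrow>
   list_all2 S (result (t_map f xs)) (map g ys)"
  by (induction xs ys rule: list_all2_induct) auto

lemma list_all2_t_map2:
  assumes "list_all2 R xs ys" "list_all2 R' xs' ys'"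
    "\<And>x y x' y'. R x y \<Longrightarrow> R' x' y' \<Longrightarrow> S (result (f x x')) (g y y')"
  shows "list_all2 S (result (t_map2 f xs xs')) (map2 g ys ys')"
  using assms(1,2)
proof (induction xs ys arbitrary: xs' ys' rule: list_all2_induct)
  case (Cons x xs y ys)
  from Cons.prems Cons.hyps Cons.IH show ?case by (cases xs'; cases ys') (auto simp: assms(3))
qed simp

lemma result_append [simp]: "result (t_append xs ys) = xs @ ys"
  by (induction xs) auto

lemma result_concat [simp]: "result (t_concat xss) = concat xss"
  by (induction xss) auto

lemma result_length [simp]: "result (t_length xs) = length xs"
  by (induction xs) auto

lemma result_upto [simp]: "result (t_upto k n) = [k..<k + n]"
  by (induction n arbitrary: k) (auto simp: upt_conv_Cons)

lemma result_mem [simp]: "result (t_mem x ys) \<longleftrightarrow> x \<in> set ys"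
  by (induction ys) auto

lemma set_remove [simp]: "set (result (t_remove x ys)) = set ys - {x}"
  by (induction ys) auto

lemma distinct_remove [simp]: "distinct ys \<Longrightarrow> distinct (result (t_remove x ys))"
  by (induction ys) auto

lemma result_diff [simp]: "result (t_diff xs ys) = filter (\<lambda>x. x \<notin> set ys) xs"
  by (induction xs) auto

lemma result_subset [simp]: "result (t_subset xs ys) \<longleftrightarrow> set xs \<subseteq> set ys"
  by (induction xs) auto

lemma result_mono_eq [simp]: "result (t_mono_eq u w) \<longleftrightarrow> set u = set w"
  by (auto simp: t_mono_eq_def)

lemma result_fresh [simp]: "result (t_fresh xs) = fresh (set xs)"
proof (induction xs)
  case (Cons x xs)
  have "fresh (set (x # xs)) = Max (insert (Suc x) (insert 0 (Suc ` set xs)))"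
    by (simp add: fresh_def insert_commute)
  also have "\<dots> = max (Suc x) (fresh (set xs))"
    unfolding fresh_def by (rule Max_insert) auto
  finally show ?case using Cons by simp
qed (simp add: fresh_def)

lemma result_lookup [simp]: "result (t_lookup ks vs j) = map_of (zip ks vs) j"
  by (induction ks vs j rule: t_lookup.induct) auto

lemma result_halve [simp]: "result (t_halve s xs) = s / 2 ^ length xs"
  by (induction xs arbitrary: s) auto

lemma rpoly_Nil [simp]: "represents_poly [] P \<longleftrightarrow> P = {}"
  by (auto simp: represents_poly_def)

lemma rpoly_Cons: "represents_poly (u # p) P \<longleftrightarrow> distinct u \<and> (\<exists>P'. set u \<notin> P' \<and> represents_poly p P' \<and> P = insert (set u) P')"
  by (auto simp: represents_poly_def)

lemma rpoly_ConsI: "distinct u \<Longrightarrow> set u \<notin> P \<Longrightarrow> represents_poly p P \<Longrightarrow> represents_poly (u # p) (insert (set u) P)"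
  by (auto simp: represents_poly_def)

lemma rpoly_finite: "represents_poly p P \<Longrightarrow> finite P" "represents_poly p P \<Longrightarrow> u \<in> P \<Longrightarrow> finite u"
  by (auto simp: represents_poly_def)

lemma rpoly_mem: "represents_poly p P \<Longrightarrow> u \<in> set p \<Longrightarrow> set u \<in> P" "represents_poly p P \<Longrightarrow> u \<in> set p \<Longrightarrow> distinct u"
  by (auto simp: represents_poly_def)

lemma rpoly_toggle:
  "represents_poly p P \<Longrightarrow> distinct u \<Longrightarrow> represents_poly (result (t_toggle u p)) (padd {set u} P)"
proof (induction p arbitrary: P)
  case Nil
  then show ?case by (auto simp: represents_poly_def)
next
  case (Cons w p)
  from Cons.prems(1) obtain P' where w: "distinct w" "set w \<notin> P'" "represents_poly p P'" "P = insert (set w) P'"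
    unfolding rpoly_Cons by blast
  show ?case
  proof (cases "set u = set w")
    case True
    with w have "padd {set u} P = P'" by (auto simp: padd_def)
    with True w show ?thesis by simp
  next
    case False
    then have eq: "padd {set u} P = insert (set w) (padd {set u} P')" and "set w \<notin> padd {set u} P'"
      using w by (auto simp: padd_def)
    then have "represents_poly (w # result (t_toggle u p)) (padd {set u} P)"
      unfolding eq using w Cons.IH[OF w(3) Cons.prems(2)] by (intro rpoly_ConsI)
    with False show ?thesis by simp
  qed
qed

lemma insert_padd: "u \<notin> P \<Longrightarrow> insert u P = padd {u} P"
  by (auto simp: padd_def)

lemma rpoly_padd: "represents_poly p P \<Longrightarrow> represents_poly q Q \<Longrightarrow> represents_poly (result (t_padd p q)) (padd P Q)"
proof (induction p arbitrary: P)
  case (Cons u p)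
  from Cons.prems(1) obtain P' where u: "distinct u" "set u \<notin> P'" "represents_poly p P'" "P = insert (set u) P'"
    unfolding rpoly_Cons by blast
  have "padd P Q = padd {set u} (padd P' Q)" unfolding u insert_padd[OF u(2)] by (rule padd_assoc)
  then show ?case using rpoly_toggle[OF Cons.IH[OF u(3) Cons.prems(2)] u(1)] by simp
qed simp

lemma rpoly_psum_list:
  "list_all2 represents_poly ps Ps \<Longrightarrow> represents_poly (result (t_psum_list ps)) (psum_list Ps)"
  by (induction ps Ps rule: list_all2_induct) (auto simp: psum_list_def rpoly_padd)

lemma result_union:
  "set (result (t_union u w)) = set u \<union> set w"
  "distinct u \<Longrightarrow> distinct w \<Longrightarrow> distinct (result (t_union u w))"
proof -
  show "set (result (t_union u w)) = set u \<union> set w" for u by (induction u) auto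
  then show "distinct u \<Longrightarrow> distinct w \<Longrightarrow> distinct (result (t_union u w))" by (induction u) auto
qed

lemma rpoly_mono_mul:
  "represents_poly p P \<Longrightarrow> distinct u \<Longrightarrow> represents_poly (result (t_mono_mul u p)) (pmul {set u} P)"
proof (induction p arbitrary: P)
  case (Cons w p)
  from Cons.prems(1) obtain P' where w: "distinct w" "set w \<notin> P'" "represents_poly p P'" "P = insert (set w) P'"
    unfolding rpoly_Cons by blast
  have "pmul {set u} P = padd {set u \<union> set w} (pmul {set u} P')"
    unfolding w insert_padd[OF w(2)] using w rpoly_finite[OF w(3)]
    by (subst (1 2) pmul_commute) (simp add: pmul_padd pmul_commute[of "{set w}"] pmul_single Un_commute)
  then show ?case
    using rpoly_toggle[OF Cons.IH[OF w(3) Cons.prems(2)] result_union(2)[OF Cons.prems(2) w(1)]]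
    by (simp add: result_union)
qed simp

lemma rpoly_pmul: "represents_poly p P \<Longrightarrow> represents_poly q Q \<Longrightarrow> represents_poly (result (t_pmul p q)) (pmul P Q)"
proof (induction p arbitrary: P)
  case (Cons u p)
  from Cons.prems(1) obtain P' where u: "distinct u" "set u \<notin> P'" "represents_poly p P'" "P = insert (set u) P'"
    unfolding rpoly_Cons by blast
  have "pmul P Q = padd (pmul {set u} Q) (pmul P' Q)"
    unfolding u insert_padd[OF u(2)] using u rpoly_finite Cons.prems by (subst pmul_padd) auto
  then show ?case
    using rpoly_padd[OF rpoly_mono_mul[OF Cons.prems(2) u(1)] Cons.IH[OF u(3) Cons.prems(2)]] by simp
qed simp

lemma psubst_padd:
  assumes "finite P" "finite P'" "finite Q"
  shows "psubst y Q (padd P P') = padd (psubst y Q P) (psubst y Q P')"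
proof -
  have inj: "inj_on (\<lambda>u. u - {y}) {u. y \<in> u}" by (auto simp: inj_on_def)
  have a: "{u \<in> padd P P'. y \<notin> u} = padd {u \<in> P. y \<notin> u} {u \<in> P'. y \<notin> u}" by (auto simp: padd_def)
  have "(\<lambda>u. u - {y}) ` {u \<in> padd P P'. y \<in> u} = padd ((\<lambda>u. u - {y}) ` {u \<in> P. y \<in> u}) ((\<lambda>u. u - {y}) ` {u \<in> P'. y \<in> u})"
  proof -
    let ?A = "{u \<in> P. y \<in> u}" and ?B = "{u \<in> P'. y \<in> u}"
    have "{u \<in> padd P P'. y \<in> u} = (?A - ?B) \<union> (?B - ?A)" by (auto simp: padd_def)
    then show ?thesis
      by (simp only: padd_def image_Un)
        (subst (1 2) inj_on_image_set_diff[OF inj], auto)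
  qed
  moreover have "pmul Q (padd A B) = padd (pmul Q A) (pmul Q B)" if "finite A" "finite B" for A B
    unfolding pmul_commute[of Q] using that assms by (intro pmul_padd)
  ultimately show ?thesis
    unfolding psubst_def a using assms by (simp add: padd_assoc padd_left_commute)
qed

lemma rpoly_psubst: "represents_poly p P \<Longrightarrow> represents_poly q Q \<Longrightarrow> represents_poly (result (t_psubst y q p)) (psubst y Q P)"
proof (induction p arbitrary: P)
  case Nil
  then show ?case by (simp add: psubst_def)
next
  case (Cons u p)
  from Cons.prems(1) obtain P' where u: "distinct u" "set u \<notin> P'" "represents_poly p P'" "P = insert (set u) P'"
    unfolding rpoly_Cons by blast
  have "psubst y Q P = padd (psubst y Q {set u}) (psubst y Q P')"
    unfolding u insert_padd[OF u(2)] using u rpoly_finite Cons.prems by (subst psubst_padd) auto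
  moreover have "psubst y Q {set u} = (if y \<in> set u then pmul Q {set u - {y}} else {set u})"
  proof -
    have "{w \<in> {set u}. y \<in> w} = (if y \<in> set u then {set u} else {})"
      "{w \<in> {set u}. y \<notin> w} = (if y \<in> set u then {} else {set u})" by auto
    then show ?thesis by (simp add: psubst_def)
  qed
  ultimately have eq: "psubst y Q P =
      padd (if y \<in> set u then pmul Q {set u - {y}} else {set u}) (psubst y Q P')" by simp
  note IH = Cons.IH[OF u(3) Cons.prems(2)]
  have m: "represents_poly (result (t_mono_mul (result (t_remove y u)) q)) (pmul Q {set u - {y}})"
    using rpoly_mono_mul[OF Cons.prems(2), of "result (t_remove y u)"] u(1) by (simp add: pmul_commute)
  show ?case
    unfolding eq using rpoly_padd[OF m IH] rpoly_toggle[OF IH u(1)] by (cases "y \<in> set u") simp_all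
qed

lemma result_shift_poly: "result (t_shift_poly k p) = map (map ((+) k)) p"
proof -
  have "result (t_map (\<lambda>x. ret (k + x)) u) = map ((+) k) u" for u
    by (induction u) auto
  then show ?thesis unfolding t_shift_poly_def by (induction p) auto
qed

lemma rpoly_shift:
  assumes p: "represents_poly p P"
  shows "represents_poly (result (t_shift_poly k p)) ((`) ((`) ((+) k)) P)"
proof -
  have inj: "inj_on ((`) ((+) k)) A" for A :: "nat set set" by (simp add: inj_on_def inj_image_eq_iff)
  have 1: "map set (map (map ((+) k)) p) = map ((`) ((+) k)) (map set p)" by simp
  have d: "distinct (map set p)" using p by (simp only: represents_poly_def)
  have 2: "distinct (map set (map (map ((+) k)) p))"
    unfolding 1 by (subst distinct_map) (use d inj in blast)
  have "set ` set (map (map ((+) k)) p) = (`) ((+) k) ` (set ` set p)"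
    by (simp only: set_map image_image)
  then have 3: "set ` set (map (map ((+) k)) p) = (`) ((`) ((+) k)) P"
    using p by (simp only: represents_poly_def)
  have 4: "\<forall>u\<in>set (map (map ((+) k)) p). distinct u"
  proof
    fix w assume "w \<in> set (map (map ((+) k)) p)"
    then obtain u where "u \<in> set p" "w = map ((+) k) u" by auto
    with rpoly_mem(2)[OF p] show "distinct w" by (simp add: distinct_map)
  qed
  show ?thesis unfolding result_shift_poly represents_poly_def using 2 3 4 by (intro conjI)
qed

subsection \<open>Rewriting\<close>

text \<open>\<open>P = x * cofactor x P + remainder x P\<close> with \<open>x\<close> in neither \<open>cofactor x P\<close> nor \<open>remainder x P\<close>\<close>

definition cofactor :: "nat \<Rightarrow> mpoly2 \<Rightarrow> mpoly2" where
  "cofactor x P = (\<lambda>u. u - {x}) ` {u \<in> P. x \<in> u}"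

definition remainder :: "nat \<Rightarrow> mpoly2 \<Rightarrow> mpoly2" where
  "remainder x P = {u \<in> P. x \<notin> u}"

lemma pmul_pvar:
  assumes "x \<notin> \<Union> E"
  shows "pmul (pvar x) E = insert x ` E"
proof -
  have "{(a, b). a \<in> pvar x \<and> b \<in> E \<and> a \<union> b = u} = (if u \<in> insert x ` E then {({x}, u - {x})} else {})" for u
    using assms by (auto simp: pvar_def)
  then show ?thesis by (auto simp: pmul_def)
qed

lemma decompose: "P = padd (pmul (pvar x) (cofactor x P)) (remainder x P)"
proof -
  have "x \<notin> \<Union> (cofactor x P)" by (auto simp: cofactor_def)
  then have "pmul (pvar x) (cofactor x P) = {u \<in> P. x \<in> u}"
    by (subst pmul_pvar) (auto simp: cofactor_def image_image insert_absorb)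
  then show ?thesis by (auto simp: padd_def remainder_def)
qed

lemma decompose_unique:
  assumes "x \<notin> \<Union> E" "x \<notin> \<Union> R"
  shows "cofactor x (padd (pmul (pvar x) E) R) = E" "remainder x (padd (pmul (pvar x) E) R) = R"
proof -
  let ?P = "padd (pmul (pvar x) E) R"
  have P: "?P = insert x ` E \<union> R" unfolding pmul_pvar[OF assms(1)] padd_def using assms by auto
  then have a: "{u \<in> ?P. x \<in> u} = insert x ` E" using assms by auto
  have "(\<lambda>u. insert x u - {x}) ` E = E" using assms(1) by (force simp: image_iff)
  then show "cofactor x ?P = E" unfolding cofactor_def a by (simp add: image_image)
  show "remainder x ?P = R" unfolding P remainder_def using assms by auto
qed

lemma padd_cancel: "padd p (padd p q) = q"
  by (auto simp: padd_def)

lemma rw_iff: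
  assumes wf: "well_formed (PSum V s P Os Is)"
  shows "PSum V s P Os Is \<leadsto> f' \<longleftrightarrow>
    (\<exists>x\<in>V. x \<notin> Vars (Os @ Is) \<and>
      (cofactor x P = {} \<and> f' = PSum (V - {x}) (2 * s) P Os Is \<or>
       cofactor x P = {{}} \<and> f' = PSum {} 0 {} (map (\<lambda>_. {}) Os) (map (\<lambda>_. {}) Is) \<or>
       (\<exists>y Q. {y} \<in> cofactor x P \<and> Q = padd {{y}} (cofactor x P) \<and> y \<notin> Vars [Q] \<and> card (Vars [Q]) \<le> 1 \<and>
          f' = PSum (V - {x}) s (psubst y Q (remainder x P)) (map (psubst y Q) Os) (map (psubst y Q) Is))))"
    (is "?L \<longleftrightarrow> ?R")
proof
  assume ?L
  then show ?R
  proof cases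
    case (Elim x)
    then have "cofactor x P = {}" by (auto simp: cofactor_def Vars_def)
    with Elim show ?thesis by (auto simp: Vars_def)
  next
    case (Z z R)
    have "pvar z = pmul (pvar z) {{}}" by (subst pmul_pvar) (auto simp: pvar_def)
    with Z have "P = padd (pmul (pvar z) {{}}) R" by simp
    moreover have "z \<notin> \<Union> R" using Z by (auto simp: Vars_def)
    ultimately have "cofactor z P = {{}}" using decompose_unique(1)[of z "{{}}" R] by simp
    with Z show ?thesis by (auto simp: Vars_def)
  next
    case (HH x y Q R)
    have x: "x \<notin> \<Union> (padd (pvar y) Q)" "x \<notin> \<Union> R" "x \<notin> Vars (Os @ Is)"
      using HH by (auto simp: Vars_def pvar_def padd_def)
    have P: "P = padd (pmul (pvar x) (padd (pvar y) Q)) R" using HH by simp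
    have d: "cofactor x P = padd (pvar y) Q" and r: "remainder x P = R"
      unfolding P by (rule decompose_unique[OF x(1,2)])+
    have "{y} \<in> cofactor x P" unfolding d using HH by (auto simp: Vars_def pvar_def padd_def)
    moreover have "Q = padd {{y}} (cofactor x P)" unfolding d by (simp only: pvar_def padd_cancel)
    moreover have "f' = PSum (V - {x}) s (psubst y Q (remainder x P)) (map (psubst y Q) Os) (map (psubst y Q) Is)"
      unfolding r using HH by simp
    ultimately show ?thesis using x(3) \<open>x \<in> V\<close> \<open>y \<notin> Vars [Q]\<close> \<open>card (Vars [Q]) \<le> 1\<close>
      by (intro bexI[of _ x] conjI disjI2 exI[of _ y] exI[of _ Q])
  qed
next
  assume ?R
  then obtain x where x: "x \<in> V" "x \<notin> Vars (Os @ Is)" and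
    c: "cofactor x P = {} \<and> f' = PSum (V - {x}) (2 * s) P Os Is \<or>
       cofactor x P = {{}} \<and> f' = PSum {} 0 {} (map (\<lambda>_. {}) Os) (map (\<lambda>_. {}) Is) \<or>
       (\<exists>y Q. {y} \<in> cofactor x P \<and> Q = padd {{y}} (cofactor x P) \<and> y \<notin> Vars [Q] \<and> card (Vars [Q]) \<le> 1 \<and>
          f' = PSum (V - {x}) s (psubst y Q (remainder x P)) (map (psubst y Q) Os) (map (psubst y Q) Is))" by blast
  have PV: "P \<subseteq> Pow V" using wf by (simp add: well_formed_def)
  have R: "remainder x P \<subseteq> Pow V" "x \<notin> \<Union> (remainder x P)" using PV by (auto simp: remainder_def)
  have D: "cofactor x P \<subseteq> Pow V" "x \<notin> \<Union> (cofactor x P)" using PV by (auto simp: cofactor_def)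
  from c show ?L
  proof (elim disjE conjE exE)
    assume "cofactor x P = {}" and f': "f' = PSum (V - {x}) (2 * s) P Os Is"
    then have "x \<notin> Vars (P # Os @ Is)" using x by (auto simp: cofactor_def Vars_def)
    then show ?L unfolding f' using x by (intro rw.Elim)
  next
    assume d: "cofactor x P = {{}}" and f': "f' = PSum {} 0 {} (map (\<lambda>_. {}) Os) (map (\<lambda>_. {}) Is)"
    have "pmul (pvar x) {{}} = pvar x" by (subst pmul_pvar) (auto simp: pvar_def)
    then have "P = padd (pvar x) (remainder x P)" using decompose[of P x] d by simp
    moreover have "PSum V s (padd (pvar x) (remainder x P)) Os Is \<leadsto> f'"
      unfolding f' using x R by (intro rw.Z) (auto simp: Vars_def)
    ultimately show ?L by simp
  next
    fix y Q assume y: "{y} \<in> cofactor x P" and Q: "Q = padd {{y}} (cofactor x P)" "y \<notin> Vars [Q]" "card (Vars [Q]) \<le> 1"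
      and f': "f' = PSum (V - {x}) s (psubst y Q (remainder x P)) (map (psubst y Q) Os) (map (psubst y Q) Is)"
    have "y \<in> V" "x \<noteq> y" using D y by auto
    moreover have "padd (pvar y) Q = cofactor x P" unfolding Q by (simp only: pvar_def padd_cancel)
    then have "P = padd (pmul (pvar x) (padd (pvar y) Q)) (remainder x P)" using decompose[of P x] by simp
    moreover have "Q \<subseteq> Pow V" "x \<notin> \<Union> Q" using D \<open>y \<in> V\<close> \<open>x \<noteq> y\<close> unfolding Q by (auto simp: padd_def)
    then have "PSum V s (padd (pmul (pvar x) (padd (pvar y) Q)) (remainder x P)) Os Is \<leadsto> f'"
      unfolding f' using x R Q \<open>y \<in> V\<close> \<open>x \<noteq> y\<close> by (intro rw.HH) (auto simp: Vars_def)
    ultimately show ?L by simp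
  qed
qed

lemma Vars_concat: "represents_poly p P \<Longrightarrow> set (concat p) = Vars [P]"
  by (auto simp: represents_poly_def Vars_def)

lemma result_occurs: "list_all2 represents_poly ps Ps \<Longrightarrow> result (t_occurs x ps) \<longleftrightarrow> x \<in> Vars Ps"
proof (induction ps Ps rule: list_all2_induct)
  case (Cons p ps P Ps)
  have "x \<in> Vars (P # Ps) \<longleftrightarrow> x \<in> Vars [P] \<or> x \<in> Vars Ps" by (auto simp: Vars_def)
  with Cons Vars_concat[OF Cons.hyps(1)] show ?case by (auto simp del: set_concat)
qed (simp add: Vars_def)

lemma result_all_eq [simp]: "result (t_all_eq x ys) \<longleftrightarrow> set ys \<subseteq> {x}"
  by (induction ys) auto

lemma rpoly_split:
  assumes "represents_poly p P"
  shows "represents_poly (fst (result (t_split x p))) (cofactor x P) \<and> represents_poly (snd (result (t_split x p))) (remainder x P)"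
  using assms
proof (induction p arbitrary: P)
  case Nil
  then show ?case by (simp add: cofactor_def remainder_def)
next
  case (Cons u p)
  from Cons.prems(1) obtain P' where u: "distinct u" "set u \<notin> P'" "represents_poly p P'" "P = insert (set u) P'"
    unfolding rpoly_Cons by blast
  note IH = Cons.IH[OF u(3)]
  show ?case
  proof (cases "x \<in> set u")
    case True
    have "cofactor x P = insert (set u - {x}) (cofactor x P')" "remainder x P = remainder x P'"
      using True by (auto simp: u cofactor_def remainder_def)
    moreover have "set u - {x} \<notin> cofactor x P'"
    proof
      assume "set u - {x} \<in> cofactor x P'"
      then obtain w where w: "w \<in> P'" "x \<in> w" "set u - {x} = w - {x}" unfolding cofactor_def by blast
      have "set u = w" using insert_Diff[OF True] insert_Diff[OF w(2)] w(3) by simp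
      with w u(2) show False by simp
    qed
    ultimately show ?thesis
      using True IH u(1) rpoly_ConsI[of "result (t_remove x u)" "cofactor x P'" "fst (result (t_split x p))"] by simp
  next
    case False
    have "cofactor x P = cofactor x P'" "remainder x P = insert (set u) (remainder x P')" "set u \<notin> remainder x P'"
      using False u(2) by (auto simp: u(4) cofactor_def remainder_def)
    then show ?thesis
      using False IH u(1) rpoly_ConsI[of u "remainder x P'" "snd (result (t_split x p))"] by simp
  qed
qed

lemma represents_set_remove: "represents_set xs X \<Longrightarrow> represents_set (result (t_remove x xs)) (X - {x})"
  by (auto simp: represents_set_def)

lemma Vars_le_1:
  assumes "represents_poly q Q"
  shows "result (case concat q of [] \<Rightarrow> ret True | v # vs \<Rightarrow> t_all_eq v vs) \<longleftrightarrow> card (Vars [Q]) \<le> 1"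
proof (cases "concat q")
  case Nil
  then have "Vars [Q] = {}" using Vars_concat[OF assms, unfolded Nil] by simp
  then show ?thesis unfolding Nil by simp
next
  case (Cons v vs)
  have V: "Vars [Q] = insert v (set vs)" using Vars_concat[OF assms, unfolded Cons] by simp
  have "set vs \<subseteq> {v} \<longleftrightarrow> card (insert v (set vs)) \<le> 1"
  proof
    assume "set vs \<subseteq> {v}"
    then have "insert v (set vs) = {v}" by auto
    then show "card (insert v (set vs)) \<le> 1" by (simp only:) simp
  next
    assume "card (insert v (set vs)) \<le> 1"
    then show "set vs \<subseteq> {v}"
      by (metis List.finite_set One_nat_def card_le_Suc0_iff_eq finite_insert insertCI singletonI subsetI)
  qed
  then show ?thesis unfolding V Cons by simp
qed

text \<open>The reducts by (HH) in which the monomial \<open>w\<close> takes the part of \<open>y\<close>\<close>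

definition HH_reducts :: "path_sum \<Rightarrow> nat \<Rightarrow> nat set \<Rightarrow> path_sum set" where
  "HH_reducts f x w = {f'. \<exists>y Q. w = {y} \<and> Q = padd {{y}} (cofactor x (phase f)) \<and> y \<notin> Vars [Q] \<and> card (Vars [Q]) \<le> 1 \<and>
      f' = PSum (vars f - {x}) (scal f) (psubst y Q (remainder x (phase f))) (map (psubst y Q) (outs f)) (map (psubst y Q) (ins f))}"

lemma HH_correct:
  assumes f: "represents A f" and D: "represents_poly D (cofactor x (phase f))" and R: "represents_poly R (remainder x (phase f))"
    and u: "distinct u"
  shows "rel_set represents (set (result (t_HH A x D R u))) (HH_reducts f x (set u))"
proof (cases "\<exists>y. u = [y]")
  case False
  then have "result (t_HH A x D R u) = []" by (cases u; cases "tl u") (auto simp: t_HH_def)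
  moreover have "set u \<noteq> {y}" for y
    using False u by (metis distinct_card card_1_singleton_iff One_nat_def length_0_conv length_Suc_conv)
  then have "HH_reducts f x (set u) = {}" by (auto simp: HH_reducts_def)
  ultimately show ?thesis by (simp add: rel_set_def)
next
  case True
  then obtain y where y: "u = [y]" by blast
  let ?q = "result (t_toggle [y] D)" and ?Q = "padd {{y}} (cofactor x (phase f))"
  have Q: "represents_poly ?q ?Q" using rpoly_toggle[OF D, of "[y]"] by simp
  let ?f' = "PSum (vars f - {x}) (scal f) (psubst y ?Q (remainder x (phase f))) (map (psubst y ?Q) (outs f)) (map (psubst y ?Q) (ins f))"
  have B: "y \<in> set (concat ?q) \<longleftrightarrow> y \<in> Vars [?Q]" using Vars_concat[OF Q] by simp
  have HH: "HH_reducts f x (set u) = (if y \<notin> Vars [?Q] \<and> card (Vars [?Q]) \<le> 1 then {?f'} else {})"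
    unfolding HH_reducts_def y by auto
  obtain V s P Os Is where A: "A = PSum V s P Os Is" by (cases A)
  obtain V' s' P' Os' Is' where f': "f = PSum V' s' P' Os' Is'" by (cases f)
  have r: "represents_set V V'" "s = s'" "represents_poly P P'" "list_all2 represents_poly Os Os'" "list_all2 represents_poly Is Is'"
    using f unfolding A f' by auto
  have s: "list_all2 represents_poly (result (t_map (t_psubst y ?q) xs)) (map (psubst y ?Q) ys)" if "list_all2 represents_poly xs ys" for xs ys
    by (rule list_all2_t_map[OF that]) (rule rpoly_psubst[OF _ Q])
  have rep: "represents (PSum (result (t_remove x (vars A))) (scal A) (result (t_psubst y ?q R))
      (result (t_map (t_psubst y ?q) (outs A))) (result (t_map (t_psubst y ?q) (ins A)))) ?f'"
    unfolding A f' psum.sel psum.rel_inject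
    using r represents_set_remove[OF r(1), of x] s[OF r(4)] s[OF r(5)] rpoly_psubst[OF R Q] by (simp add: f')
  have res: "result (t_HH A x D R u) = (if y \<notin> Vars [?Q] \<and> card (Vars [?Q]) \<le> 1
     then [PSum (result (t_remove x (vars A))) (scal A) (result (t_psubst y ?q R))
      (result (t_map (t_psubst y ?q) (outs A))) (result (t_map (t_psubst y ?q) (ins A)))] else [])"
    unfolding t_HH_def y using B Vars_le_1[OF Q] by simp
  show ?thesis unfolding res HH using rep by (simp add: rel_set_def)
qed

definition reducts_at :: "path_sum \<Rightarrow> nat \<Rightarrow> path_sum set" where
  "reducts_at f x = (if x \<in> Vars (outs f @ ins f) then {} else
     (if cofactor x (phase f) = {} then {PSum (vars f - {x}) (2 * scal f) (phase f) (outs f) (ins f)} else {}) \<union>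
     (if cofactor x (phase f) = {{}} then {PSum {} 0 {} (map (\<lambda>_. {}) (outs f)) (map (\<lambda>_. {}) (ins f))} else {}) \<union>
     (\<Union>w\<in>cofactor x (phase f). HH_reducts f x w))"

lemma rw_iff_reducts_at: "well_formed f \<Longrightarrow> {f'. f \<leadsto> f'} = (\<Union>x\<in>vars f. reducts_at f x)"
proof (cases f)
  case (PSum V s P Os Is)
  assume wf: "well_formed f"
  show ?thesis
    unfolding PSum rw_iff[OF wf[unfolded PSum]] reducts_at_def HH_reducts_def psum.sel
    by (rule set_eqI) (auto split: if_splits)
qed

lemma rel_set_UN:
  assumes "\<And>x y. S x y \<Longrightarrow> rel_set R (F x) (G y)" "rel_set S X Y"
  shows "rel_set R (\<Union> (F ` X)) (\<Union> (G ` Y))"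
  using assms unfolding rel_set_def by (smt (verit) UN_E UN_I)

lemma set_concat_map: "set (concat (result (t_map f xs))) = (\<Union>x\<in>set xs. set (result (f x)))"
  by (induction xs) auto

lemma reducts_at_correct:
  assumes f: "represents A f"
  shows "rel_set represents (set (result (t_reducts_at A x))) (reducts_at f x)"
proof -
  obtain V s P Os Is where A: "A = PSum V s P Os Is" by (cases A)
  obtain V' s' P' Os' Is' where f': "f = PSum V' s' P' Os' Is'" by (cases f)
  have r: "represents_set V V'" "s = s'" "represents_poly P P'" "list_all2 represents_poly Os Os'" "list_all2 represents_poly Is Is'"
    using f unfolding A f' by auto
  let ?DR = "result (t_split x P)"
  have DR: "represents_poly (fst ?DR) (cofactor x P')" "represents_poly (snd ?DR) (remainder x P')" using rpoly_split[OF r(3)] by auto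
  have occ: "result (t_occurs x Os) \<or> result (t_occurs x Is) \<longleftrightarrow> x \<in> Vars (Os' @ Is')"
    using result_occurs[OF r(4)] result_occurs[OF r(5)] by (auto simp: Vars_def)
  have z: "list_all2 represents_poly (result (t_map (\<lambda>_. ret []) xs)) (map (\<lambda>_. {}) ys)" if "list_all2 represents_poly xs ys" for xs ys
    by (rule list_all2_t_map[OF that]) simp
  show ?thesis
  proof (cases "x \<in> Vars (Os' @ Is')")
    case True
    with occ have "result (t_reducts_at A x) = []" by (auto simp: t_reducts_at_def A)
    moreover have "reducts_at f x = {}" using True by (simp add: reducts_at_def f')
    ultimately show ?thesis by (simp add: rel_set_def)
  next
    case False
    with occ have o: "\<not> result (t_occurs x Os)" "\<not> result (t_occurs x Is)" by auto
    consider "fst ?DR = []" | "fst ?DR = [[]]" | "fst ?DR \<noteq> []" "fst ?DR \<noteq> [[]]" by blast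
    then show ?thesis
    proof cases
      case 1
      then have d: "cofactor x P' = {}" using DR(1) by simp
      have "result (t_reducts_at A x) = [PSum (result (t_remove x V)) (2 * s) P Os Is]"
        using o 1 by (simp add: t_reducts_at_def A)
      moreover have "reducts_at f x = {PSum (V' - {x}) (2 * s') P' Os' Is'}"
        using False d by (simp add: reducts_at_def f')
      ultimately show ?thesis using r represents_set_remove[OF r(1)] by (simp add: rel_set_def)
    next
      case 2
      then have d: "cofactor x P' = {{}}" using DR(1) by (simp add: represents_poly_def)
      have "result (t_reducts_at A x) = [PSum [] 0 [] (result (t_map (\<lambda>_. ret []) Os)) (result (t_map (\<lambda>_. ret []) Is))]"
        using o 2 by (simp add: t_reducts_at_def A)
      moreover have "reducts_at f x = {PSum {} 0 {} (map (\<lambda>_. {}) Os') (map (\<lambda>_. {}) Is')}"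
        using False d by (simp add: reducts_at_def f' HH_reducts_def)
      ultimately show ?thesis using z[OF r(4)] z[OF r(5)] by (simp add: rel_set_def represents_set_def)
    next
      case 3
      then have d: "cofactor x P' \<noteq> {}" using DR(1) by (auto simp: represents_poly_def)
      have d': "cofactor x P' \<noteq> {{}}"
      proof
        assume "cofactor x P' = {{}}"
        then have "set ` set (fst ?DR) = {{}}" "distinct (map set (fst ?DR))" using DR(1) by (auto simp: represents_poly_def)
        then have "card (set (map set (fst ?DR))) = 1" "\<forall>u\<in>set (fst ?DR). u = []" by auto
        then have "length (fst ?DR) = 1" "\<forall>u\<in>set (fst ?DR). u = []"
          using distinct_card[OF \<open>distinct (map set (fst ?DR))\<close>] by auto
        then have "fst ?DR = [[]]" by (cases "fst ?DR") auto
        with 3 show False by simp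
      qed
      have "result (t_reducts_at A x) = concat (result (t_map (t_HH A x (fst ?DR) (snd ?DR)) (fst ?DR)))"
        using o 3 by (simp add: t_reducts_at_def A split: list.splits)
      then have "set (result (t_reducts_at A x)) = (\<Union>u\<in>set (fst ?DR). set (result (t_HH A x (fst ?DR) (snd ?DR) u)))"
        by (simp only: set_concat_map)
      moreover have "reducts_at f x = (\<Union>w\<in>cofactor x P'. HH_reducts f x w)"
        using False d d' by (simp add: reducts_at_def f')
      moreover have "rel_set represents (\<Union>u\<in>set (fst ?DR). set (result (t_HH A x (fst ?DR) (snd ?DR) u))) (\<Union>w\<in>cofactor x P'. HH_reducts f x w)"
      proof (rule rel_set_UN)
        show "rel_set (\<lambda>u w. distinct u \<and> w = set u) (set (fst ?DR)) (cofactor x P')"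
          using DR(1) unfolding represents_poly_def rel_set_def by blast
        show "rel_set represents (set (result (t_HH A x (fst ?DR) (snd ?DR) u))) (HH_reducts f x w)"
          if "distinct u \<and> w = set u" for u w
          using HH_correct[OF f, of "fst ?DR" x "snd ?DR" u] DR that by (simp add: f')
      qed
      ultimately show ?thesis by simp
    qed
  qed
qed

lemma t_reducts_correct:
  assumes "represents A f" "well_formed f"
  shows "rel_set represents (set (result (t_reducts A))) {f'. f \<leadsto> f'}"
proof -
  have "set (result (t_reducts A)) = (\<Union>x\<in>set (vars A). set (result (t_reducts_at A x)))"
    by (simp add: t_reducts_def set_concat_map del: set_concat)
  moreover have "set (vars A) = vars f" using assms(1) by (cases A; cases f) (auto simp: represents_set_def)
  ultimately show ?thesis
    unfolding rw_iff_reducts_at[OF assms(2)]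
    using rel_set_UN[of "(=)" represents "\<lambda>x. set (result (t_reducts_at A x))" "reducts_at f" "vars f" "vars f"]
      reducts_at_correct[OF assms(1)] by (simp add: rel_set_eq)
qed

subsection \<open>Evaluation\<close>

lemma result_peval:
  assumes "represents_poly p P" shows "result (t_peval T p) = peval P (\<lambda>x. of_bool (x \<in> set T))"
  using assms
proof (induction p arbitrary: P)
  case (Cons u p)
  from Cons.prems(1) obtain P' where u: "distinct u" "set u \<notin> P'" "represents_poly p P'" "P = insert (set u) P'"
    unfolding rpoly_Cons by blast
  have "(\<Prod>x\<in>set u. of_bool (x \<in> set T)) = (of_bool (set u \<subseteq> set T) :: bit)"
    by (cases "set u \<subseteq> set T") (auto intro!: prod.neutral)
  moreover have "peval P v = (\<Prod>x\<in>set u. v x) + peval P' v" for v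
    unfolding u(4) peval_def using rpoly_finite(1)[OF u(3)] u(2) by (rule sum.insert)
  ultimately have "peval P (\<lambda>x. of_bool (x \<in> set T)) = of_bool (set u \<subseteq> set T) + result (t_peval T p)"
    by (simp only: Cons.IH[OF u(3)])
  then show ?case by (cases "set u \<subseteq> set T") simp_all
qed (simp add: peval_def)

lemma result_sum_paths:
  assumes "represents_poly p P" "distinct vs"
  shows "result (t_sum_paths p T vs) = (\<Sum>S\<in>Pow (set vs). sgn2 (peval P (\<lambda>x. of_bool (x \<in> set T \<union> S))))"
  using assms(2)
proof (induction vs arbitrary: T)
  case Nil
  then show ?case using result_peval[OF assms(1)] by simp
next
  case (Cons v vs)
  let ?g = "\<lambda>T S. sgn2 (peval P (\<lambda>x. of_bool (x \<in> set T \<union> S)))"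
  have "(\<Sum>S\<in>Pow (set (v # vs)). ?g T S) = (\<Sum>S\<in>Pow (set vs). ?g T S) + (\<Sum>S\<in>insert v ` Pow (set vs). ?g T S)"
    unfolding list.set Pow_insert using Cons.prems by (intro sum.union_disjoint) auto
  also have "(\<Sum>S\<in>insert v ` Pow (set vs). ?g T S) = (\<Sum>S\<in>Pow (set vs). ?g T (insert v S))"
    using Cons.prems by (intro sum.reindex_cong[of "insert v"] inj_onI) auto
  also have "\<dots> = (\<Sum>S\<in>Pow (set vs). ?g (v # T) S)" by simp
  finally show ?case using Cons by simp
qed

lemma t_eval_correct:
  assumes A: "represents A f" and wf: "well_formed f" and c: "outs f = []" "ins f = []"
  shows "result (t_eval A) = eval f [] []"
proof -
  obtain V s P Os Is where A': "A = PSum V s P Os Is" by (cases A)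
  obtain V' s' P' Os' Is' where f': "f = PSum V' s' P' Os' Is'" by (cases f)
  have r: "represents_set V V'" "s = s'" "represents_poly P P'" using A unfolding A' f' by auto
  have V: "distinct V" "set V = V'" using r(1) by (auto simp: represents_set_def)
  have P: "\<Union> P' \<subseteq> V'" using wf by (auto simp: well_formed_def f')
  have "(\<Sum>S\<in>Pow V'. sgn2 (peval P' (\<lambda>x. of_bool (x \<in> S)))) = (\<Sum>v\<in>V' \<rightarrow>\<^sub>E UNIV. sgn2 (peval P' v))"
  proof (rule sum.reindex_bij_witness[where j = "\<lambda>S. \<lambda>x\<in>V'. of_bool (x \<in> S)" and i = "\<lambda>v. {x \<in> V'. v x = 1}"])
    fix S assume "S \<in> Pow V'"
    then show "{x \<in> V'. (\<lambda>x\<in>V'. of_bool (x \<in> S) :: bit) x = 1} = S" by auto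
    have "peval P' (\<lambda>x\<in>V'. of_bool (x \<in> S)) = peval P' (\<lambda>x. of_bool (x \<in> S))"
      unfolding peval_def using P by (intro sum.cong prod.cong refl) auto
    then show "sgn2 (peval P' (\<lambda>x\<in>V'. of_bool (x \<in> S))) = sgn2 (peval P' (\<lambda>x. of_bool (x \<in> S)))" by simp
  next
    fix v :: "nat \<Rightarrow> bit" assume v: "v \<in> V' \<rightarrow>\<^sub>E UNIV"
    show "(\<lambda>x\<in>V'. of_bool (x \<in> {x \<in> V'. v x = 1})) = v"
    proof
      fix x show "(\<lambda>x\<in>V'. of_bool (x \<in> {x \<in> V'. v x = 1})) x = v x"
      proof (cases "x \<in> V'")
        case True
        then show ?thesis by (cases "v x") simp_all
      next
        case False
        then show ?thesis using PiE_arb[OF v] by simp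
      qed
    qed
    show "{x \<in> V'. v x = 1} \<in> Pow V'" by blast
  next
    fix S :: "nat set"
    show "(\<lambda>x\<in>V'. of_bool (x \<in> S)) \<in> V' \<rightarrow>\<^sub>E (UNIV :: bit set)" by (intro restrict_PiE_iff[THEN iffD2]) simp
  qed
  then show ?thesis
    using c V r(2) result_sum_paths[OF r(3) V(1), of "[]"] by (simp add: t_eval_def eval_def A' f')
qed

subsection \<open>Building the path sum\<close>

lemma rpoly_pvar: "represents_poly [[x]] (pvar x)"
  by (simp add: represents_poly_def pvar_def)

lemma represents_set_upt: "represents_set [a..<b] {a..<b}"
  by (simp add: represents_set_def)

lemma map_pvars: "list_all2 represents_poly (result (t_map (\<lambda>x. ret [[x]]) xs)) (map pvar xs)"
  by (rule list_all2_t_map[of "(=)"]) (auto simp: list.rel_eq rpoly_pvar)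

lemma t_ident_correct: "represents (result (t_ident k)) (ident k)"
  using map_pvars[of "[0..<k]"] represents_set_upt[of 0 k] by (simp add: t_ident_def ident_def)

lemma t_dagger_correct: "represents A f \<Longrightarrow> represents (result (t_dagger A)) (dagger f)"
  by (cases A; cases f) (auto simp: t_dagger_def dagger_def)

lemma t_ket_correct: "represents (result (t_ket x)) (ket x)"
proof -
  have "list_all2 represents_poly (result (t_map (\<lambda>b. ret (if b = 1 then [[]] else [])) x)) (map pconst x)"
    by (rule list_all2_t_map[of "(=)"]) (auto simp: list.rel_eq represents_poly_def pconst_def)
  then show ?thesis by (simp add: t_ket_def ket_def represents_set_def)
qed

lemma t_shift_correct: "represents A f \<Longrightarrow> represents (result (t_shift k A)) (shift k f)"
proof -
  assume r: "represents A f"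
  have m: "result (t_map (\<lambda>x. ret (k + x)) xs) = map ((+) k) xs" for xs by (induction xs) auto
  have l: "list_all2 represents_poly (result (t_map (t_shift_poly k) xs)) (map ((`) ((`) ((+) k))) ys)"
    if "list_all2 represents_poly xs ys" for xs ys by (rule list_all2_t_map[OF that]) (rule rpoly_shift)
  have v: "represents_set (map ((+) k) xs) ((+) k ` X)" if "represents_set xs X" for xs X
    using that by (auto simp: represents_set_def distinct_map)
  show ?thesis using r
    by (cases A; cases f) (simp add: t_shift_def shift_def m v l rpoly_shift)
qed

lemma shift_sel: "vars (shift k A) = (+) k ` vars A" "scal (shift k A) = scal A"
  "length (outs (shift k A)) = length (outs A)" "length (ins (shift k A)) = length (ins A)"
  by (cases A; simp add: shift_def)+

lemma represents_iff: "represents A f \<longleftrightarrow>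
  represents_set (vars A) (vars f) \<and> scal A = scal f \<and> represents_poly (phase A) (phase f) \<and>
  list_all2 represents_poly (outs A) (outs f) \<and> list_all2 represents_poly (ins A) (ins f)"
  by (cases A; cases f) auto

lemma fresh_gt: "finite V \<Longrightarrow> x \<in> V \<Longrightarrow> x < fresh V"
  unfolding fresh_def by (metis Max_ge Suc_le_lessD finite_imageI finite_insert imageI insertCI)

lemma represents_set_append: "represents_set xs X \<Longrightarrow> represents_set ys Y \<Longrightarrow> X \<inter> Y = {} \<Longrightarrow> represents_set (xs @ ys) (X \<union> Y)"
  by (auto simp: represents_set_def)

lemma shift_disjoint: "finite V \<Longrightarrow> V \<inter> (+) (fresh V) ` W = {}"
  using fresh_gt by fastforce

lemma t_tensor_correct:
  assumes "represents A f" "represents B g"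
  shows "represents (result (t_tensor A B)) (f \<otimes> g)"
proof -
  have a: "vars f = set (vars A)" "scal B = scal g" using assms by (auto simp: represents_iff represents_set_def)
  note s = t_shift_correct[OF assms(2), of "fresh (vars f)"]
  have d: "vars f \<inter> vars (shift (fresh (vars f)) g) = {}"
    unfolding shift_sel by (rule shift_disjoint) (simp add: a)
  show ?thesis using assms(1) s d
    by (auto simp: t_tensor_def tensor_def Let_def represents_iff rpoly_padd a(1)[symmetric] a(2)
        intro!: represents_set_append list_all2_appendI)
qed

lemma t_compose_correct:
  assumes "represents A f" "represents B g"
  shows "represents (result (t_compose A B)) (f \<odot> g)"
proof -
  have a: "vars f = set (vars A)" "vars g = set (vars B)"
    using assms by (auto simp: represents_iff represents_set_def)
  define k where "k = fresh (vars f)"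
  define l where "l = fresh (vars g)"
  let ?ys = "[k + l..<k + l + length (ins A)]"
  note s = t_shift_correct[OF assms(2), of k]
  have p: "length (ins A) = length (ins f)" using assms(1) by (auto simp: represents_iff list_all2_lengthD)
  have ys: "map (\<lambda>i. k + l + i) [0..<length (ins f)] = ?ys"
    by (simp add: p map_add_upt add.commute)
  have d1: "vars (shift k g) \<inter> set ?ys = {}"
    unfolding shift_sel using fresh_gt[of "vars g"] by (fastforce simp: a l_def)
  have d2: "vars f \<inter> vars (shift k g) = {}"
    unfolding shift_sel k_def by (rule shift_disjoint) (simp add: a)
  have d3: "vars f \<inter> set ?ys = {}"
    using fresh_gt[of "vars f"] by (fastforce simp: a k_def)
  have ds: "list_all2 represents_poly (result (t_map2 t_padd (outs (result (t_shift k B))) (ins A))) (map2 padd (outs (shift k g)) (ins f))"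
    by (rule list_all2_t_map2[of represents_poly _ _ represents_poly]) (use assms s in \<open>auto simp: represents_iff rpoly_padd\<close>)
  have ls: "list_all2 represents_poly (result (t_map2 (\<lambda>y. t_pmul [[y]]) ?ys (result (t_map2 t_padd (outs (result (t_shift k B))) (ins A)))))
      (map2 (\<lambda>y. pmul (pvar y)) ?ys (map2 padd (outs (shift k g)) (ins f)))"
    by (rule list_all2_t_map2[OF _ ds, of "(=)"]) (auto simp: list.rel_eq simp del: t_pmul.simps intro: rpoly_pmul[OF rpoly_pvar])
  have V: "represents_set (vars A @ vars (result (t_shift k B)) @ ?ys) (vars f \<union> vars (shift k g) \<union> set ?ys)"
    unfolding Un_assoc using assms(1) s d1 d2 d3
    by (intro represents_set_append) (auto simp: represents_iff represents_set_def)
  show ?thesis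
    unfolding compose_def t_compose_def Let_def k_def[symmetric] l_def[symmetric] ys
    using assms s V rpoly_psum_list[OF ls] p
    by (simp add: a(1,2)[symmetric] k_def[symmetric] l_def[symmetric] represents_iff rpoly_padd)
qed

lemma t_wires_correct [simp]: "result (t_wires g) = wires g"
  by (cases g) auto

lemma t_gate_psum_correct: "represents (result (t_gate_psum g)) (gate_psum g)"
proof (cases g)
  case (CZGate cs q)
  have "represents_poly [[0..<Suc (length cs)]] {{0..<Suc (length cs)}}" by (simp add: represents_poly_def del: upt_Suc)
  then show ?thesis
    using map_pvars[of "[0..<Suc (length cs)]"] represents_set_upt[of 0 "Suc (length cs)"]
    by (simp add: CZGate Let_def del: upt_Suc t_upto.simps)
next
  case (HGate q)
  have "pmul (pvar 0) (pvar 1) = {{0, 1}}" by (simp add: pvar_def pmul_single insert_commute)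
  then show ?thesis by (simp add: HGate represents_poly_def represents_set_def pvar_def)
next
  case (XGate q)
  have "padd (pvar 0) (pconst 1) = {{0}, {}}" by (auto simp: pvar_def padd_def pconst_def)
  then show ?thesis by (simp add: XGate represents_poly_def represents_set_def pvar_def insert_commute)
next
  case (SwapGate q r)
  then show ?thesis by (simp add: represents_poly_def represents_set_def pvar_def)
qed

lemma map_of_zip_rel:
  assumes "list_all2 R xs ys" "length ks = length xs" "j \<in> set ks"
  shows "R (the (map_of (zip ks xs) j)) (the (map_of (zip ks ys) j))"
  using assms
proof (induction xs ys arbitrary: ks rule: list_all2_induct)
  case (Cons x xs y ys)
  then show ?case by (cases ks) auto
qed simp

lemma result_arrange:
  "result (t_arrange N pos ps) = map (\<lambda>j. the (map_of (zip pos ps) j)) [0..<N]"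
  unfolding t_arrange_def by (simp add: result_map[where g = "\<lambda>j. the (map_of (zip pos ps) j)"])

lemma t_place_correct:
  assumes "represents A f" "distinct ws" "set ws \<subseteq> {..<N}"
    "length (outs f) = length ws" "length (ins f) = length ws"
  shows "represents (result (t_place N ws A)) (place N ws f)"
proof -
  define pos where "pos = ws @ filter (\<lambda>j. j \<notin> set ws) [0..<N]"
  have pos: "set pos = {..<N}" "distinct pos" using assms by (auto simp: pos_def)
  then have len: "length pos = N" using distinct_card[of pos] by simp
  have "length ws \<le> N" using distinct_card[OF assms(2)] card_mono[OF _ assms(3)] by simp
  let ?T = "f \<otimes> ident (N - length ws)"
  note T = t_tensor_correct[OF assms(1) t_ident_correct[of "N - length ws"]]
  have l: "length (outs ?T) = N" "length (ins ?T) = N"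
    using assms \<open>length ws \<le> N\<close> by (simp_all add: tensor_def Let_def shift_sel ident_def[of "N - length ws"])
  have arr: "list_all2 represents_poly (map (\<lambda>j. the (map_of (zip pos ps) j)) [0..<N]) (map (\<lambda>j. the (map_of (zip pos Ps) j)) [0..<N])"
    if "list_all2 represents_poly ps Ps" "length Ps = N" for ps Ps
    unfolding list_all2_map1 list_all2_map2
  proof (rule list.rel_refl_strong)
    fix j assume "j \<in> set [0..<N]"
    then show "represents_poly (the (map_of (zip pos ps) j)) (the (map_of (zip pos Ps) j))"
      using pos(1) len that(2) list_all2_lengthD[OF that(1)] by (intro map_of_zip_rel[OF that(1)]) auto
  qed
  show ?thesis
    unfolding place_def t_place_def Let_def pos_def[symmetric]
    using T arr l by (simp add: represents_iff result_arrange pos_def[symmetric])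
qed

lemma length_gate: "length (outs (gate_psum g)) = length (wires g)" "length (ins (gate_psum g)) = length (wires g)"
  by (cases g; simp add: Let_def)+

lemma t_interp_from_correct:
  assumes "represents A f" "circuit_on N C"
  shows "represents (result (t_interp_from N A C)) (foldl (\<lambda>A g. place N (wires g) (gate_psum g) \<odot> A) f C)"
  using assms
proof (induction C arbitrary: A f)
  case (Cons g C)
  then have "distinct (wires g)" "set (wires g) \<subseteq> {..<N}" "circuit_on N C" by (auto simp: circuit_on_def)
  with Cons show ?case by (simp add: t_compose_correct t_place_correct t_gate_psum_correct length_gate)
qed simp

lemma t_measurement_psum_correct:
  assumes "circuit_on N C"
  shows "represents (result (t_measurement_psum N C x i)) (measurement_psum N C x i)"
proof -
  have "represents (PSum [] 1 [] [[[]]] [[[]]]) proj1"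
    by (simp add: proj1_def represents_iff represents_set_def represents_poly_def pconst_def)
  then show ?thesis
    using t_interp_from_correct[OF t_ident_correct assms]
    by (simp add: t_measurement_psum_def measurement_psum_def output_psum_def interp_def Let_def
        t_compose_correct t_tensor_correct t_dagger_correct t_ket_correct t_ident_correct)
qed

subsection \<open>well-formedness\<close>


lemma well_formed_rw: "f \<leadsto> f' \<Longrightarrow> well_formed f \<Longrightarrow> well_formed f'"
proof (induction rule: rw.induct)
  case (HH x V y Q R Os Is s)
  have sub: "psubst y Q p \<subseteq> Pow (V - {x})" if "p \<subseteq> Pow V" "x \<notin> \<Union> p" for p
  proof -
    let ?B = "(\<lambda>u. u - {y}) ` {u \<in> p. y \<in> u}"
    have "pmul Q ?B \<subseteq> (\<lambda>(a, b). a \<union> b) ` (Q \<times> ?B)" by (rule pmul_subset)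
    also have "\<dots> \<subseteq> Pow (V - {x})" using that HH by (auto simp: Vars_def)
    finally have "pmul Q ?B \<subseteq> Pow (V - {x})" .
    moreover have "{u \<in> p. y \<notin> u} \<subseteq> Pow (V - {x})" using that by auto
    ultimately show ?thesis unfolding psubst_def padd_def by blast
  qed
  show ?case unfolding well_formed_def
  proof (intro conjI ballI)
    fix p assume "p \<in> set (phase (PSum (V - {x}) s (psubst y Q R) (map (psubst y Q) Os) (map (psubst y Q) Is)) #
      outs (PSum (V - {x}) s (psubst y Q R) (map (psubst y Q) Os) (map (psubst y Q) Is)) @
      ins (PSum (V - {x}) s (psubst y Q R) (map (psubst y Q) Os) (map (psubst y Q) Is)))"
    then obtain q where q: "p = psubst y Q q" "q \<in> set (R # Os @ Is)" by auto
    moreover have "\<forall>p\<in>set (R # Os @ Is). p \<subseteq> Pow V" using HH by (simp add: well_formed_def)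
    then have "q \<subseteq> Pow V" using q(2) by (rule bspec)
    moreover have "x \<notin> \<Union> q" using q(2) HH by (auto simp: Vars_def)
    ultimately show "p \<subseteq> Pow (vars (PSum (V - {x}) s (psubst y Q R) (map (psubst y Q) Os) (map (psubst y Q) Is)))"
      using sub by simp
  qed (use HH in \<open>simp add: well_formed_def\<close>)
next
  case (Elim x V P Os Is s)
  then show ?case by (fastforce simp: well_formed_def Vars_def)
next
  case (Z z V R Os Is s)
  then show ?case by (auto simp: well_formed_def)
qed

lemma well_formed_shift: "well_formed f \<Longrightarrow> well_formed (shift k f)"
  by (cases f) (fastforce simp: well_formed_def shift_def)

lemma padd_subset: "p \<subseteq> X \<Longrightarrow> q \<subseteq> X \<Longrightarrow> padd p q \<subseteq> X"
  by (auto simp: padd_def)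

lemma pmul_subset_Pow: "p \<subseteq> Pow V \<Longrightarrow> q \<subseteq> Pow V \<Longrightarrow> pmul p q \<subseteq> Pow V"
  by (rule order_trans[OF pmul_subset]) auto

lemma Pow_subset_mono: "p \<subseteq> Pow V \<Longrightarrow> V \<subseteq> W \<Longrightarrow> p \<subseteq> Pow W"
  by auto

lemma psum_list_subset: "(\<And>p. p \<in> set ps \<Longrightarrow> p \<subseteq> X) \<Longrightarrow> psum_list ps \<subseteq> X"
  unfolding psum_list_def by (induction ps) (simp_all add: padd_subset)

lemma well_formed_tensor:
  assumes "well_formed f" "well_formed g" shows "well_formed (f \<otimes> g)"
proof -
  let ?g = "shift (fresh (vars f)) g"
  have g: "well_formed ?g" using assms(2) by (rule well_formed_shift)
  have poly: "p \<subseteq> Pow (vars f \<union> vars ?g)" if "p \<in> set (phase f # outs f @ ins f) \<or> p \<in> set (phase ?g # outs ?g @ ins ?g)" for p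
    using that assms(1) g unfolding well_formed_def by blast
  have "padd (phase f) (phase ?g) \<subseteq> Pow (vars f \<union> vars ?g)"
    by (intro padd_subset) (simp_all add: poly)
  moreover have "finite (vars f \<union> vars ?g)" using assms(1) g by (simp add: well_formed_def)
  ultimately show ?thesis
    unfolding tensor_def Let_def well_formed_def psum.sel by (simp add: poly ball_Un)
qed

lemma in_set_map2: "p \<in> set (map2 h xs zs) \<Longrightarrow> \<exists>a\<in>set xs. \<exists>b\<in>set zs. p = h a b"
  by (induction xs zs rule: list_induct2') auto

lemma well_formed_compose:
  assumes "well_formed f" "well_formed g" shows "well_formed (f \<odot> g)"
proof -
  let ?g = "shift (fresh (vars f)) g"
  define ys where "ys = map (\<lambda>i. fresh (vars f) + fresh (vars g) + i) [0..<length (ins f)]"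
  define W where "W = vars f \<union> vars ?g \<union> set ys"
  have g: "well_formed ?g" using assms(2) by (rule well_formed_shift)
  have poly: "p \<subseteq> Pow W" if "p \<in> set (phase f # outs f @ ins f) \<or> p \<in> set (phase ?g # outs ?g @ ins ?g)" for p
    using that assms(1) g unfolding well_formed_def W_def by blast
  have "psum_list (map2 (\<lambda>y. pmul (pvar y)) ys (map2 padd (outs ?g) (ins f))) \<subseteq> Pow W"
  proof (rule psum_list_subset)
    fix p assume "p \<in> set (map2 (\<lambda>y. pmul (pvar y)) ys (map2 padd (outs ?g) (ins f)))"
    then obtain y a b where p: "p = pmul (pvar y) (padd a b)" "y \<in> set ys" "a \<in> set (outs ?g)" "b \<in> set (ins f)"
      by (blast dest: in_set_map2)
    have "padd a b \<subseteq> Pow W" using p by (intro padd_subset poly) auto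
    moreover have "pvar y \<subseteq> Pow W" using p(2) by (simp add: pvar_def W_def)
    ultimately show "p \<subseteq> Pow W" unfolding p(1) by (intro pmul_subset_Pow)
  qed
  then have "padd (phase f) (padd (phase ?g) (psum_list (map2 (\<lambda>y. pmul (pvar y)) ys (map2 padd (outs ?g) (ins f))))) \<subseteq> Pow W"
    (is "?P \<subseteq> _")
    by (intro padd_subset) (simp_all add: poly)
  moreover have "finite W" using assms(1) g by (simp add: W_def well_formed_def)
  moreover have "f \<odot> g = PSum W (scal f * scal g / 2 ^ length (ins f)) ?P (outs f) (ins ?g)"
    unfolding compose_def Let_def ys_def[symmetric] W_def[symmetric] by (simp only: shift_sel)
  ultimately show ?thesis unfolding well_formed_def by (simp add: poly ball_Un)
qed

lemma well_formed_simple: "well_formed (ident k)" "well_formed (ket x)" "well_formed proj1"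
  "well_formed (gate_psum g)" "well_formed f \<Longrightarrow> well_formed (dagger f)"
proof -
  show "well_formed (gate_psum g)"
  proof (cases g)
    case (HGate q)
    have "pmul (pvar 0) (pvar 1) = {{0, 1}}" by (simp add: pvar_def pmul_single insert_commute)
    with HGate show ?thesis by (simp add: well_formed_def pvar_def)
  qed (auto simp: well_formed_def pvar_def padd_def pconst_def Let_def)
qed (auto simp: well_formed_def ident_def ket_def proj1_def dagger_def pvar_def pconst_def)

lemma well_formed_mono:
  assumes "well_formed T" "set Os \<subseteq> set (outs T)" "set Is \<subseteq> set (ins T)"
  shows "well_formed (PSum (vars T) s (phase T) Os Is)"
  using assms unfolding well_formed_def by (simp add: ball_Un) (blast dest: subsetD)

lemma well_formed_place:
  assumes "well_formed f" "distinct ws" "set ws \<subseteq> {..<N}"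
    "length (outs f) = length ws" "length (ins f) = length ws"
  shows "well_formed (place N ws f)"
proof -
  define pos where "pos = ws @ filter (\<lambda>j. j \<notin> set ws) [0..<N]"
  have pos: "set pos = {..<N}" "distinct pos" using assms by (auto simp: pos_def)
  then have len: "length pos = N" using distinct_card[of pos] by simp
  have "length ws \<le> N" using distinct_card[OF assms(2)] card_mono[OF _ assms(3)] by simp
  let ?T = "f \<otimes> ident (N - length ws)"
  have l: "length (outs ?T) = N" "length (ins ?T) = N"
    using assms \<open>length ws \<le> N\<close> by (simp_all add: tensor_def Let_def shift_sel ident_def[of "N - length ws"])
  have arr: "set (map (\<lambda>j. the (map_of (zip pos Ps) j)) [0..<N]) \<subseteq> set Ps" if "length Ps = N" for Ps :: "mpoly2 list"
  proof
    fix p assume "p \<in> set (map (\<lambda>j. the (map_of (zip pos Ps) j)) [0..<N])"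
    then obtain j where j: "j < N" "p = the (map_of (zip pos Ps) j)" by auto
    then have "j \<in> set pos" by (simp add: pos(1))
    then have "map_of (zip pos Ps) j \<noteq> None" using len that by simp
    then obtain q where "map_of (zip pos Ps) j = Some q" by blast
    then show "p \<in> set Ps" using j(2) set_zip_rightD[OF map_of_SomeD] by simp
  qed
  have "well_formed ?T" using assms(1) by (intro well_formed_tensor well_formed_simple)
  then show ?thesis using arr[OF l(1)] arr[OF l(2)]
    unfolding place_def Let_def pos_def[symmetric] by (rule well_formed_mono)
qed

lemma well_formed_measurement_psum:
  assumes "circuit_on N C" shows "well_formed (measurement_psum N C x i)"
proof -
  have "well_formed (foldl (\<lambda>A g. place N (wires g) (gate_psum g) \<odot> A) f C)" if "well_formed f" for f
    using that assms
  proof (induction C arbitrary: f)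
    case (Cons g C)
    then have "distinct (wires g)" "set (wires g) \<subseteq> {..<N}" "circuit_on N C" by (auto simp: circuit_on_def)
    with Cons show ?case
      by (simp add: well_formed_compose well_formed_place well_formed_simple length_gate)
  qed simp
  then have "well_formed (interp N C)" by (simp add: interp_def well_formed_simple)
  then show ?thesis
    unfolding measurement_psum_def output_psum_def Let_def
    by (intro well_formed_compose well_formed_simple well_formed_tensor)
qed

end

theory Submission
  imports Defs
begin

text \<open>
  Reducing the closed path sum of a measurement to one without variables is easy for a suitable
  order of the steps: the variables created by compositions, the last Hadamard layer and half of the
  first one occur linearly in the phase, and each of them removes one more variable through (HH).
  Since \<open>f0\<close> and the bent quadratic form then occur twice, they cancel, and a linear phase remains.
  The algorithm, however, may choose any order.  This is harmless because the rules are confluent up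
  to affine substitutions of single variables: \<open>|Var Q| \<le> 1\<close> makes each step (HH) such a substitution
  \<open>y := z + c\<close> or \<open>y := c\<close>.  So if one reduction eliminates all variables, no reduction gets stuck
  before, and the value is preserved.  For the same reason degrees never grow, so that a path sum
  with \<open>M\<close> variables keeps at most \<open>(M + 1)^(m + 1)\<close> monomials, and every step removes a variable.
\<close>

text \<open>The final brute-force evaluation takes exponential time in the number of variables, so
  everything hinges on normal forms having none, whatever choices led to them; this is the invariant
  \<open>good\<close>. The rule (HH) leaves \<open>y\<close> behind as a variable that no longer
  occurs. To avoid tracking such leftovers when reductions are compared, \<open>good\<close> fuses
  (HH) with the (Elim) of \<open>y\<close>. A pivot equation reads \<open>y + z + c = 0\<close> or
  \<open>y + c = 0\<close>, hence two choices of \<open>y\<close> for the same \<open>x\<close>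
  differ by a renaming. The existence of one complete reduction is not shown by rewriting gate by
  gate: a path sum is described by surviving parameters, all other variables being absorbed into
  solved linear constraints, and this description is composed along the circuit. It meets the
  restriction on \<open>Q\<close> because a wire always carries at most one variable plus a
  constant: H puts a fresh variable on it, the other gates at most permute wires or add 1. List
  sizes are not tracked through substitutions, each of which may multiply the bound. They are read
  off from the number of variables, which decreases, and the degree, which does not grow.\<close>

text \<open>Bit addition and multiplication would otherwise be rewritten to XOR and AND, out of reach of ring simplification.\<close>

declare add_bit_eq_xor [simp del] mult_bit_eq_and [simp del]

section \<open>Confluence\<close>

definition depends_on :: "'a set \<Rightarrow> (('a \<Rightarrow> bit) \<Rightarrow> 'b) \<Rightarrow> bool" where
  "depends_on V f \<longleftrightarrow> (\<forall>v w. (\<forall>a\<in>V. v a = w a) \<longrightarrow> f v = f w)"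

definition indep :: "'a \<Rightarrow> (('a \<Rightarrow> bit) \<Rightarrow> bit) \<Rightarrow> bool" where
  "indep x f \<longleftrightarrow> (\<forall>v b. f (v(x := b)) = f v)"

text \<open>For a multilinear polynomial this is the coefficient of \<open>x\<close>
  (\<open>peval_decompose\<close>), so the patterns \<open>z + R\<close> and
  \<open>x * (y + Q) + R\<close> in the rules say that the derivative is 1 or
  \<open>y + Q\<close>.\<close>

definition deriv :: "'a \<Rightarrow> (('a \<Rightarrow> bit) \<Rightarrow> bit) \<Rightarrow> ('a \<Rightarrow> bit) \<Rightarrow> bit" where
  "deriv x f v = f (v(x := 1)) + f (v(x := 0))"

text \<open>The bound \<open>k\<close> counts variables: 1 is the side condition on \<open>Q\<close>
  in (HH), 2 is the shape \<open>y + Q\<close> of a constraint that (HH) can solve.\<close>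

definition affine_in :: "nat \<Rightarrow> 'a set \<Rightarrow> (('a \<Rightarrow> bit) \<Rightarrow> bit) \<Rightarrow> bool" where
  "affine_in k V f \<longleftrightarrow> (\<exists>S c. finite S \<and> S \<subseteq> V \<and> card S \<le> k \<and> f = (\<lambda>v. (\<Sum>a\<in>S. v a) + c))"

lemma bit_add_self_left [simp]: "(b::bit) + (b + c) = c"
  by (cases b; cases c) auto

lemma bit_add_eq_0_iff: "(b::bit) + c = 0 \<longleftrightarrow> b = c"
  by (cases b; cases c) auto

lemma depends_onD: "depends_on V f \<Longrightarrow> (\<And>a. a \<in> V \<Longrightarrow> v a = w a) \<Longrightarrow> f v = f w"
  by (auto simp: depends_on_def)

lemma depends_on_mono: "depends_on V f \<Longrightarrow> V \<subseteq> W \<Longrightarrow> depends_on W f"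
  by (auto simp: depends_on_def subset_iff)

lemma depends_on_indep: "depends_on V f \<Longrightarrow> x \<notin> V \<Longrightarrow> indep x f"
  unfolding indep_def by (intro allI depends_onD[of V f]) auto

lemma depends_on_remove:
  assumes "depends_on V f" "indep x f" shows "depends_on (V - {x}) f"
  unfolding depends_on_def
proof (intro allI impI)
  fix v w :: "'a \<Rightarrow> bit" assume "\<forall>a\<in>V - {x}. v a = w a"
  then have "f (v(x := w x)) = f w" by (intro depends_onD[OF assms(1)]) auto
  then show "f v = f w" using assms(2) by (simp add: indep_def)
qed

lemma indepD: "indep x f \<Longrightarrow> f (v(x := b)) = f v"
  by (simp add: indep_def)

lemma deriv_0_iff: "(\<forall>v. deriv x f v = 0) \<longleftrightarrow> indep x f"
proof
  assume d: "\<forall>v. deriv x f v = 0"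
  have 01: "f (v(x := 1)) = f (v(x := 0))" for v using d by (simp add: deriv_def bit_add_eq_0_iff)
  have all: "f (v(x := b)) = f (v(x := 0))" for v b using 01[of v] by (cases b) auto
  show "indep x f" unfolding indep_def
  proof (intro allI)
    fix v b show "f (v(x := b)) = f v" using all[of v b] all[of v "v x"] by simp
  qed
qed (simp add: deriv_def indep_def)

lemma deriv_apply: "f (v(x := b)) = f (v(x := 0)) + b * deriv x f v"
  by (cases b) (simp_all add: deriv_def add.commute)

lemma deriv_swap: "x \<noteq> z \<Longrightarrow> deriv x (deriv z f) v = deriv z (deriv x f) v"
  by (simp add: deriv_def fun_upd_twist ac_simps)

text \<open>Mixed derivatives are symmetric. This decides whether two competing steps interfere:
  \<open>x\<close> occurs in the coefficient of \<open>z\<close> exactly if \<open>z\<close> occurs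
  in that of \<open>x\<close>.\<close>

lemma indep_deriv_swap: "x \<noteq> z \<Longrightarrow> indep x (deriv z f) \<longleftrightarrow> indep z (deriv x f)"
  unfolding deriv_0_iff[symmetric] by (simp add: deriv_swap)

lemma indep_deriv_self: "indep x (deriv x f)"
  by (simp add: indep_def deriv_def)

lemma affine_const: "affine_in k V (\<lambda>_. c)"
  unfolding affine_in_def by (rule exI[of _ "{}"], rule exI[of _ c]) simp

lemma affine_var_const: "a \<in> V \<Longrightarrow> 1 \<le> k \<Longrightarrow> affine_in k V (\<lambda>v. v a + c)"
  unfolding affine_in_def by (rule exI[of _ "{a}"], rule exI[of _ c]) simp

lemma affine_var: "a \<in> V \<Longrightarrow> 1 \<le> k \<Longrightarrow> affine_in k V (\<lambda>v. v a)"
  using affine_var_const[of a V k 0] by simp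

lemma affine_mono: "affine_in k V f \<Longrightarrow> k \<le> l \<Longrightarrow> V \<subseteq> W \<Longrightarrow> affine_in l W f"
  unfolding affine_in_def by (elim exE conjE, intro exI conjI) (assumption | erule (1) order_trans)+

lemma affine_depends: "affine_in k V f \<Longrightarrow> depends_on V f"
  unfolding affine_in_def depends_on_def by (fastforce intro!: sum.cong)

lemma affine_indep: "affine_in k V f \<Longrightarrow> x \<notin> V \<Longrightarrow> indep x f"
  by (rule depends_on_indep[OF affine_depends])

text \<open>Variables common to both summands cancel modulo 2, so the support of the sum is the
  symmetric difference.\<close>

lemma affine_add:
  assumes "affine_in j V f" "affine_in k V g"
  shows "affine_in (j + k) V (\<lambda>v. f v + g v)"
proof -
  obtain S c where f: "finite S" "S \<subseteq> V" "card S \<le> j" "f = (\<lambda>v. (\<Sum>a\<in>S. v a) + c)"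
    using assms(1) by (auto simp: affine_in_def)
  obtain T d where g: "finite T" "T \<subseteq> V" "card T \<le> k" "g = (\<lambda>v. (\<Sum>a\<in>T. v a) + d)"
    using assms(2) by (auto simp: affine_in_def)
  let ?D = "(S - T) \<union> (T - S)"
  have "sum v ?D = sum v S + sum v T" for v :: "'a \<Rightarrow> bit"
  proof -
    have "sum v ?D = sum v (S - T) + sum v (T - S)" using f g by (intro sum.union_disjoint) auto
    moreover have "sum v S = sum v (S \<inter> T) + sum v (S - T)" using f(1) by (rule sum.Int_Diff)
    moreover have "sum v T = sum v (S \<inter> T) + sum v (T - S)" using sum.Int_Diff[OF g(1), of v S] by (simp add: Int_commute)
    ultimately show ?thesis by (simp add: ac_simps)
  qed
  moreover have "card ?D \<le> card (S \<union> T)" using f g by (intro card_mono) auto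
  then have "card ?D \<le> j + k" using card_Un_le[of S T] f g by linarith
  ultimately show ?thesis unfolding affine_in_def using f g
    by (intro exI[of _ ?D] exI[of _ "c + d"]) (auto simp: ac_simps)
qed

text \<open>Each variable of \<open>f\<close> is replaced by at most one variable plus a constant,
  so their number cannot grow. This closure property keeps all constraints within two variables
  throughout.\<close>

lemma affine_comp:
  assumes "affine_in k V f" "\<And>a. a \<in> V \<Longrightarrow> affine_in 1 W (\<lambda>w. e w a)"
  shows "affine_in k W (\<lambda>w. f (e w))"
proof -
  obtain S c where f: "finite S" "S \<subseteq> V" "card S \<le> k" "f = (\<lambda>v. (\<Sum>a\<in>S. v a) + c)"
    using assms(1) by (auto simp: affine_in_def)
  have "affine_in (card S) W (\<lambda>w. (\<Sum>a\<in>S. e w a) + c)" using f(1,2)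
  proof (induction S rule: finite_induct)
    case (insert a S)
    have "affine_in (1 + card S) W (\<lambda>w. e w a + ((\<Sum>a\<in>S. e w a) + c))"
      using insert assms(2) by (intro affine_add) auto
    then show ?case using insert by (simp add: ac_simps)
  qed (simp add: affine_const)
  then show ?thesis unfolding f(4) by (rule affine_mono[OF _ f(3)]) simp
qed

lemma affine_1_cases:
  assumes "affine_in 1 V f"
  obtains c where "f = (\<lambda>_. c)" | z c where "z \<in> V" "f = (\<lambda>v. v z + c)"
proof -
  obtain S c where f: "finite S" "S \<subseteq> V" "card S \<le> 1" "f = (\<lambda>v. (\<Sum>a\<in>S. v a) + c)"
    using assms(1) by (auto simp: affine_in_def)
  consider "S = {}" | z where "S = {z}"
    using f(1,3) by (metis One_nat_def card_0_eq card_1_singletonE le_SucE le_zero_eq)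
  then show thesis using f that by cases auto
qed

text \<open>Any variable in the support can be split off as the pivot, at the cost of one in the
  bound; \<open>k = 1\<close> turns a two-variable constraint into the form required by
  (HH).\<close>

lemma affine_Suc_cases:
  assumes "affine_in (Suc k) V f"
  obtains c where "f = (\<lambda>_. c)" | y Q where "y \<in> V" "affine_in k (V - {y}) Q" "f = (\<lambda>v. v y + Q v)"
proof -
  obtain S c where f: "finite S" "S \<subseteq> V" "card S \<le> Suc k" "f = (\<lambda>v. (\<Sum>a\<in>S. v a) + c)"
    using assms(1) by (auto simp: affine_in_def)
  show thesis
  proof (cases "S = {}")
    case True then show ?thesis using f that(1)[of c] by simp
  next
    case False
    then obtain y where y: "y \<in> S" by blast
    have "affine_in k (V - {y}) (\<lambda>v. (\<Sum>a\<in>S - {y}. v a) + c)"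
      unfolding affine_in_def using f y by (intro exI[of _ "S - {y}"] exI[of _ c]) auto
    moreover have "f = (\<lambda>v. v y + ((\<Sum>a\<in>S - {y}. v a) + c))"
      unfolding f(4) using f(1) y by (simp add: sum.remove add.assoc)
    ultimately show ?thesis using that(2) f y by blast
  qed
qed

lemma affine_restrict:
  assumes "affine_in 1 V f" "indep x f" shows "affine_in 1 (V - {x}) f"
  using assms(1)
proof (cases rule: affine_1_cases)
  case (1 c) then show ?thesis by (simp add: affine_const)
next
  case (2 z c)
  have "z \<noteq> x"
  proof
    assume "z = x"
    then have "f ((\<lambda>_. 0)(x := 1)) \<noteq> f (\<lambda>_. 0)" using 2 by simp
    then show False using assms(2) by (auto simp: indep_def)
  qed
  with 2 show ?thesis by (simp add: affine_var_const)
qed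

text \<open>Suppose the derivative in \<open>x\<close> is \<open>y + Q\<close>. Where
  \<open>y \<noteq> Q\<close>, the two values of \<open>x\<close> contribute opposite signs, and
  where \<open>y = Q\<close> the phase does not depend on \<open>x\<close>; hence the value 0 for
  \<open>x\<close> is an arbitrary choice. Both \<open>x\<close> and \<open>y\<close> disappear, as
  in (HH) followed by (Elim) of \<open>y\<close>.\<close>

definition hh :: "(('a \<Rightarrow> bit) \<Rightarrow> bit) \<Rightarrow> 'a \<Rightarrow> 'a \<Rightarrow> (('a \<Rightarrow> bit) \<Rightarrow> bit) \<Rightarrow> ('a \<Rightarrow> bit) \<Rightarrow> bit" where
  "hh f x y Q v = f (v(x := 0, y := Q v))"

text \<open>
  Some reduction of the closed path sum with phase \<open>f\<close> eliminates all variables.  Phases are functions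
  rather than polynomials, so that the side conditions of the rules are conditions on derivatives.
\<close>

inductive good :: "'a set \<Rightarrow> (('a \<Rightarrow> bit) \<Rightarrow> bit) \<Rightarrow> bool" where
  good_empty: "good {} f"
| good_elim: "x \<in> V \<Longrightarrow> indep x f \<Longrightarrow> good (V - {x}) f \<Longrightarrow> good V f"
| good_zero: "x \<in> V \<Longrightarrow> (\<And>v. deriv x f v = 1) \<Longrightarrow> good V f"
| good_hh: "x \<in> V \<Longrightarrow> y \<in> V \<Longrightarrow> x \<noteq> y \<Longrightarrow> affine_in 1 (V - {x, y}) Q \<Longrightarrow>
    (\<And>v. deriv x f v = v y + Q v) \<Longrightarrow> good (V - {x, y}) (hh f x y Q) \<Longrightarrow> good V f"

lemma depends_on_hh:
  assumes "depends_on V f" "affine_in 1 (V - {x, y}) Q"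
  shows "depends_on (V - {x, y}) (hh f x y Q)"
  unfolding depends_on_def hh_def
proof (intro allI impI)
  fix v w :: "'a \<Rightarrow> bit" assume a: "\<forall>a\<in>V - {x, y}. v a = w a"
  then have "Q v = Q w" by (intro depends_onD[OF affine_depends[OF assms(2)]]) auto
  then show "f (v(x := 0, y := Q v)) = f (w(x := 0, y := Q w))"
    using a by (intro depends_onD[OF assms(1)]) auto
qed

text \<open>Such a substitution carries every rule application over to the image, since it maps
  derivatives to derivatives and pivot equations to pivot equations. Constants must be allowed
  because a change of pivot introduces them.\<close>

lemma good_rename:
  assumes "good V f" "inj_on \<sigma> V" "depends_on V f"
  shows "good (\<sigma> ` V) (\<lambda>w. f (\<lambda>a. w (\<sigma> a) + c a))"
  using assms
proof (induction arbitrary: rule: good.induct)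
  case (good_empty f)
  then show ?case by (simp add: good.good_empty)
next
  case (good_elim x V f)
  let ?g = "\<lambda>w. f (\<lambda>a. w (\<sigma> a) + c a)"
  have d: "depends_on (V - {x}) f" using good_elim by (intro depends_on_remove)
  have im: "\<sigma> ` V - {\<sigma> x} = \<sigma> ` (V - {x})"
    using good_elim by (simp add: inj_on_image_set_diff[where C = V])
  have "indep (\<sigma> x) ?g" unfolding indep_def
  proof (intro allI depends_onD[OF d])
    fix w b a assume "a \<in> V - {x}"
    then show "(w(\<sigma> x := b)) (\<sigma> a) + c a = w (\<sigma> a) + c a" using good_elim by (auto simp: inj_on_def)
  qed
  moreover have "good (\<sigma> ` (V - {x})) ?g"
    using d inj_on_subset[OF good_elim.prems(1)] by (intro good_elim.IH) auto
  ultimately show ?case unfolding im[symmetric] by (rule good.good_elim[OF imageI[OF good_elim.hyps(1)]])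
next
  case (good_zero x V f)
  \<comment> \<open>The constant \<open>c x\<close> merely swaps the two terms of the
    derivative.\<close>
  have "(\<lambda>w. f (\<lambda>a. w (\<sigma> a) + c a)) (w(\<sigma> x := b)) = f ((\<lambda>a. w (\<sigma> a) + c a)(x := b + c x))" for w b
    using good_zero by (intro depends_onD[OF good_zero.prems(2)]) (auto simp: inj_on_def)
  then have "deriv (\<sigma> x) (\<lambda>w. f (\<lambda>a. w (\<sigma> a) + c a)) w = deriv x f (\<lambda>a. w (\<sigma> a) + c a)" for w
    by (cases "c x") (simp_all add: deriv_def add.commute)
  then show ?case
    using good_zero.hyps(2) by (intro good.good_zero[OF imageI[OF good_zero.hyps(1)]]) simp
next
  case (good_hh x V y Q f)
  let ?T = "\<lambda>w a. w (\<sigma> a) + c a"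
  let ?g = "\<lambda>w. f (?T w)"
  \<comment> \<open>The equation \<open>y = Q\<close> becomes
    \<open>w (\<sigma> y) + c y = Q (?T w)\<close>, solved here for
    \<open>w (\<sigma> y)\<close>.\<close>
  let ?Q = "\<lambda>w. Q (?T w) + c y"
  have inj: "\<sigma> a = \<sigma> b \<longleftrightarrow> a = b" if "a \<in> V" "b \<in> V" for a b using that good_hh.prems(1) by (auto simp: inj_on_def)
  have upd: "?g (w(\<sigma> x := b)) = f ((?T w)(x := b + c x))" for w b
    using good_hh by (intro depends_onD[OF good_hh.prems(2)]) (auto simp: inj)
  have der: "deriv (\<sigma> x) ?g w = deriv x f (?T w)" for w
    unfolding deriv_def upd by (cases "c x") (simp_all add: add.commute)
  have im: "\<sigma> ` V - {\<sigma> x, \<sigma> y} = \<sigma> ` (V - {x, y})" using good_hh.hyps inj by auto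
  have Q1: "affine_in 1 (\<sigma> ` (V - {x, y})) (\<lambda>w. Q (?T w))"
    by (rule affine_comp[OF good_hh.hyps(4)]) (auto intro: affine_var_const)
  from affine_1_cases[OF Q1] have Q2: "affine_in 1 (\<sigma> ` (V - {x, y})) ?Q"
  proof cases
    case (1 d) then have "?Q = (\<lambda>_. d + c y)" by (simp add: fun_eq_iff)
    then show ?thesis by (simp only: affine_const)
  next
    case (2 z d) then have "?Q = (\<lambda>w. w z + (d + c y))" by (auto simp: fun_eq_iff add.assoc)
    then show ?thesis using 2 by (simp only:) (intro affine_var_const, auto)
  qed
  have "hh ?g (\<sigma> x) (\<sigma> y) ?Q w = hh f x y Q (?T w)" for w
  proof -
    have "hh ?g (\<sigma> x) (\<sigma> y) ?Q w = f (((?T w)(y := Q (?T w)))(x := c x))"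
      unfolding hh_def using good_hh.hyps inj by (intro depends_onD[OF good_hh.prems(2)]) auto
    also have "\<dots> = f (((?T w)(y := Q (?T w)))(x := 0)) + c x * deriv x f ((?T w)(y := Q (?T w)))" by (rule deriv_apply)
    \<comment> \<open>Setting \<open>w (\<sigma> x)\<close> to 0 puts \<open>c x\<close> at
      \<open>x\<close>; on the solution of the pivot equation the phase is the same for both values
      of \<open>x\<close>.\<close>
    also have "deriv x f ((?T w)(y := Q (?T w))) = 0"
      using good_hh.hyps(5) indepD[OF affine_indep[OF good_hh.hyps(4)], of y] by simp
    finally show ?thesis
      unfolding hh_def[of f x y Q "?T w"] fun_upd_twist[OF good_hh.hyps(3)] by (simp only: mult_zero_right add_0_right)
  qed
  then have eq: "hh ?g (\<sigma> x) (\<sigma> y) ?Q = (\<lambda>w. hh f x y Q (?T w))" by blast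
  have "good (\<sigma> ` (V - {x, y})) (\<lambda>w. hh f x y Q (?T w))"
    using good_hh.prems by (intro good_hh.IH depends_on_hh good_hh.hyps(4)) (auto intro: inj_on_subset)
  then have 1: "good (\<sigma> ` V - {\<sigma> x, \<sigma> y}) (hh ?g (\<sigma> x) (\<sigma> y) ?Q)" unfolding im eq .
  have 2: "deriv (\<sigma> x) ?g w = w (\<sigma> y) + ?Q w" for w unfolding der good_hh.hyps(5) by (simp add: ac_simps)
  show ?case
    using inj[OF good_hh.hyps(1,2)] good_hh.hyps(3) Q2 unfolding im[symmetric]
    by (intro good.good_hh[OF imageI[OF good_hh.hyps(1)] imageI[OF good_hh.hyps(2)] _ _ 2 1]) simp_all
qed

section \<open>Change of pivot and commutation of Hadamard steps\<close>

definition hh_form :: "'a set \<Rightarrow> (('a \<Rightarrow> bit) \<Rightarrow> bit) \<Rightarrow> 'a \<Rightarrow> 'a \<Rightarrow> (('a \<Rightarrow> bit) \<Rightarrow> bit) \<Rightarrow> bool" where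
  "hh_form V f x y Q \<longleftrightarrow> x \<in> V \<and> y \<in> V \<and> x \<noteq> y \<and> affine_in 1 (V - {x, y}) Q \<and> (\<forall>v. deriv x f v = v y + Q v)"

lemma hh_formD:
  assumes "hh_form V f x y Q"
  shows "x \<in> V" "y \<in> V" "x \<noteq> y" "affine_in 1 (V - {x, y}) Q" "deriv x f v = v y + Q v"
    "deriv x f = (\<lambda>v. v y + Q v)" "indep x Q" "indep y Q" "depends_on (V - {x, y}) Q"
  using assms affine_indep[of 1 "V - {x, y}" Q] affine_depends[of 1 "V - {x, y}" Q]
  by (auto simp: hh_form_def)

lemma good_hh_form: "hh_form V f x y Q \<Longrightarrow> good (V - {x, y}) (hh f x y Q) \<Longrightarrow> good V f"
  unfolding hh_form_def by (blast intro: good.good_hh)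

text \<open>As \<open>y\<close> does not occur in \<open>Q\<close>, nothing in \<open>y + Q\<close>
  cancels, so the absence of \<open>z\<close> from the sum is its absence from both parts.\<close>

lemma indep_pivot:
  assumes "indep z (\<lambda>v. v y + Q v)" "indep y Q"
  shows "z \<noteq> y" "indep z Q"
proof -
  show "z \<noteq> y"
  proof
    assume "z = y"
    then have "1 + Q (\<lambda>_. 0) = 0 + Q (\<lambda>_. 0)"
      using indepD[OF assms(1), of "\<lambda>_. 0" 1] indepD[OF assms(2), of "\<lambda>_. 0" 1] by simp
    then show False by (simp add: add_right_cancel)
  qed
  then show "indep z Q" using assms(1) by (simp add: indep_def)
qed

text \<open>Unless the pivots coincide, both steps solve the same equation
  \<open>y + z + c = 0\<close>, one for \<open>y\<close> and the other for \<open>z\<close>. The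
  survivor is called \<open>z\<close> in one case and \<open>y\<close> in the other, so the results
  differ by a renaming with constant \<open>c\<close>.\<close>

lemma repivot_good:
  assumes h: "hh_form V f x y Q" and h': "hh_form V f x z Q'"
    and d: "depends_on V f" and g: "good (V - {x, y}) (hh f x y Q)"
  shows "good (V - {x, z}) (hh f x z Q')"
proof (cases "y = z")
  case True
  have "Q' = Q" using hh_formD(5)[OF h] hh_formD(5)[OF h'] True by (auto simp: fun_eq_iff)
  with True g show ?thesis by simp
next
  case False
  have eq: "v y + Q v = v z + Q' v" for v using hh_formD(5)[OF h] hh_formD(5)[OF h'] by simp
  have zQ: "\<not> indep z Q"
  proof
    assume "indep z Q"
    then have "Q ((\<lambda>_. 0)(z := 1)) = Q (\<lambda>_. 0)" by (rule indepD)
    moreover have "Q' ((\<lambda>_. 0)(z := 1)) = Q' (\<lambda>_. 0)" by (rule indepD[OF hh_formD(8)[OF h']])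
    ultimately show False using eq[of "\<lambda>_. 0"] eq[of "(\<lambda>_. 0)(z := 1)"] False by auto
  qed
  obtain c where Q: "Q = (\<lambda>v. v z + c)"
    using hh_formD(4)[OF h]
  proof (cases rule: affine_1_cases)
    case (1 c) with zQ show ?thesis by (simp add: indep_def)
  next
    case (2 z' c)
    then have "z' = z" using zQ by (cases "z' = z") (auto simp: indep_def)
    with 2 that show ?thesis by blast
  qed
  have Q': "Q' v = v y + c" for v
  proof -
    have "v z + (v z + Q' v) = v z + (v y + (v z + c))" using eq[of v] unfolding Q by simp
    then show ?thesis by (simp add: ac_simps)
  qed
  let ?\<sigma> = "id(z := y)"
  let ?c = "(\<lambda>_. 0)(z := c)"
  have im: "?\<sigma> ` (V - {x, y}) = V - {x, z}"
    using False hh_formD(1-3)[OF h] hh_formD(1-3)[OF h'] by (auto simp: image_iff)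
  have "hh f x y Q (\<lambda>a. w (?\<sigma> a) + ?c a) = hh f x z Q' w" for w
  proof -
    have "(\<lambda>a. w (?\<sigma> a) + ?c a)(x := 0, y := Q (\<lambda>a. w (?\<sigma> a) + ?c a)) = w(x := 0, z := Q' w)"
      using False hh_formD(3)[OF h] hh_formD(3)[OF h'] by (auto simp: fun_eq_iff Q Q' ac_simps)
    then show ?thesis by (simp only: hh_def)
  qed
  moreover have "good (?\<sigma> ` (V - {x, y})) (\<lambda>w. hh f x y Q (\<lambda>a. w (?\<sigma> a) + ?c a))"
    using g by (rule good_rename) (auto simp: inj_on_def intro: depends_on_hh[OF d hh_formD(4)[OF h]])
  ultimately show ?thesis unfolding im by simp
qed

text \<open>The equation \<open>y + z + c = 0\<close> is symmetric in its two variables, so each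
  variable of the derivative can be taken as the pivot.\<close>

lemma repivot_form:
  assumes h: "hh_form V f x y Q" and z: "\<not> indep z (deriv x f)"
  obtains Q' where "hh_form V f x z Q'"
proof (cases "z = y")
  case True with h that show ?thesis by blast
next
  case False
  have zQ: "\<not> indep z Q" using z False unfolding hh_formD(6)[OF h] by (auto simp: indep_def)
  have "z \<in> V - {x, y} \<and> (\<exists>c. Q = (\<lambda>v. v z + c))"
    using hh_formD(4)[OF h]
  proof (cases rule: affine_1_cases)
    case (1 c) with zQ show ?thesis by (simp add: indep_def)
  next
    case (2 z' c)
    then have "z' = z" using zQ by (cases "z' = z") (auto simp: indep_def)
    with 2 show ?thesis by blast
  qed
  then obtain c where c: "z \<in> V - {x, y}" "Q = (\<lambda>v. v z + c)" by blast
  have "hh_form V f x z (\<lambda>v. v y + c)"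
    using c hh_formD(1-3)[OF h] hh_formD(5)[OF h] unfolding hh_form_def
    by (intro conjI affine_var_const) (auto simp: ac_simps)
  then show ?thesis by (rule that)
qed

lemma deriv_hh:
  assumes "z \<noteq> x" "z \<noteq> y" "indep z Q"
  shows "deriv z (hh f x y Q) v = deriv z f (v(x := 0, y := Q v))"
proof -
  have "hh f x y Q (v(z := b)) = f ((v(x := 0, y := Q v))(z := b))" for b
    using assms indepD[OF assms(3), of v b] unfolding hh_def by (simp add: fun_upd_twist)
  then show ?thesis by (simp add: deriv_def)
qed

lemma indep_hh:
  assumes "z \<noteq> x" "z \<noteq> y" "indep z Q" "indep z f"
  shows "indep z (hh f x y Q)"
  using deriv_hh[OF assms(1-3), of f] assms(4) unfolding deriv_0_iff[symmetric] by simp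

lemma indep_hh_self:
  assumes h: "hh_form V f x y Q"
  shows "indep x (hh f x y Q)" "indep y (hh f x y Q)"
  using hh_formD(3,7,8)[OF h] by (simp_all add: indep_def hh_def fun_upd_twist)

lemma indep_deriv:
  assumes "indep z f" shows "indep z (deriv x f)"
proof (cases "x = z")
  case True then show ?thesis by (simp add: indep_deriv_self)
next
  case False
  then show ?thesis using assms unfolding indep_def deriv_def by (simp add: fun_upd_twist)
qed

lemma not_indep_pivot: "hh_form V f x y Q \<Longrightarrow> \<not> indep y (deriv x f)"
  using indep_pivot(1)[of y y Q] hh_formD(6,8)[of V f x y Q] by auto

text \<open>If \<open>f\<close> lacks \<open>z\<close>, so does its derivative in \<open>x\<close>,
  whence \<open>z\<close> is outside the pivot equation; and \<open>z\<close> is not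
  \<open>x\<close>, because \<open>y\<close> occurs in that derivative. The two steps thus
  commute.\<close>

lemma elim_hh_form:
  assumes h: "hh_form V f x y Q" and z: "indep z f" "z \<in> V"
  shows "z \<noteq> x" "z \<noteq> y" "indep z Q" "hh_form (V - {z}) f x y Q" "indep z (hh f x y Q)"
proof -
  have i: "indep z (deriv x f)" using z(1) by (rule indep_deriv)
  note p = indep_pivot[OF i[unfolded hh_formD(6)[OF h]] hh_formD(8)[OF h]]
  show "z \<noteq> y" "indep z Q" using p by auto
  show "z \<noteq> x"
  proof
    assume "z = x"
    then have "deriv x f v = 0" for v using z(1) unfolding deriv_0_iff[symmetric] by simp
    then have "indep y (deriv x f)" by (simp add: indep_def)
    with not_indep_pivot[OF h] show False by blast
  qed
  then show "indep z (hh f x y Q)" using p z by (intro indep_hh)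
  have "affine_in 1 (V - {x, y} - {z}) Q" using hh_formD(4)[OF h] p(2) by (rule affine_restrict)
  moreover have "V - {x, y} - {z} = V - {z} - {x, y}" by auto
  ultimately show "hh_form (V - {z}) f x y Q"
    using \<open>z \<noteq> x\<close> p(1) hh_formD(1-3)[OF h] hh_formD(5)[OF h] unfolding hh_form_def by simp
qed

text \<open>A constant derivative in \<open>z\<close> has no \<open>x\<close> in it; by symmetry
  \<open>z\<close> is missing from the derivative in \<open>x\<close>. So the step does not touch
  \<open>z\<close>, and (Z) is applicable afterwards.\<close>

lemma zero_hh_form:
  assumes h: "hh_form V f x y Q" and z: "\<And>v. deriv z f v = 1" "z \<in> V"
  shows "z \<in> V - {x, y}" "deriv z (hh f x y Q) v = 1"
proof -
  have zx: "z \<noteq> x"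
  proof
    assume "z = x"
    then have "deriv x f v = 1" for v using z(1) by blast
    then have "indep y (deriv x f)" by (simp add: indep_def)
    with not_indep_pivot[OF h] show False by blast
  qed
  have "indep x (deriv z f)" using z(1) by (simp add: indep_def)
  then have i: "indep z (deriv x f)" using indep_deriv_swap[OF zx] by blast
  note p = indep_pivot[OF i[unfolded hh_formD(6)[OF h]] hh_formD(8)[OF h]]
  show "z \<in> V - {x, y}" using zx p z(2) by blast
  show "deriv z (hh f x y Q) v = 1" using deriv_hh[OF zx p] z(1) by simp
qed

text \<open>Two steps with separate equations can be done in either order. Since \<open>Q\<close> is
  free of \<open>y0\<close>, the equation for \<open>y\<close> is unaffected; \<open>Q0\<close> may
  contain \<open>y\<close>, and \<open>Q1\<close> is \<open>Q0\<close> with that equation inserted,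
  still affine in one variable.\<close>

lemma hh_commute:
  assumes h: "hh_form V f x y Q" and h0: "hh_form V f x0 y0 Q0"
    and ne: "x \<noteq> x0" "y \<noteq> y0" and i: "indep x0 (deriv x f)" "indep y0 Q"
  defines "Q1 \<equiv> \<lambda>v. Q0 (v(x := 0, y := Q v))"
  shows "hh_form (V - {x0, y0}) (hh f x0 y0 Q0) x y Q"
    "hh_form (V - {x, y}) (hh f x y Q) x0 y0 Q1"
    "hh (hh f x0 y0 Q0) x y Q = hh (hh f x y Q) x0 y0 Q1"
proof -
  have i0: "indep x (deriv x0 f)" using i(1) indep_deriv_swap[OF ne(1)] by blast
  note p = indep_pivot[OF i(1)[unfolded hh_formD(6)[OF h]] hh_formD(8)[OF h]]
  note p0 = indep_pivot[OF i0[unfolded hh_formD(6)[OF h0]] hh_formD(8)[OF h0]]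
  note D = hh_formD[OF h] and D0 = hh_formD[OF h0]
  have Qa: "affine_in 1 (V - {x, y} - {x0} - {y0}) Q" using D(4) p(2) i(2) by (intro affine_restrict)
  have Q0a: "affine_in 1 (V - {x0, y0} - {x}) Q0" using D0(4) p0(2) by (intro affine_restrict)
  have s: "V - {x, y} - {x0} - {y0} = V - {x0, y0} - {x, y}" by auto
  have s': "V - {x, y} - {x0} - {y0} = V - {x, y} - {x0, y0}" by auto
  have "deriv x (hh f x0 y0 Q0) v = v y + Q v" for v
    using deriv_hh[OF ne(1) p0(1) p0(2), of f v] D(5) p ne indepD[OF p(2)] indepD[OF i(2)] by simp
  then show "hh_form (V - {x0, y0}) (hh f x0 y0 Q0) x y Q"
    using Qa ne p(1) p0(1) D(1-3) unfolding hh_form_def s by auto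
  have Q1a: "affine_in 1 (V - {x, y} - {x0, y0}) Q1" unfolding Q1_def
  proof (rule affine_comp[OF Q0a])
    fix a assume "a \<in> V - {x0, y0} - {x}"
    then show "affine_in 1 (V - {x, y} - {x0, y0}) (\<lambda>w. (w(x := 0, y := Q w)) a)"
      using Qa[unfolded s'] by (cases "a = y") (auto intro: affine_var)
  qed
  have "deriv x0 (hh f x y Q) v = v y0 + Q1 v" for v
    using deriv_hh[OF ne(1)[symmetric] p(1) p(2), of f v] D0(5) ne p0(1) unfolding Q1_def by simp
  then show "hh_form (V - {x, y}) (hh f x y Q) x0 y0 Q1"
    using Q1a ne p(1) p0(1) D0(1-3) unfolding hh_form_def by auto
  show "hh (hh f x0 y0 Q0) x y Q = hh (hh f x y Q) x0 y0 Q1"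
  proof
    fix v
    have "Q (v(x0 := 0, y0 := Q1 v)) = Q v" using indepD[OF p(2)] indepD[OF i(2)] by simp
    moreover have "(v(x := 0, y := Q v))(x0 := 0, y0 := Q1 v) = (v(x0 := 0, y0 := Q1 v))(x := 0, y := Q v)"
      using ne p(1) p0(1) by (auto simp: fun_eq_iff)
    ultimately show "hh (hh f x0 y0 Q0) x y Q v = hh (hh f x y Q) x0 y0 Q1 v"
      by (simp add: hh_def Q1_def)
  qed
qed

text \<open>
  Two competing steps either commute or differ by an affine substitution of one variable, which
  preserves \<open>good\<close>; so no choice of a step loses the reduction to no variables.
\<close>

lemma good_step:
  assumes "finite V" "good V f" "depends_on V f"
  shows "(\<forall>x\<in>V. indep x f \<longrightarrow> good (V - {x}) f) \<and> (\<forall>x y Q. hh_form V f x y Q \<longrightarrow> good (V - {x, y}) (hh f x y Q))"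
  using assms
proof (induction "card V" arbitrary: V f rule: less_induct)
  case less
  have smaller: "card (V - {a}) < card V" "card (V - {a, b}) < card V" if "a \<in> V" for a b
    by (rule psubset_card_mono[OF less.prems(1)], use that in blast)+
  have IHe: "good (W - {x}) g" if "good W g" "depends_on W g" "x \<in> W" "indep x g" "card W < card V" "W \<subseteq> V" for W g x
    using less.hyps[OF that(5) finite_subset[OF that(6) less.prems(1)] that(1,2)] that(3,4) by blast
  have IHh: "good (W - {x, y}) (hh g x y Q)" if "good W g" "depends_on W g" "hh_form W g x y Q" "card W < card V" "W \<subseteq> V" for W g x y Q
    using less.hyps[OF that(4) finite_subset[OF that(5) less.prems(1)] that(1,2)] that(3) by blast
  have commE: "(V - {a}) - {b} = (V - {b}) - {a}" "(V - {a}) - {b, c} = (V - {b, c}) - {a}"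
    "(V - {a, d}) - {b, c} = (V - {b, c}) - {a, d}" for a b c d by blast+
  note dep = less.prems(3)
  from less.prems(2) show ?case
  proof (cases rule: good.cases)
    case good_empty
    then show ?thesis by (auto simp: hh_form_def)
  next
    case (good_elim x0)
    have d0: "depends_on (V - {x0}) f" using dep good_elim by (intro depends_on_remove)
    have "good (V - {x}) f" if x: "x \<in> V" "indep x f" for x
    proof (cases "x = x0")
      case True with good_elim show ?thesis by simp
    next
      case False
      then have "good (V - {x0} - {x}) f" by (intro IHe[OF good_elim(3) d0 _ x(2) smaller(1)]) (use good_elim x in auto)
      then have "good (V - {x} - {x0}) f" unfolding commE(1)[of x0 x] .
      then show ?thesis by - (rule good.good_elim[OF _ good_elim(2)], use False good_elim(1) in auto)
    qed
    moreover have "good (V - {x, y}) (hh f x y Q)" if h: "hh_form V f x y Q" for x y Q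
    proof -
      note e = elim_hh_form[OF h good_elim(2,1)]
      have "good (V - {x0} - {x, y}) (hh f x y Q)" by (rule IHh[OF good_elim(3) d0 e(4) smaller(1)[OF good_elim(1)] Diff_subset])
      then have "good (V - {x, y} - {x0}) (hh f x y Q)" unfolding commE(2)[of x0] .
      then show ?thesis by - (rule good.good_elim[OF _ e(5)], use e good_elim(1) in auto)
    qed
    ultimately show ?thesis by blast
  next
    case (good_zero x0)
    have "good (V - {x}) f" if x: "x \<in> V" "indep x f" for x
    proof -
      have "x \<noteq> x0" using good_zero(2) x(2) unfolding deriv_0_iff[symmetric] by auto
      then show ?thesis by - (rule good.good_zero[OF _ good_zero(2)], use good_zero in auto)
    qed
    moreover have "good (V - {x, y}) (hh f x y Q)" if h: "hh_form V f x y Q" for x y Q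
      using zero_hh_form[OF h good_zero(2,1)] by (rule good.good_zero)
    ultimately show ?thesis by blast
  next
    case (good_hh x0 y0 Q0)
    have h0: "hh_form V f x0 y0 Q0" using good_hh unfolding hh_form_def by blast
    have d0: "depends_on (V - {x0, y0}) (hh f x0 y0 Q0)" by (rule depends_on_hh[OF dep hh_formD(4)[OF h0]])
    have "good (V - {x}) f" if x: "x \<in> V" "indep x f" for x
    proof -
      note e = elim_hh_form[OF h0 x(2,1)]
      have "good (V - {x0, y0} - {x}) (hh f x0 y0 Q0)" by (rule IHe[OF good_hh(6) d0 _ e(5) smaller(2)[OF good_hh(1)] Diff_subset]) (use e x in auto)
      then have "good (V - {x} - {x0, y0}) (hh f x0 y0 Q0)" unfolding commE(2) .
      then show ?thesis by (rule good_hh_form[OF e(4)])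
    qed
    moreover have "good (V - {x, y}) (hh f x y Q)" if h: "hh_form V f x y Q" for x y Q
    \<comment> \<open>There are three cases. Equal \<open>x\<close>: both steps use the same
      equation. Neither of \<open>x\<close>, \<open>x0\<close> in the equation of the other: the
      steps can be reconciled, after a change of pivot if necessary. Otherwise each can be the pivot
      of the other, and then both steps give the same phase.\<close>
    proof (cases "x = x0")
      case True
      show ?thesis unfolding True
        by (rule repivot_good[OF h0 _ dep good_hh(6)]) (use h True in simp)
    next
      case xne: False
      show ?thesis
      proof (cases "indep x0 (deriv x f)")
        case True
        then have i0: "indep x (deriv x0 f)" using indep_deriv_swap[OF xne] by blast
        \<comment> \<open>\<open>hh_commute\<close> needs one of the two right-hand sides to be free
          of the other pivot; \<open>C1\<close> and \<open>C2\<close> cover the two possibilities.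
          The pivots are generalized so that they can be changed beforehand.\<close>
        have C1: "good (V - {x, y}) (hh f x y Q)"
          if h: "hh_form V f x y Q" and h0: "hh_form V f x0 y0 Q0" and g0: "good (V - {x0, y0}) (hh f x0 y0 Q0)"
            and ne: "y \<noteq> y0" and i: "indep y0 Q" for y Q y0 Q0
        proof -
          note L = hh_commute[OF h h0 xne ne True i]
          have "depends_on (V - {x0, y0}) (hh f x0 y0 Q0)" by (rule depends_on_hh[OF dep hh_formD(4)[OF h0]])
          then have "good (V - {x0, y0} - {x, y}) (hh (hh f x0 y0 Q0) x y Q)"
            by (intro IHh[OF g0 _ L(1) smaller(2)[OF hh_formD(1)[OF h0]] Diff_subset])
          then show ?thesis unfolding commE(3)[of x0 y0 x y] L(3) by (rule good_hh_form[OF L(2)])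
        qed
        have C2: "good (V - {x, y}) (hh f x y Q)"
          if h: "hh_form V f x y Q" and h0: "hh_form V f x0 y0 Q0" and g0: "good (V - {x0, y0}) (hh f x0 y0 Q0)"
            and ne: "y \<noteq> y0" and i: "indep y Q0" for y Q y0 Q0
        proof -
          note L = hh_commute[OF h0 h xne[symmetric] ne[symmetric] i0 i]
          have "depends_on (V - {x0, y0}) (hh f x0 y0 Q0)" by (rule depends_on_hh[OF dep hh_formD(4)[OF h0]])
          then have "good (V - {x0, y0} - {x, y}) (hh (hh f x0 y0 Q0) x y (\<lambda>v. Q (v(x0 := 0, y0 := Q0 v))))"
            by (intro IHh[OF g0 _ L(2) smaller(2)[OF hh_formD(1)[OF h0]] Diff_subset])
          then show ?thesis unfolding commE(3)[of x0 y0 x y] L(3)[symmetric] by (rule good_hh_form[OF L(1)])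
        qed
        \<comment> \<open>With a common pivot \<open>y0\<close>, solving one equation turns the
          other into \<open>Q + Q0 = 0\<close>. If this is constant, the remaining variable falls to
          (Elim) or (Z); otherwise some variable occurs in only one of \<open>Q\<close> and
          \<open>Q0\<close>, and pivoting on it there separates the pivots.\<close>
        have same: "good (V - {x, y0}) (hh f x y0 Q)" if h: "hh_form V f x y0 Q" for Q
        proof -
          have Qa: "indep x0 Q" and x0y: "x0 \<noteq> y0"
            using indep_pivot[OF True[unfolded hh_formD(6)[OF h]] hh_formD(8)[OF h]] by auto
          have Q0a: "indep x Q0" and xy: "x \<noteq> y0"
            using indep_pivot[OF i0[unfolded hh_formD(6)[OF h0]] hh_formD(8)[OF h0]] by auto
          have der: "deriv x0 (hh f x y0 Q) v = Q v + Q0 v" for v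
            using deriv_hh[OF xne[symmetric] x0y Qa, of f v] hh_formD(5)[OF h0] xy
              indepD[OF Q0a] indepD[OF hh_formD(8)[OF h0]] by simp
          have x0V: "x0 \<in> V - {x, y0}" using hh_formD(1)[OF h0] xne x0y by auto
          have fin: ?thesis if "\<And>v. Q v + Q0 v = c" for c
          proof (cases "c = 0")
            case c0: True
            then have Q: "Q = Q0" using that c0 by (auto simp: bit_add_eq_0_iff)
            have "deriv x (hh f x0 y0 Q0) v = 0" for v
              using deriv_hh[OF xne xy Q0a, of f v] hh_formD(5)[OF h] x0y
                indepD[OF Qa] indepD[OF hh_formD(8)[OF h]] by (simp add: Q)
            then have ix: "indep x (hh f x0 y0 Q0)" unfolding deriv_0_iff[symmetric] by blast
            have "good (V - {x0, y0} - {x}) (hh f x0 y0 Q0)"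
              by (rule IHe[OF good_hh(6) d0 _ ix smaller(2)[OF good_hh(1)] Diff_subset]) (use hh_formD(1)[OF h] xne xy in auto)
            moreover have "hh f x y0 Q = hh f x0 y0 Q0"
            proof
              fix v
              have ix0: "indep x0 (hh f x y0 Q)" unfolding deriv_0_iff[symmetric] using der that c0 by simp
              have "hh f x y0 Q v = hh f x y0 Q (v(x0 := 0))" using indepD[OF ix0] by simp
              also have "\<dots> = hh f x0 y0 Q0 (v(x := 0))"
                using xne xy x0y indepD[OF Qa] indepD[OF Q0a] by (simp add: hh_def Q fun_upd_twist)
              also have "\<dots> = hh f x0 y0 Q0 v" using indepD[OF ix] by simp
              finally show "hh f x y0 Q v = hh f x0 y0 Q0 v" .
            qed
            moreover have "V - {x0, y0} - {x} = V - {x, y0} - {x0}" by auto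
            moreover have "indep x0 (hh f x y0 Q)" unfolding deriv_0_iff[symmetric] using der that c0 by simp
            ultimately show ?thesis using good.good_elim[OF x0V] by simp
          next
            case False
            then show ?thesis by - (rule good.good_zero[OF x0V], use der that False in auto)
          qed
          show ?thesis
          proof (cases "\<exists>c. \<forall>v. Q v + Q0 v = c")
            case True then show ?thesis using fin by blast
          next
            case nc: False
            note Q1 = hh_formD(4)[OF h] and Q01 = hh_formD(4)[OF h0]
            have "(\<exists>z. \<not> indep z Q0 \<and> indep z Q \<and> z \<noteq> y0) \<or> (\<exists>z. \<not> indep z Q \<and> indep z Q0 \<and> z \<noteq> y0)"
            proof -
              have var: "\<not> indep z (\<lambda>v. v z + c)" for z :: 'a and c
                by (auto simp: indep_def intro!: exI[of _ "\<lambda>_. 0"] exI[of _ 1])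
              have var': "z \<noteq> z' \<Longrightarrow> indep z (\<lambda>v. v z' + c)" for z z' :: 'a and c
                by (simp add: indep_def)
              have cn: "indep z (\<lambda>v. c)" for z :: 'a and c by (simp add: indep_def)
              from Q1 show ?thesis
              proof (cases rule: affine_1_cases)
                case Q: (1 c)
                from Q01 show ?thesis
                proof (cases rule: affine_1_cases)
                  case (1 d) with Q nc show ?thesis by blast
                next
                  case (2 z d) with Q show ?thesis using var cn by blast
                qed
              next
                case Q: (2 z c)
                from Q01 show ?thesis
                proof (cases rule: affine_1_cases)
                  case (1 d) with Q show ?thesis using var cn by blast
                next
                  case (2 z' d)
                  have "z \<noteq> z'"
                  proof
                    assume "z = z'"
                    then have "Q v + Q0 v = c + d" for v using 2 Q by (simp add: ac_simps)
                    with nc show False by blast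
                  qed
                  with 2 Q show ?thesis using var var' by blast
                qed
              qed
            qed
            then show ?thesis
            proof (elim disjE exE conjE)
              fix z assume z: "\<not> indep z Q0" "indep z Q" "z \<noteq> y0"
              have "\<not> indep z (deriv x0 f)" unfolding hh_formD(6)[OF h0]
                using z indep_pivot(2)[of z y0 Q0] hh_formD(8)[OF h0] by blast
              then obtain Q0' where h0': "hh_form V f x0 z Q0'" using repivot_form[OF h0] by blast
              show ?thesis using h h0' repivot_good[OF h0 h0' dep good_hh(6)] z(3)[symmetric] z(2) by (rule C1)
            next
              fix z assume z: "\<not> indep z Q" "indep z Q0" "z \<noteq> y0"
              have "\<not> indep z (deriv x f)" unfolding hh_formD(6)[OF h]
                using z indep_pivot(2)[of z y0 Q] hh_formD(8)[OF h] by blast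
              then obtain Q' where h': "hh_form V f x z Q'" using repivot_form[OF h] by blast
              have "good (V - {x, z}) (hh f x z Q')" using h' h0 good_hh(6) z(3) z(2) by (rule C2)
              then show ?thesis by (rule repivot_good[OF h' h dep])
            qed
          qed
        qed
        show ?thesis
        proof (cases "indep y0 (deriv x f)")
          case i: True
          note p = indep_pivot[OF i[unfolded hh_formD(6)[OF h]] hh_formD(8)[OF h]]
          show ?thesis using h h0 good_hh(6) p(1)[symmetric] p(2) by (rule C1)
        next
          case False
          \<comment> \<open>Here \<open>y0\<close> occurs in the equation of \<open>x\<close> as
            well, so both steps can use it as the pivot.\<close>
          then obtain Q' where h': "hh_form V f x y0 Q'" using repivot_form[OF h] by blast
          show ?thesis by (rule repivot_good[OF h' h dep same[OF h']])
        qed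
      next
        case False
        then have nx: "\<not> indep x (deriv x0 f)" using indep_deriv_swap[OF xne] by blast
        from False obtain Q' where h': "hh_form V f x x0 Q'" using repivot_form[OF h] by blast
        from nx obtain Q0' where h0': "hh_form V f x0 x Q0'" using repivot_form[OF h0] by blast
        have g0: "good (V - {x0, x}) (hh f x0 x Q0')" by (rule repivot_good[OF h0 h0' dep good_hh(6)])
        \<comment> \<open>Both sides equal \<open>f\<close> at \<open>x = x0 = 0\<close> plus
          \<open>Q' * Q0'\<close>, by expanding in \<open>x0\<close> and in
          \<open>x\<close>.\<close>
        have "hh f x x0 Q' = hh f x0 x Q0'"
        proof
          fix v :: "'a \<Rightarrow> bit"
          let ?v = "v(x := 0, x0 := 0) :: 'a \<Rightarrow> bit"
          have Q: "Q' ?v = Q' v" "Q0' ?v = Q0' v"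
            using indepD[OF hh_formD(7)[OF h']] indepD[OF hh_formD(8)[OF h']]
              indepD[OF hh_formD(7)[OF h0']] indepD[OF hh_formD(8)[OF h0']] by simp_all
          have "hh f x x0 Q' v = f (?v(x0 := Q' v))" by (simp add: hh_def)
          also have "\<dots> = f ?v + Q' v * Q0' v"
            unfolding deriv_apply[of f ?v x0 "Q' v"] hh_formD(5)[OF h0'] Q using xne by simp
          also have "\<dots> = f (?v(x := Q0' v))"
            unfolding deriv_apply[of f ?v x "Q0' v"] hh_formD(5)[OF h'] Q using xne by (simp add: fun_upd_twist[of x0 x] mult.commute)
          also have "\<dots> = hh f x0 x Q0' v" using xne by (simp add: hh_def fun_upd_twist[of x x0])
          finally show "hh f x x0 Q' v = hh f x0 x Q0' v" .
        qed
        then have "good (V - {x, x0}) (hh f x x0 Q')" using g0 by (simp add: insert_commute)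
        then show ?thesis by (rule repivot_good[OF h' h dep])
      qed
    qed
    ultimately show ?thesis by blast
  qed
qed

section \<open>Values and linear elimination\<close>

definition ind :: "'a set \<Rightarrow> 'a \<Rightarrow> bit" where
  "ind S x = of_bool (x \<in> S)"

text \<open>Assignments are coded as subsets of \<open>V\<close>, so that a variable is split off by
  \<open>Pow_insert\<close> and sums are reindexed without restricting functions to
  \<open>V\<close>.\<close>

definition path_value :: "'a set \<Rightarrow> (('a \<Rightarrow> bit) \<Rightarrow> bit) \<Rightarrow> complex" where
  "path_value V f = (\<Sum>S\<in>Pow V. sgn2 (f (ind S)))"

lemma ind_upd: "(ind S)(x := 1) = ind (insert x S)" "(ind S)(x := 0) = ind (S - {x})"
  by (auto simp: ind_def fun_eq_iff)

lemma path_value_insert: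
  assumes "finite V" "x \<notin> V"
  shows "path_value (insert x V) f = path_value V (\<lambda>v. f (v(x := 0))) + path_value V (\<lambda>v. f (v(x := 1)))"
proof -
  have "path_value (insert x V) f = (\<Sum>S\<in>Pow V. sgn2 (f (ind S))) + (\<Sum>S\<in>insert x ` Pow V. sgn2 (f (ind S)))"
    unfolding path_value_def Pow_insert using assms by (intro sum.union_disjoint) auto
  also have "(\<Sum>S\<in>insert x ` Pow V. sgn2 (f (ind S))) = (\<Sum>S\<in>Pow V. sgn2 (f ((ind S)(x := 1))))"
    unfolding ind_upd using assms by (intro sum.reindex_cong[of "insert x"] inj_onI) auto
  also have "(\<Sum>S\<in>Pow V. sgn2 (f (ind S))) = (\<Sum>S\<in>Pow V. sgn2 (f ((ind S)(x := 0))))"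
    unfolding ind_upd using assms(2) by (intro sum.cong refl arg_cong[where f = "\<lambda>S. sgn2 (f (ind S))"]) auto
  finally show ?thesis unfolding path_value_def .
qed

lemma path_value_remove:
  assumes "finite V" "x \<in> V"
  shows "path_value V f = path_value (V - {x}) (\<lambda>v. f (v(x := 0))) + path_value (V - {x}) (\<lambda>v. f (v(x := 1)))"
  using path_value_insert[of "V - {x}" x f] assms by (simp add: insert_absorb)

lemma path_value_elim:
  assumes "finite V" "x \<in> V" "indep x f"
  shows "path_value V f = 2 * path_value (V - {x}) f"
  using path_value_remove[OF assms(1,2), of f] indepD[OF assms(3)] by simp

lemma sgn2_flip: "sgn2 (b + 1) = - sgn2 b"
  by (cases b) (simp_all add: sgn2_def)

lemma path_value_flip: "path_value V (\<lambda>v. f v + 1) = - path_value V f"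
  unfolding path_value_def by (simp add: sgn2_flip sum_negf)

lemma path_value_zero:
  assumes "finite V" "x \<in> V" "\<And>v. deriv x f v = 1"
  shows "path_value V f = 0"
proof -
  have "f (v(x := 1)) = f (v(x := 0)) + 1" for v
    using deriv_apply[of f v x 1] assms(3) by simp
  then show ?thesis using path_value_remove[OF assms(1,2), of f] by (simp add: path_value_flip)
qed

text \<open>For \<open>y \<noteq> Q\<close> the terms for the two values of \<open>x\<close> cancel;
  for \<open>y = Q\<close> they are equal, which gives the factor 2.\<close>

lemma path_value_hh:
  assumes "finite V" and h: "hh_form V f x y Q"
  shows "path_value V f = 2 * path_value (V - {x, y}) (hh f x y Q)"
proof -
  note D = hh_formD[OF h]
  let ?W = "V - {x, y}"
  have W: "V - {x} - {y} = ?W" by auto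
  have "path_value V f = path_value (V - {x}) (\<lambda>v. f (v(x := 0))) + path_value (V - {x}) (\<lambda>v. f (v(x := 1)))"
    using assms(1) D(1) by (rule path_value_remove)
  also have "\<dots> = (\<Sum>S\<in>Pow ?W. sgn2 (f ((ind S)(y := 0, x := 0))) + sgn2 (f ((ind S)(y := 1, x := 0)))
      + (sgn2 (f ((ind S)(y := 0, x := 1))) + sgn2 (f ((ind S)(y := 1, x := 1)))))"
    using D(1-3) assms(1) by (subst (1 2) path_value_remove[of "V - {x}" y]) (auto simp: W path_value_def sum.distrib)
  also have "\<dots> = (\<Sum>S\<in>Pow ?W. 2 * sgn2 (hh f x y Q (ind S)))"
  proof (rule sum.cong[OF refl])
    fix S
    have d: "f ((ind S)(y := a, x := 1)) = f ((ind S)(y := a, x := 0)) + (a + Q (ind S))" for a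
      using deriv_apply[of f "(ind S)(y := a)" x 1] D(5)[of "(ind S)(y := a)"] indepD[OF D(8)] by simp
    have e: "hh f x y Q (ind S) = f ((ind S)(y := Q (ind S), x := 0))"
      using D(3) by (simp add: hh_def fun_upd_twist[of x y])
    show "sgn2 (f ((ind S)(y := 0, x := 0))) + sgn2 (f ((ind S)(y := 1, x := 0)))
      + (sgn2 (f ((ind S)(y := 0, x := 1))) + sgn2 (f ((ind S)(y := 1, x := 1)))) = 2 * sgn2 (hh f x y Q (ind S))"
      unfolding d e by (cases "Q (ind S)") (simp_all add: sgn2_flip)
  qed
  finally show ?thesis by (simp add: path_value_def sum_distrib_left)
qed

text \<open>The last three conjuncts make \<open>e\<close> a bijection, on \<open>W\<close>, between
  the assignments to \<open>K\<close> and the solutions of \<open>C\<close>. The first one makes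
  every coordinate a constant or a parameter plus a constant, which lets such descriptions be
  composed without leaving the scope of (HH).\<close>

definition parametrizes :: "'a set \<Rightarrow> (('a \<Rightarrow> bit) \<Rightarrow> bool) \<Rightarrow> 'k set \<Rightarrow> (('k \<Rightarrow> bit) \<Rightarrow> 'a \<Rightarrow> bit) \<Rightarrow> bool" where
  "parametrizes W C K e \<longleftrightarrow> (\<forall>a\<in>W. affine_in 1 K (\<lambda>w. e w a)) \<and> (\<forall>w. C (e w)) \<and>
     (\<forall>v. C v \<longrightarrow> (\<exists>w. \<forall>a\<in>W. v a = e w a)) \<and> (\<forall>w w'. (\<forall>a\<in>W. e w a = e w' a) \<longrightarrow> (\<forall>k\<in>K. w k = w' k))"

lemma parametrizesD:
  assumes "parametrizes W C K e"
  shows "a \<in> W \<Longrightarrow> affine_in 1 K (\<lambda>w. e w a)" "C (e w)" "C v \<Longrightarrow> \<exists>w. \<forall>a\<in>W. v a = e w a"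
    "(\<And>a. a \<in> W \<Longrightarrow> e w a = e w' a) \<Longrightarrow> k \<in> K \<Longrightarrow> w k = w' k"
  using assms unfolding parametrizes_def by blast+

lemma depends_on_param:
  assumes "parametrizes W C K e" "depends_on W f"
  shows "depends_on K (\<lambda>w. f (e w))"
  unfolding depends_on_def
proof (intro allI impI)
  fix w w' :: "'b \<Rightarrow> bit" assume "\<forall>k\<in>K. w k = w' k"
  then show "f (e w) = f (e w')"
    using depends_onD[OF affine_depends[OF parametrizesD(1)[OF assms(1)]]]
    by (intro depends_onD[OF assms(2)]) blast
qed

text \<open>Change of variables along the bijection \<open>e\<close>, whose inverse \<open>g\<close>
  is picked by choice.\<close>

lemma sum_param:
  fixes F :: "('a \<Rightarrow> bit) \<Rightarrow> complex"
  assumes p: "parametrizes W C K e" and C: "depends_on W C" and d: "depends_on W F" and fin: "finite W"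
  shows "(\<Sum>S\<in>Pow W. if C (ind S) then F (ind S) else 0) = (\<Sum>T\<in>Pow K. F (e (ind T)))"
proof -
  have ek: "e w a = e w' a" if "a \<in> W" "\<And>k. k \<in> K \<Longrightarrow> w k = w' k" for w w' a
    using depends_onD[OF affine_depends[OF parametrizesD(1)[OF p that(1)]] that(2)] .
  define g where "g S = (SOME w. \<forall>a\<in>W. ind S a = e w a)" for S
  have g: "ind S a = e (g S) a" if "C (ind S)" "a \<in> W" for S a
    using someI_ex[OF parametrizesD(3)[OF p that(1)]] that(2) unfolding g_def by blast
  have eg: "e (ind {k \<in> K. g S k = 1}) a = ind S a" if "C (ind S)" "a \<in> W" for S a
    unfolding g[OF that] using that(2) by (intro ek) (auto simp: ind_def)
  have "(\<Sum>S\<in>Pow W. if C (ind S) then F (ind S) else 0) = (\<Sum>S\<in>{S \<in> Pow W. C (ind S)}. F (ind S))"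
    using fin by (intro sum.mono_neutral_cong_right) auto
  also have "\<dots> = (\<Sum>T\<in>Pow K. F (e (ind T)))"
  proof (rule sum.reindex_bij_witness[where i = "\<lambda>T. {a \<in> W. e (ind T) a = 1}" and j = "\<lambda>S. {k \<in> K. g S k = 1}"])
    fix S assume S: "S \<in> {S \<in> Pow W. C (ind S)}"
    then show "{a \<in> W. e (ind {k \<in> K. g S k = 1}) a = 1} = S" using eg by (auto simp: ind_def)
    show "F (e (ind {k \<in> K. g S k = 1})) = F (ind S)" using S eg by (intro depends_onD[OF d]) auto
  next
    fix T assume T: "T \<in> Pow K"
    let ?S = "{a \<in> W. e (ind T) a = 1}"
    have eS: "ind ?S a = e (ind T) a" if "a \<in> W" for a using that by (auto simp: ind_def)
    have CS: "C (ind ?S)" using parametrizesD(2)[OF p, of "ind T"] depends_onD[OF C eS] by simp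
    then show "?S \<in> {S \<in> Pow W. C (ind S)}" by auto
    have "e (g ?S) a = e (ind T) a" if "a \<in> W" for a using g[OF CS that] eS[OF that] by simp
    then have "g ?S k = ind T k" if "k \<in> K" for k using that by (rule parametrizesD(4)[OF p])
    then show "{k \<in> K. g ?S k = 1} = T" using T by (auto simp: ind_def)
  qed auto
  finally show ?thesis .
qed

lemma sgn2_add: "sgn2 (a + b) = sgn2 a * sgn2 b"
  by (cases a; cases b) (simp_all add: sgn2_def)

text \<open>Summing over the two values of one \<open>u\<close> gives 1 plus the sign of its
  constraint, which is 2 or 0: the variable acts as a Lagrange multiplier. The weight
  \<open>F\<close> is arbitrary so that the induction can absorb the constraints one at a
  time.\<close>

lemma sum_links:
  fixes F :: "('a \<Rightarrow> bit) \<Rightarrow> complex"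
  assumes "finite U" "finite W" "U \<inter> W = {}" "\<And>u. u \<in> U \<Longrightarrow> depends_on W (l u)" "depends_on W F"
  shows "(\<Sum>S\<in>Pow (U \<union> W). sgn2 (\<Sum>u\<in>U. ind S u * l u (ind S)) * F (ind S)) =
    2 ^ card U * (\<Sum>S\<in>Pow W. if \<forall>u\<in>U. l u (ind S) = 0 then F (ind S) else 0)"
  using assms(1,3-5)
proof (induction U arbitrary: F rule: finite_induct)
  case empty
  then show ?case by (simp add: sgn2_def)
next
  case (insert u U)
  let ?V = "U \<union> W"
  let ?G = "\<lambda>S. sgn2 (\<Sum>u\<in>U. ind S u * l u (ind S)) * F (ind S)"
  have uV: "u \<notin> ?V" using insert by auto
  have "(\<Sum>S\<in>Pow (insert u U \<union> W). sgn2 (\<Sum>u\<in>insert u U. ind S u * l u (ind S)) * F (ind S)) =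
     (\<Sum>S\<in>Pow ?V. sgn2 (\<Sum>u\<in>insert u U. ind S u * l u (ind S)) * F (ind S)) +
     (\<Sum>S\<in>insert u ` Pow ?V. sgn2 (\<Sum>u\<in>insert u U. ind S u * l u (ind S)) * F (ind S))"
    unfolding Un_insert_left Pow_insert using insert assms(2) uV by (intro sum.union_disjoint) auto
  also have "(\<Sum>S\<in>insert u ` Pow ?V. sgn2 (\<Sum>u\<in>insert u U. ind S u * l u (ind S)) * F (ind S)) =
     (\<Sum>S\<in>Pow ?V. sgn2 (l u (ind S)) * ?G S)"
  proof (rule sum.reindex_cong[of "insert u"])
    show "inj_on (insert u) (Pow ?V)" using uV by (intro inj_onI) auto
    fix S assume S: "S \<in> Pow ?V"
    have i: "ind (insert u S) a = ind S a" if "a \<in> ?V" for a using that uV by (auto simp: ind_def)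
    have l: "l u' (ind (insert u S)) = l u' (ind S)" if "u' \<in> insert u U" for u'
      using insert.prems(2)[OF that] i by (rule depends_onD) simp
    have "F (ind (insert u S)) = F (ind S)" using insert.prems(3) i by (rule depends_onD) simp
    moreover have "(\<Sum>u'\<in>U. ind (insert u S) u' * l u' (ind (insert u S))) = (\<Sum>u'\<in>U. ind S u' * l u' (ind S))"
      using i l by (intro sum.cong) auto
    ultimately show "sgn2 (\<Sum>u'\<in>insert u U. ind (insert u S) u' * l u' (ind (insert u S))) * F (ind (insert u S)) =
        sgn2 (l u (ind S)) * ?G S"
      using insert.hyps l[of u] by (simp add: sgn2_add ind_def[of "insert u S" u] mult.assoc)
  qed simp
  also have "(\<Sum>S\<in>Pow ?V. sgn2 (\<Sum>u\<in>insert u U. ind S u * l u (ind S)) * F (ind S)) = (\<Sum>S\<in>Pow ?V. ?G S)"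
  proof (rule sum.cong[OF refl])
    fix S assume "S \<in> Pow ?V"
    then have "ind S u = 0" using uV by (auto simp: ind_def)
    then show "sgn2 (\<Sum>u\<in>insert u U. ind S u * l u (ind S)) * F (ind S) = ?G S" using insert.hyps by simp
  qed
  also have "(\<Sum>S\<in>Pow ?V. ?G S) + (\<Sum>S\<in>Pow ?V. sgn2 (l u (ind S)) * ?G S) =
    2 * (\<Sum>S\<in>Pow ?V. sgn2 (\<Sum>u\<in>U. ind S u * l u (ind S)) * (if l u (ind S) = 0 then F (ind S) else 0))"
    unfolding sum.distrib[symmetric] sum_distrib_left by (intro sum.cong refl) (auto simp: sgn2_def)
  also have "(\<Sum>S\<in>Pow ?V. sgn2 (\<Sum>u\<in>U. ind S u * l u (ind S)) * (if l u (ind S) = 0 then F (ind S) else 0)) =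
    2 ^ card U * (\<Sum>S\<in>Pow W. if \<forall>u\<in>U. l u (ind S) = 0 then if l u (ind S) = 0 then F (ind S) else 0 else 0)"
  proof (rule insert.IH)
    have "depends_on W (l u)" using insert.prems by blast
    then show "depends_on W (\<lambda>v. if l u v = 0 then F v else 0)"
      using insert.prems(3) unfolding depends_on_def by metis
  qed (use insert.prems in auto)
  also have "\<dots> = 2 ^ card U * (\<Sum>S\<in>Pow W. if \<forall>u\<in>insert u U. l u (ind S) = 0 then F (ind S) else 0)"
    by (intro arg_cong2[of _ _ _ _ "(*)"] sum.cong refl) auto
  finally show ?case using insert.hyps by simp
qed

text \<open>Without constraints a parametrization has no room: surjectivity excludes constant
  coordinates and two coordinates sharing a parameter, injectivity excludes idle parameters. So it
  is a bijective renaming up to constants, and \<open>good_rename\<close> applies to its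
  inverse.\<close>

lemma good_param:
  assumes p: "parametrizes W (\<lambda>_. True) K e" and d: "depends_on W f" and g: "good K (\<lambda>w. f (e w))"
  shows "good W f"
proof -
  have "\<exists>k\<in>K. \<exists>c. \<forall>w. e w a = w k + c" if a: "a \<in> W" for a
    using parametrizesD(1)[OF p a]
  proof (cases rule: affine_1_cases)
    case (1 c)
    \<comment> \<open>A constant coordinate would never take the other value
      \<open>c + 1\<close>.\<close>
    obtain w where "(\<lambda>_. c + 1) a = e w a" using parametrizesD(3)[OF p, of "\<lambda>_. c + 1"] a by auto
    moreover have "e w a = c" using 1 by (rule fun_cong)
    ultimately show ?thesis by (cases c) simp_all
  next
    case (2 z c) then show ?thesis by (auto dest: fun_cong)
  qed
  then obtain \<kappa> c where k: "\<And>a. a \<in> W \<Longrightarrow> \<kappa> a \<in> K" "\<And>a w. a \<in> W \<Longrightarrow> e w a = w (\<kappa> a) + c a" by metis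
  have inj: "inj_on \<kappa> W"
  proof (rule inj_onI, rule ccontr)
    fix a b assume ab: "a \<in> W" "b \<in> W" "\<kappa> a = \<kappa> b" "a \<noteq> b"
    \<comment> \<open>Sharing a parameter would fix the difference of the two coordinates to
      \<open>c a + c b\<close>; the assignment chosen here violates this.\<close>
    obtain w where "\<forall>x\<in>W. ((\<lambda>_. 0)(a := c a + c b + 1)) x = e w x"
      using parametrizesD(3)[OF p, of "(\<lambda>_. 0)(a := c a + c b + 1)"] by auto
    then have "c a + c b + 1 = w (\<kappa> a) + c a" "0 = w (\<kappa> b) + c b"
      using ab k(2) by auto
    then show False using ab(3) by (cases "w (\<kappa> b)"; cases "c a"; cases "c b") auto
  qed
  have im: "\<kappa> ` W = K"
  proof
    show "\<kappa> ` W \<subseteq> K" using k(1) by blast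
    show "K \<subseteq> \<kappa> ` W"
    proof
      fix j assume j: "j \<in> K"
      show "j \<in> \<kappa> ` W"
      proof (rule ccontr)
        assume "j \<notin> \<kappa> ` W"
        then have "e ((\<lambda>_. 0)(j := 1)) a = e (\<lambda>_. 0) a" if "a \<in> W" for a using that k(2) by auto
        then have "((\<lambda>_. 0)(j := 1)) j = (\<lambda>_. 0 :: bit) j" using j by (rule parametrizesD(4)[OF p])
        then show False by simp
      qed
    qed
  qed
  let ?s = "the_inv_into W \<kappa>"
  have s: "?s (\<kappa> a) = a" if "a \<in> W" for a using the_inv_into_f_f[OF inj that] .
  have "good (?s ` K) (\<lambda>v. f (e (\<lambda>j. v (?s j) + c (?s j))))"
    using g depends_on_param[OF p d] by (intro good_rename[of K "\<lambda>w. f (e w)"]) (auto simp: im[symmetric] inj intro: inj_on_the_inv_into)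
  moreover have "?s ` K = W" using s by (force simp: im[symmetric])
  moreover have "f (e (\<lambda>j. v (?s j) + c (?s j))) = f v" for v
    using k s by (intro depends_onD[OF d]) (simp add: add.assoc)
  ultimately show ?thesis by simp
qed

text \<open>Each \<open>u\<close> plays the part of \<open>x\<close> in (HH): its derivative is the
  constraint \<open>l u\<close>. A nonconstant one is \<open>y + Q\<close>, and the step replaces
  \<open>y\<close> by \<open>Q\<close> everywhere; the remaining constraints still involve at most
  two variables, and \<open>K\<close> and \<open>e\<close> still parametrize their solutions. A
  constant one must be 0, as solutions exist, so that (Elim) removes \<open>u\<close>.\<close>

lemma elimination:
  assumes "finite U" "finite W" "U \<inter> W = {}" "\<And>u. u \<in> U \<Longrightarrow> affine_in 2 W (l u)" "depends_on W g"
    "\<And>v. f v = (\<Sum>u\<in>U. v u * l u v) + g v" "parametrizes W (\<lambda>v. \<forall>u\<in>U. l u v = 0) K e"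
  shows "good K (\<lambda>w. g (e w)) \<Longrightarrow> good (U \<union> W) f"
    "path_value (U \<union> W) f = 2 ^ card U * path_value K (\<lambda>w. g (e w))"
proof -
  have "depends_on W (\<lambda>v. \<forall>u\<in>U. l u v = 0)" using affine_depends[OF assms(4)] unfolding depends_on_def by metis
  moreover have F: "depends_on W (\<lambda>v. sgn2 (g v))" using assms(5) unfolding depends_on_def by metis
  moreover have "(\<Sum>S\<in>Pow (U \<union> W). sgn2 (\<Sum>u\<in>U. ind S u * l u (ind S)) * sgn2 (g (ind S))) =
    2 ^ card U * (\<Sum>S\<in>Pow W. if \<forall>u\<in>U. l u (ind S) = 0 then sgn2 (g (ind S)) else 0)"
    using assms(1-3) affine_depends[OF assms(4)] F by (rule sum_links)
  ultimately show "path_value (U \<union> W) f = 2 ^ card U * path_value K (\<lambda>w. g (e w))"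
    using sum_param[OF assms(7) _ _ assms(2), of "\<lambda>v. sgn2 (g v)"] unfolding path_value_def assms(6) sgn2_add by simp
next
  assume "good K (\<lambda>w. g (e w))"
  with assms show "good (U \<union> W) f"
  proof (induction U arbitrary: W l g f rule: finite_induct)
    case empty
    then have "f = g" by (simp add: fun_eq_iff)
    with empty show ?case using good_param[of W K e g] by simp
  next
    case (insert u U)
    have uW: "u \<notin> W" "U \<inter> W = {}" using insert.prems by auto
    have fin: "finite (insert u U \<union> W)" using insert by simp
    have f: "f v = v u * l u v + ((\<Sum>u'\<in>U. v u' * l u' v) + g v)" for v
      using insert.prems(5) insert.hyps by (simp add: add.assoc)
    have iu: "indep u (l u')" if "u' \<in> insert u U" for u'
      using affine_indep[OF insert.prems(3)[OF that] uW(1)] .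
    have gu: "indep u g" by (rule depends_on_indep[OF insert.prems(4) uW(1)])
    have der: "deriv u f v = l u v" for v
    proof -
      have r: "(\<Sum>u'\<in>U. (v(u := b)) u' * l u' (v(u := b))) + g (v(u := b)) = (\<Sum>u'\<in>U. v u' * l u' v) + g v" for b
        using insert.hyps(2) indepD[OF gu] iu by (intro arg_cong2[of _ _ _ _ "(+)"] sum.cong) (auto simp: indepD)
      show ?thesis unfolding deriv_def f r using indepD[OF iu[of u]] by (simp add: ac_simps)
    qed
    note P = parametrizesD[OF insert.prems(6)]
    have "affine_in (Suc 1) W (l u)" using insert.prems(3)[of u] by (simp add: numeral_2_eq_2)
    then show ?case
    proof (cases rule: affine_Suc_cases)
      case (1 c)
      then have l0: "l u = (\<lambda>_. 0)" using P(2) by auto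
      have "parametrizes W (\<lambda>v. \<forall>u\<in>U. l u v = 0) K e"
        using insert.prems(6) unfolding parametrizes_def by (simp add: l0)
      moreover have "f v = (\<Sum>u'\<in>U. v u' * l u' v) + g v" for v using f by (simp add: l0)
      ultimately have IH: "good (U \<union> W) f"
        using insert.prems insert.hyps by (intro insert.IH) auto
      have "indep u f" unfolding deriv_0_iff[symmetric] der l0 by simp
      moreover have "insert u U \<union> W - {u} = U \<union> W" using uW insert.hyps by auto
      ultimately show ?thesis using IH good_elim[of u "insert u U \<union> W" f] by auto
    next
      case (2 y Q)
      have yU: "y \<notin> U" "y \<noteq> u" using 2 uW by auto
      have set: "insert u U \<union> W - {u, y} = U \<union> (W - {y})" using yU uW insert.hyps by auto
      have Qy: "indep y Q" by (rule affine_indep[OF 2(2)]) simp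
      have h: "hh_form (insert u U \<union> W) f u y Q"
        unfolding hh_form_def set using 2 yU der by (auto intro: affine_mono[OF 2(2)])
      \<comment> \<open>The solutions \<open>e w\<close> satisfy \<open>y = Q\<close> already, so
        the substitution leaves \<open>e\<close> unchanged and the same parametrization serves the
        induction hypothesis.\<close>
      have ey: "(e w)(y := Q (e w)) = e w" for w
      proof -
        have "e w y + Q (e w) = 0" using P(2)[of w] 2(3) by simp
        then show ?thesis by (simp add: fun_eq_iff bit_add_eq_0_iff)
      qed
      have "good (U \<union> (W - {y})) (hh f u y Q)"
      proof (rule insert.IH[where l = "\<lambda>u' v. l u' (v(y := Q v))" and g = "\<lambda>v. g (v(y := Q v))" and W = "W - {y}"])
        show "finite (W - {y})" "U \<inter> (W - {y}) = {}" using insert.prems by auto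
        show "affine_in 2 (W - {y}) (\<lambda>v. l u' (v(y := Q v)))" if "u' \<in> U" for u'
        proof (rule affine_comp[of 2 W "l u'" "W - {y}" "\<lambda>v. v(y := Q v)"])
          show "affine_in 2 W (l u')" using insert.prems(3) that by blast
          fix a assume "a \<in> W"
          then show "affine_in 1 (W - {y}) (\<lambda>w. (w(y := Q w)) a)"
            using 2(2) by (cases "a = y") (auto intro: affine_var)
        qed
        show "depends_on (W - {y}) (\<lambda>v. g (v(y := Q v)))"
          unfolding depends_on_def
        proof (intro allI impI depends_onD[OF insert.prems(4)])
          fix v w :: "'a \<Rightarrow> bit" and a assume "\<forall>a\<in>W - {y}. v a = w a" "a \<in> W"
          then show "(v(y := Q v)) a = (w(y := Q w)) a"
            using depends_onD[OF affine_depends[OF 2(2)], of v w] by auto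
        qed
        show "hh f u y Q v = (\<Sum>u'\<in>U. v u' * l u' (v(y := Q v))) + g (v(y := Q v))" for v
        proof -
          have "l u' (v(u := 0, y := Q v)) = l u' (v(y := Q v))" if "u' \<in> U" for u'
            using iu[of u'] that yU(2) by (simp add: fun_upd_twist[of u y] indepD)
          then have "(\<Sum>u'\<in>U. (v(u := 0, y := Q v)) u' * l u' (v(u := 0, y := Q v))) = (\<Sum>u'\<in>U. v u' * l u' (v(y := Q v)))"
            using yU insert.hyps(2) by (intro sum.cong refl) auto
          moreover have "g (v(u := 0, y := Q v)) = g (v(y := Q v))"
            unfolding fun_upd_twist[OF yU(2)[symmetric]] by (rule indepD[OF gu])
          ultimately show ?thesis unfolding hh_def f using yU by simp
        qed
        show "good K (\<lambda>w. g ((e w)(y := Q (e w))))" unfolding ey by (rule insert.prems(7))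
        show "parametrizes (W - {y}) (\<lambda>v. \<forall>u'\<in>U. l u' (v(y := Q v)) = 0) K e"
          unfolding parametrizes_def
        proof (intro conjI allI ballI impI)
          fix v assume c: "\<forall>u'\<in>U. l u' (v(y := Q v)) = 0"
          have "l u (v(y := Q v)) = 0" using 2(3) indepD[OF Qy] by simp
          with c have "\<forall>u\<in>insert u U. l u (v(y := Q v)) = 0" by simp
          then obtain w where "\<forall>a\<in>W. (v(y := Q v)) a = e w a" using P(3) by blast
          then show "\<exists>w. \<forall>a\<in>W - {y}. v a = e w a" by (metis DiffE fun_upd_other singletonI)
        next
          fix w w' k assume eq: "\<forall>a\<in>W - {y}. e w a = e w' a" and k: "k \<in> K"
          have "e w y = Q (e w)" "e w' y = Q (e w')" using ey by (metis fun_upd_same)+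
          moreover have "Q (e w) = Q (e w')" using eq by (intro depends_onD[OF affine_depends[OF 2(2)]]) auto
          ultimately have "e w a = e w' a" if "a \<in> W" for a using eq that by (cases "a = y") auto
          then show "w k = w' k" using k by (rule P(4))
        next
          fix w u' assume "u' \<in> U"
          then show "l u' ((e w)(y := Q (e w))) = 0" unfolding ey using P(2) by blast
        qed (use P(1) in auto)
      qed
      then show ?thesis unfolding set[symmetric] by (rule good_hh_form[OF h])
    qed
  qed
qed

section \<open>Path sums of circuits\<close>

lemma well_formedD:
  assumes "well_formed A"
  shows "finite (vars A)" "phase A \<subseteq> Pow (vars A)" "p \<in> set (outs A @ ins A) \<Longrightarrow> p \<subseteq> Pow (vars A)"
  using assms by (auto simp: well_formed_def)

lemma poly_finite:
  assumes "well_formed A" "p \<in> set (phase A # outs A @ ins A)"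
  shows "finite p" "u \<in> p \<Longrightarrow> finite u"
proof -
  have "p \<subseteq> Pow (vars A)" "finite (vars A)" using assms by (auto simp: well_formed_def)
  then show "finite p" "u \<in> p \<Longrightarrow> finite u" by (auto intro: finite_subset)
qed

lemma peval_depends: "p \<subseteq> Pow V \<Longrightarrow> depends_on V (peval p)"
  unfolding depends_on_def peval_def by (intro allI impI sum.cong prod.cong refl) auto

lemma peval_shift: "peval ((`) ((`) ((+) a)) p) v = peval p (\<lambda>x. v (a + x))"
proof -
  have inj: "inj_on ((`) ((+) a)) p" by (simp add: inj_on_def inj_image_eq_iff)
  have "(\<Prod>x\<in>(+) a ` u. v x) = (\<Prod>x\<in>u. v (a + x))" for u :: "nat set"
    by (subst prod.reindex) (auto simp: inj_on_def)
  then show ?thesis unfolding peval_def by (subst sum.reindex[OF inj]) simp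
qed

lemma shift_polys:
  "phase (shift a B) = (`) ((`) ((+) a)) (phase B)"
  "outs (shift a B) = map ((`) ((`) ((+) a))) (outs B)"
  "ins (shift a B) = map ((`) ((`) ((+) a))) (ins B)"
  by (cases B; simp add: shift_def)+

text \<open>
  The variables in \<open>U\<close> occur linearly in the phase and impose the constraints \<open>l u = 0\<close>, whose
  solutions are parametrized by \<open>K\<close>.  Composition links one output to one input, so that a
  constraint involves at most two variables.
\<close>

definition presented :: "path_sum \<Rightarrow> 'k set \<Rightarrow> (('k \<Rightarrow> bit) \<Rightarrow> nat \<Rightarrow> bit) \<Rightarrow> (('k \<Rightarrow> bit) \<Rightarrow> bit) \<Rightarrow> complex \<Rightarrow> bool" where
  "presented A K e f r \<longleftrightarrow> well_formed A \<and> finite K \<and> (\<exists>U l g. U \<subseteq> vars A \<and>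
     (\<forall>u\<in>U. affine_in 2 (vars A - U) (l u)) \<and> depends_on (vars A - U) g \<and>
     (\<forall>v. peval (phase A) v = (\<Sum>u\<in>U. v u * l u v) + g v) \<and>
     (\<forall>p\<in>set (outs A @ ins A). affine_in 1 (vars A - U) (peval p)) \<and>
     parametrizes (vars A - U) (\<lambda>v. \<forall>u\<in>U. l u v = 0) K e \<and> (\<forall>w. g (e w) = f w) \<and> scal A * 2 ^ card U = r)"

text \<open>The operator of \<open>A\<close> is \<open>r\<close> times the sum over the parameters
  \<open>K\<close> of the sign of \<open>f\<close>, from inputs \<open>Is\<close> to outputs
  \<open>Os\<close> (\<open>eval_presents\<close>). The factors 2 released by the constraint
  variables are collected in \<open>r\<close>.\<close>

definition presents :: "path_sum \<Rightarrow> 'k set \<Rightarrow> (('k \<Rightarrow> bit) \<Rightarrow> bit) \<Rightarrow> (('k \<Rightarrow> bit) \<Rightarrow> bit list) \<Rightarrow> (('k \<Rightarrow> bit) \<Rightarrow> bit list) \<Rightarrow> complex \<Rightarrow> bool" where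
  "presents A K f Os Is r \<longleftrightarrow> (\<exists>e. presented A K e f r \<and>
     (\<forall>w. map (\<lambda>p. peval p (e w)) (outs A) = Os w) \<and> (\<forall>w. map (\<lambda>p. peval p (e w)) (ins A) = Is w))"

section \<open>Joining presented path sums\<close>

lemma affine_shift: "affine_in k W f \<Longrightarrow> affine_in k ((+) a ` W) (\<lambda>v. f (\<lambda>x. v (a + x)))"
  by (rule affine_comp[of k W f "(+) a ` W" "\<lambda>v x. v (a + x)"]) (auto intro: affine_var)

lemma depends_shift: "depends_on W f \<Longrightarrow> depends_on ((+) a ` W) (\<lambda>v. f (\<lambda>x. v (a + x)))"
  unfolding depends_on_def by simp

text \<open>Common core of composition and tensor product, the latter with \<open>p = 0\<close>.
  Each link variable \<open>c + i\<close> contributes the constraint that output \<open>i\<close> of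
  \<open>B\<close> equals input \<open>i\<close> of \<open>A\<close>; since both sides have at most
  one variable, it fits into two variables. The hypotheses on \<open>hA\<close> and
  \<open>hB\<close> say that \<open>K\<close> parametrizes the pairs of old parameters agreeing on
  the links. The factor \<open>2 ^ p\<close> lost in the scalar is regained from the link
  variables.\<close>

lemma presented_join:
  assumes A: "presented A KA eA fA rA" and B: "presented B KB eB fB rB" and a: "a = fresh (vars A)"
    and c: "a + fresh (vars B) \<le> c" and p: "p \<le> length (ins A)" "p \<le> length (outs B)"
    and C: "well_formed C" "vars C = vars A \<union> (+) a ` vars B \<union> {c..<c + p}" "scal C * 2 ^ p = scal A * scal B"
      "\<And>v. peval (phase C) v = peval (phase A) v + (peval (phase (shift a B)) v +
        (\<Sum>i<p. v (c + i) * (peval (outs (shift a B) ! i) v + peval (ins A ! i) v)))"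
      "set (outs C @ ins C) \<subseteq> set (outs A @ ins A) \<union> set (outs (shift a B) @ ins (shift a B))"
    and K: "finite K" and hA: "\<And>k. k \<in> KA \<Longrightarrow> affine_in 1 K (\<lambda>w. hA w k)" and hB: "\<And>k. k \<in> KB \<Longrightarrow> affine_in 1 K (\<lambda>w. hB w k)"
    and link: "\<And>w i. i < p \<Longrightarrow> peval (ins A ! i) (eA (hA w)) = peval (outs B ! i) (eB (hB w))"
    and surj: "\<And>wA wB. (\<And>i. i < p \<Longrightarrow> peval (ins A ! i) (eA wA) = peval (outs B ! i) (eB wB)) \<Longrightarrow>
        \<exists>w. (\<forall>k\<in>KA. wA k = hA w k) \<and> (\<forall>k\<in>KB. wB k = hB w k)"
    and inj: "\<And>w w' k. (\<And>k. k \<in> KA \<Longrightarrow> hA w k = hA w' k) \<Longrightarrow> (\<And>k. k \<in> KB \<Longrightarrow> hB w k = hB w' k) \<Longrightarrow> k \<in> K \<Longrightarrow> w k = w' k"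
  shows "presented C K (\<lambda>w x. if x < a then eA (hA w) x else eB (hB w) (x - a)) (\<lambda>w. fA (hA w) + fB (hB w)) (rA * rB)"
proof -
  obtain UA lA gA where PA: "well_formed A" "UA \<subseteq> vars A" "\<And>u. u \<in> UA \<Longrightarrow> affine_in 2 (vars A - UA) (lA u)"
    "depends_on (vars A - UA) gA" "\<And>v. peval (phase A) v = (\<Sum>u\<in>UA. v u * lA u v) + gA v"
    "\<And>p. p \<in> set (outs A @ ins A) \<Longrightarrow> affine_in 1 (vars A - UA) (peval p)"
    "parametrizes (vars A - UA) (\<lambda>v. \<forall>u\<in>UA. lA u v = 0) KA eA" "\<And>w. gA (eA w) = fA w" "scal A * 2 ^ card UA = rA"
    using A unfolding presented_def by blast
  obtain UB lB gB where PB: "well_formed B" "UB \<subseteq> vars B" "\<And>u. u \<in> UB \<Longrightarrow> affine_in 2 (vars B - UB) (lB u)"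
    "depends_on (vars B - UB) gB" "\<And>v. peval (phase B) v = (\<Sum>u\<in>UB. v u * lB u v) + gB v"
    "\<And>p. p \<in> set (outs B @ ins B) \<Longrightarrow> affine_in 1 (vars B - UB) (peval p)"
    "parametrizes (vars B - UB) (\<lambda>v. \<forall>u\<in>UB. lB u v = 0) KB eB" "\<And>w. gB (eB w) = fB w" "scal B * 2 ^ card UB = rB"
    using B unfolding presented_def by blast
  have fin: "finite (vars A)" "finite (vars B)" using well_formedD(1) PA(1) PB(1) by auto
  have ltA: "x < a" if "x \<in> vars A" for x using fresh_gt[OF fin(1) that] a by simp
  have ltB: "a + x < c" if "x \<in> vars B" for x using fresh_gt[OF fin(2) that] c by simp
  let ?t = "\<lambda>v x. v (a + x) :: bit"
  let ?e = "\<lambda>w x. if x < a then eA (hA w) x else eB (hB w) (x - a)"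
  define WA where "WA = vars A - UA"
  define WB where "WB = vars B - UB"
  have finU: "finite UA" "finite UB" using finite_subset PA(2) PB(2) fin by auto
  \<comment> \<open>The names are separated by \<open>a\<close> and \<open>c\<close>: variables of
    \<open>A\<close> lie below \<open>a\<close>, the shifted ones of \<open>B\<close> in between,
    and the links from \<open>c\<close> on. This lets \<open>l\<close> tell the three kinds of
    constraints apart.\<close>
  define U where "U = UA \<union> ((+) a ` UB \<union> {c..<c + p})"
  define l where "l u v = (if u < a then lA u v else if u < c then lB (u - a) (?t v)
      else peval (outs B ! (u - c)) (?t v) + peval (ins A ! (u - c)) v)" for u v
  define g where "g v = gA v + gB (?t v)" for v
  have ac: "a \<le> c" using c by simp
  have disj: "UA \<inter> ((+) a ` UB \<union> {c..<c + p}) = {}" "(+) a ` UB \<inter> {c..<c + p} = {}"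
    using ltA ltB PA(2) PB(2) ac by fastforce+
  have inja: "inj_on ((+) a) X" for X by (simp add: inj_on_def)
  have W: "vars C - U = WA \<union> (+) a ` WB"
  proof
    show "vars C - U \<subseteq> WA \<union> (+) a ` WB" unfolding C(2) U_def WA_def WB_def by auto
    show "WA \<union> (+) a ` WB \<subseteq> vars C - U"
    proof
      fix x assume "x \<in> WA \<union> (+) a ` WB"
      then show "x \<in> vars C - U"
      proof
        assume x: "x \<in> WA"
        then have "x < a" using ltA by (simp add: WA_def)
        with x ac show ?thesis unfolding C(2) U_def WA_def by auto
      next
        assume "x \<in> (+) a ` WB"
        then obtain y where y: "x = a + y" "y \<in> WB" by auto
        then have "a + y < c" using ltB by (simp add: WB_def)
        moreover have "a + y \<notin> UA" using ltA[of "a + y"] PA(2) by auto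
        ultimately show ?thesis using y unfolding C(2) U_def WB_def by auto
      qed
    qed
  qed
  have insA: "affine_in 1 WA (peval (ins A ! i))" if "i < p" for i using that p PA(6)[of "ins A ! i"] by (simp add: WA_def)
  have outB: "affine_in 1 WB (peval (outs B ! i))" if "i < p" for i using that p PB(6)[of "outs B ! i"] by (simp add: WB_def)
  have eA: "depends_on WA F \<Longrightarrow> F (?e w) = F (eA (hA w))" for F :: "(nat \<Rightarrow> bit) \<Rightarrow> bit" and w
    by (rule depends_onD[of WA F]) (auto simp: WA_def ltA)
  have eB: "?t (?e w) = eB (hB w)" for w by simp
  have lA: "l u v = lA u v" if "u \<in> UA" for u v using ltA[of u] that PA(2) by (auto simp: l_def)
  have lB: "l (a + u) v = lB u (?t v)" if "u \<in> UB" for u v using ltB[of u] that PB(2) by (auto simp: l_def)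
  have lC: "l (c + i) v = peval (outs B ! i) (?t v) + peval (ins A ! i) v" for i v using ac by (simp add: l_def)
  have cases_U: "P u" if "u \<in> U" "\<And>u. u \<in> UA \<Longrightarrow> P u" "\<And>u. u \<in> UB \<Longrightarrow> P (a + u)" "\<And>i. i < p \<Longrightarrow> P (c + i)" for P u
  proof -
    have "u = c + (u - c) \<and> u - c < p" if "u \<in> {c..<c + p}" using that by auto
    then show ?thesis using that unfolding U_def by (metis UnE imageE)
  qed
  have aff: "affine_in k WA F \<Longrightarrow> affine_in k (WA \<union> (+) a ` WB) F" for k F by (erule affine_mono) auto
  have aff': "affine_in k WB F \<Longrightarrow> affine_in k (WA \<union> (+) a ` WB) (\<lambda>v. F (?t v))" for k F
    using affine_mono[OF affine_shift[of k WB F a]] by blast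
  have "U \<subseteq> vars C" using PA(2) PB(2) unfolding U_def C(2) by auto
  moreover have "affine_in 2 (vars C - U) (l u)" if "u \<in> U" for u
    unfolding W using that
  proof (rule cases_U)
    fix u assume u: "u \<in> UA"
    then have "l u = lA u" using lA by blast
    then show "affine_in 2 (WA \<union> (+) a ` WB) (l u)" using aff PA(3)[OF u] by (simp add: WA_def)
  next
    fix u assume u: "u \<in> UB"
    then have "l (a + u) = (\<lambda>v. lB u (?t v))" using lB by blast
    then show "affine_in 2 (WA \<union> (+) a ` WB) (l (a + u))" using aff' PB(3)[OF u] by (simp add: WB_def)
  next
    fix i assume i: "i < p"
    have "l (c + i) = (\<lambda>v. peval (outs B ! i) (?t v) + peval (ins A ! i) v)" using lC by blast
    then show "affine_in 2 (WA \<union> (+) a ` WB) (l (c + i))"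
      using affine_add[OF aff'[OF outB[OF i]] aff[OF insA[OF i]]] by (simp add: numeral_2_eq_2)
  qed
  moreover have "depends_on (vars C - U) g"
  proof -
    have "depends_on (WA \<union> (+) a ` WB) gA" using PA(4) by (rule depends_on_mono) (simp add: WA_def)
    moreover have "depends_on (WA \<union> (+) a ` WB) (\<lambda>v. gB (?t v))"
      using depends_shift[OF PB(4)] by (rule depends_on_mono) (auto simp: WB_def)
    ultimately show ?thesis unfolding W g_def depends_on_def by metis
  qed
  moreover have "peval (phase C) v = (\<Sum>u\<in>U. v u * l u v) + g v" for v
  proof -
    have "(\<Sum>u\<in>U. v u * l u v) = (\<Sum>u\<in>UA. v u * l u v) + ((\<Sum>u\<in>(+) a ` UB. v u * l u v) + (\<Sum>u\<in>{c..<c + p}. v u * l u v))"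
      unfolding U_def using finU disj by (simp add: sum.union_disjoint)
    also have "(\<Sum>u\<in>UA. v u * l u v) = (\<Sum>u\<in>UA. v u * lA u v)" using lA by (intro sum.cong) auto
    also have "(\<Sum>u\<in>(+) a ` UB. v u * l u v) = (\<Sum>u\<in>UB. ?t v u * lB u (?t v))"
      using lB by (simp add: sum.reindex[OF inja])
    also have "(\<Sum>u\<in>{c..<c + p}. v u * l u v) = (\<Sum>i<p. v (c + i) * l (c + i) v)"
      by (rule sum.reindex_bij_witness[of _ "\<lambda>i. c + i" "\<lambda>u. u - c"]) auto
    finally have "(\<Sum>u\<in>U. v u * l u v) = (\<Sum>u\<in>UA. v u * lA u v) + ((\<Sum>u\<in>UB. ?t v u * lB u (?t v)) +
        (\<Sum>i<p. v (c + i) * (peval (outs B ! i) (?t v) + peval (ins A ! i) v)))" unfolding lC .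
    moreover have "(\<Sum>i<p. v (c + i) * (peval (outs (shift a B) ! i) v + peval (ins A ! i) v)) =
        (\<Sum>i<p. v (c + i) * (peval (outs B ! i) (?t v) + peval (ins A ! i) v))"
      using p by (intro sum.cong refl) (simp add: shift_polys peval_shift)
    ultimately show ?thesis unfolding C(4) shift_polys(1) peval_shift PA(5) PB(5) g_def
      by (simp only: ac_simps)
  qed
  moreover have "affine_in 1 (vars C - U) (peval q)" if "q \<in> set (outs C @ ins C)" for q
  proof -
    from that C(5) consider "q \<in> set (outs A @ ins A)" | "q \<in> set (outs (shift a B) @ ins (shift a B))" by blast
    then have "affine_in 1 (WA \<union> (+) a ` WB) (peval q)"
    proof cases
      case 1 then show ?thesis using aff PA(6) by (simp add: WA_def)
    next
      case 2
      then obtain q' where q': "q = (`) ((`) ((+) a)) q'" "q' \<in> set (outs B @ ins B)" unfolding shift_polys by auto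
      have "peval q = (\<lambda>v. peval q' (?t v))" unfolding q'(1) peval_shift ..
      then show ?thesis using aff' PB(6)[OF q'(2)] by (simp add: WB_def)
    qed
    then show ?thesis unfolding W .
  qed
  moreover have "parametrizes (vars C - U) (\<lambda>v. \<forall>u\<in>U. l u v = 0) K ?e"
    unfolding parametrizes_def W
  proof (intro conjI allI ballI impI)
    fix x assume "x \<in> WA \<union> (+) a ` WB"
    then show "affine_in 1 K (\<lambda>w. ?e w x)"
    proof
      assume x: "x \<in> WA"
      then have "x < a" using ltA by (simp add: WA_def)
      then show ?thesis using affine_comp[OF parametrizesD(1)[OF PA(7)] hA, of x] x by (simp add: WA_def)
    next
      assume "x \<in> (+) a ` WB"
      then obtain y where y: "x = a + y" "y \<in> WB" by auto
      then show ?thesis using affine_comp[OF parametrizesD(1)[OF PB(7)] hB, of y] by (simp add: WB_def)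
    qed
  next
    fix w u assume "u \<in> U"
    then show "l u (?e w) = 0"
    proof (rule cases_U)
      fix u assume u: "u \<in> UA"
      have "lA u (?e w) = lA u (eA (hA w))" using affine_depends[OF PA(3)[OF u]] unfolding WA_def[symmetric] by (rule eA)
      also have "\<dots> = 0" using parametrizesD(2)[OF PA(7)] u by blast
      finally show "l u (?e w) = 0" using lA[OF u] by simp
    next
      fix u assume u: "u \<in> UB"
      have "lB u (eB (hB w)) = 0" using parametrizesD(2)[OF PB(7)] u by blast
      then show "l (a + u) (?e w) = 0" using lB[OF u, of "?e w"] eB by simp
    next
      fix i assume i: "i < p"
      have "peval (ins A ! i) (?e w) = peval (ins A ! i) (eA (hA w))" using affine_depends[OF insA[OF i]] by (rule eA)
      then show "l (c + i) (?e w) = 0" using lC[of i "?e w"] eB link[OF i, of w] by simp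
    qed
  next
    fix v assume v: "\<forall>u\<in>U. l u v = 0"
    have "lA u v = 0" if "u \<in> UA" for u using bspec[OF v, of u] lA[OF that, of v] that by (simp add: U_def)
    then obtain wA where wA: "\<forall>x\<in>WA. v x = eA wA x" using parametrizesD(3)[OF PA(7)] unfolding WA_def by blast
    have "lB u (?t v) = 0" if "u \<in> UB" for u using bspec[OF v, of "a + u"] lB[OF that, of v] that by (simp add: U_def)
    then obtain wB where wB: "\<forall>x\<in>WB. ?t v x = eB wB x" using parametrizesD(3)[OF PB(7), of "?t v"] unfolding WB_def by blast
    have "peval (ins A ! i) (eA wA) = peval (outs B ! i) (eB wB)" if i: "i < p" for i
    proof -
      have "c + i \<in> U" using i by (simp add: U_def)
      then have "peval (outs B ! i) (?t v) = peval (ins A ! i) v" using v lC[of i v] by (metis bit_add_eq_0_iff)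
      moreover have "peval (outs B ! i) (?t v) = peval (outs B ! i) (eB wB)"
        using wB by (intro depends_onD[OF affine_depends[OF outB[OF i]]]) blast
      moreover have "peval (ins A ! i) v = peval (ins A ! i) (eA wA)"
        using wA by (intro depends_onD[OF affine_depends[OF insA[OF i]]]) blast
      ultimately show ?thesis by simp
    qed
    \<comment> \<open>The solutions found for \<open>A\<close> and for \<open>B\<close> separately
      agree on the links, so they come from one assignment to \<open>K\<close>.\<close>
    from surj[OF this] obtain w where w: "\<forall>k\<in>KA. wA k = hA w k" "\<forall>k\<in>KB. wB k = hB w k" by blast
    show "\<exists>w. \<forall>x\<in>WA \<union> (+) a ` WB. v x = ?e w x"
    proof (intro exI[of _ w] ballI)
      fix x assume "x \<in> WA \<union> (+) a ` WB"
      then show "v x = ?e w x"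
      proof
        assume x: "x \<in> WA"
        then have "eA wA x = eA (hA w) x"
          using w(1) by (intro depends_onD[OF affine_depends[OF parametrizesD(1)[OF PA(7)]]]) (auto simp: WA_def)
        then show ?thesis using wA x ltA[of x] by (simp add: WA_def)
      next
        assume "x \<in> (+) a ` WB"
        then obtain y where y: "x = a + y" "y \<in> WB" by auto
        then have "eB wB y = eB (hB w) y"
          using w(2) by (intro depends_onD[OF affine_depends[OF parametrizesD(1)[OF PB(7)]]]) (auto simp: WB_def)
        then show ?thesis using wB y by simp
      qed
    qed
  next
    fix w w' k assume eq: "\<forall>x\<in>WA \<union> (+) a ` WB. ?e w x = ?e w' x" and k: "k \<in> K"
    have "eA (hA w) x = eA (hA w') x" if "x \<in> vars A - UA" for x
      using bspec[OF eq, of x] that ltA[of x] by (simp add: WA_def)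
    then have 1: "hA w k = hA w' k" if "k \<in> KA" for k using that by (rule parametrizesD(4)[OF PA(7)])
    have "eB (hB w) x = eB (hB w') x" if "x \<in> vars B - UB" for x
      using bspec[OF eq, of "a + x"] that by (simp add: WB_def)
    then have "hB w k = hB w' k" if "k \<in> KB" for k using that by (rule parametrizesD(4)[OF PB(7)])
    with 1 show "w k = w' k" using k by (rule inj)
  qed
  moreover have "g (?e w) = fA (hA w) + fB (hB w)" for w
    using eA[of gA w] PA(4) PA(8) PB(8) by (simp add: g_def WA_def)
  moreover have "scal C * 2 ^ card U = rA * rB"
  proof -
    have "card U = p + (card UA + card UB)"
      unfolding U_def using finU disj by (simp add: card_Un_disjoint card_image[OF inja])
    then have "scal C * 2 ^ card U = (scal C * 2 ^ p) * (2 ^ card UA * 2 ^ card UB)" by (simp only: power_add mult.assoc)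
    then show ?thesis unfolding C(3) PA(9)[symmetric] PB(9)[symmetric] by (simp only: ac_simps)
  qed
  ultimately show ?thesis unfolding presented_def using C(1) K
    by (intro conjI exI[of _ U] exI[of _ l] exI[of _ g]) blast+
qed

lemma peval_simps [simp]: "peval (pvar x) v = v x" "peval (pconst b) v = b" "peval {} v = 0" "peval {u} v = (\<Prod>x\<in>u. v x)"
  by (cases b; simp_all add: peval_def pvar_def pconst_def)+

lemma affine_pvar: "x \<in> V \<Longrightarrow> affine_in 1 V (peval (pvar x))"
proof -
  assume "x \<in> V"
  then have "affine_in 1 V (\<lambda>v. v x)" by (rule affine_var) simp
  moreover have "peval (pvar x) = (\<lambda>v. v x)" by (simp add: fun_eq_iff)
  ultimately show ?thesis by simp
qed

lemma peval_psum_list: "(\<And>p. p \<in> set ps \<Longrightarrow> finite p) \<Longrightarrow> finite (psum_list ps) \<and> peval (psum_list ps) v = (\<Sum>p\<leftarrow>ps. peval p v)"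
  unfolding psum_list_def by (induction ps) (simp_all add: peval_padd)

text \<open>There is one link per wire between \<open>A\<close> and \<open>B\<close>, and the new
  parameters describe the pairs of old ones that agree on these wires.\<close>

lemma presents_compose:
  assumes A: "presents A KA fA OA IA rA" and B: "presents B KB fB OB IB rB" and len: "length (ins A) = length (outs B)"
    and K: "finite K" and hA: "\<And>k. k \<in> KA \<Longrightarrow> affine_in 1 K (\<lambda>w. hA w k)" and hB: "\<And>k. k \<in> KB \<Longrightarrow> affine_in 1 K (\<lambda>w. hB w k)"
    and link: "\<And>w. IA (hA w) = OB (hB w)"
    and surj: "\<And>wA wB. IA wA = OB wB \<Longrightarrow> \<exists>w. (\<forall>k\<in>KA. wA k = hA w k) \<and> (\<forall>k\<in>KB. wB k = hB w k)"
    and inj: "\<And>w w' k. (\<And>k. k \<in> KA \<Longrightarrow> hA w k = hA w' k) \<Longrightarrow> (\<And>k. k \<in> KB \<Longrightarrow> hB w k = hB w' k) \<Longrightarrow> k \<in> K \<Longrightarrow> w k = w' k"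
  shows "presents (A \<odot> B) K (\<lambda>w. fA (hA w) + fB (hB w)) (\<lambda>w. OA (hA w)) (\<lambda>w. IB (hB w)) (rA * rB)"
proof -
  obtain eA where eA: "presented A KA eA fA rA" "\<And>w. map (\<lambda>p. peval p (eA w)) (outs A) = OA w"
    "\<And>w. map (\<lambda>p. peval p (eA w)) (ins A) = IA w" using A unfolding presents_def by blast
  obtain eB where eB: "presented B KB eB fB rB" "\<And>w. map (\<lambda>p. peval p (eB w)) (outs B) = OB w"
    "\<And>w. map (\<lambda>p. peval p (eB w)) (ins B) = IB w" using B unfolding presents_def by blast
  have wf: "well_formed A" "well_formed B" using eA(1) eB(1) by (simp_all add: presented_def)
  define a where "a = fresh (vars A)"
  define c where "c = a + fresh (vars B)"
  let ?p = "length (ins A)"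
  let ?B = "shift a B"
  have wfB: "well_formed ?B" using wf(2) by (rule well_formed_shift)
  have ys: "map (\<lambda>i. a + fresh (vars B) + i) [0..<?p] = [c..<c + ?p]" by (simp add: c_def map_add_upt add.commute)
  let ?L = "map2 (\<lambda>y. pmul (pvar y)) [c..<c + ?p] (map2 padd (outs ?B) (ins A))"
  have AB: "A \<odot> B = PSum (vars A \<union> vars ?B \<union> {c..<c + ?p}) (scal A * scal B / 2 ^ ?p)
      (padd (phase A) (padd (phase ?B) (psum_list ?L))) (outs A) (ins ?B)"
    unfolding compose_def Let_def a_def[symmetric] ys by (simp add: shift_sel)
  have L: "?L = map (\<lambda>i. pmul (pvar (c + i)) (padd (outs ?B ! i) (ins A ! i))) [0..<?p]"
    by (rule nth_equalityI) (simp_all add: len shift_sel)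
  have finp: "finite p" "\<And>u. u \<in> p \<Longrightarrow> finite u" if "p \<in> set (phase A # outs A @ ins A) \<or> p \<in> set (phase ?B # outs ?B @ ins ?B)" for p
    using that poly_finite[OF wf(1), of p] poly_finite[OF wfB, of p] by blast+
  have q: "finite (padd (outs ?B ! i) (ins A ! i))" "\<And>u. u \<in> padd (outs ?B ! i) (ins A ! i) \<Longrightarrow> finite u"
    "peval (padd (outs ?B ! i) (ins A ! i)) v = peval (outs ?B ! i) v + peval (ins A ! i) v" if "i < ?p" for i v
  proof -
    have "outs ?B ! i \<in> set (outs ?B)" "ins A ! i \<in> set (ins A)" using that len by (simp_all add: shift_sel)
    then have f: "finite (outs ?B ! i)" "finite (ins A ! i)" "\<And>u. u \<in> outs ?B ! i \<Longrightarrow> finite u" "\<And>u. u \<in> ins A ! i \<Longrightarrow> finite u"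
      using finp by auto
    then show "finite (padd (outs ?B ! i) (ins A ! i))" "\<And>u. u \<in> padd (outs ?B ! i) (ins A ! i) \<Longrightarrow> finite u"
      "peval (padd (outs ?B ! i) (ins A ! i)) v = peval (outs ?B ! i) v + peval (ins A ! i) v"
      by (simp_all add: peval_padd) (auto simp: padd_def)
  qed
  have m: "finite (pmul (pvar (c + i)) (padd (outs ?B ! i) (ins A ! i)))"
    "peval (pmul (pvar (c + i)) (padd (outs ?B ! i) (ins A ! i))) v = v (c + i) * (peval (outs ?B ! i) v + peval (ins A ! i) v)"
    if "i < ?p" for i v
    using q[OF that] by (simp_all add: pvar_def) (subst peval_pmul, auto)
  have ps: "finite (psum_list ?L) \<and> peval (psum_list ?L) v = (\<Sum>i<?p. v (c + i) * (peval (outs ?B ! i) v + peval (ins A ! i) v))" for v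
  proof -
    have "finite (psum_list ?L) \<and> peval (psum_list ?L) v = (\<Sum>p\<leftarrow>?L. peval p v)"
      unfolding L using m(1) by (intro peval_psum_list) auto
    moreover have "(\<Sum>p\<leftarrow>?L. peval p v) = (\<Sum>i<?p. v (c + i) * (peval (outs ?B ! i) v + peval (ins A ! i) v))"
      unfolding L using m(2) by (simp add: comp_def interv_sum_list_conv_sum_set_nat atLeast0LessThan)
    ultimately show ?thesis by simp
  qed
  let ?e = "\<lambda>w x. if x < a then eA (hA w) x else eB (hB w) (x - a)"
  have nth: "peval (ins A ! i) (eA wA) = IA wA ! i" "peval (outs B ! i) (eB wB) = OB wB ! i" if "i < ?p" for i wA wB
    using that len by (simp_all add: eA(3)[symmetric] eB(2)[symmetric])
  have lenI: "length (IA wA) = ?p" "length (OB wB) = ?p" for wA wB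
    using len by (simp_all add: eA(3)[symmetric] eB(2)[symmetric])
  have "presented (A \<odot> B) K ?e (\<lambda>w. fA (hA w) + fB (hB w)) (rA * rB)"
  proof (rule presented_join[OF eA(1) eB(1) a_def _ order_refl, of c])
    show "well_formed (A \<odot> B)" using wf by (rule well_formed_compose)
    show "peval (phase (A \<odot> B)) v = peval (phase A) v + (peval (phase ?B) v +
        (\<Sum>i<?p. v (c + i) * (peval (outs ?B ! i) v + peval (ins A ! i) v)))" for v
      using ps[of v] finp unfolding AB by (simp add: peval_padd)
    show "\<exists>w. (\<forall>k\<in>KA. wA k = hA w k) \<and> (\<forall>k\<in>KB. wB k = hB w k)"
      if "\<And>i. i < ?p \<Longrightarrow> peval (ins A ! i) (eA wA) = peval (outs B ! i) (eB wB)" for wA wB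
      using that nth by (intro surj nth_equalityI) (simp_all add: lenI)
    show "w k = w' k" if "\<And>k. k \<in> KA \<Longrightarrow> hA w k = hA w' k" "\<And>k. k \<in> KB \<Longrightarrow> hB w k = hB w' k" "k \<in> K" for w w' k
      using that by (rule inj)
  qed (use len K hA hB link nth in \<open>auto simp: AB c_def shift_sel\<close>)
  moreover have "peval p (?e w) = peval p (eA (hA w))" if "p \<in> set (outs A)" for p w
  proof (rule depends_onD[of "vars A" "peval p"])
    show "depends_on (vars A) (peval p)" using that well_formedD(3)[OF wf(1), of p] by (intro peval_depends) simp
    fix x assume "x \<in> vars A"
    then show "?e w x = eA (hA w) x" using fresh_gt[OF well_formedD(1)[OF wf(1)]] by (simp add: a_def)
  qed
  then have "map (\<lambda>p. peval p (?e w)) (outs (A \<odot> B)) = OA (hA w)" for w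
    unfolding eA(2)[symmetric] by (simp add: AB)
  moreover have "map (\<lambda>p. peval p (?e w)) (ins (A \<odot> B)) = IB (hB w)" for w
    unfolding eB(3)[symmetric] by (simp add: AB shift_polys peval_shift)
  ultimately show ?thesis unfolding presents_def by (intro exI[of _ ?e]) blast
qed

text \<open>Without links the parameters of both factors vary independently.\<close>

lemma presents_tensor:
  assumes A: "presents A KA fA OA IA rA" and B: "presents B KB fB OB IB rB"
    and K: "finite K" and hA: "\<And>k. k \<in> KA \<Longrightarrow> affine_in 1 K (\<lambda>w. hA w k)" and hB: "\<And>k. k \<in> KB \<Longrightarrow> affine_in 1 K (\<lambda>w. hB w k)"
    and surj: "\<And>wA wB. \<exists>w. (\<forall>k\<in>KA. wA k = hA w k) \<and> (\<forall>k\<in>KB. wB k = hB w k)"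
    and inj: "\<And>w w' k. (\<And>k. k \<in> KA \<Longrightarrow> hA w k = hA w' k) \<Longrightarrow> (\<And>k. k \<in> KB \<Longrightarrow> hB w k = hB w' k) \<Longrightarrow> k \<in> K \<Longrightarrow> w k = w' k"
  shows "presents (A \<otimes> B) K (\<lambda>w. fA (hA w) + fB (hB w)) (\<lambda>w. OA (hA w) @ OB (hB w)) (\<lambda>w. IA (hA w) @ IB (hB w)) (rA * rB)"
proof -
  obtain eA where eA: "presented A KA eA fA rA" "\<And>w. map (\<lambda>p. peval p (eA w)) (outs A) = OA w"
    "\<And>w. map (\<lambda>p. peval p (eA w)) (ins A) = IA w" using A unfolding presents_def by blast
  obtain eB where eB: "presented B KB eB fB rB" "\<And>w. map (\<lambda>p. peval p (eB w)) (outs B) = OB w"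
    "\<And>w. map (\<lambda>p. peval p (eB w)) (ins B) = IB w" using B unfolding presents_def by blast
  have wf: "well_formed A" "well_formed B" using eA(1) eB(1) by (simp_all add: presented_def)
  define a where "a = fresh (vars A)"
  let ?B = "shift a B"
  have wfB: "well_formed ?B" using wf(2) by (rule well_formed_shift)
  have AB: "A \<otimes> B = PSum (vars A \<union> vars ?B) (scal A * scal B) (padd (phase A) (phase ?B)) (outs A @ outs ?B) (ins A @ ins ?B)"
    unfolding tensor_def Let_def a_def[symmetric] ..
  let ?e = "\<lambda>w x. if x < a then eA (hA w) x else eB (hB w) (x - a)"
  have "presented (A \<otimes> B) K ?e (\<lambda>w. fA (hA w) + fB (hB w)) (rA * rB)"
  proof (rule presented_join[OF eA(1) eB(1) a_def order_refl, of 0])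
    show "well_formed (A \<otimes> B)" using wf by (rule well_formed_tensor)
    show "peval (phase (A \<otimes> B)) v = peval (phase A) v + (peval (phase ?B) v +
        (\<Sum>i<0. v (a + fresh (vars B) + i) * (peval (outs ?B ! i) v + peval (ins A ! i) v)))" for v
      using poly_finite(1)[OF wf(1), of "phase A"] poly_finite(1)[OF wfB, of "phase ?B"] unfolding AB by (simp add: peval_padd)
    show "\<exists>w. (\<forall>k\<in>KA. wA k = hA w k) \<and> (\<forall>k\<in>KB. wB k = hB w k)" for wA wB by (rule surj)
    show "w k = w' k" if "\<And>k. k \<in> KA \<Longrightarrow> hA w k = hA w' k" "\<And>k. k \<in> KB \<Longrightarrow> hB w k = hB w' k" "k \<in> K" for w w' k
      using that by (rule inj)
  qed (use K hA hB in \<open>auto simp: AB shift_sel\<close>)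
  moreover have pA: "peval p (?e w) = peval p (eA (hA w))" if "p \<in> set (outs A @ ins A)" for p w
  proof (rule depends_onD[of "vars A" "peval p"])
    show "depends_on (vars A) (peval p)" using that by (intro peval_depends well_formedD(3)[OF wf(1)])
    fix x assume "x \<in> vars A"
    then show "?e w x = eA (hA w) x" using fresh_gt[OF well_formedD(1)[OF wf(1)]] by (simp add: a_def)
  qed
  moreover have "map (\<lambda>p. peval p (?e w)) (outs (A \<otimes> B)) = OA (hA w) @ OB (hB w)" for w
    unfolding eA(2)[symmetric] eB(2)[symmetric] using pA by (simp add: AB shift_polys peval_shift)
  moreover have "map (\<lambda>p. peval p (?e w)) (ins (A \<otimes> B)) = IA (hA w) @ IB (hB w)" for w
    unfolding eA(3)[symmetric] eB(3)[symmetric] using pA by (simp add: AB shift_polys peval_shift)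
  ultimately show ?thesis unfolding presents_def by (intro exI[of _ ?e]) blast
qed

section \<open>Presentations of identities, adjoints and gates\<close>

lemma parametrizes_id: "parametrizes W (\<lambda>_. True) W (\<lambda>w. w)"
  unfolding parametrizes_def by (auto intro: affine_var)

lemma presents_basic:
  assumes "well_formed A" "\<And>p. p \<in> set (outs A @ ins A) \<Longrightarrow> affine_in 1 (vars A) (peval p)"
    "finite K" "parametrizes (vars A) (\<lambda>_. True) K e"
  shows "presents A K (\<lambda>w. peval (phase A) (e w)) (\<lambda>w. map (\<lambda>p. peval p (e w)) (outs A)) (\<lambda>w. map (\<lambda>p. peval p (e w)) (ins A)) (scal A)"
proof -
  have "depends_on (vars A) (peval (phase A))" using assms(1) by (intro peval_depends well_formedD(2))
  then have "presented A K e (\<lambda>w. peval (phase A) (e w)) (scal A)"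
    unfolding presented_def using assms
    by (intro conjI exI[of _ "{}"] exI[of _ "peval (phase A)"]) auto
  then show ?thesis unfolding presents_def by blast
qed

text \<open>A wire carries at most one parameter plus a constant. This is the invariant that allows
  the next gate to be composed, where its input parameters are replaced by wire contents.\<close>

lemma presents_affine_outs:
  assumes "presents A K f Os Is r" "i < length (outs A)"
  shows "affine_in 1 K (\<lambda>w. Os w ! i)"
proof -
  obtain e where e: "presented A K e f r" "\<And>w. map (\<lambda>p. peval p (e w)) (outs A) = Os w"
    using assms(1) unfolding presents_def by blast
  obtain U l g where U: "U \<subseteq> vars A \<and> (\<forall>u\<in>U. affine_in 2 (vars A - U) (l u)) \<and> depends_on (vars A - U) g \<and>
     (\<forall>v. peval (phase A) v = (\<Sum>u\<in>U. v u * l u v) + g v) \<and>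
     (\<forall>p\<in>set (outs A @ ins A). affine_in 1 (vars A - U) (peval p)) \<and>
     parametrizes (vars A - U) (\<lambda>v. \<forall>u\<in>U. l u v = 0) K e \<and> (\<forall>w. g (e w) = f w) \<and> scal A * 2 ^ card U = r"
    using e(1) unfolding presented_def by blast
  have par: "parametrizes (vars A - U) (\<lambda>v. \<forall>u\<in>U. l u v = 0) K e" using U by blast
  have "affine_in 1 (vars A - U) (peval (outs A ! i))" using U assms(2) by (auto simp: ball_Un)
  then have "affine_in 1 K (\<lambda>w. peval (outs A ! i) (e w))"
    by (rule affine_comp[OF _ parametrizesD(1)[OF par]])
  moreover have "peval (outs A ! i) (e w) = Os w ! i" for w using assms(2) by (simp add: e(2)[symmetric])
  ultimately show ?thesis by simp
qed

lemma presents_length: "presents A K f Os Is r \<Longrightarrow> length (Os w) = length (outs A)" "presents A K f Os Is r \<Longrightarrow> length (Is w) = length (ins A)"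
  unfolding presents_def by (metis length_map)+

lemma presents_ident:
  assumes "finite K" "parametrizes {0..<k} (\<lambda>_. True) K e"
  shows "presents (ident k) K (\<lambda>_. 0) (\<lambda>w. map (e w) [0..<k]) (\<lambda>w. map (e w) [0..<k]) 1"
proof -
  have "presents (ident k) K (\<lambda>w. peval (phase (ident k)) (e w)) (\<lambda>w. map (\<lambda>p. peval p (e w)) (outs (ident k)))
      (\<lambda>w. map (\<lambda>p. peval p (e w)) (ins (ident k))) (scal (ident k))"
    by (rule presents_basic[OF well_formed_simple(1) _ assms(1)])
      (use assms(2) in \<open>auto simp: ident_def intro: affine_pvar[unfolded One_nat_def]\<close>)
  then show ?thesis by (simp add: ident_def comp_def)
qed

lemma presents_dagger:
  assumes "presents A K f Os Is r" shows "presents (dagger A) K f Is Os (cnj r)"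
proof -
  obtain e where e: "presented A K e f r" "\<And>w. map (\<lambda>p. peval p (e w)) (outs A) = Os w"
    "\<And>w. map (\<lambda>p. peval p (e w)) (ins A) = Is w" using assms unfolding presents_def by blast
  then have wf: "well_formed (dagger A)" unfolding presented_def using well_formed_simple(5) by blast
  have d: "vars (dagger A) = vars A" "scal (dagger A) = cnj (scal A)" "phase (dagger A) = phase A"
    "outs (dagger A) = ins A" "ins (dagger A) = outs A" by (simp_all add: dagger_def)
  obtain U l g where "U \<subseteq> vars A \<and> (\<forall>u\<in>U. affine_in 2 (vars A - U) (l u)) \<and> depends_on (vars A - U) g \<and>
     (\<forall>v. peval (phase A) v = (\<Sum>u\<in>U. v u * l u v) + g v) \<and>
     (\<forall>p\<in>set (outs A @ ins A). affine_in 1 (vars A - U) (peval p)) \<and>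
     parametrizes (vars A - U) (\<lambda>v. \<forall>u\<in>U. l u v = 0) K e \<and> (\<forall>w. g (e w) = f w) \<and> scal A * 2 ^ card U = r"
    using e(1) unfolding presented_def by blast
  then have "presented (dagger A) K e f (cnj r)" unfolding presented_def d using wf e(1)
    by (intro conjI exI[of _ U] exI[of _ l] exI[of _ g]) (auto simp: presented_def)
  with e show ?thesis unfolding presents_def d by blast
qed

lemma presents_cong:
  assumes "presents A K f Os Is r" "\<And>w. f w = f' w" "\<And>w. Os w = Os' w" "\<And>w. Is w = Is' w" "r = r'"
  shows "presents A K f' Os' Is' r'"
proof -
  have "f = f'" "Os = Os'" "Is = Is'" using assms by auto
  with assms show ?thesis by simp
qed

text \<open>The extra bit \<open>x\<close> is the outcome of a Hadamard gate; the other gates ignore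
  it.\<close>

fun gate_bits :: "gate \<Rightarrow> bit \<Rightarrow> (nat \<Rightarrow> bit) \<Rightarrow> nat \<Rightarrow> bit" where
  "gate_bits (HGate q) x b = b(q := x)"
| "gate_bits (XGate q) x b = b(q := b q + 1)"
| "gate_bits (SwapGate q r) x b = b(q := b r, r := b q)"
| "gate_bits (CZGate cs q) x b = b"

fun gate_phase :: "gate \<Rightarrow> bit \<Rightarrow> (nat \<Rightarrow> bit) \<Rightarrow> bit" where
  "gate_phase (HGate q) x b = b q * x"
| "gate_phase (XGate q) x b = 0"
| "gate_phase (SwapGate q r) x b = 0"
| "gate_phase (CZGate cs q) x b = (\<Prod>j\<in>set (cs @ [q]). b j)"

fun is_H :: "gate \<Rightarrow> bool" where
  "is_H (HGate q) \<longleftrightarrow> True" | "is_H _ \<longleftrightarrow> False"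

text \<open>Serves \<open>place\<close>, which only permutes the outputs and inputs of a tensor
  product.\<close>

lemma presented_mono:
  assumes "presented A K e f r" "well_formed C" "vars C = vars A" "scal C = scal A" "phase C = phase A"
    "set (outs C @ ins C) \<subseteq> set (outs A @ ins A)"
  shows "presented C K e f r"
proof -
  obtain U l g where U: "U \<subseteq> vars A \<and> (\<forall>u\<in>U. affine_in 2 (vars A - U) (l u)) \<and> depends_on (vars A - U) g \<and>
     (\<forall>v. peval (phase A) v = (\<Sum>u\<in>U. v u * l u v) + g v) \<and>
     (\<forall>p\<in>set (outs A @ ins A). affine_in 1 (vars A - U) (peval p)) \<and>
     parametrizes (vars A - U) (\<lambda>v. \<forall>u\<in>U. l u v = 0) K e \<and> (\<forall>w. g (e w) = f w) \<and> scal A * 2 ^ card U = r"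
    using assms(1) unfolding presented_def by blast
  moreover have "finite K" using assms(1) by (simp add: presented_def)
  moreover have "\<forall>p\<in>set (outs C @ ins C). affine_in 1 (vars A - U) (peval p)" using U assms(6) by (meson subsetD)
  ultimately show ?thesis unfolding presented_def assms(3-5) using assms(2)
    by (intro conjI exI[of _ U] exI[of _ l] exI[of _ g]) (elim conjE, assumption)+
qed

lemma is_HE: "is_H g \<Longrightarrow> \<exists>q. g = HGate q"
  by (cases g) auto

lemma vars_gate: "vars (gate_psum g) = {..<length (wires g)} \<union> (if is_H g then {1} else {})"
  by (cases g) (auto simp: Let_def)

lemma peval_negated_var: "peval (padd (pvar x) (pconst 1)) = (\<lambda>v. v x + 1)"
proof
  fix v
  have "finite (pvar x)" "finite (pconst 1)" by (simp_all add: pvar_def pconst_def)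
  then show "peval (padd (pvar x) (pconst 1)) v = v x + 1" by (simp add: peval_padd)
qed

lemma gate_psum_eval:
  assumes "distinct (wires g)" "\<And>i. i < length (wires g) \<Longrightarrow> v i = b (wires g ! i)" "is_H g \<Longrightarrow> v 1 = x"
  shows "peval (phase (gate_psum g)) v = gate_phase g x b"
    "map (\<lambda>p. peval p v) (outs (gate_psum g)) = map (gate_bits g x b) (wires g)"
    "map (\<lambda>p. peval p v) (ins (gate_psum g)) = map b (wires g)"
proof -
  have "peval (phase (gate_psum g)) v = gate_phase g x b \<and>
    map (\<lambda>p. peval p v) (outs (gate_psum g)) = map (gate_bits g x b) (wires g) \<and>
    map (\<lambda>p. peval p v) (ins (gate_psum g)) = map b (wires g)"
  proof (cases g)
    case (HGate q)
    have "pmul (pvar 0) (pvar 1) = {{0, 1}}" by (simp add: pvar_def pmul_single insert_commute)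
    then show ?thesis using assms HGate by simp
  next
    case (XGate q)
    show ?thesis using assms XGate by (simp add: peval_negated_var)
  next
    case (SwapGate q r)
    have "v 0 = b q" "v 1 = b r" using assms(2)[of 0] assms(2)[of 1] SwapGate by auto
    then show ?thesis using assms(1) SwapGate by simp
  next
    case (CZGate cs q)
    let ?ws = "cs @ [q]"
    have v: "map v [0..<length ?ws] = map b ?ws"
      using assms(2) CZGate by (intro nth_equalityI) (simp_all del: upt_Suc map_append)
    have "(\<Prod>x\<in>{0..<length ?ws}. v x) = prod_list (map v [0..<length ?ws])"
      by (simp add: prod.distinct_set_conv_list[symmetric] del: upt_Suc)
    also have "\<dots> = (\<Prod>j\<in>set ?ws. b j)" unfolding v using assms(1) CZGate
      by (subst prod.distinct_set_conv_list) auto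
    finally show ?thesis using v CZGate by (simp add: Let_def comp_def del: upt_Suc)
  qed
  then show "peval (phase (gate_psum g)) v = gate_phase g x b"
    "map (\<lambda>p. peval p v) (outs (gate_psum g)) = map (gate_bits g x b) (wires g)"
    "map (\<lambda>p. peval p v) (ins (gate_psum g)) = map b (wires g)" by auto
qed

lemma gate_psum_affine: "p \<in> set (outs (gate_psum g) @ ins (gate_psum g)) \<Longrightarrow> affine_in 1 (vars (gate_psum g)) (peval p)"
proof (cases g)
  case (XGate q)
  have "affine_in 1 {0} (peval (padd (pvar 0) (pconst 1)))"
    unfolding peval_negated_var by (rule affine_var_const) simp_all
  moreover assume "p \<in> set (outs (gate_psum g) @ ins (gate_psum g))"
  ultimately show ?thesis using XGate by (auto intro: affine_pvar[unfolded One_nat_def])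
qed (auto intro: affine_pvar[unfolded One_nat_def] simp: Let_def)

lemma gate_bits_other: "j \<notin> set (wires g) \<Longrightarrow> gate_bits g x b j = b j"
  by (cases g) auto

lemma gate_cong:
  assumes "set (wires g) \<subseteq> {..<N}" "\<And>j. j < N \<Longrightarrow> b j = b' j"
  shows "j < N \<Longrightarrow> gate_bits g x b j = gate_bits g x b' j" "gate_phase g x b = gate_phase g x b'"
proof -
  have b: "b j = b' j" if "j \<in> set (wires g)" for j using that assms by auto
  show "gate_bits g x b j = gate_bits g x b' j" if "j < N" using b assms(2)[OF that] by (cases g) auto
  show "gate_phase g x b = gate_phase g x b'"
  proof (cases g)
    case (CZGate cs q)
    then show ?thesis using b unfolding CZGate gate_phase.simps by (intro prod.cong) simp_all
  qed (use b in auto)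
qed

lemma map_of_zip_nth':
  "distinct xs \<Longrightarrow> length xs = length ys \<Longrightarrow> i < length xs \<Longrightarrow> map_of (zip xs ys) (xs ! i) = Some (ys ! i)"
  by (simp add: map_of_zip_nth)

text \<open>The parameters are the bits on the \<open>N\<close> wires before the gate, with an
  additional parameter \<open>N\<close> for the outcome of a Hadamard gate.\<close>

lemma presents_place:
  assumes "distinct (wires g)" "set (wires g) \<subseteq> {..<N}"
  shows "presents (place N (wires g) (gate_psum g)) ({..<N} \<union> (if is_H g then {N} else {}))
    (\<lambda>w. gate_phase g (w N) w) (\<lambda>w. map (gate_bits g (w N) w) [0..<N]) (\<lambda>w. map w [0..<N]) (scal (gate_psum g))"
proof -
  let ?ws = "wires g"
  let ?k = "length ?ws"
  define rest where "rest = filter (\<lambda>j. j \<notin> set ?ws) [0..<N]"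
  define pos where "pos = ?ws @ rest"
  let ?K = "{..<N} \<union> (if is_H g then {N} else {})"
  have pos: "set pos = {..<N}" "distinct pos" using assms by (auto simp: pos_def rest_def)
  then have len: "length pos = N" using distinct_card[of pos] by simp
  then have lr: "length rest = N - ?k" "?k \<le> N" by (simp_all add: pos_def)
  have wsN: "?ws ! i < N" if "i < ?k" for i using that assms(2) by (meson lessThan_iff nth_mem subsetD)
  have rN: "rest ! i < N" if "i < N - ?k" for i
    using nth_mem[of i rest] that lr by (auto simp: rest_def)
  define hA where "hA w i = (if i < ?k then w (?ws ! i) else w N :: bit)" for w i
  define hB where "hB w i = (w (rest ! i) :: bit)" for w i
  let ?G = "gate_psum g" and ?J = "ident (N - ?k)"
  have Hk: "?k = 1" if "is_H g" using is_HE[OF that] by auto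
  have T: "presents (?G \<otimes> ?J) ?K (\<lambda>w. peval (phase ?G) (hA w) + 0)
    (\<lambda>w. map (\<lambda>p. peval p (hA w)) (outs ?G) @ map (hB w) [0..<N - ?k])
    (\<lambda>w. map (\<lambda>p. peval p (hA w)) (ins ?G) @ map (hB w) [0..<N - ?k]) (scal ?G * 1)"
  proof (rule presents_tensor[OF presents_basic[OF well_formed_simple(4) gate_psum_affine _ parametrizes_id]
        presents_ident[OF _ parametrizes_id]])
    show "finite (vars ?G)" by (rule well_formedD(1)[OF well_formed_simple(4)])
    show "affine_in 1 ?K (\<lambda>w. hA w i)" if "i \<in> vars ?G" for i
      using that wsN Hk by (cases "i < ?k") (auto simp: hA_def vars_gate intro!: affine_var split: if_splits)
    show "affine_in 1 ?K (\<lambda>w. hB w i)" if "i \<in> {0..<N - ?k}" for i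
      using that rN by (auto simp: hB_def intro!: affine_var)
    show "\<exists>w. (\<forall>i\<in>vars ?G. wA i = hA w i) \<and> (\<forall>i\<in>{0..<N - ?k}. wB i = hB w i)" for wA wB
    proof -
      \<comment> \<open>Inverse of \<open>hA\<close> and \<open>hB\<close>: a wire is looked up
        through its place in \<open>pos\<close>, and the default \<open>wA 1\<close> provides the
        Hadamard outcome.\<close>
      define w where "w j = (if j < N then the (map_of (zip pos (map wA [0..<?k] @ map wB [0..<N - ?k])) j) else wA 1)" for j
      have w: "w (pos ! i) = (map wA [0..<?k] @ map wB [0..<N - ?k]) ! i" if "i < N" for i
      proof -
        have "pos ! i < N" using that len pos(1) nth_mem[of i pos] by auto
        then show ?thesis using that len lr pos(2) by (simp add: w_def map_of_zip_nth')
      qed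
      have "wA i = hA w i" if "i \<in> vars ?G" for i
      proof (cases "i < ?k")
        case True
        then show ?thesis using w[of i] lr by (simp add: hA_def pos_def nth_append)
      next
        case False
        with that have "i = 1" by (auto simp: vars_gate split: if_splits)
        with False show ?thesis by (simp add: hA_def w_def)
      qed
      moreover have "wB i = hB w i" if "i < N - ?k" for i
        using w[of "?k + i"] that lr by (simp add: hB_def pos_def nth_append)
      ultimately show ?thesis by auto
    qed
    show "w j = w' j" if A: "\<And>i. i \<in> vars ?G \<Longrightarrow> hA w i = hA w' i" and B: "\<And>i. i \<in> {0..<N - ?k} \<Longrightarrow> hB w i = hB w' i"
      and j: "j \<in> ?K" for w w' j
    proof (cases "j < N")
      case True
      then obtain i where i: "i < N" "j = pos ! i" using pos(1) len by (metis in_set_conv_nth lessThan_iff)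
      show ?thesis
      proof (cases "i < ?k")
        case True
        then show ?thesis using A[of i] i by (simp add: hA_def pos_def nth_append vars_gate)
      next
        case False
        then show ?thesis using B[of "i - ?k"] i by (simp add: hB_def pos_def nth_append)
      qed
    next
      case False
      then have "is_H g" "j = N" using j by (auto split: if_splits)
      then show ?thesis using A[of 1] Hk by (simp add: hA_def vars_gate)
    qed
  qed (cases "is_H g", simp_all)
  then obtain e where e: "presented (?G \<otimes> ?J) ?K e (\<lambda>w. peval (phase ?G) (hA w) + 0) (scal ?G * 1)"
    "\<And>w. map (\<lambda>p. peval p (e w)) (outs (?G \<otimes> ?J)) = map (\<lambda>p. peval p (hA w)) (outs ?G) @ map (hB w) [0..<N - ?k]"
    "\<And>w. map (\<lambda>p. peval p (e w)) (ins (?G \<otimes> ?J)) = map (\<lambda>p. peval p (hA w)) (ins ?G) @ map (hB w) [0..<N - ?k]"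
    unfolding presents_def by blast
  define arr where "arr ps = map (\<lambda>j. the (map_of (zip pos ps) j)) [0..<N]" for ps :: "mpoly2 list"
  have P: "place N ?ws ?G = PSum (vars (?G \<otimes> ?J)) (scal (?G \<otimes> ?J)) (phase (?G \<otimes> ?J)) (arr (outs (?G \<otimes> ?J))) (arr (ins (?G \<otimes> ?J)))"
    unfolding place_def Let_def pos_def rest_def arr_def ..
  have pos_ex: "\<exists>i<N. j = pos ! i" if "j < N" for j using that pos(1) len by (metis in_set_conv_nth lessThan_iff)
  have arr_set: "set (arr ps) \<subseteq> set ps" if "length ps = N" for ps
  proof
    fix p assume "p \<in> set (arr ps)"
    then obtain j where j: "j < N" "p = the (map_of (zip pos ps) j)" by (auto simp: arr_def)
    from pos_ex[OF j(1)] obtain i where i: "i < N" "j = pos ! i" by blast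
    have "p = ps ! i" unfolding j(2) i(2) using that i(1) len pos(2) by (simp add: map_of_zip_nth')
    then show "p \<in> set ps" using that i(1) by simp
  qed
  have arr_map: "map (\<lambda>p. peval p v) (arr ps) = map h [0..<N]" if "map (\<lambda>p. peval p v) ps = map h pos" for ps v h
  proof (rule nth_equalityI)
    fix j assume "j < length (map (\<lambda>p. peval p v) (arr ps))"
    then have j: "j < N" by (simp add: arr_def)
    then obtain i where i: "i < N" "j = pos ! i" using pos_ex by blast
    have l: "length ps = N" using arg_cong[OF that, of length] len by simp
    have "peval (ps ! i) v = h (pos ! i)" using arg_cong[OF that, of "\<lambda>xs. xs ! i"] i l len by simp
    then show "map (\<lambda>p. peval p v) (arr ps) ! j = map h [0..<N] ! j"
      using j i l len pos(2) by (simp add: arr_def map_of_zip_nth')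
  qed (simp add: arr_def)
  have l: "length (outs (?G \<otimes> ?J)) = N" "length (ins (?G \<otimes> ?J)) = N"
    using lr length_gate[of g] by (simp_all add: tensor_def Let_def shift_sel ident_def[of "N - ?k"])
  have "presented (place N ?ws ?G) ?K e (\<lambda>w. peval (phase ?G) (hA w) + 0) (scal ?G * 1)"
    using e(1)
  proof (rule presented_mono)
    show "well_formed (place N ?ws ?G)"
      using assms length_gate[of g] by (intro well_formed_place well_formed_simple) auto
  qed (use arr_set[OF l(1)] arr_set[OF l(2)] in \<open>auto simp: P\<close>)
  moreover have G: "peval (phase ?G) (hA w) = gate_phase g (w N) w"
    "map (\<lambda>p. peval p (hA w)) (outs ?G) = map (gate_bits g (w N) w) ?ws"
    "map (\<lambda>p. peval p (hA w)) (ins ?G) = map w ?ws" for w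
    using Hk by (intro gate_psum_eval assms(1); simp add: hA_def)+
  have r: "map (hB w) [0..<N - ?k] = map w rest" for w
    using lr by (intro nth_equalityI) (simp_all add: hB_def)
  have r': "map w rest = map (gate_bits g (w N) w) rest" for w
    by (intro map_cong refl) (simp add: rest_def gate_bits_other)
  have "map (\<lambda>p. peval p (e w)) (outs (?G \<otimes> ?J)) = map (gate_bits g (w N) w) pos" for w
    unfolding e(2) G r by (simp add: pos_def r'[symmetric])
  then have "map (\<lambda>p. peval p (e w)) (outs (place N ?ws ?G)) = map (gate_bits g (w N) w) [0..<N]" for w
    unfolding P psum.sel by (rule arr_map)
  moreover have "map (\<lambda>p. peval p (e w)) (ins (?G \<otimes> ?J)) = map w pos" for w
    unfolding e(3) G r by (simp add: pos_def)
  then have "map (\<lambda>p. peval p (e w)) (ins (place N ?ws ?G)) = map w [0..<N]" for w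
    unfolding P psum.sel by (rule arr_map)
  ultimately show ?thesis unfolding presents_def G add_0_right mult_1_right by blast
qed

text \<open>The label \<open>(t, q)\<close> stands for the outcome of the \<open>t\<close>-th Hadamard gate on wire \<open>q\<close>, and \<open>(0, q)\<close> for the input.\<close>

fun count_H :: "gate \<Rightarrow> (nat \<Rightarrow> nat) \<Rightarrow> nat \<Rightarrow> nat" where
  "count_H (HGate q) t = t(q := Suc (t q))" | "count_H _ t = t"

text \<open>The label \<open>(0, 0)\<close> is a dummy for gates that ignore the outcome
  bit.\<close>

fun new_label :: "gate \<Rightarrow> (nat \<Rightarrow> nat) \<Rightarrow> nat \<times> nat" where
  "new_label (HGate q) t = (Suc (t q), q)" | "new_label _ t = (0, 0)"

fun run_count :: "circuit \<Rightarrow> (nat \<Rightarrow> nat) \<Rightarrow> nat \<Rightarrow> nat" where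
  "run_count [] t = t" | "run_count (g # C) t = run_count C (count_H g t)"

text \<open>Symbolic execution: the state holds the bit on every wire and the phase accumulated so
  far, given the label values \<open>w\<close>, while \<open>t\<close> counts the Hadamard gates
  passed on each wire.\<close>

fun run_circuit :: "(nat \<times> nat \<Rightarrow> bit) \<Rightarrow> circuit \<Rightarrow> (nat \<Rightarrow> nat) \<Rightarrow> (nat \<Rightarrow> bit) \<times> bit \<Rightarrow> (nat \<Rightarrow> bit) \<times> bit" where
  "run_circuit w [] t s = s"
| "run_circuit w (g # C) t s = run_circuit w C (count_H g t)
     (gate_bits g (w (new_label g t)) (fst s), snd s + gate_phase g (w (new_label g t)) (fst s))"

section \<open>The path sum of a circuit as its symbolic execution\<close>

lemma run_count_append: "run_count (C @ D) t = run_count D (run_count C t)"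
  by (induction C arbitrary: t) auto

lemma run_circuit_append: "run_circuit w (C @ D) t s = run_circuit w D (run_count C t) (run_circuit w C t s)"
  by (induction C arbitrary: t s) auto

definition labels :: "nat \<Rightarrow> (nat \<Rightarrow> nat) \<Rightarrow> (nat \<times> nat) set" where
  "labels N t = {(s, q). q < N \<and> s \<le> t q}"

lemma finite_labels: "finite (labels N t)"
proof -
  have "labels N t = (\<Union>q<N. (\<lambda>s. (s, q)) ` {..t q})" by (auto simp: labels_def)
  then show ?thesis by simp
qed

lemma outs_compose: "outs (A \<odot> B) = outs A"
  by (simp add: compose_def Let_def)

lemma length_place: "length (outs (place N ws A)) = N" "length (ins (place N ws A)) = N"
  by (simp_all add: place_def Let_def)

lemma length_outs_interp: "length (outs (interp N C)) = N"
proof (induction C rule: rev_induct)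
  case Nil then show ?case by (simp add: interp_def ident_def)
next
  case (snoc g C) then show ?case by (simp add: interp_def outs_compose length_place)
qed

text \<open>Induction on the last gate, since \<open>interp\<close> composes gates on the left. The
  gate reads wire contents, each affine in one label, so all variables except the inputs and the
  Hadamard outcomes are absorbed by constraints.\<close>

lemma presents_interp:
  assumes "circuit_on N C"
  shows "presents (interp N C) (labels N (run_count C (\<lambda>_. 0)))
    (\<lambda>w. snd (run_circuit w C (\<lambda>_. 0) (\<lambda>q. w (0, q), 0)))
    (\<lambda>w. map (fst (run_circuit w C (\<lambda>_. 0) (\<lambda>q. w (0, q), 0))) [0..<N])
    (\<lambda>w. map (\<lambda>q. w (0, q)) [0..<N]) (1 / sqrt 2 ^ length (filter is_H C))"
  using assms
proof (induction C rule: rev_induct)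
  case Nil
  have "parametrizes {0..<N} (\<lambda>_. True) (labels N (\<lambda>_. 0)) (\<lambda>w q. w (0, q))"
    unfolding parametrizes_def
  proof (intro conjI allI impI ballI)
    fix v :: "nat \<Rightarrow> bit" show "\<exists>w. \<forall>q\<in>{0..<N}. v q = w (0 :: nat, q)"
      by (rule exI[of _ "\<lambda>(s, q). v q"]) simp
  qed (auto simp: labels_def intro: affine_var)
  then show ?case using presents_ident[OF finite_labels] by (simp add: interp_def)
next
  case (snoc g C)
  then have C: "circuit_on N C" and g: "distinct (wires g)" "set (wires g) \<subseteq> {..<N}" by (auto simp: circuit_on_def)
  let ?t = "run_count C (\<lambda>_. 0)"
  let ?s = "\<lambda>w. run_circuit w C (\<lambda>_. 0) (\<lambda>q. w (0, q), 0)"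
  let ?lab = "new_label g ?t"
  let ?K = "labels N (run_count (C @ [g]) (\<lambda>_. 0))"
  define hA where "hA w k = (if k < N then fst (?s w) k else w ?lab)" for w k
  note IH = snoc.IH[OF C]
  note A = presents_place[OF g]
  have K: "?K = labels N ?t \<union> (if is_H g then {?lab} else {})"
    using g(2) by (cases g) (auto simp: run_count_append labels_def split: if_splits)
  have len: "length (ins (place N (wires g) (gate_psum g))) = length (outs (interp N C))"
    by (simp add: length_outs_interp length_place)
  have irr: "gate_bits g (hA w N) b = gate_bits g (w ?lab) b" "gate_phase g (hA w N) b = gate_phase g (w ?lab) b" for w b
    by (simp_all add: hA_def)
  have "presents (place N (wires g) (gate_psum g) \<odot> interp N C) ?K
    (\<lambda>w. gate_phase g (hA w N) (hA w) + snd (?s w)) (\<lambda>w. map (gate_bits g (hA w N) (hA w)) [0..<N])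
    (\<lambda>w. map (\<lambda>q. w (0, q)) [0..<N]) (scal (gate_psum g) * (1 / sqrt 2 ^ length (filter is_H C)))"
  proof (rule presents_compose[OF A IH len finite_labels])
    show "affine_in 1 ?K (\<lambda>w. hA w k)" if "k \<in> {..<N} \<union> (if is_H g then {N} else {})" for k
    proof (cases "k < N")
      case True
      then have "affine_in 1 (labels N ?t) (\<lambda>w. map (fst (?s w)) [0..<N] ! k)"
        using presents_affine_outs[OF IH] by (simp add: length_outs_interp)
      with True show ?thesis by (auto simp: hA_def K intro: affine_mono)
    next
      case False
      with that show ?thesis by (auto simp: hA_def K intro!: affine_var split: if_splits)
    qed
    show "affine_in 1 ?K (\<lambda>w. w k)" if "k \<in> labels N ?t" for k
      using that by (intro affine_var) (auto simp: K)
    show "map (hA w) [0..<N] = map (fst (?s w)) [0..<N]" for w by (simp add: hA_def)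
    show "\<exists>w. (\<forall>k\<in>{..<N} \<union> (if is_H g then {N} else {}). wA k = hA w k) \<and> (\<forall>k\<in>labels N ?t. wB k = w k)"
      if eq: "map wA [0..<N] = map (fst (?s wB)) [0..<N]" for wA wB
    proof -
      \<comment> \<open>The new label is absent from the earlier labels, so its value can be set to
        the outcome of the gate without changing any wire.\<close>
      define w where "w = (if is_H g then wB(?lab := wA N) else wB)"
      have lab: "?lab \<notin> labels N ?t" if "is_H g" using that by (cases g) (auto simp: labels_def)
      then have wB: "wB k = w k" if "k \<in> labels N ?t" for k using that by (auto simp: w_def)
      have "fst (?s w) k = fst (?s wB) k" if "k < N" for k
      proof -
        have "affine_in 1 (labels N ?t) (\<lambda>w. map (fst (?s w)) [0..<N] ! k)"
          using presents_affine_outs[OF IH] that by (simp add: length_outs_interp)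
        note aff = this
        have "map (fst (?s wB)) [0..<N] ! k = map (fst (?s w)) [0..<N] ! k"
          by (rule depends_onD[OF affine_depends[OF aff]]) (rule wB)
        with that show ?thesis by simp
      qed
      then have "wA k = hA w k" if "k \<in> {..<N} \<union> (if is_H g then {N} else {})" for k
        using that eq by (auto simp: hA_def w_def split: if_splits)
      with wB show ?thesis by blast
    qed
    show "w k = w' k" if "\<And>k. k \<in> {..<N} \<union> (if is_H g then {N} else {}) \<Longrightarrow> hA w k = hA w' k"
      "\<And>k. k \<in> labels N ?t \<Longrightarrow> w k = w' k" "k \<in> ?K" for w w' k
    proof (cases "k \<in> labels N ?t")
      case True then show ?thesis by (rule that(2))
    next
      case False
      with that(3) have "is_H g" "k = ?lab" by (auto simp: K split: if_splits)
      then show ?thesis using that(1)[of N] by (simp add: hA_def)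
    qed
  qed
  moreover have "place N (wires g) (gate_psum g) \<odot> interp N C = interp N (C @ [g])" by (simp add: interp_def)
  ultimately have P: "presents (interp N (C @ [g])) ?K
    (\<lambda>w. gate_phase g (hA w N) (hA w) + snd (?s w)) (\<lambda>w. map (gate_bits g (hA w N) (hA w)) [0..<N])
    (\<lambda>w. map (\<lambda>q. w (0, q)) [0..<N]) (scal (gate_psum g) * (1 / sqrt 2 ^ length (filter is_H C)))" by simp
  have h: "hA w j = fst (?s w) j" if "j < N" for w j using that by (simp add: hA_def)
  have e: "gate_phase g x (hA w) = gate_phase g x (fst (?s w))"
    "map (gate_bits g x (hA w)) [0..<N] = map (gate_bits g x (fst (?s w))) [0..<N]" for x w
    using gate_cong(1)[OF g(2), of "hA w" "fst (?s w)" _ x] gate_cong(2)[OF g(2), of "hA w" "fst (?s w)" x] h by auto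
  show ?case
  proof (rule presents_cong[OF P])
    show "scal (gate_psum g) * (1 / sqrt 2 ^ length (filter is_H C)) = 1 / sqrt 2 ^ length (filter is_H (C @ [g]))"
      by (cases g) (simp_all add: Let_def)
  qed (simp_all only: irr e run_circuit_append run_circuit.simps fst_conv snd_conv add.commute)
qed

section \<open>Goodness, values and matrix entries from a presentation\<close>

lemma sum_PiE_Pow:
  assumes "finite V" "depends_on V F"
  shows "(\<Sum>v\<in>V \<rightarrow>\<^sub>E UNIV. F v) = (\<Sum>S\<in>Pow V. F (ind S) :: complex)"
proof (rule sum.reindex_bij_witness[where i = "\<lambda>S. restrict (ind S) V" and j = "\<lambda>v. {x \<in> V. v x = 1}"])
  fix v :: "'a \<Rightarrow> bit" assume v: "v \<in> V \<rightarrow>\<^sub>E UNIV"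
  have e: "ind {x \<in> V. v x = 1} x = v x" if "x \<in> V" for x using that by (cases "v x") (auto simp: ind_def)
  show "restrict (ind {x \<in> V. v x = 1}) V = v"
  proof
    fix x show "restrict (ind {x \<in> V. v x = 1}) V x = v x"
      using e[of x] PiE_arb[OF v, of x] by (cases "x \<in> V") simp_all
  qed
  show "F (ind {x \<in> V. v x = 1}) = F v" using e by (rule depends_onD[OF assms(2)])
qed (auto simp: ind_def)

lemma presents_obtain:
  assumes "presents A K f Os Is r"
  obtains e U l g where "well_formed A" "U \<subseteq> vars A" "\<And>u. u \<in> U \<Longrightarrow> affine_in 2 (vars A - U) (l u)"
    "depends_on (vars A - U) g" "\<And>v. peval (phase A) v = (\<Sum>u\<in>U. v u * l u v) + g v"
    "\<And>p. p \<in> set (outs A @ ins A) \<Longrightarrow> affine_in 1 (vars A - U) (peval p)"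
    "parametrizes (vars A - U) (\<lambda>v. \<forall>u\<in>U. l u v = 0) K e" "(\<lambda>w. g (e w)) = f" "scal A * 2 ^ card U = r"
    "\<And>w. map (\<lambda>p. peval p (e w)) (outs A) = Os w" "\<And>w. map (\<lambda>p. peval p (e w)) (ins A) = Is w"
proof -
  obtain e where e: "presented A K e f r" "\<And>w. map (\<lambda>p. peval p (e w)) (outs A) = Os w"
    "\<And>w. map (\<lambda>p. peval p (e w)) (ins A) = Is w" using assms unfolding presents_def by blast
  obtain U l g where U: "U \<subseteq> vars A \<and> (\<forall>u\<in>U. affine_in 2 (vars A - U) (l u)) \<and> depends_on (vars A - U) g \<and>
     (\<forall>v. peval (phase A) v = (\<Sum>u\<in>U. v u * l u v) + g v) \<and>
     (\<forall>p\<in>set (outs A @ ins A). affine_in 1 (vars A - U) (peval p)) \<and>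
     parametrizes (vars A - U) (\<lambda>v. \<forall>u\<in>U. l u v = 0) K e \<and> (\<forall>w. g (e w) = f w) \<and> scal A * 2 ^ card U = r"
    using e(1) unfolding presented_def by blast
  have "well_formed A" using e(1) by (simp add: presented_def)
  moreover have "(\<lambda>w. g (e w)) = f" using U by (simp add: fun_eq_iff)
  moreover have "\<forall>w. map (\<lambda>p. peval p (e w)) (outs A) = Os w" "\<forall>w. map (\<lambda>p. peval p (e w)) (ins A) = Is w"
    using e(2,3) by simp_all
  ultimately show thesis using U by (elim conjE) (rule that[of U l g e]; (assumption | erule (1) bspec | erule spec))
qed

lemma presents_good:
  assumes P: "presents A K f Os Is r"
  shows "good K f \<Longrightarrow> good (vars A) (peval (phase A))" "scal A * path_value (vars A) (peval (phase A)) = r * path_value K f"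
proof -
  from P show "good (vars A) (peval (phase A))" if g: "good K f"
  proof (rule presents_obtain)
    fix e U l g
    assume A: "well_formed A" "U \<subseteq> vars A" "\<And>u. u \<in> U \<Longrightarrow> affine_in 2 (vars A - U) (l u)"
      "depends_on (vars A - U) g" "\<And>v. peval (phase A) v = (\<Sum>u\<in>U. v u * l u v) + g v"
      "parametrizes (vars A - U) (\<lambda>v. \<forall>u\<in>U. l u v = 0) K e" "(\<lambda>w. g (e w)) = f"
    have V: "U \<union> (vars A - U) = vars A" using A(2) by blast
    have "good (U \<union> (vars A - U)) (peval (phase A))"
      using well_formedD(1)[OF A(1)] finite_subset[OF A(2)] A g by (intro elimination(1)[of U "vars A - U" l g]) auto
    then show ?thesis unfolding V .
  qed
  from P show "scal A * path_value (vars A) (peval (phase A)) = r * path_value K f"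
  proof (rule presents_obtain)
    fix e U l g
    assume A: "well_formed A" "U \<subseteq> vars A" "\<And>u. u \<in> U \<Longrightarrow> affine_in 2 (vars A - U) (l u)"
      "depends_on (vars A - U) g" "\<And>v. peval (phase A) v = (\<Sum>u\<in>U. v u * l u v) + g v"
      "parametrizes (vars A - U) (\<lambda>v. \<forall>u\<in>U. l u v = 0) K e" "(\<lambda>w. g (e w)) = f" "scal A * 2 ^ card U = r"
    have V: "U \<union> (vars A - U) = vars A" using A(2) by blast
    have "path_value (U \<union> (vars A - U)) (peval (phase A)) = 2 ^ card U * path_value K (\<lambda>w. g (e w))"
      using well_formedD(1)[OF A(1)] finite_subset[OF A(2)] A by (intro elimination(2)[of U "vars A - U" l g]) auto
    then show ?thesis unfolding V A(7) A(8)[symmetric] by simp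
  qed
qed

text \<open>The conditions on outputs and inputs only involve the surviving variables, so they form
  part of the weight in \<open>sum_links\<close> and pass through the change of variables.\<close>

lemma eval_presents:
  assumes P: "presents A K f Os Is r"
  shows "eval A a b = r * (\<Sum>T\<in>Pow K. if Os (ind T) = b \<and> Is (ind T) = a then sgn2 (f (ind T)) else 0)"
  using P
proof (rule presents_obtain)
  fix e U l g
  assume A: "well_formed A" "U \<subseteq> vars A" "\<And>u. u \<in> U \<Longrightarrow> affine_in 2 (vars A - U) (l u)"
    "depends_on (vars A - U) g" "\<And>v. peval (phase A) v = (\<Sum>u\<in>U. v u * l u v) + g v"
    "\<And>p. p \<in> set (outs A @ ins A) \<Longrightarrow> affine_in 1 (vars A - U) (peval p)"
    "parametrizes (vars A - U) (\<lambda>v. \<forall>u\<in>U. l u v = 0) K e" "(\<lambda>w. g (e w)) = f" "scal A * 2 ^ card U = r"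
    "\<And>w. map (\<lambda>p. peval p (e w)) (outs A) = Os w" "\<And>w. map (\<lambda>p. peval p (e w)) (ins A) = Is w"
  let ?W = "vars A - U"
  let ?ok = "\<lambda>v. map (\<lambda>p. peval p v) (outs A) = b \<and> map (\<lambda>p. peval p v) (ins A) = a"
  let ?F = "\<lambda>v. if ?ok v then sgn2 (g v) else 0"
  have V: "U \<union> ?W = vars A" using A(2) by blast
  have fin: "finite (vars A)" "finite U" using well_formedD(1)[OF A(1)] finite_subset[OF A(2)] by auto
  have dq: "depends_on ?W (peval p)" if "p \<in> set (outs A @ ins A)" for p using affine_depends[OF A(6)[OF that]] .
  have dok: "?ok v = ?ok w" if "\<And>x. x \<in> ?W \<Longrightarrow> v x = w x" for v w
  proof -
    have "map (\<lambda>p. peval p v) (outs A) = map (\<lambda>p. peval p w) (outs A)" "map (\<lambda>p. peval p v) (ins A) = map (\<lambda>p. peval p w) (ins A)"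
      using depends_onD[OF dq that] by auto
    then show ?thesis by (simp only:)
  qed
  have dF: "depends_on ?W ?F" unfolding depends_on_def
  proof (intro allI impI)
    fix v w :: "nat \<Rightarrow> bit" assume e: "\<forall>x\<in>?W. v x = w x"
    then have "?ok v = ?ok w" by (intro dok) blast
    moreover have "g v = g w" using e by (intro depends_onD[OF A(4)]) blast
    ultimately show "?F v = ?F w" by simp
  qed
  have dl: "depends_on ?W (l u)" if "u \<in> U" for u using affine_depends[OF A(3)[OF that]] .
  have d: "depends_on (vars A) (\<lambda>v. if ?ok v then sgn2 (peval (phase A) v) else 0)" unfolding depends_on_def
  proof (intro allI impI)
    fix v w :: "nat \<Rightarrow> bit" assume e: "\<forall>x\<in>vars A. v x = w x"
    then have "?ok v = ?ok w" by (intro dok) blast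
    moreover have "peval (phase A) v = peval (phase A) w"
      using e by (intro depends_onD[OF peval_depends[OF well_formedD(2)[OF A(1)]]]) blast
    ultimately show "(if ?ok v then sgn2 (peval (phase A) v) else 0) = (if ?ok w then sgn2 (peval (phase A) w) else 0)" by simp
  qed
  have "eval A a b = scal A * (\<Sum>v\<in>vars A \<rightarrow>\<^sub>E UNIV. if ?ok v then sgn2 (peval (phase A) v) else 0)"
    unfolding eval_def ..
  also have "(\<Sum>v\<in>vars A \<rightarrow>\<^sub>E UNIV. if ?ok v then sgn2 (peval (phase A) v) else 0) =
    (\<Sum>S\<in>Pow (vars A). if ?ok (ind S) then sgn2 (peval (phase A) (ind S)) else 0)"
    using fin(1) d by (rule sum_PiE_Pow)
  also have "\<dots> = (\<Sum>S\<in>Pow (U \<union> ?W). sgn2 (\<Sum>u\<in>U. ind S u * l u (ind S)) * ?F (ind S))"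
    unfolding V A(5) sgn2_add by (intro sum.cong refl) simp
  also have "\<dots> = 2 ^ card U * (\<Sum>S\<in>Pow ?W. if \<forall>u\<in>U. l u (ind S) = 0 then ?F (ind S) else 0)"
    using fin dl dF by (intro sum_links) auto
  also have "(\<Sum>S\<in>Pow ?W. if \<forall>u\<in>U. l u (ind S) = 0 then ?F (ind S) else 0) = (\<Sum>T\<in>Pow K. ?F (e (ind T)))"
  proof (rule sum_param[OF A(7) _ dF])
    show "depends_on ?W (\<lambda>v. \<forall>u\<in>U. l u v = 0)"
      unfolding depends_on_def
    proof (intro allI impI ball_cong refl)
      fix v w :: "nat \<Rightarrow> bit" and u assume "\<forall>x\<in>?W. v x = w x" "u \<in> U"
      then have "l u v = l u w" by (intro depends_onD[OF dl]) auto
      then show "(l u v = 0) = (l u w = 0)" by simp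
    qed
  qed (use fin in simp)
  also have "\<dots> = (\<Sum>T\<in>Pow K. if Os (ind T) = b \<and> Is (ind T) = a then sgn2 (f (ind T)) else 0)"
    unfolding A(8)[symmetric] A(10,11) ..
  finally show ?thesis unfolding A(9)[symmetric] by (simp only: mult.assoc)
qed

section \<open>Hidden shift circuits\<close>

lemma run_H_layer:
  assumes "distinct qs"
  shows "run_count (map HGate qs) t = (\<lambda>q. if q \<in> set qs then Suc (t q) else t q) \<and>
    run_circuit w (map HGate qs) t (b, f) = (\<lambda>q. if q \<in> set qs then w (Suc (t q), q) else b q, f + (\<Sum>q\<in>set qs. b q * w (Suc (t q), q)))"
  using assms
proof (induction qs arbitrary: t b f)
  case (Cons q qs)
  have s: "(\<Sum>r\<in>set qs. (if r = q then x else b r) * w (Suc (if r = q then y else t r), r)) = (\<Sum>r\<in>set qs. b r * w (Suc (t r), r))" for x y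
    using Cons.prems by (intro sum.cong) auto
  show ?case using Cons by (auto simp: s fun_eq_iff add.assoc)
qed simp

text \<open>The outcome of no label matters without a Hadamard gate, so label values and counters
  may be exchanged at will, and the phase collected on the way is independent of the initial
  one.\<close>

lemma run_no_H:
  assumes "\<forall>g\<in>set C. \<not> is_H g"
  shows "run_count C t = t" "run_circuit w C t (b, f) = (fst (run_circuit w' C t' (b, 0)), f + snd (run_circuit w' C t' (b, 0)))"
proof -
  have c: "count_H g t = t" "gate_bits g x b = gate_bits g y b" "gate_phase g x b = gate_phase g y b" if "\<not> is_H g" for g t x y b
    using that by (cases g; simp)+
  show "run_count C t = t" using assms by (induction C arbitrary: t) (auto simp: c)
  have "run_circuit w C t (b, f + f') = (fst (run_circuit w' C t' (b, f')), f + snd (run_circuit w' C t' (b, f')))" for f'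
    using assms
  proof (induction C arbitrary: t t' b f')
    case (Cons g C)
    have g: "\<not> is_H g" using Cons.prems by simp
    show ?case using Cons.IH[of t _ "f' + gate_phase g (w' (new_label g t')) b" t'] Cons.prems
        c(2)[OF g, of "w (new_label g t)" b "w' (new_label g t')"] c(3)[OF g, of "w (new_label g t)" b "w' (new_label g t')"]
      by (simp add: c(1)[OF g] add.assoc)
  qed simp
  from this[of 0] show "run_circuit w C t (b, f) = (fst (run_circuit w' C t' (b, 0)), f + snd (run_circuit w' C t' (b, 0)))" by simp
qed

lemma run_cong:
  assumes "circuit_on N C" "\<And>j. j < N \<Longrightarrow> b j = b' j"
  shows "snd (run_circuit w C t (b, f)) = snd (run_circuit w C t (b', f))"
    "j < N \<Longrightarrow> fst (run_circuit w C t (b, f)) j = fst (run_circuit w C t (b', f)) j"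
proof -
  have "snd (run_circuit w C t (b, f)) = snd (run_circuit w C t (b', f)) \<and>
    (\<forall>j<N. fst (run_circuit w C t (b, f)) j = fst (run_circuit w C t (b', f)) j)"
    using assms
  proof (induction C arbitrary: t b b' f)
    case (Cons g C)
    have g: "set (wires g) \<subseteq> {..<N}" "circuit_on N C" using Cons.prems(1) by (auto simp: circuit_on_def)
    have G: "gate_phase g x b = gate_phase g x b'" for x by (rule gate_cong(2)[OF g(1)]) (rule Cons.prems(2))
    show ?case unfolding run_circuit.simps fst_conv snd_conv G
      using Cons.prems(2) by (intro Cons.IH[OF g(2)] gate_cong(1)[OF g(1)])
  qed simp
  then show "snd (run_circuit w C t (b, f)) = snd (run_circuit w C t (b', f))"
    "j < N \<Longrightarrow> fst (run_circuit w C t (b, f)) j = fst (run_circuit w C t (b', f)) j" by auto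
qed

lemma oracle_gate_not_H: "oracle_gate m g \<Longrightarrow> \<not> is_H g"
  by (cases g) auto

lemma sgn2_inject: "sgn2 a = sgn2 b \<longleftrightarrow> a = b" "sgn2 a \<noteq> 0"
  by (cases a; cases b; simp add: sgn2_def)+

text \<open>The oracle is specified only through its matrix, whereas the proof needs its symbolic
  execution. Free of Hadamard gates, its path sum has one term per column; the diagonal entry is
  nonzero, which forces the run to end in its initial bits, and the sign of the term gives the
  phase.\<close>

lemma run_oracle:
  assumes "implements_phase m N \<phi> C"
  shows "run_count C t = t" "snd (run_circuit w C t (b, f)) = f + \<phi> (map b [0..<N])"
    "j < N \<Longrightarrow> fst (run_circuit w C t (b, f)) j = b j"
proof -
  have C: "circuit_on N C"
    and ev: "\<And>z z'. length z = N \<Longrightarrow> length z' = N \<Longrightarrow> eval (interp N C) z z' = (if z' = z then sgn2 (\<phi> z) else 0)"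
    using assms unfolding implements_phase_def by auto
  have "\<forall>g\<in>set C. oracle_gate m g" using assms unfolding implements_phase_def by auto
  then have noH: "\<forall>g\<in>set C. \<not> is_H g" using oracle_gate_not_H by auto
  note no = run_no_H[OF noH]
  show "run_count C t = t" by (rule no(1))
  define T where "T = {(0 :: nat, q) |q. q < N \<and> b q = 1}"
  have bT: "ind T (0, q) = b q" if "q < N" for q using that by (cases "b q") (auto simp: T_def ind_def)
  let ?run = "\<lambda>S. run_circuit (ind S) C (\<lambda>_. 0) (\<lambda>q. ind S (0, q), 0)"
  let ?z = "map b [0..<N]"
  have L: "labels N (run_count C (\<lambda>_. 0)) = {0} \<times> {..<N}" unfolding no(1) labels_def by auto
  have noH': "filter is_H C = []" using noH by (simp add: filter_empty_conv)
  have "sgn2 (\<phi> ?z) = eval (interp N C) ?z ?z" using ev by simp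
  also have "\<dots> = (\<Sum>S\<in>Pow ({0} \<times> {..<N}). if map (fst (?run S)) [0..<N] = ?z \<and> map (\<lambda>q. ind S (0, q)) [0..<N] = ?z
      then sgn2 (snd (?run S)) else 0)"
    unfolding eval_presents[OF presents_interp[OF C]] L noH' by simp
  \<comment> \<open>The condition on the inputs singles out the assignment \<open>T\<close> that
    encodes \<open>b\<close>.\<close>
  also have "\<dots> = (\<Sum>S\<in>Pow ({0} \<times> {..<N}). if S = T then if map (fst (?run S)) [0..<N] = ?z then sgn2 (snd (?run S)) else 0 else 0)"
  proof (rule sum.cong[OF refl])
    fix S assume S: "S \<in> Pow ({0 :: nat} \<times> {..<N})"
    have "map (\<lambda>q. ind S (0, q)) [0..<N] = ?z \<longleftrightarrow> S = T"
    proof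
      assume "map (\<lambda>q. ind S (0, q)) [0..<N] = ?z"
      then have "ind S (0, q) = b q" if "q < N" for q using that by auto
      then have "(0, q) \<in> S \<longleftrightarrow> b q = 1" if "q < N" for q using that by (fastforce simp: ind_def split: if_splits)
      then show "S = T" using S by (auto simp: T_def)
    next
      assume "S = T" then show "map (\<lambda>q. ind S (0, q)) [0..<N] = ?z" using bT by auto
    qed
    then show "(if map (fst (?run S)) [0..<N] = ?z \<and> map (\<lambda>q. ind S (0, q)) [0..<N] = ?z then sgn2 (snd (?run S)) else 0) =
      (if S = T then if map (fst (?run S)) [0..<N] = ?z then sgn2 (snd (?run S)) else 0 else 0)" by simp
  qed
  also have "\<dots> = (if map (fst (?run T)) [0..<N] = ?z then sgn2 (snd (?run T)) else 0)"
    by (subst sum.delta) (auto simp: T_def)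
  finally have *: "sgn2 (\<phi> ?z) = (if map (fst (?run T)) [0..<N] = ?z then sgn2 (snd (?run T)) else 0)" .
  have z: "map (fst (?run T)) [0..<N] = ?z"
  proof (rule ccontr)
    assume "map (fst (?run T)) [0..<N] \<noteq> ?z"
    then have "sgn2 (\<phi> ?z) = 0" unfolding * by (rule if_not_P)
    then show False using sgn2_inject(2) by blast
  qed
  have "sgn2 (\<phi> ?z) = sgn2 (snd (?run T))" unfolding * using z by (rule if_P)
  then have p: "\<phi> ?z = snd (?run T)" by (simp only: sgn2_inject)
  note r = no(2)[of w t b f "ind T" "\<lambda>_. 0"]
  note rc = run_cong[OF C, where b = b and b' = "\<lambda>q. ind T (0, q)" and w = "ind T" and t = "\<lambda>_. 0" and f = 0]
  have "snd (run_circuit (ind T) C (\<lambda>_. 0) (b, 0)) = snd (?run T)" by (rule rc(1)) (simp add: bT)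
  then show "snd (run_circuit w C t (b, f)) = f + \<phi> ?z" unfolding r p by simp
  show "fst (run_circuit w C t (b, f)) j = b j" if "j < N"
  proof -
    have "fst (run_circuit (ind T) C (\<lambda>_. 0) (b, 0)) j = fst (?run T) j" by (rule rc(2)) (simp_all add: bT that)
    moreover have "fst (?run T) j = b j" using z that by simp
    ultimately show ?thesis unfolding r by simp
  qed
qed

text \<open>State after \<open>k\<close> Hadamard layers: every wire carries its latest label,
  without any constant. Oracles preserve this and only add to the phase.\<close>

definition at_layer :: "(nat \<times> nat \<Rightarrow> bit) \<Rightarrow> nat \<Rightarrow> nat \<Rightarrow> bit \<Rightarrow> (nat \<Rightarrow> nat) \<Rightarrow> (nat \<Rightarrow> bit) \<times> bit \<Rightarrow> bool" where
  "at_layer w N k f t st \<longleftrightarrow> (\<forall>q<N. t q = k \<and> fst st q = w (k, q)) \<and> snd st = f"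

lemma at_layer_H:
  assumes "at_layer w N k f t st" "distinct qs" "set qs = {..<N}"
  shows "at_layer w N (Suc k) (f + (\<Sum>q<N. w (k, q) * w (Suc k, q))) (run_count (map HGate qs) t) (run_circuit w (map HGate qs) t st)"
proof -
  obtain b f' where st: "st = (b, f')" by (cases st)
  have "(\<Sum>q<N. b q * w (Suc (t q), q)) = (\<Sum>q<N. w (k, q) * w (Suc k, q))"
    using assms(1) by (intro sum.cong) (auto simp: at_layer_def st)
  with assms(1) run_H_layer[OF assms(2), of t w b f'] show ?thesis by (simp add: at_layer_def st assms(3))
qed

lemma at_layer_oracle:
  assumes "at_layer w N k f t st" "implements_phase m N \<phi> C"
  shows "at_layer w N k (f + \<phi> (map (\<lambda>q. w (k, q)) [0..<N])) (run_count C t) (run_circuit w C t st)"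
proof -
  obtain b f' where st: "st = (b, f')" by (cases st)
  have b: "map b [0..<N] = map (\<lambda>q. w (k, q)) [0..<N]" using assms(1) by (simp add: at_layer_def st)
  show ?thesis using assms(1) run_oracle(3)[OF assms(2), where w = w and t = t and b = b and f = f']
    unfolding at_layer_def st run_oracle(1,2)[OF assms(2)] b by simp
qed

text \<open>Phase of the circuit when layer 0, the input, is zero: then the first Hadamard layer
  adds nothing. The oracles \<open>\<phi>\<close> and \<open>\<psi>\<close> act on the labels of
  layers 1 and 2.\<close>

definition shift_phase :: "nat \<Rightarrow> (bit list \<Rightarrow> bit) \<Rightarrow> (bit list \<Rightarrow> bit) \<Rightarrow> (nat \<times> nat \<Rightarrow> bit) \<Rightarrow> bit" where
  "shift_phase N \<phi> \<psi> w = \<phi> (map (\<lambda>q. w (1, q)) [0..<N]) + (\<Sum>q<N. w (1, q) * w (2, q)) +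
     (\<psi> (map (\<lambda>q. w (2, q)) [0..<N]) + (\<Sum>q<N. w (2, q) * w (3, q)))"

lemma H_layer_circuit: "H_layer N C \<Longrightarrow> circuit_on N C \<and> length (filter is_H C) = N"
proof -
  assume "H_layer N C"
  then obtain qs where qs: "distinct qs" "set qs = {..<N}" "C = map HGate qs" by (auto simp: H_layer_def)
  have "length qs = N" using distinct_card[OF qs(1)] qs(2) by simp
  then show ?thesis using qs by (auto simp: circuit_on_def filter_map comp_def)
qed

lemma oracle_no_H: "implements_phase m N \<phi> C \<Longrightarrow> circuit_on N C \<and> filter is_H C = []"
  using oracle_gate_not_H by (auto simp: implements_phase_def filter_empty_conv)

lemma presents_layers:
  assumes L: "H_layer N L1" "H_layer N L2" "H_layer N L3" and O: "implements_phase m N \<phi> CG" "implements_phase m N \<psi> CF"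
    and C: "C = L1 @ CG @ L2 @ CF @ L3"
  shows "circuit_on N C" "presents (interp N C) ({..3} \<times> {..<N}) (\<lambda>w. (\<Sum>q<N. w (0, q) * w (1, q)) + shift_phase N \<phi> \<psi> w)
    (\<lambda>w. map (\<lambda>q. w (3, q)) [0..<N]) (\<lambda>w. map (\<lambda>q. w (0, q)) [0..<N]) (1 / sqrt 2 ^ (3 * N))"
proof -
  show on: "circuit_on N C" using H_layer_circuit[OF L(1)] H_layer_circuit[OF L(2)] H_layer_circuit[OF L(3)] oracle_no_H[OF O(1)] oracle_no_H[OF O(2)]
    unfolding C circuit_on_def by auto
  have h: "length (filter is_H C) = 3 * N"
    using H_layer_circuit[OF L(1)] H_layer_circuit[OF L(2)] H_layer_circuit[OF L(3)] oracle_no_H[OF O(1)] oracle_no_H[OF O(2)]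
    unfolding C by simp
  have fin: "at_layer w N 3 ((\<Sum>q<N. w (0, q) * w (1, q)) + shift_phase N \<phi> \<psi> w) (run_count C (\<lambda>_. 0))
      (run_circuit w C (\<lambda>_. 0) (\<lambda>q. w (0, q), 0))" for w
  proof -
    obtain q1 q2 q3 where q: "distinct q1" "set q1 = {..<N}" "L1 = map HGate q1" "distinct q2" "set q2 = {..<N}" "L2 = map HGate q2"
      "distinct q3" "set q3 = {..<N}" "L3 = map HGate q3" using L by (auto simp: H_layer_def)
    have "at_layer w N 0 0 (\<lambda>_. 0) (\<lambda>q. w (0, q), 0)" by (simp add: at_layer_def)
    note 1 = at_layer_H[OF this q(1,2), folded q(3)]
    note 2 = at_layer_oracle[OF 1 O(1)]
    note 3 = at_layer_H[OF 2 q(4,5), folded q(6)]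
    note 4 = at_layer_oracle[OF 3 O(2)]
    note 5 = at_layer_H[OF 4 q(7,8), folded q(9)]
    then show ?thesis unfolding C run_circuit_append run_count_append shift_phase_def
      by (simp add: numeral_2_eq_2 numeral_3_eq_3 add.assoc)
  qed
  have c: "run_count C (\<lambda>_. 0) q = 3" if "q < N" for q using fin that unfolding at_layer_def by blast
  then have K: "labels N (run_count C (\<lambda>_. 0)) = {..3} \<times> {..<N}" unfolding labels_def by auto
  show "presents (interp N C) ({..3} \<times> {..<N}) (\<lambda>w. (\<Sum>q<N. w (0, q) * w (1, q)) + shift_phase N \<phi> \<psi> w)
    (\<lambda>w. map (\<lambda>q. w (3, q)) [0..<N]) (\<lambda>w. map (\<lambda>q. w (0, q)) [0..<N]) (1 / sqrt 2 ^ (3 * N))"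
    by (rule presents_cong[OF presents_interp[OF on, unfolded K h]])
      (use fin in \<open>auto simp: at_layer_def\<close>)
qed

section \<open>Fixing the input and closing up the measurement\<close>

lemma presents_constant:
  assumes "vars A = {}" "well_formed A" "phase A = {}" "outs A = map pconst xs" "ins A = map pconst ys"
  shows "presents A ({} :: 'k set) (\<lambda>_. 0) (\<lambda>_. xs) (\<lambda>_. ys) (scal A)"
proof -
  have c: "peval (pconst b) = (\<lambda>_. b)" for b by (simp add: fun_eq_iff)
  have "presents A ({} :: 'k set) (\<lambda>w. peval (phase A) ((\<lambda>_ _. 0) w)) (\<lambda>w. map (\<lambda>p. peval p ((\<lambda>_ _. 0) w)) (outs A))
      (\<lambda>w. map (\<lambda>p. peval p ((\<lambda>_ _. 0) w)) (ins A)) (scal A)"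
    using assms by (intro presents_basic) (auto simp: parametrizes_def c affine_const)
  then show ?thesis by (simp add: assms comp_def)
qed

text \<open>Composition with the zero state fixes layer 0 to 0, so its labels drop out and with them
  the phases of the first Hadamard layer.\<close>

lemma presents_output:
  assumes P: "presents (interp N C) ({..3} \<times> {..<N}) (\<lambda>w. (\<Sum>q<N. w (0, q) * w (1, q)) + shift_phase N \<phi> \<psi> w)
    (\<lambda>w. map (\<lambda>q. w (3, q)) [0..<N]) (\<lambda>w. map (\<lambda>q. w (0, q)) [0..<N]) r"
  shows "presents (output_psum N C (replicate N 0)) ({1..3} \<times> {..<N}) (shift_phase N \<phi> \<psi>)
    (\<lambda>w. map (\<lambda>q. w (3, q)) [0..<N]) (\<lambda>w. []) r"
proof -
  define hA where "hA w k = (if fst k = 0 then 0 else w k)" for w :: "nat \<times> nat \<Rightarrow> bit" and k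
  have ket: "presents (ket (replicate N 0)) ({} :: (nat \<times> nat) set) (\<lambda>_. 0) (\<lambda>_. replicate N 0) (\<lambda>_. []) 1"
    using presents_constant[OF _ well_formed_simple(2), of "replicate N 0" "replicate N 0" "[]"] by (simp add: ket_def)
  have len: "length (ins (interp N C)) = length (outs (ket (replicate N 0)))"
    using presents_length(2)[OF P] by (simp add: ket_def)
  have "presents (interp N C \<odot> ket (replicate N 0)) ({1..3} \<times> {..<N})
    (\<lambda>w. (\<Sum>q<N. hA w (0, q) * hA w (1, q)) + shift_phase N \<phi> \<psi> (hA w) + 0)
    (\<lambda>w. map (\<lambda>q. hA w (3, q)) [0..<N]) (\<lambda>w. []) (r * 1)"
  proof (rule presents_compose[OF P ket len, where hB = "\<lambda>w. w"])
    show "affine_in 1 ({1..3} \<times> {..<N}) (\<lambda>w. hA w k)" if "k \<in> {..3} \<times> {..<N}" for k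
      using that by (cases "fst k = 0") (auto simp: hA_def affine_const intro!: affine_var)
    show "map (\<lambda>q. hA w (0, q)) [0..<N] = replicate N 0" for w
      by (intro nth_equalityI) (simp_all add: hA_def)
    show "\<exists>w. (\<forall>k\<in>{..3} \<times> {..<N}. wA k = hA w k) \<and> (\<forall>k\<in>{}. wB k = w k)"
      if "map (\<lambda>q. wA (0, q)) [0..<N] = replicate N 0" for wA wB
    proof -
      have "wA (0, q) = 0" if "q < N" for q
        using arg_cong[OF \<open>map (\<lambda>q. wA (0, q)) [0..<N] = replicate N 0\<close>, of "\<lambda>xs. xs ! q"] that by simp
      then show ?thesis by (intro exI[of _ wA]) (auto simp: hA_def)
    qed
    show "w k = w' k" if eq: "\<And>k. k \<in> {..3} \<times> {..<N} \<Longrightarrow> hA w k = hA w' k" and k: "k \<in> {1..3} \<times> {..<N}" for w w' k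
      using eq[of k] k by (auto simp: hA_def)
  qed auto
  then show ?thesis unfolding output_psum_def
    by (rule presents_cong) (simp_all add: hA_def shift_phase_def)
qed

lemma presents_projector:
  assumes "i < N"
  shows "presents (ident i \<otimes> proj1 \<otimes> ident (N - i - 1)) ({..<N} - {i}) (\<lambda>_. 0)
    (\<lambda>w. map (w(i := 1)) [0..<N]) (\<lambda>w. map (w(i := 1)) [0..<N]) 1"
proof -
  let ?k = "N - i - 1"
  have par: "parametrizes {0..<?k} (\<lambda>_. True) {i<..<N} (\<lambda>w k. w (i + 1 + k))"
    unfolding parametrizes_def
  proof (intro conjI allI impI ballI)
    fix v :: "nat \<Rightarrow> bit" show "\<exists>w. \<forall>k\<in>{0..<?k}. v k = w (i + 1 + k)"
      by (rule exI[of _ "\<lambda>j. v (j - i - 1)"]) simp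
  next
    fix w w' :: "nat \<Rightarrow> bit" and k assume "\<forall>a\<in>{0..<?k}. w (i + 1 + a) = w' (i + 1 + a)" "k \<in> {i<..<N}"
    then show "w k = w' k" using bspec[of "{0..<?k}" "\<lambda>a. w (i + 1 + a) = w' (i + 1 + a)" "k - i - 1"] by auto
  qed (auto intro!: affine_var)
  have p1: "presents proj1 ({} :: nat set) (\<lambda>_. 0) (\<lambda>_. [1]) (\<lambda>_. [1]) 1"
    using presents_constant[OF _ well_formed_simple(3), of "[1]" "[1]"] by (simp add: proj1_def)
  have "presents (proj1 \<otimes> ident ?k) {i<..<N} (\<lambda>w. 0 + 0) (\<lambda>w. [1] @ map (\<lambda>k. w (i + 1 + k)) [0..<?k])
     (\<lambda>w. [1] @ map (\<lambda>k. w (i + 1 + k)) [0..<?k]) (1 * 1)"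
  proof (rule presents_tensor[OF p1 presents_ident[OF _ par], where hA = "\<lambda>w. w" and hB = "\<lambda>w. w"])
    fix wA wB :: "nat \<Rightarrow> bit" show "\<exists>w. (\<forall>k\<in>{}. wA k = w k) \<and> (\<forall>k\<in>{i<..<N}. wB k = w k)" by blast
  qed (auto intro!: affine_var)
  then have p2: "presents (proj1 \<otimes> ident ?k) {i<..<N} (\<lambda>w. 0) (\<lambda>w. [1] @ map (\<lambda>k. w (i + 1 + k)) [0..<?k])
     (\<lambda>w. [1] @ map (\<lambda>k. w (i + 1 + k)) [0..<?k]) 1" by simp
  have "presents (ident i \<otimes> proj1 \<otimes> ident ?k) ({..<N} - {i}) (\<lambda>w. 0 + 0) (\<lambda>w. map w [0..<i] @ [1] @ map (\<lambda>k. w (i + 1 + k)) [0..<?k])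
     (\<lambda>w. map w [0..<i] @ [1] @ map (\<lambda>k. w (i + 1 + k)) [0..<?k]) (1 * 1)"
  proof (rule presents_tensor[OF presents_ident[OF _ parametrizes_id] p2, where hA = "\<lambda>w. w" and hB = "\<lambda>w. w"])
    fix wA wB :: "nat \<Rightarrow> bit"
    show "\<exists>w. (\<forall>k\<in>{0..<i}. wA k = w k) \<and> (\<forall>k\<in>{i<..<N}. wB k = w k)"
      by (rule exI[of _ "\<lambda>k. if k < i then wA k else wB k"]) simp
  next
    fix w w' :: "nat \<Rightarrow> bit" and k
    assume "\<And>k. k \<in> {0..<i} \<Longrightarrow> w k = w' k" "\<And>k. k \<in> {i<..<N} \<Longrightarrow> w k = w' k" "k \<in> {..<N} - {i}"
    then show "w k = w' k" by (cases "k < i") auto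
  qed (use assms in \<open>auto intro!: affine_var\<close>)
  moreover have "map w [0..<i] @ [1] @ map (\<lambda>k. w (i + 1 + k)) [0..<?k] = map (w(i := 1)) [0..<N]" for w :: "nat \<Rightarrow> bit"
  proof (rule nth_equalityI)
    fix j assume "j < length (map w [0..<i] @ [1] @ map (\<lambda>k. w (i + 1 + k)) [0..<?k])"
    then show "(map w [0..<i] @ [1] @ map (\<lambda>k. w (i + 1 + k)) [0..<?k]) ! j = map (w(i := 1)) [0..<N] ! j"
      using assms by (cases j i rule: linorder_cases) (auto simp: nth_append nth_Cons')
  qed (use assms in simp)
  ultimately show ?thesis by simp
qed

text \<open>The label component \<open>False\<close> marks the copy of the circuit in the ket and
  \<open>True\<close> the copy in the bra. Linking both through the projector identifies their last
  layers, kept under \<open>False\<close>, and fixes the measured wire to 1 there.\<close>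

lemma presents_measurement:
  fixes F :: "(nat \<times> nat \<Rightarrow> bit) \<Rightarrow> bit"
  assumes P: "presents (output_psum N C x) ({1..3} \<times> {..<N}) F (\<lambda>w. map (\<lambda>q. w (3, q)) [0..<N]) (\<lambda>w. []) r" and i: "i < N"
  shows "presents (measurement_psum N C x i) ({False} \<times> ({1..3} \<times> {..<N} - {(3, i)}) \<union> {True} \<times> {1..2} \<times> {..<N})
    (\<lambda>w. (\<Sum>c\<in>{True, False}. F (\<lambda>(t, q). if t = 3 then if q = i then 1 else w (False, 3, q) else w (c, t, q)))) (\<lambda>_. []) (\<lambda>_. []) (cnj r * r)"
proof -
  let ?g = "output_psum N C x" and ?M = "ident i \<otimes> proj1 \<otimes> ident (N - i - 1)"
  let ?K = "{1..3} \<times> {..<N}" and ?K1 = "{1..3} \<times> {..<N} - {(3, i)}"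
  let ?K2 = "{False} \<times> ?K1 \<union> {True} \<times> {1..2 :: nat} \<times> {..<N}"
  define hB where "hB w = w((3 :: nat, i) := 1 :: bit)" for w
  have leng: "length (outs ?g) = N" "length (ins ?g) = 0"
    using presents_length[OF P] by simp_all
  have lenM: "length (ins ?M) = N" "length (outs ?M) = N" using presents_length[OF presents_projector[OF i]] by simp_all
  have "presents (?M \<odot> ?g) ?K1 (\<lambda>w. 0 + F (hB w)) (\<lambda>w. map ((\<lambda>q. w (3, q))(i := 1)) [0..<N]) (\<lambda>w. []) (1 * r)"
  proof (rule presents_compose[OF presents_projector[OF i] P, where hA = "\<lambda>w q. w (3, q)"])
    show "affine_in 1 ?K1 (\<lambda>w. hB w k)" if "k \<in> ?K" for k
      using that by (cases "k = (3, i)") (auto simp: hB_def affine_const intro!: affine_var)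
    show "map ((\<lambda>q. w (3, q))(i := 1)) [0..<N] = map (\<lambda>q. hB w (3, q)) [0..<N]" for w by (simp add: hB_def)
    show "\<exists>w. (\<forall>k\<in>{..<N} - {i}. wA k = w (3, k)) \<and> (\<forall>k\<in>?K. wB k = hB w k)"
      if eq: "map (wA(i := 1)) [0..<N] = map (\<lambda>q. wB (3, q)) [0..<N]" for wA wB
    proof -
      have q: "(wA(i := 1)) q = wB (3, q)" if "q < N" for q
        using arg_cong[OF eq, of "\<lambda>xs. xs ! q"] that by simp
      have "wA k = wB (3, k)" if "k \<in> {..<N} - {i}" for k using q[of k] that by simp
      moreover have "wB (3, i) = 1" using q[OF i] by simp
      ultimately show ?thesis by (intro exI[of _ wB]) (auto simp: hB_def)
    qed
    show "w k = w' k" if eq: "\<And>k. k \<in> ?K \<Longrightarrow> hB w k = hB w' k" and k: "k \<in> ?K1" for w w' k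
    proof -
      have "k \<in> ?K" "k \<noteq> (3, i)" using k by auto
      then show ?thesis using eq[of k] by (simp add: hB_def)
    qed
    show "length (ins ?M) = length (outs ?g)" unfolding lenM(1) leng(1) ..
  qed (auto intro!: affine_var)
  then have Mg: "presents (?M \<odot> ?g) ?K1 (\<lambda>w. F (hB w)) (\<lambda>w. map ((\<lambda>q. w (3, q))(i := 1)) [0..<N]) (\<lambda>w. []) r" by simp
  define h where "h w = (\<lambda>(t, q). if t = 3 then if q = i then 1 else w (False, 3, q) else w (True, t, q) :: bit)" for w :: "bool \<times> nat \<times> nat \<Rightarrow> bit"
  define h' where "h' w k = (w (False, k) :: bit)" for w :: "bool \<times> nat \<times> nat \<Rightarrow> bit" and k
  have "presents (dagger ?g \<odot> ?M \<odot> ?g) ?K2 (\<lambda>w. F (h w) + F (hB (h' w))) (\<lambda>_. []) (\<lambda>_. []) (cnj r * r)"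
  proof (rule presents_compose[OF presents_dagger[OF P] Mg, of ?K2 h h'])
    show "length (ins (dagger ?g)) = length (outs (?M \<odot> ?g))"
      unfolding outs_compose lenM(2) using leng(1) by (simp add: dagger_def)
    show "affine_in 1 ?K2 (\<lambda>w. h w k)" if k: "k \<in> ?K" for k
    proof -
      obtain t q where tq: "k = (t, q)" by (cases k)
      consider "t = 3" "q = i" | "t = 3" "q \<noteq> i" | "t \<noteq> 3" by blast
      then show ?thesis
      proof cases
        case 1 then show ?thesis by (simp add: h_def tq affine_const)
      next
        case 2 then show ?thesis using k by (auto simp: h_def tq intro!: affine_var)
      next
        case 3 then show ?thesis using k by (auto simp: h_def tq intro!: affine_var)
      qed
    qed
    show "affine_in 1 ?K2 (\<lambda>w. h' w k)" if "k \<in> ?K1" for k using that by (auto simp: h'_def intro!: affine_var)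
    show "map (\<lambda>q. h w (3, q)) [0..<N] = map ((\<lambda>q. h' w (3, q))(i := 1)) [0..<N]" for w
      by (simp add: h_def h'_def)
    show "\<exists>w. (\<forall>k\<in>?K. wA k = h w k) \<and> (\<forall>k\<in>?K1. wB k = h' w k)"
      if eq: "map (\<lambda>q. wA (3, q)) [0..<N] = map ((\<lambda>q. wB (3, q))(i := 1)) [0..<N]" for wA wB
    proof -
      have q: "wA (3, q) = ((\<lambda>q. wB (3, q))(i := 1)) q" if "q < N" for q
        using arg_cong[OF eq, of "\<lambda>xs. xs ! q"] that by simp
      show ?thesis
        by (rule exI[of _ "\<lambda>(c, k). if c then wA k else wB k"]) (use q in \<open>auto simp: h_def h'_def\<close>)
    qed
    show "w k = w' k" if eq: "\<And>k. k \<in> ?K \<Longrightarrow> h w k = h w' k" "\<And>k. k \<in> ?K1 \<Longrightarrow> h' w k = h' w' k" and k: "k \<in> ?K2" for w w' k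
    proof -
      obtain c t q where ctq: "k = (c, t, q)" by (cases k)
      show ?thesis
      proof (cases c)
        case True then show ?thesis using eq(1)[of "(t, q)"] k by (auto simp: ctq h_def)
      next
        case False then show ?thesis using eq(2)[of "(t, q)"] k by (auto simp: ctq h'_def)
      qed
    qed
  qed simp
  moreover have "hB (h' w) = (\<lambda>(t, q). if t = 3 then if q = i then 1 else w (False, 3, q) else w (False, t, q))" for w
    by (auto simp: fun_eq_iff hB_def h'_def)
  ultimately show ?thesis unfolding measurement_psum_def Let_def by (simp add: h_def)
qed

section \<open>Cancellation of the oracle phases\<close>

lemma ip_sum: "length xs = n \<Longrightarrow> length ys = n \<Longrightarrow> ip xs ys = (\<Sum>j<n. xs ! j * ys ! j)"
proof -
  assume l: "length xs = n" "length ys = n"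
  then have "map2 (*) xs ys = map (\<lambda>j. xs ! j * ys ! j) [0..<n]" by (intro nth_equalityI) simp_all
  then show ?thesis by (simp add: ip_def interv_sum_list_conv_sum_set_nat atLeast0LessThan)
qed

lemma permutes_less: "\<pi> permutes {..<n} \<Longrightarrow> j < n \<Longrightarrow> \<pi> j < n" "\<pi> permutes {..<n} \<Longrightarrow> j < n \<Longrightarrow> inv \<pi> j < n"
  using permutes_in_image[of \<pi> "{..<n}" j] permutes_in_image[OF permutes_inv, of \<pi> "{..<n}" j] by auto

lemma G_phase_map:
  assumes "\<pi> permutes {..<n}" "length s = 2 * n"
  shows "G_phase n \<pi> f0 s (map z [0..<2 * n]) =
    (\<Sum>j<n. (z j + s ! j) * (z (n + \<pi> j) + s ! (n + \<pi> j))) + f0 (map (\<lambda>l. z (n + l) + s ! (n + l)) [0..<n])"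
proof -
  have x: "vadd (take n (map z [0..<2 * n])) (take n s) = map (\<lambda>j. z j + s ! j) [0..<n]"
    using assms(2) by (intro nth_equalityI) (simp_all add: vadd_def)
  have y: "vadd (drop n (map z [0..<2 * n])) (drop n s) = map (\<lambda>l. z (n + l) + s ! (n + l)) [0..<n]"
    using assms(2) by (intro nth_equalityI) (simp_all add: vadd_def)
  have "ip (map (\<lambda>j. z j + s ! j) [0..<n]) (permute_list \<pi> (map (\<lambda>l. z (n + l) + s ! (n + l)) [0..<n])) =
    (\<Sum>j<n. (z j + s ! j) * (z (n + \<pi> j) + s ! (n + \<pi> j)))"
    using permutes_less(1)[OF assms(1)] by (subst ip_sum[of _ n]) (auto simp: permute_list_def intro!: sum.cong)
  then show ?thesis by (simp only: G_phase_def Let_def x y)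
qed

lemma F_phase_map:
  assumes "\<pi> permutes {..<n}"
  shows "F_phase n \<pi> f0 (map z [0..<2 * n]) = (\<Sum>j<n. z j * z (n + \<pi> j)) + f0 (map (\<lambda>l. z (inv \<pi> l)) [0..<n])"
proof -
  have x: "take n (map z [0..<2 * n]) = map z [0..<n]"
    and y: "drop n (map z [0..<2 * n]) = map (\<lambda>l. z (n + l)) [0..<n]"
    by (auto intro: nth_equalityI)
  have "ip (map z [0..<n]) (permute_list \<pi> (map (\<lambda>l. z (n + l)) [0..<n])) = (\<Sum>j<n. z j * z (n + \<pi> j))"
    using permutes_less(1)[OF assms(1)] by (subst ip_sum[of _ n]) (auto simp: permute_list_def intro!: sum.cong)
  moreover have "permute_list (inv \<pi>) (map z [0..<n]) = map (\<lambda>l. z (inv \<pi> l)) [0..<n]"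
    using permutes_less(2)[OF assms] by (auto simp: permute_list_def)
  ultimately show ?thesis by (simp only: F_phase_def Let_def x y)
qed

lemma sum_split_half: "(\<Sum>q<2 * (n :: nat). f q) = (\<Sum>j<n. f j) + (\<Sum>l<n. f (n + l) :: bit)"
proof -
  have "{..<2 * n} = {..<n} \<union> (+) n ` {..<n}"
  proof -
    have "q \<in> (+) n ` {..<n}" if "q < 2 * n" "\<not> q < n" for q
      using that by (intro image_eqI[of _ _ "q - n"]) auto
    then show ?thesis by auto
  qed
  then have "(\<Sum>q<2 * n. f q) = (\<Sum>q<n. f q) + (\<Sum>q\<in>(+) n ` {..<n}. f q)"
    using sum.union_disjoint[of "{..<n}" "(+) n ` {..<n}" f] by (auto simp: disjoint_iff)
  then show ?thesis by (simp add: sum.reindex)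
qed

text \<open>What is left of the phase after splitting off the terms linear in layer 3 and in the
  first half of layer 1; \<open>b\<close> and \<open>a\<close> stand for layers 1 and 2. The
  quadratic term in \<open>a\<close> is the bent form of the second oracle.\<close>

definition shift_rest :: "nat \<Rightarrow> (nat \<Rightarrow> nat) \<Rightarrow> bit list \<Rightarrow> (bit list \<Rightarrow> bit) \<Rightarrow> (nat \<Rightarrow> bit) \<Rightarrow> (nat \<Rightarrow> bit) \<Rightarrow> bit" where
  "shift_rest n \<pi> s f0 b a = (\<Sum>j<n. s ! j * (b (n + \<pi> j) + s ! (n + \<pi> j))) + f0 (map (\<lambda>l. b (n + l) + s ! (n + l)) [0..<n]) +
     (\<Sum>l<n. b (n + l) * a (n + l)) + (\<Sum>j<n. a j * a (n + \<pi> j)) + f0 (map (\<lambda>l. a (inv \<pi> l)) [0..<n])"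

lemma shift_rest_cong:
  assumes \<pi>: "\<pi> permutes {..<n}" and "\<And>l. l < n \<Longrightarrow> b (n + l) = b' (n + l)" "\<And>q. q < 2 * n \<Longrightarrow> a q = a' q"
  shows "shift_rest n \<pi> s f0 b a = shift_rest n \<pi> s f0 b' a'"
proof -
  have p: "\<pi> j < n" "inv \<pi> j < n" if "j < n" for j using permutes_less[OF \<pi> that] .
  have a: "a j = a' j" "a (n + j) = a' (n + j)" if "j < n" for j using assms(3) that by auto
  have "map (\<lambda>l. b (n + l) + s ! (n + l)) [0..<n] = map (\<lambda>l. b' (n + l) + s ! (n + l)) [0..<n]"
    "map (\<lambda>l. a (inv \<pi> l)) [0..<n] = map (\<lambda>l. a' (inv \<pi> l)) [0..<n]"
    using assms(2) a p by auto
  then show ?thesis unfolding shift_rest_def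
    by (intro arg_cong2[of _ _ _ _ "(+)"] sum.cong refl arg_cong[of _ _ f0]) (use assms(2) a p in simp_all)
qed

text \<open>
  The variables of the last layer, except the measured one, and the first halves of the first
  layers occur linearly.  The constraints that they impose identify the two copies of the middle
  layer off the measured wire and determine the second halves of the first layers.
\<close>

lemma shift_phase_split:
  fixes \<pi> :: "nat \<Rightarrow> nat" and z :: "nat \<times> nat \<Rightarrow> bit"
  assumes \<pi>: "\<pi> permutes {..<n}" and s: "length s = 2 * n" and i: "i < 2 * n" and zi: "z (3, i) = 1"
  shows "shift_phase (2 * n) (G_phase n \<pi> f0 s) (F_phase n \<pi> f0) z =
    (\<Sum>j<n. z (1, j) * (z (1, n + \<pi> j) + s ! (n + \<pi> j) + z (2, j))) + (\<Sum>q\<in>{..<2 * n} - {i}. z (3, q) * z (2, q)) +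
    (shift_rest n \<pi> s f0 (\<lambda>q. z (1, q)) (\<lambda>q. z (2, q)) + z (2, i))"
proof -
  \<comment> \<open>The measured wire contributes \<open>z (2, i)\<close>, as its last label is
    fixed to 1.\<close>
  have 3: "(\<Sum>q<2 * n. z (2, q) * z (3, q)) = z (2, i) + (\<Sum>q\<in>{..<2 * n} - {i}. z (3, q) * z (2, q))"
    using i zi by (subst sum.remove[of _ i]) (auto simp: mult.commute)
  have 1: "(\<Sum>j<n. (z (1, j) + s ! j) * (z (1, n + \<pi> j) + s ! (n + \<pi> j))) + (\<Sum>j<n. z (1, j) * z (2, j)) =
     (\<Sum>j<n. z (1, j) * (z (1, n + \<pi> j) + s ! (n + \<pi> j) + z (2, j))) + (\<Sum>j<n. s ! j * (z (1, n + \<pi> j) + s ! (n + \<pi> j)))"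
    unfolding sum.distrib[symmetric] by (intro sum.cong refl) (simp add: algebra_simps)
  have "shift_phase (2 * n) (G_phase n \<pi> f0 s) (F_phase n \<pi> f0) z =
    ((\<Sum>j<n. (z (1, j) + s ! j) * (z (1, n + \<pi> j) + s ! (n + \<pi> j))) + (\<Sum>j<n. z (1, j) * z (2, j))) +
    (f0 (map (\<lambda>l. z (1, n + l) + s ! (n + l)) [0..<n]) + (\<Sum>l<n. z (1, n + l) * z (2, n + l)) +
    ((\<Sum>j<n. z (2, j) * z (2, n + \<pi> j)) + f0 (map (\<lambda>l. z (2, inv \<pi> l)) [0..<n]) + (\<Sum>q<2 * n. z (2, q) * z (3, q))))"
    unfolding shift_phase_def G_phase_map[OF \<pi> s] F_phase_map[OF \<pi>] sum_split_half[of "\<lambda>q. z (1, q) * z (2, q)"]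
    by (simp only: ac_simps)
  then show ?thesis unfolding 1 3 shift_rest_def by (simp only: ac_simps)
qed

text \<open>The hypothesis makes \<open>b + s\<close> on the second half a permuted copy of
  \<open>a\<close> on the first half. Then both occurrences of \<open>f0\<close> have the same
  argument, and the product of \<open>b\<close> and \<open>a\<close> on the second half yields the
  bent form of \<open>a\<close> a second time; both pairs cancel, leaving the inner product of
  \<open>s\<close> and \<open>a\<close>.\<close>

lemma shift_phase_solved:
  fixes \<pi> :: "nat \<Rightarrow> nat" and a b :: "nat \<Rightarrow> bit"
  assumes \<pi>: "\<pi> permutes {..<n}" and b: "\<And>l. l < n \<Longrightarrow> b (n + l) = a (inv \<pi> l) + s ! (n + l)"
  shows "shift_rest n \<pi> s f0 b a = (\<Sum>q<2 * n. s ! q * a q)"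
proof -
  have 1: "(\<Sum>j<n. s ! j * (b (n + \<pi> j) + s ! (n + \<pi> j))) = (\<Sum>j<n. s ! j * a j)"
    using permutes_less[OF \<pi>] permutes_inverses(2)[OF \<pi>] by (intro sum.cong refl) (simp add: b add.assoc)
  have 2: "map (\<lambda>l. b (n + l) + s ! (n + l)) [0..<n] = map (\<lambda>l. a (inv \<pi> l)) [0..<n]"
    by (simp add: b add.assoc)
  have 3: "(\<Sum>j<n. a j * a (n + \<pi> j)) = (\<Sum>l<n. a (inv \<pi> l) * a (n + l))"
    using sum.permute[OF \<pi>, of "\<lambda>l. a (inv \<pi> l) * a (n + l)"] permutes_inverses(2)[OF \<pi>] by (simp add: comp_def)
  have 4: "(\<Sum>l<n. b (n + l) * a (n + l)) = (\<Sum>l<n. a (inv \<pi> l) * a (n + l)) + (\<Sum>l<n. s ! (n + l) * a (n + l))"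
    unfolding sum.distrib[symmetric] by (intro sum.cong refl) (simp add: b distrib_right)
  show ?thesis unfolding shift_rest_def sum_split_half[of "\<lambda>q. s ! q * a q"] 1 2 3 4 by (simp add: ac_simps)
qed

lemma good_const: "finite V \<Longrightarrow> good V (\<lambda>_. c) \<and> path_value V (\<lambda>_. c) = 2 ^ card V * sgn2 c"
proof (induction V rule: finite_induct)
  case empty then show ?case by (simp add: path_value_def good_empty)
next
  case (insert x V)
  then have "insert x V - {x} = V" by auto
  moreover have i: "indep x (\<lambda>_. c)" by (simp add: indep_def)
  ultimately show ?case using insert good_elim[OF _ i, of "insert x V"] path_value_elim[OF _ _ i, of "insert x V"] by simp
qed

text \<open>Solving the constraints makes the bra and ket copies agree in layer 2 except on wire
  \<open>i\<close>, and turns each phase into the inner product with \<open>s\<close> plus the bit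
  on wire \<open>i\<close>. In the sum only \<open>(s ! i + 1) * (a + a')\<close> survives, where
  \<open>a\<close> and \<open>a'\<close> are the two bits on wire \<open>i\<close>. It vanishes if
  \<open>s ! i = 1\<close> and is balanced otherwise. The \<open>4 * n - 1\<close> constraint
  variables and the \<open>2 * n + 1\<close> parameters account for
  \<open>2 ^ (6 * n)\<close>.\<close>

lemma closed_measurement:
  fixes n i :: nat and s :: "bit list" and f0 :: "bit list \<Rightarrow> bit"
  assumes \<pi>: "\<pi> permutes {..<n}" and s: "length s = 2 * n" and i: "i < 2 * n"
  defines "K \<equiv> {False} \<times> ({1..3} \<times> {..<2 * n} - {(3, i)}) \<union> {True} \<times> {1..2} \<times> {..<2 * n}"
    and "F \<equiv> \<lambda>w :: bool \<times> nat \<times> nat \<Rightarrow> bit. \<Sum>c\<in>{True, False}. shift_phase (2 * n) (G_phase n \<pi> f0 s) (F_phase n \<pi> f0)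
      (\<lambda>(t, q). if t = 3 then if q = i then 1 else w (False, 3, q) else w (c, t, q))"
  shows "good K F" "path_value K F = (if s ! i = 1 then 2 ^ (6 * n) else 0)"
proof -
  let ?N = "2 * n"
  \<comment> \<open>Labels of the last layer: each identifies the two copies of layer 2 on its
    wire.\<close>
  define UH where "UH = (\<lambda>q. (False, 3 :: nat, q)) ` ({..<?N} - {i})"
  \<comment> \<open>First halves of layer 1 in both copies: each determines one bit in the second
    half of that layer.\<close>
  define UX where "UX = (\<lambda>(c :: bool, j). (c, 1 :: nat, j)) ` (UNIV \<times> {..<n})"
  define U where "U = UH \<union> UX"
  define W where "W = (UNIV :: bool set) \<times> {2 :: nat} \<times> {..<?N} \<union> UNIV \<times> {1} \<times> {n..<?N}"
  define l where "l = (\<lambda>(c :: bool, t, j) w. if t = (3 :: nat) then w (False, 2 :: nat, j) + w (True, 2, j)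
      else w (c, 1, n + \<pi> j) + s ! (n + \<pi> j) + w (c, 2, j) :: bit)"
  define side where "side c w = shift_rest n \<pi> s f0 (\<lambda>q. w (c, 1, q)) (\<lambda>q. w (c, 2, q)) + w (c, 2, i)" for c :: bool and w :: "bool \<times> nat \<times> nat \<Rightarrow> bit"
  define g where "g w = side True w + side False w" for w
  \<comment> \<open>Parameter \<open>q < ?N\<close> is the common bit of layer 2 on wire
    \<open>q\<close>. On the measured wire it belongs to the ket copy only, and the bra copy has the
    extra parameter \<open>?N\<close>.\<close>
  define mid where "mid c w q = (if c \<and> q = i then w ?N else w q)" for c and w :: "nat \<Rightarrow> bit" and q
  define e where "e w = (\<lambda>(c, t, q). if t = (2 :: nat) then mid c w q else mid c w (inv \<pi> (q - n)) + s ! q)" for w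
  have injH: "inj_on (\<lambda>q. (False, 3 :: nat, q)) A" for A :: "nat set" by (simp add: inj_on_def)
  have injX: "inj_on (\<lambda>(c :: bool, j). (c, 1 :: nat, j)) A" for A :: "(bool \<times> nat) set" by (auto simp: inj_on_def)
  have finU: "finite UH" "finite UX" "finite U" "finite W" by (simp_all add: UH_def UX_def U_def W_def)
  have disj: "UH \<inter> UX = {}" "U \<inter> W = {}" by (auto simp: U_def UH_def UX_def W_def)
  have card: "card U = 4 * n - 1"
  proof -
    have "card UH = ?N - 1" unfolding UH_def card_image[OF injH] using i by simp
    moreover have "card UX = ?N" unfolding UX_def card_image[OF injX] by (simp add: card_cartesian_product UNIV_bool)
    ultimately show ?thesis unfolding U_def using finU disj i by (simp add: card_Un_disjoint)
  qed
  have KUW: "K = U \<union> W"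
  proof (rule set_eqI)
    fix k :: "bool \<times> nat \<times> nat" obtain c t q where k: "k = (c, t, q)" by (cases k)
    have "t \<in> {1..3} \<longleftrightarrow> t = 1 \<or> t = 2 \<or> t = 3" "t \<in> {1..2} \<longleftrightarrow> t = 1 \<or> t = 2" by auto
    moreover have "(c, t, q) \<in> UH \<longleftrightarrow> \<not> c \<and> t = 3 \<and> q < ?N \<and> q \<noteq> i" by (auto simp: UH_def)
    moreover have "(c, t, q) \<in> UX \<longleftrightarrow> t = 1 \<and> q < n" by (force simp: UX_def)
    ultimately show "k \<in> K \<longleftrightarrow> k \<in> U \<union> W" unfolding k K_def U_def W_def using i by auto
  qed
  have pl: "\<pi> j < n" "inv \<pi> j < n" "inv \<pi> (\<pi> j) = j" "\<pi> (inv \<pi> j) = j" if "j < n" for j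
    using permutes_less[OF \<pi> that] permutes_inverses[OF \<pi>] by auto
  have UE: "P u" if "u \<in> U" "\<And>q. q < ?N \<Longrightarrow> q \<noteq> i \<Longrightarrow> P (False, 3, q)" "\<And>c j. j < n \<Longrightarrow> P (c, 1, j)" for P u
    using that by (auto simp: U_def UH_def UX_def)
  have W1: "(c, 1, n + j) \<in> W" if "j < n" for c j using that by (simp add: W_def)
  have W2: "(c, 2, q) \<in> W" if "q < ?N" for c q using that by (simp add: W_def)
  have aff: "affine_in 2 W (l u)" if "u \<in> U" for u using that
  proof (rule UE)
    fix q assume "q < ?N"
    then have "affine_in (1 + 1) W (\<lambda>w. w (False, 2, q) + w (True, 2, q))" by (intro affine_add affine_var W2) auto
    then show "affine_in 2 W (l (False, 3, q))" by (simp add: l_def numeral_2_eq_2)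
  next
    fix c j assume j: "j < n"
    have "affine_in (1 + 1) W (\<lambda>w. (w (c, 1, n + \<pi> j) + s ! (n + \<pi> j)) + w (c, 2, j))"
      using j pl(1)[OF j] by (intro affine_add affine_var affine_var_const W1 W2) auto
    then show "affine_in 2 W (l (c, 1, j))" by (simp add: l_def numeral_2_eq_2)
  qed
  have dep: "depends_on W g" unfolding depends_on_def
  proof (intro allI impI)
    fix v w :: "bool \<times> nat \<times> nat \<Rightarrow> bit" assume eq: "\<forall>a\<in>W. v a = w a"
    have "side c v = side c w" for c
    proof -
      have "shift_rest n \<pi> s f0 (\<lambda>q. v (c, 1, q)) (\<lambda>q. v (c, 2, q)) = shift_rest n \<pi> s f0 (\<lambda>q. w (c, 1, q)) (\<lambda>q. w (c, 2, q))"
        using eq W1 W2 by (intro shift_rest_cong[OF \<pi>]) blast+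
      moreover have "v (c, 2, i) = w (c, 2, i)" using eq W2[OF i] by blast
      ultimately show ?thesis by (simp add: side_def)
    qed
    then show "g v = g w" by (simp add: g_def)
  qed
  have F: "F w = (\<Sum>u\<in>U. w u * l u w) + g w" for w
  proof -
    have "(\<Sum>u\<in>U. w u * l u w) = (\<Sum>u\<in>UH. w u * l u w) + (\<Sum>u\<in>UX. w u * l u w)"
      unfolding U_def using finU disj by (intro sum.union_disjoint) auto
    also have "(\<Sum>u\<in>UH. w u * l u w) = (\<Sum>q\<in>{..<?N} - {i}. w (False, 3, q) * (w (False, 2, q) + w (True, 2, q)))"
      unfolding UH_def by (subst sum.reindex[OF injH]) (simp add: l_def)
    also have "\<dots> = (\<Sum>q\<in>{..<?N} - {i}. w (False, 3, q) * w (False, 2, q)) + (\<Sum>q\<in>{..<?N} - {i}. w (False, 3, q) * w (True, 2, q))"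
      by (simp only: distrib_left sum.distrib)
    also have "(\<Sum>u\<in>UX. w u * l u w) = (\<Sum>(c, j)\<in>UNIV \<times> {..<n}. w (c, 1, j) * (w (c, 1, n + \<pi> j) + s ! (n + \<pi> j) + w (c, 2, j)))"
      unfolding UX_def by (subst sum.reindex[OF injX]) (auto simp: l_def intro!: sum.cong)
    also have "\<dots> = (\<Sum>j<n. w (True, 1, j) * (w (True, 1, n + \<pi> j) + s ! (n + \<pi> j) + w (True, 2, j))) +
        (\<Sum>j<n. w (False, 1, j) * (w (False, 1, n + \<pi> j) + s ! (n + \<pi> j) + w (False, 2, j)))"
      unfolding sum.cartesian_product[symmetric] by (simp add: UNIV_bool add.commute)
    finally have U: "(\<Sum>u\<in>U. w u * l u w) = (\<Sum>q\<in>{..<?N} - {i}. w (False, 3, q) * w (False, 2, q)) + (\<Sum>q\<in>{..<?N} - {i}. w (False, 3, q) * w (True, 2, q)) +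
       ((\<Sum>j<n. w (True, 1, j) * (w (True, 1, n + \<pi> j) + s ! (n + \<pi> j) + w (True, 2, j))) +
        (\<Sum>j<n. w (False, 1, j) * (w (False, 1, n + \<pi> j) + s ! (n + \<pi> j) + w (False, 2, j))))" .
    have S: "shift_phase ?N (G_phase n \<pi> f0 s) (F_phase n \<pi> f0) (\<lambda>(t, q). if t = 3 then if q = i then 1 else w (False, 3, q) else w (c, t, q)) =
      (\<Sum>j<n. w (c, 1, j) * (w (c, 1, n + \<pi> j) + s ! (n + \<pi> j) + w (c, 2, j))) + (\<Sum>q\<in>{..<?N} - {i}. w (False, 3, q) * w (c, 2, q)) + side c w" for c
      by (subst shift_phase_split[OF \<pi> s i]) (auto simp: side_def intro!: sum.cong)
    show ?thesis unfolding F_def S U g_def by (simp add: ac_simps)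
  qed
  have par: "parametrizes W (\<lambda>v. \<forall>u\<in>U. l u v = 0) {..?N} e"
    unfolding parametrizes_def
  proof (intro conjI allI ballI impI)
    fix a assume "a \<in> W"
    then obtain c t q where a: "a = (c, t, q)" "t = 2 \<and> q < ?N \<or> t = 1 \<and> n \<le> q \<and> q < ?N" by (auto simp: W_def)
    have m: "affine_in 1 {..?N} (\<lambda>w. mid c w q + d)" if "q < ?N" for q d
      using that by (cases "c \<and> q = i") (auto simp: mid_def intro!: affine_var_const)
    show "affine_in 1 {..?N} (\<lambda>w. e w a)"
    proof (cases "t = 2")
      case True then show ?thesis using m[of q 0] a by (auto simp: e_def)
    next
      case False
      then have "q - n < n" using a by auto
      then have "inv \<pi> (q - n) < ?N" using pl(2)[of "q - n"] by simp
      then show ?thesis using m[of "inv \<pi> (q - n)" "s ! q"] False by (simp add: e_def a(1))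
    qed
  next
    fix w u assume "u \<in> U"
    then show "l u (e w) = 0"
    proof (rule UE)
      fix q assume "q \<noteq> i" then show "l (False, 3, q) (e w) = 0" by (simp add: l_def e_def mid_def)
    next
      fix c j assume "j < n" then show "l (c, 1, j) (e w) = 0" using pl(3)[of j] by (simp add: l_def e_def add.assoc)
    qed
  next
    fix v assume v: "\<forall>u\<in>U. l u v = 0"
    let ?w = "\<lambda>q. if q = ?N then v (True, 2, i) else v (False, 2, q)"
    have H: "v (False, 2, q) = v (True, 2, q)" if "q < ?N" "q \<noteq> i" for q
    proof -
      have "(False, 3, q) \<in> U" using that by (auto simp: U_def UH_def)
      from bspec[OF v this] show ?thesis by (simp add: l_def bit_add_eq_0_iff)
    qed
    have X: "v (c, 1, n + j) = v (c, 2, inv \<pi> j) + s ! (n + j)" if "j < n" for c j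
    proof -
      have "(c, 1, inv \<pi> j) \<in> U" using pl(2)[OF that] by (force simp: U_def UX_def)
      from bspec[OF v this] have "v (c, 1, n + j) + s ! (n + j) + v (c, 2, inv \<pi> j) = 0" using pl(4)[OF that] by (simp add: l_def)
      then show ?thesis by (cases "v (c, 1, n + j)"; cases "s ! (n + j)"; cases "v (c, 2, inv \<pi> j)") simp_all
    qed
    have M: "mid c ?w q = v (c, 2, q)" if "q < ?N" for c q
      using that H i by (cases c) (auto simp: mid_def)
    show "\<exists>w. \<forall>a\<in>W. v a = e w a"
    proof (intro exI[of _ ?w] ballI)
      fix a assume "a \<in> W"
      then obtain c t q where a: "a = (c, t, q)" "t = 2 \<and> q < ?N \<or> t = 1 \<and> n \<le> q \<and> q < ?N" by (auto simp: W_def)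
      show "v a = e ?w a"
      proof (cases "t = 2")
        case True then show ?thesis using a M by (simp add: e_def)
      next
        case False
        then have q: "t = 1" "q - n < n" "n + (q - n) = q" using a by auto
        then have "inv \<pi> (q - n) < ?N" using pl(2)[of "q - n"] by simp
        then show ?thesis using X[OF q(2), of c] M q by (simp add: e_def a(1))
      qed
    qed
  next
    fix w w' :: "nat \<Rightarrow> bit" and k assume eq: "\<forall>a\<in>W. e w a = e w' a" and k: "k \<in> {..?N}"
    show "w k = w' k"
    proof (cases "k = ?N")
      case True then show ?thesis using bspec[OF eq W2[OF i, of True]] by (simp add: e_def mid_def)
    next
      case False
      then have "k < ?N" using k by simp
      from bspec[OF eq W2[OF this, of False]] show ?thesis by (simp add: e_def mid_def)
    qed
  qed
  have ge: "g (e w) = (s ! i + 1) * (w i + w ?N)" for w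
  proof -
    have side: "side c (e w) = (\<Sum>q<?N. s ! q * mid c w q) + mid c w i" for c
    proof -
      have "shift_rest n \<pi> s f0 (\<lambda>q. e w (c, 1, q)) (\<lambda>q. e w (c, 2, q)) = (\<Sum>q<?N. s ! q * e w (c, 2, q))"
        by (rule shift_phase_solved[OF \<pi>]) (simp add: e_def)
      then show ?thesis by (simp add: side_def e_def)
    qed
    have m: "(\<Sum>q<?N. s ! q * mid c w q) = s ! i * mid c w i + (\<Sum>q\<in>{..<?N} - {i}. s ! q * w q)" for c
      using i by (subst sum.remove[of _ i]) (auto simp: mid_def intro!: sum.cong)
    show ?thesis unfolding g_def side m by (simp add: mid_def distrib_left distrib_right ac_simps)
  qed
  note E = elimination[OF finU(3,4) disj(2) aff dep F par, folded KUW]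
  have "good {..?N} (\<lambda>w. g (e w)) \<and> path_value {..?N} (\<lambda>w. g (e w)) = (if s ! i = 1 then 2 ^ (2 * n + 1) else 0)"
  proof (cases "s ! i = 1")
    case True
    then show ?thesis using good_const[of "{..?N}" 0] unfolding ge by (simp add: sgn2_def)
  next
    case False
    then have z: "g (e w) = w i + w ?N" for w by (simp add: ge)
    \<comment> \<open>One of the two bits on the measured wire enters the phase linearly, so the
      rule (Z) applies.\<close>
    have d: "deriv ?N (\<lambda>w. w i + w ?N) v = 1" for v using i by (simp add: deriv_def add.assoc add.left_commute[of 1])
    show ?thesis using good_zero[of ?N "{..?N}", OF _ d] path_value_zero[of "{..?N}" ?N, OF _ _ d] False unfolding z by simp
  qed
  then show "good K F" "path_value K F = (if s ! i = 1 then 2 ^ (6 * n) else 0)"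
    using E i unfolding card by (auto simp: power_add[symmetric] simp del: power_Suc)
qed

text \<open>The \<open>6 * n\<close> Hadamard gates occur both in the bra and in the ket, so the
  scalar is \<open>1 / 2 ^ (6 * n)\<close>, which cancels the value of the reduced sum for a bit 1
  of the shift.\<close>

lemma hidden_shift_measurement:
  assumes "hidden_shift_circuit m n \<pi> f0 s C" and i: "i < 2 * n"
  defines "f \<equiv> measurement_psum (2 * n) C (replicate (2 * n) 0) i"
  shows "outs f = []" "ins f = []" "good (vars f) (peval (phase f))"
    "scal f * path_value (vars f) (peval (phase f)) = (if s ! i = 1 then 1 else 0)"
proof -
  let ?N = "2 * n"
  obtain L1 CG L2 CF L3 where h: "\<pi> permutes {..<n}" "length s = 2 * n" "C = L1 @ CG @ L2 @ CF @ L3"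
    "H_layer ?N L1" "H_layer ?N L2" "H_layer ?N L3"
    "implements_phase m ?N (G_phase n \<pi> f0 s) CG" "implements_phase m ?N (F_phase n \<pi> f0) CF"
    using assms(1) unfolding hidden_shift_circuit_def by blast
  let ?r = "1 / sqrt 2 ^ (3 * ?N) :: complex"
  note P = presents_measurement[OF presents_output[OF presents_layers(2)[OF h(4-8) h(3)]] i, folded f_def]
  note M = closed_measurement[OF h(1,2) i, of f0]
  show "outs f = []" "ins f = []" using presents_length[OF P] by simp_all
  show "good (vars f) (peval (phase f))" using presents_good(1)[OF P M(1)] .
  have "complex_of_real (sqrt 2) * complex_of_real (sqrt 2) = 2" by (simp flip: of_real_mult)
  then have "cnj ?r * ?r = 1 / 2 ^ (3 * ?N)" by (simp add: power_mult_distrib[symmetric])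
  then show "scal f * path_value (vars f) (peval (phase f)) = (if s ! i = 1 then 1 else 0)"
    unfolding presents_good(2)[OF P] M(2) by (simp add: mult.commute)
qed

section \<open>The rewrite system\<close>

lemma prod_ind: "finite w \<Longrightarrow> (\<Prod>x\<in>w. ind u x) = of_bool (w \<subseteq> u)"
  by (induction w rule: finite_induct) (auto simp: ind_def)

text \<open>At the indicator of a monomial of least size every other monomial vanishes, so the value
  there would be 1.\<close>

lemma peval_eq_0D:
  assumes "finite p" "\<And>u. u \<in> p \<Longrightarrow> finite u" "\<And>v. peval p v = 0"
  shows "p = {}"
proof (rule ccontr)
  assume "p \<noteq> {}"
  then obtain u where u: "u \<in> p" "\<And>w. w \<in> p \<Longrightarrow> card u \<le> card w"
    using ex_has_least_nat[of "\<lambda>w. w \<in> p" _ card] by blast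
  have "peval p (ind u) = (\<Sum>w\<in>p. of_bool (w = u))" unfolding peval_def
  proof (rule sum.cong[OF refl])
    fix w assume w: "w \<in> p"
    then have "w \<subseteq> u \<longleftrightarrow> w = u" using card_seteq[OF assms(2)[OF u(1)], of w] u(2)[OF w] by auto
    then show "(\<Prod>x\<in>w. ind u x) = of_bool (w = u)" using prod_ind[OF assms(2)[OF w]] by simp
  qed
  also have "\<dots> = 1" using assms(1) u(1) by (simp add: of_bool_def)
  finally show False using assms(3)[of "ind u"] by simp
qed

lemma peval_inject:
  assumes "finite p" "\<And>u. u \<in> p \<Longrightarrow> finite u" "finite q" "\<And>u. u \<in> q \<Longrightarrow> finite u" "\<And>v. peval p v = peval q v"
  shows "p = q"
proof -
  have "padd p q = {}"
  proof (rule peval_eq_0D)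
    show "peval (padd p q) v = 0" for v using assms by (simp add: peval_padd)
  qed (use assms in \<open>auto simp: padd_def\<close>)
  then show ?thesis by (auto simp: padd_def)
qed

lemma peval_decompose:
  assumes "finite P" "\<And>u. u \<in> P \<Longrightarrow> finite u"
  shows "peval (cofactor x P) v = deriv x (peval P) v" "peval (remainder x P) v = peval P (v(x := 0))"
proof -
  have P: "peval P v = v x * peval (cofactor x P) v + peval (remainder x P) v" for v
  proof -
    have px: "finite (pvar x)" "\<And>u. u \<in> pvar x \<Longrightarrow> finite u" by (simp_all add: pvar_def)
    have fc: "finite (cofactor x P)" "\<And>u. u \<in> cofactor x P \<Longrightarrow> finite u" and fr: "finite (remainder x P)"
      using assms by (auto simp: cofactor_def remainder_def)
    have "peval (pmul (pvar x) (cofactor x P)) v = peval (pvar x) v * peval (cofactor x P) v"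
      using px(1) fc(1) by (rule peval_pmul) (use px(2) fc(2) in blast)
    then have "peval (padd (pmul (pvar x) (cofactor x P)) (remainder x P)) v = v x * peval (cofactor x P) v + peval (remainder x P) v"
      using px(1) fc(1) fr by (simp add: peval_padd)
    then show ?thesis unfolding decompose[of P x, symmetric] .
  qed
  have c: "peval (cofactor x P) (v(x := b)) = peval (cofactor x P) v" for b
    by (rule depends_onD[OF peval_depends[of _ "- {x}"]]) (auto simp: cofactor_def)
  have r: "peval (remainder x P) (v(x := b)) = peval (remainder x P) v" for b
    by (rule depends_onD[OF peval_depends[of _ "- {x}"]]) (auto simp: remainder_def)
  show "peval (cofactor x P) v = deriv x (peval P) v" unfolding deriv_def P c r by (simp add: ac_simps)
  show "peval (remainder x P) v = peval P (v(x := 0))" unfolding P c r by simp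
qed

text \<open>The only monomials available are 1 and the single variable \<open>z\<close>. This
  translates the side condition of (HH) into the language of functions.\<close>

lemma affine_small_poly:
  assumes "Q \<subseteq> Pow Z" "card Z \<le> 1" "finite Z" "Z \<subseteq> V"
  shows "affine_in 1 V (peval Q)"
proof -
  have fin: "finite Q" using assms(1,3) by (meson finite_Pow_iff finite_subset)
  consider "Z = {}" | z where "Z = {z}" using assms(2,3)
    by (metis One_nat_def card_0_eq card_1_singletonE le_SucE le_zero_eq)
  then show ?thesis
  proof cases
    case 1
    have "affine_in 1 V (\<lambda>_. peval Q (\<lambda>_. 0))" by (rule affine_const)
    moreover have "peval Q = (\<lambda>_. peval Q (\<lambda>_. 0))"
      by (rule ext, rule depends_onD[OF peval_depends[OF assms(1)]]) (simp add: 1)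
    ultimately show ?thesis by simp
  next
    case (2 z)
    have Q: "Q = (if {z} \<in> Q then {{z}} else {}) \<union> (if {} \<in> Q then {{}} else {})"
      using assms(1) unfolding 2 by (auto simp: subset_singleton_iff Pow_insert)
    have "affine_in 1 V (\<lambda>v. of_bool ({z} \<in> Q) * v z + of_bool ({} \<in> Q))"
      using 2 assms(4) by (cases "{z} \<in> Q") (auto intro!: affine_const affine_var_const affine_var)
    moreover have "peval Q v = of_bool ({z} \<in> Q) * v z + of_bool ({} \<in> Q)" for v
      by (subst Q) (auto simp: peval_def)
    then have "peval Q = (\<lambda>v. of_bool ({z} \<in> Q) * v z + of_bool ({} \<in> Q))" by blast
    ultimately show ?thesis by simp
  qed
qed

section \<open>Invariant and result of the rewriting loop\<close>

definition closed_form :: "path_sum \<Rightarrow> bool" where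
  "closed_form f \<longleftrightarrow> well_formed f \<and> outs f = [] \<and> ins f = [] \<and> good (vars f) (peval (phase f))"

definition amplitude :: "path_sum \<Rightarrow> complex" where
  "amplitude f = scal f * path_value (vars f) (peval (phase f))"

text \<open>\<open>good_step\<close> keeps the phase good under any choice, and the scalars of the
  rules match the change of \<open>path_value\<close>: (Elim) doubles the scalar and halves the sum,
  while in (Z) the sum is 0.\<close>

lemma closed_form_rw:
  assumes f: "closed_form f" and st: "f \<leadsto> f'"
  shows "closed_form f'" "amplitude f' = amplitude f" "vars f' \<subset> vars f"
proof -
  obtain V s P where fe: "f = PSum V s P [] []" using f by (cases f) (simp add: closed_form_def)
  have wf: "well_formed (PSum V s P [] [])" and g: "good V (peval P)" using f by (simp_all add: closed_form_def fe)
  have V: "finite V" and PV: "P \<subseteq> Pow V" using well_formedD(1,2)[OF wf] by simp_all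
  have fP: "finite P" "\<And>u. u \<in> P \<Longrightarrow> finite u" using poly_finite[OF wf, of P] by auto
  have dP: "depends_on V (peval P)" by (rule peval_depends[OF PV])
  note G = good_step[OF V g dP]
  have wf': "well_formed f'" using well_formed_rw[OF st] f by (simp add: closed_form_def)
  from st[unfolded fe rw_iff[OF wf]] obtain x where x: "x \<in> V" and c:
    "cofactor x P = {} \<and> f' = PSum (V - {x}) (2 * s) P [] [] \<or> cofactor x P = {{}} \<and> f' = PSum {} 0 {} [] [] \<or>
     (\<exists>y Q. {y} \<in> cofactor x P \<and> Q = padd {{y}} (cofactor x P) \<and> y \<notin> Vars [Q] \<and> card (Vars [Q]) \<le> 1 \<and>
        f' = PSum (V - {x}) s (psubst y Q (remainder x P)) [] [])" by auto
  have D: "peval (cofactor z P) v = deriv z (peval P) v" "peval (remainder z P) v = peval P (v(z := 0))" for z v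
    using peval_decompose[of P z v] fP by auto
  have "closed_form f' \<and> amplitude f' = amplitude f \<and> vars f' \<subset> vars f"
    using c
  proof (elim disjE conjE exE)
    assume c: "cofactor x P = {}" and f': "f' = PSum (V - {x}) (2 * s) P [] []"
    have i: "indep x (peval P)" unfolding deriv_0_iff[symmetric] D(1)[of x, symmetric] c by simp
    then have "good (V - {x}) (peval P)" using G x by blast
    then show ?thesis using wf' x path_value_elim[OF V x i] by (auto simp: closed_form_def amplitude_def f' fe)
  next
    assume c: "cofactor x P = {{}}" and f': "f' = PSum {} 0 {} [] []"
    have "deriv x (peval P) v = 1" for v unfolding D(1)[of x, symmetric] c by simp
    then show ?thesis using wf' x path_value_zero[OF V x] by (auto simp: closed_form_def amplitude_def f' fe good_empty)
  next
    fix y Q assume y: "{y} \<in> cofactor x P" and Q: "Q = padd {{y}} (cofactor x P)" "y \<notin> Vars [Q]" "card (Vars [Q]) \<le> 1"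
      and f': "f' = PSum (V - {x}) s (psubst y Q (remainder x P)) [] []"
    have cV: "cofactor x P \<subseteq> Pow (V - {x})" using PV by (auto simp: cofactor_def)
    have yV: "y \<in> V" "x \<noteq> y" using y cV by auto
    have QV: "\<Union> Q \<subseteq> V - {x, y}" using cV Q(2) yV unfolding Q(1) by (auto simp: padd_def Vars_def)
    have VQ: "Vars [Q] = \<Union> Q" by (simp add: Vars_def)
    have fQ: "finite (\<Union> Q)" using QV V by (meson finite_Diff finite_subset)
    have aff: "affine_in 1 (V - {x, y}) (peval Q)"
      using Q(3) fQ QV unfolding VQ by (intro affine_small_poly[of Q "\<Union> Q"]) auto
    have fQ': "finite Q" "\<And>u. u \<in> Q \<Longrightarrow> finite u" using fQ finite_UnionD by (blast, meson Union_upper finite_subset)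
    have cQ: "cofactor x P = padd {{y}} Q" unfolding Q(1) by (simp only: padd_cancel)
    have "deriv x (peval P) v = v y + peval Q v" for v
      unfolding D(1)[of x, symmetric] cQ using fQ' by (simp add: peval_padd)
    then have h: "hh_form V (peval P) x y (peval Q)" unfolding hh_form_def using x yV aff by blast
    have p: "peval (psubst y Q (remainder x P)) = hh (peval P) x y (peval Q)"
    proof
      fix v
      have r: "finite (remainder x P)" "\<And>u. u \<in> remainder x P \<Longrightarrow> finite u" using fP by (auto simp: remainder_def)
      have "peval (psubst y Q (remainder x P)) v = peval (remainder x P) (v(y := peval Q v))"
        using r(1) fQ'(1) by (rule peval_psubst) (use r(2) fQ'(2) in blast)
      also have "\<dots> = hh (peval P) x y (peval Q) v"
        unfolding D(2) hh_def fun_upd_twist[OF yV(2)] ..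
      finally show "peval (psubst y Q (remainder x P)) v = hh (peval P) x y (peval Q) v" .
    qed
    \<comment> \<open>The rule removes only \<open>x\<close>; \<open>y\<close> remains as a variable
      that no longer occurs. Its elimination accounts for the factor 2 in
      \<open>path_value_hh\<close>, which is why (HH) leaves the scalar alone.\<close>
    have i: "indep y (hh (peval P) x y (peval Q))" by (rule indep_hh_self(2)[OF h])
    have V2: "V - {x} - {y} = V - {x, y}" and yx: "y \<in> V - {x}" using yV by auto
    have "good (V - {x, y}) (hh (peval P) x y (peval Q))" using G h by blast
    then have "good (V - {x}) (hh (peval P) x y (peval Q))" unfolding V2[symmetric] by (rule good_elim[OF yx i])
    moreover have "path_value (V - {x}) (hh (peval P) x y (peval Q)) = path_value V (peval P)"
      using path_value_elim[OF _ yx i] V path_value_hh[OF V h] by (simp add: V2)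
    ultimately show ?thesis using wf' x by (auto simp: closed_form_def amplitude_def f' fe p)
  qed
  then show "closed_form f'" "amplitude f' = amplitude f" "vars f' \<subset> vars f" by auto
qed

text \<open>The outermost rule in the derivation of \<open>good\<close> is itself an applicable
  rewrite, so a normal form can only come from the rule for no variables.\<close>

lemma closed_form_normal:
  assumes f: "closed_form f" and nf: "\<nexists>f'. f \<leadsto> f'"
  shows "vars f = {}"
proof -
  obtain V s P where fe: "f = PSum V s P [] []" using f by (cases f) (simp add: closed_form_def)
  have wf: "well_formed (PSum V s P [] [])" and g: "good V (peval P)" using f by (simp_all add: closed_form_def fe)
  have fP: "finite P" "\<And>u. u \<in> P \<Longrightarrow> finite u" using poly_finite[OF wf, of P] by auto
  have D: "peval (cofactor z P) v = deriv z (peval P) v" for z v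
    using peval_decompose(1)[of P z v] fP by auto
  have inj: "cofactor x P = q" if "finite q" "\<And>u. u \<in> q \<Longrightarrow> finite u" "\<And>v. deriv x (peval P) v = peval q v" for x q
  proof (rule peval_inject)
    show "finite (cofactor x P)" using fP(1) by (simp add: cofactor_def)
    show "finite u" if "u \<in> cofactor x P" for u using that fP(2) by (auto simp: cofactor_def)
    show "peval (cofactor x P) v = peval q v" for v using that(3) by (simp only: D)
  qed (use that(1,2) in simp_all)
  note R = nf[unfolded fe rw_iff[OF wf]]
  from g have "V = {}"
  proof (cases rule: good.cases)
    case (good_elim x)
    have "deriv x (peval P) v = 0" for v using good_elim(2) unfolding deriv_0_iff[symmetric] by blast
    then have "cofactor x P = {}" by (intro inj) simp_all
    with R good_elim(1) show ?thesis by (auto simp: Vars_def)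
  next
    case (good_zero x)
    have "cofactor x P = {{}}" by (rule inj) (simp_all add: good_zero(2))
    with R good_zero(1) show ?thesis by (auto simp: Vars_def)
  next
    case (good_hh x y Q)
    \<comment> \<open>The derivation speaks of functions, the rewrite rule of polynomials:
      \<open>Q\<close> has to be written as a polynomial in at most one variable.\<close>
    have "\<exists>q. finite q \<and> (\<forall>u\<in>q. finite u) \<and> peval q = Q \<and> y \<notin> Vars [q] \<and> card (Vars [q]) \<le> 1"
      using good_hh(4)
    proof (cases rule: affine_1_cases)
      case (1 c)
      then have "peval (pconst c) = Q" by (simp add: fun_eq_iff)
      moreover have "Vars [pconst c] = {}" by (simp add: Vars_def pconst_def)
      moreover have "finite (pconst c)" "\<forall>u\<in>pconst c. finite u" by (simp_all add: pconst_def)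
      ultimately show ?thesis by (intro exI[of _ "pconst c"]) simp
    next
      case (2 z c)
      let ?q = "padd (pvar z) (pconst c)"
      have q: "finite (pvar z)" "finite (pconst c)" "\<forall>u\<in>?q. finite u" by (auto simp: pvar_def pconst_def padd_def)
      then have "peval ?q = Q" using 2 by (simp add: fun_eq_iff peval_padd)
      moreover have "Vars [?q] = {z}" by (auto simp: Vars_def pvar_def pconst_def padd_def)
      ultimately show ?thesis using q 2(1) by (intro exI[of _ ?q]) simp
    qed
    then obtain q where q: "finite q" "\<And>u. u \<in> q \<Longrightarrow> finite u" "peval q = Q" "y \<notin> Vars [q]" "card (Vars [q]) \<le> 1" by blast
    have c: "cofactor x P = padd {{y}} q"
    proof (rule inj)
      show "deriv x (peval P) v = peval (padd {{y}} q) v" for v using q(1,3) good_hh(5) by (simp add: peval_padd)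
    qed (use q(1,2) in \<open>auto simp: padd_def\<close>)
    have "{y} \<in> cofactor x P" unfolding c using q(4) by (auto simp: padd_def Vars_def)
    moreover have "q = padd {{y}} (cofactor x P)" unfolding c by (simp only: padd_cancel)
    ultimately show ?thesis using R good_hh(1) q(4,5) by (auto simp: Vars_def)
  qed
  then show ?thesis by (simp add: fe)
qed

lemma eval_closed:
  assumes "closed_form f" shows "eval f [] [] = amplitude f"
proof -
  have wf: "well_formed f" and oi: "outs f = []" "ins f = []" using assms by (simp_all add: closed_form_def)
  have "depends_on (vars f) (\<lambda>v. sgn2 (peval (phase f) v))"
    using peval_depends[OF well_formedD(2)[OF wf]] unfolding depends_on_def by metis
  then show ?thesis
    using sum_PiE_Pow[OF well_formedD(1)[OF wf]] by (simp add: eval_def amplitude_def path_value_def oi)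
qed

lemma ex_represents_poly:
  assumes "finite P" "\<And>u. u \<in> P \<Longrightarrow> finite u"
  shows "\<exists>p. represents_poly p P"
  using assms
proof (induction P rule: finite_induct)
  case empty show ?case by (rule exI[of _ "[]"]) simp
next
  case (insert u P)
  then obtain p xs where "represents_poly p P" "set xs = u" "distinct xs" using finite_distinct_list by (metis insertCI)
  then show ?case using rpoly_ConsI[of xs P p] insert by (intro exI[of _ "xs # p"]) simp
qed

text \<open>Runs charge time on list representations, so their existence presupposes one for every
  path sum met on the way.\<close>

lemma ex_represents:
  assumes "closed_form f" shows "\<exists>A. represents A f"
proof -
  have wf: "well_formed f" and oi: "outs f = []" "ins f = []" using assms by (simp_all add: closed_form_def)
  obtain xs where "set xs = vars f" "distinct xs" using finite_distinct_list[OF well_formedD(1)[OF wf]] by blast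
  moreover obtain p where "represents_poly p (phase f)"
    using ex_represents_poly[of "phase f"] poly_finite[OF wf, of "phase f"] by auto
  ultimately have "represents (PSum xs (scal f) p [] []) f" by (simp add: represents_iff represents_set_def oi)
  then show ?thesis by blast
qed

lemma closed_form_terminates: "closed_form (F 0) \<Longrightarrow> \<not> (\<forall>k. F k \<leadsto> F (Suc k))"
proof
  assume f: "closed_form (F 0)" and st: "\<forall>k. F k \<leadsto> F (Suc k)"
  have cf: "closed_form (F k)" for k by (induction k) (use f st closed_form_rw(1) in auto)
  have less: "card (vars (F (Suc k))) < card (vars (F k))" for k
    using cf[of k] psubset_card_mono[OF _ closed_form_rw(3)[OF cf st[rule_format]], of k]
    by (simp add: closed_form_def well_formed_def)
  have "card (vars (F k)) + k \<le> card (vars (F 0))" for k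
  proof (induction k)
    case (Suc k) then show ?case using less[of k] by simp
  qed simp
  from this[of "Suc (card (vars (F 0)))"] show False by simp
qed

lemma ex_loop_run: "closed_form f \<Longrightarrow> \<exists>r t. loop_run f r t"
proof (induction "card (vars f)" arbitrary: f rule: less_induct)
  case less
  obtain A where A: "represents A f" using ex_represents[OF less.prems] by blast
  show ?case
  proof (cases "\<exists>f'. f \<leadsto> f'")
    case True
    then obtain f' where f': "f \<leadsto> f'" by blast
    note c = closed_form_rw[OF less.prems f']
    have "finite (vars f)" using less.prems by (simp add: closed_form_def well_formed_def)
    then have "card (vars f') < card (vars f)" using c(3) by (rule psubset_card_mono)
    then show ?thesis using less.hyps c(1) loop_run.rewrite[OF A f'] by blast
  next
    case False
    then show ?thesis using loop_run.finish[OF A] by blast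
  qed
qed

lemma loop_run_result: "loop_run f r t \<Longrightarrow> closed_form f \<Longrightarrow> r = amplitude f"
proof (induction rule: loop_run.induct)
  case (finish A f) then show ?case using eval_closed by simp
next
  case (rewrite A f f' r t) then show ?case using closed_form_rw by simp
qed

section \<open>Running time\<close>

lemma time_mem: "time (t_mem x ys) \<le> length ys + 1"
  by (induction ys) auto

lemma time_remove: "time (t_remove x ys) = length ys + 1" "length (result (t_remove x ys)) \<le> length ys"
  by (induction ys) auto

lemma time_append: "time (t_append xs ys) = length xs + 1"
  by (induction xs) auto

lemma time_length: "time (t_length xs) = length xs + 1"
  by (induction xs) auto

lemma time_upto: "time (t_upto k n) = n + 1"
  by (induction n arbitrary: k) auto

lemma time_fresh: "time (t_fresh xs) = length xs + 1"
  by (induction xs) auto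

lemma time_halve: "time (t_halve s xs) = length xs + 1"
  by (induction xs arbitrary: s) auto

lemma time_lookup: "time (t_lookup ks vs j) \<le> length ks + 1"
  by (induction ks vs j rule: t_lookup.induct) auto

lemma time_all_eq: "time (t_all_eq x ys) \<le> length ys + 1"
  by (induction ys) auto

lemma time_subset: "time (t_subset xs ys) \<le> length xs * (length ys + 2) + 1"
proof (induction xs)
  case (Cons x xs)
  then show ?case using time_mem[of x ys] by (auto simp: algebra_simps)
qed simp

lemma time_diff: "time (t_diff xs ys) \<le> length xs * (length ys + 2) + 1"
proof (induction xs)
  case (Cons x xs)
  then show ?case using time_mem[of x ys] by (auto simp: algebra_simps)
qed simp

lemma time_map: "(\<And>x. x \<in> set xs \<Longrightarrow> time (f x) \<le> c) \<Longrightarrow> time (t_map f xs) \<le> length xs * (c + 1) + 1"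
proof (induction xs)
  case (Cons x xs)
  have "time (f x) \<le> c" "time (t_map f xs) \<le> length xs * (c + 1) + 1" using Cons by simp_all
  then show ?case by (simp add: algebra_simps)
qed simp

lemma result_t_map: "result (t_map f xs) = map (\<lambda>x. result (f x)) xs"
  by (induction xs) auto

lemma time_map2: "(\<And>x y. x \<in> set xs \<Longrightarrow> y \<in> set ys \<Longrightarrow> time (f x y) \<le> c) \<Longrightarrow> time (t_map2 f xs ys) \<le> length xs * (c + 1) + 1"
proof (induction f xs ys rule: t_map2.induct)
  case (1 f x xs y ys)
  have "time (f x y) \<le> c" "time (t_map2 f xs ys) \<le> length xs * (c + 1) + 1" using 1 by simp_all
  then show ?case by (simp add: algebra_simps)
qed auto

lemma result_t_map2:
  "z \<in> set (result (t_map2 f xs ys)) \<Longrightarrow> \<exists>x\<in>set xs. \<exists>y\<in>set ys. z = result (f x y)" "length (result (t_map2 f xs ys)) \<le> length xs"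
  by (induction f xs ys rule: t_map2.induct) auto

lemma time_concat: "(\<And>xs. xs \<in> set xss \<Longrightarrow> length xs \<le> b) \<Longrightarrow> time (t_concat xss) \<le> length xss * (b + 2) + 1"
proof (induction xss)
  case (Cons xs xss)
  have "length xs \<le> b" "time (t_concat xss) \<le> length xss * (b + 2) + 1" using Cons by simp_all
  then show ?case using time_append[of xs] by (simp add: algebra_simps)
qed simp

lemma length_concat_le: "(\<And>xs. xs \<in> set xss \<Longrightarrow> length xs \<le> b) \<Longrightarrow> length (concat xss) \<le> length xss * b"
proof (induction xss)
  case (Cons xs xss)
  have "length xs \<le> b" "length (concat xss) \<le> length xss * b" using Cons by simp_all
  then show ?case by simp
qed simp

section \<open>Cost of polynomial arithmetic\<close>

definition psz :: "nat \<Rightarrow> nat \<Rightarrow> lpoly \<Rightarrow> bool" where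
  "psz L b p \<longleftrightarrow> length p \<le> L \<and> (\<forall>u\<in>set p. length u \<le> b)"

lemma psz_simps [simp]: "psz L b []" "psz L b (u # p) \<longleftrightarrow> length u \<le> b \<and> Suc (length p) \<le> L \<and> (\<forall>u\<in>set p. length u \<le> b)"
  by (auto simp: psz_def)

lemma psz_mono: "psz L b p \<Longrightarrow> L \<le> L' \<Longrightarrow> b \<le> b' \<Longrightarrow> psz L' b' p"
  by (fastforce simp: psz_def)

text \<open>The cost bounds follow the recursion of the programs and use sums and products only,
  hence are monotone and polynomial in their arguments.\<close>

definition c_eq :: "nat \<Rightarrow> nat" where "c_eq b = 2 * (b * (b + 2)) + 3"
definition c_toggle :: "nat \<Rightarrow> nat \<Rightarrow> nat" where "c_toggle L b = (L + 1) * (c_eq b + 1)"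
definition c_padd :: "nat \<Rightarrow> nat \<Rightarrow> nat \<Rightarrow> nat" where "c_padd L1 L2 b = L1 * (1 + c_toggle (L1 + L2) b) + 1"
definition c_psum_list :: "nat \<Rightarrow> nat \<Rightarrow> nat \<Rightarrow> nat" where "c_psum_list k L b = k * (1 + c_padd L (k * L) b) + 1"
definition c_mono_mul :: "nat \<Rightarrow> nat \<Rightarrow> nat \<Rightarrow> nat" where "c_mono_mul a L b = L * (a * (b + 2) + 2 + c_toggle L (a + b)) + 1"
definition c_pmul :: "nat \<Rightarrow> nat \<Rightarrow> nat \<Rightarrow> nat \<Rightarrow> nat" where
  "c_pmul L1 a L2 b = L1 * (1 + c_mono_mul a L2 b + c_padd L2 (L1 * L2) (a + b)) + 1"
definition c_psubst :: "nat \<Rightarrow> nat \<Rightarrow> nat \<Rightarrow> nat \<Rightarrow> nat" where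
  "c_psubst K a L b = L * (2 * b + 3 + c_mono_mul b K a + c_padd K (L * (K + 1)) (a + b) + c_toggle (L * (K + 1)) (a + b)) + 1"

lemma c_eq_mono: "b \<le> b' \<Longrightarrow> c_eq b \<le> c_eq b'" unfolding c_eq_def by (intro add_mono mult_mono) auto
lemma c_toggle_mono: "L \<le> L' \<Longrightarrow> b \<le> b' \<Longrightarrow> c_toggle L b \<le> c_toggle L' b'"
  unfolding c_toggle_def by (intro add_mono mult_mono c_eq_mono) auto
lemma c_padd_mono: "L1 \<le> L1' \<Longrightarrow> L2 \<le> L2' \<Longrightarrow> b \<le> b' \<Longrightarrow> c_padd L1 L2 b \<le> c_padd L1' L2' b'"
  unfolding c_padd_def by (intro add_mono mult_mono c_toggle_mono) auto

lemma time_mono_eq: "length u \<le> b \<Longrightarrow> length w \<le> b \<Longrightarrow> time (t_mono_eq u w) \<le> c_eq b"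
proof -
  assume l: "length u \<le> b" "length w \<le> b"
  have "length u * (length w + 2) \<le> b * (b + 2)" "length w * (length u + 2) \<le> b * (b + 2)"
    using l by (intro mult_mono; simp)+
  then show ?thesis using time_subset[of u w] time_subset[of w u] by (simp add: t_mono_eq_def c_eq_def)
qed

lemma time_toggle_aux:
  "length u \<le> b \<Longrightarrow> \<forall>w\<in>set p. length w \<le> b \<Longrightarrow>
   time (t_toggle u p) \<le> (length p + 1) * (c_eq b + 1) \<and> psz (length p + 1) b (result (t_toggle u p))"
proof (induction p)
  case (Cons w p)
  have IH: "time (t_toggle u p) \<le> (length p + 1) * (c_eq b + 1) \<and> psz (length p + 1) b (result (t_toggle u p))"
    using Cons by simp
  have t: "time (t_mono_eq u w) \<le> c_eq b" using Cons.prems by (intro time_mono_eq) auto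
  show ?case
  proof (cases "set u = set w")
    case True
    then show ?thesis using t Cons.prems by (auto simp: psz_def algebra_simps)
  next
    case False
    then show ?thesis using t IH Cons.prems by (auto simp: psz_def algebra_simps)
  qed
qed simp

lemma time_toggle:
  assumes "psz L b p" "length u \<le> b"
  shows "time (t_toggle u p) \<le> c_toggle L b" "psz (L + 1) b (result (t_toggle u p))"
proof -
  have A: "time (t_toggle u p) \<le> (length p + 1) * (c_eq b + 1)" "psz (length p + 1) b (result (t_toggle u p))"
    using time_toggle_aux[of u b p] assms by (auto simp: psz_def)
  have "(length p + 1) * (c_eq b + 1) \<le> c_toggle L b" unfolding c_toggle_def using assms by (intro mult_mono) (auto simp: psz_def)
  then show "time (t_toggle u p) \<le> c_toggle L b" using A(1) by linarith
  show "psz (L + 1) b (result (t_toggle u p))" using assms by (intro psz_mono[OF A(2)]) (auto simp: psz_def)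
qed

text \<open>The extra \<open>K\<close> bounds every intermediate result, so that all calls inside
  the recursion can be charged the same cost. The same device recurs in other loops over
  polynomials.\<close>

lemma time_padd_aux:
  assumes q: "psz L2 b q"
  shows "\<forall>u\<in>set p. length u \<le> b \<Longrightarrow> length p + L2 \<le> K \<Longrightarrow>
   time (t_padd p q) \<le> length p * (1 + c_toggle K b) + 1 \<and> psz (length p + L2) b (result (t_padd p q))"
proof (induction p)
  case Nil then show ?case using q by simp
next
  case (Cons u p)
  have IH: "time (t_padd p q) \<le> length p * (1 + c_toggle K b) + 1" "psz (length p + L2) b (result (t_padd p q))"
    using Cons by auto
  note T = time_toggle[OF IH(2), of u]
  have "c_toggle (length p + L2) b \<le> c_toggle K b" using Cons.prems by (intro c_toggle_mono) auto
  then have "time (t_toggle u (result (t_padd p q))) \<le> c_toggle K b" using T(1) Cons.prems by simp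
  then show ?case using T(2) IH(1) Cons.prems by (simp add: algebra_simps)
qed

lemma time_padd:
  assumes "psz L1 b p" "psz L2 b q"
  shows "time (t_padd p q) \<le> c_padd L1 L2 b" "psz (L1 + L2) b (result (t_padd p q))"
proof -
  have A: "time (t_padd p q) \<le> length p * (1 + c_toggle (L1 + L2) b) + 1" "psz (length p + L2) b (result (t_padd p q))"
    using time_padd_aux[OF assms(2), of p "L1 + L2"] assms(1) by (auto simp: psz_def)
  have "length p * (1 + c_toggle (L1 + L2) b) + 1 \<le> c_padd L1 L2 b" unfolding c_padd_def
    using assms(1) by (intro add_mono mult_mono) (auto simp: psz_def)
  then show "time (t_padd p q) \<le> c_padd L1 L2 b" using A(1) by linarith
  show "psz (L1 + L2) b (result (t_padd p q))" using assms(1) by (intro psz_mono[OF A(2)]) (auto simp: psz_def)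
qed

lemma time_psum_list_aux:
  "\<forall>p\<in>set ps. psz L b p \<Longrightarrow> length ps * L \<le> K \<Longrightarrow>
   time (t_psum_list ps) \<le> length ps * (1 + c_padd L K b) + 1 \<and> psz (length ps * L) b (result (t_psum_list ps))"
proof (induction ps)
  case (Cons p ps)
  have IH: "time (t_psum_list ps) \<le> length ps * (1 + c_padd L K b) + 1" "psz (length ps * L) b (result (t_psum_list ps))"
    using Cons by auto
  have p: "psz L b p" using Cons.prems by simp
  note T = time_padd[OF p IH(2)]
  have "c_padd L (length ps * L) b \<le> c_padd L K b" using Cons.prems by (intro c_padd_mono) auto
  then show ?case using T IH(1) by (simp add: algebra_simps)
qed simp

lemma time_psum_list:
  assumes "\<forall>p\<in>set ps. psz L b p" "length ps \<le> k"
  shows "time (t_psum_list ps) \<le> c_psum_list k L b" "psz (k * L) b (result (t_psum_list ps))"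
proof -
  have le: "length ps * L \<le> k * L" using assms(2) by (rule mult_right_mono) simp
  note A = time_psum_list_aux[OF assms(1) le]
  have "length ps * (1 + c_padd L (k * L) b) + 1 \<le> c_psum_list k L b" unfolding c_psum_list_def
    using assms(2) by (intro add_mono mult_mono) auto
  then show "time (t_psum_list ps) \<le> c_psum_list k L b" using A by linarith
  show "psz (k * L) b (result (t_psum_list ps))" using A le by (auto intro: psz_mono)
qed

lemma time_union: "time (t_union u w) \<le> length u * (length w + 2) + 1" "length (result (t_union u w)) \<le> length u + length w"
proof (induction u)
  case (Cons x u)
  { case 1 then show ?case using Cons.IH(1) time_mem[of x w] by (auto simp: algebra_simps) }
  { case 2 then show ?case using Cons.IH(2) by auto }
qed auto

lemma time_mono_mul_aux:
  assumes u: "length u \<le> a"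
  shows "\<forall>w\<in>set p. length w \<le> b \<Longrightarrow> length p \<le> L \<Longrightarrow>
   time (t_mono_mul u p) \<le> length p * (a * (b + 2) + 2 + c_toggle L (a + b)) + 1 \<and> psz (length p) (a + b) (result (t_mono_mul u p))"
proof (induction p)
  case (Cons w p)
  have IH: "time (t_mono_mul u p) \<le> length p * (a * (b + 2) + 2 + c_toggle L (a + b)) + 1" "psz (length p) (a + b) (result (t_mono_mul u p))"
    using Cons by auto
  have w: "length w \<le> b" using Cons.prems by simp
  have uw: "length (result (t_union u w)) \<le> a + b" using time_union(2)[of u w] u w by simp
  note T = time_toggle[OF IH(2) uw]
  have "c_toggle (length p) (a + b) \<le> c_toggle L (a + b)" using Cons.prems by (intro c_toggle_mono) auto
  moreover have "length u * (length w + 2) \<le> a * (b + 2)" using u w by (intro mult_mono) auto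
  ultimately show ?case using T IH(1) time_union(1)[of u w] by (simp add: algebra_simps)
qed simp

lemma time_mono_mul:
  assumes "length u \<le> a" "psz L b p"
  shows "time (t_mono_mul u p) \<le> c_mono_mul a L b" "psz L (a + b) (result (t_mono_mul u p))"
proof -
  note A = time_mono_mul_aux[OF assms(1), of p b L]
  have "length p * (a * (b + 2) + 2 + c_toggle L (a + b)) + 1 \<le> c_mono_mul a L b" unfolding c_mono_mul_def
    using assms(2) by (intro add_mono mult_mono) (auto simp: psz_def)
  then show "time (t_mono_mul u p) \<le> c_mono_mul a L b" using A assms(2) by (auto simp: psz_def)
  show "psz L (a + b) (result (t_mono_mul u p))" using A assms(2) by (auto simp: psz_def)
qed

lemma time_pmul_aux:
  assumes q: "psz L2 b q"
  shows "\<forall>u\<in>set p. length u \<le> a \<Longrightarrow> length p * L2 \<le> K \<Longrightarrow>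
   time (t_pmul p q) \<le> length p * (1 + c_mono_mul a L2 b + c_padd L2 K (a + b)) + 1 \<and> psz (length p * L2) (a + b) (result (t_pmul p q))"
proof (induction p)
  case (Cons u p)
  have IH: "time (t_pmul p q) \<le> length p * (1 + c_mono_mul a L2 b + c_padd L2 K (a + b)) + 1" "psz (length p * L2) (a + b) (result (t_pmul p q))"
    using Cons by auto
  have u: "length u \<le> a" using Cons.prems by simp
  note M = time_mono_mul[OF u q]
  note T = time_padd[OF M(2) IH(2)]
  have "c_padd L2 (length p * L2) (a + b) \<le> c_padd L2 K (a + b)" using Cons.prems by (intro c_padd_mono) auto
  then show ?case using T M(1) IH(1) by (simp add: algebra_simps)
qed simp

lemma time_pmul:
  assumes "psz L1 a p" "psz L2 b q"
  shows "time (t_pmul p q) \<le> c_pmul L1 a L2 b" "psz (L1 * L2) (a + b) (result (t_pmul p q))"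
proof -
  have le: "length p * L2 \<le> L1 * L2" using assms(1) by (simp add: psz_def mult_right_mono)
  have a: "\<forall>u\<in>set p. length u \<le> a" using assms(1) by (simp add: psz_def)
  note A = time_pmul_aux[OF assms(2) a le]
  have "length p * (1 + c_mono_mul a L2 b + c_padd L2 (L1 * L2) (a + b)) + 1 \<le> c_pmul L1 a L2 b" unfolding c_pmul_def
    using assms(1) by (intro add_mono mult_mono) (auto simp: psz_def)
  then show "time (t_pmul p q) \<le> c_pmul L1 a L2 b" using A by linarith
  show "psz (L1 * L2) (a + b) (result (t_pmul p q))" using A le by (auto intro: psz_mono)
qed

lemma time_psubst_aux:
  assumes Q: "psz K a Q"
  shows "\<forall>u\<in>set p. length u \<le> b \<Longrightarrow> length p * (K + 1) \<le> J \<Longrightarrow>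
   time (t_psubst y Q p) \<le> length p * (2 * b + 3 + c_mono_mul b K a + c_padd K J (a + b) + c_toggle J (a + b)) + 1 \<and>
   psz (length p * (K + 1)) (a + b) (result (t_psubst y Q p))"
proof (induction p)
  case (Cons u p)
  let ?r = "result (t_psubst y Q p)"
  have IH: "time (t_psubst y Q p) \<le> length p * (2 * b + 3 + c_mono_mul b K a + c_padd K J (a + b) + c_toggle J (a + b)) + 1"
    "psz (length p * (K + 1)) (a + b) ?r" using Cons by auto
  have u: "length u \<le> b" using Cons.prems by simp
  have J: "length p * (K + 1) \<le> J" using Cons.prems by simp
  show ?case
  proof (cases "y \<in> set u")
    case True
    have u': "length (result (t_remove y u)) \<le> b" using time_remove(2)[of y u] u by simp
    have M: "time (t_mono_mul (result (t_remove y u)) Q) \<le> c_mono_mul b K a"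
      "psz K (a + b) (result (t_mono_mul (result (t_remove y u)) Q))"
      using time_mono_mul[OF u' Q] by (simp_all add: add.commute)
    note T = time_padd[OF M(2) IH(2)]
    have "c_padd K (length p * (K + 1)) (a + b) \<le> c_padd K J (a + b)" using J by (intro c_padd_mono) auto
    moreover have "psz (Suc (length p) * (K + 1)) (a + b) (result (t_padd (result (t_mono_mul (result (t_remove y u)) Q)) ?r))"
      using T(2) by (rule psz_mono) auto
    ultimately show ?thesis using True T(1) M(1) IH(1) u time_remove(1)[of y u] time_mem[of y u] by (simp add: algebra_simps)
  next
    case False
    have "length u \<le> a + b" using u by simp
    note T = time_toggle[OF IH(2) this]
    have "c_toggle (length p * (K + 1)) (a + b) \<le> c_toggle J (a + b)" using J by (intro c_toggle_mono) auto
    moreover have "psz (Suc (length p) * (K + 1)) (a + b) (result (t_toggle u ?r))"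
      using T(2) by (rule psz_mono) auto
    ultimately show ?thesis using False T(1) IH(1) u time_mem[of y u] by (simp add: algebra_simps)
  qed
qed simp

text \<open>The size of the result is left out on purpose: the recursion only yields a factor
  \<open>K + 1\<close>, which would compound over the rewrites. Sizes of later path sums come from
  \<open>psz_represents\<close>.\<close>

lemma time_psubst:
  assumes "psz K a Q" "psz L b p"
  shows "time (t_psubst y Q p) \<le> c_psubst K a L b"
proof -
  have le: "length p * (K + 1) \<le> L * (K + 1)" using assms(2) by (intro mult_right_mono) (auto simp: psz_def)
  have a: "\<forall>u\<in>set p. length u \<le> b" using assms(2) by (simp add: psz_def)
  note A = time_psubst_aux[OF assms(1) a le, of y]
  have "length p * (2 * b + 3 + c_mono_mul b K a + c_padd K (L * (K + 1)) (a + b) + c_toggle (L * (K + 1)) (a + b)) + 1 \<le> c_psubst K a L b"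
    unfolding c_psubst_def using assms(2) by (intro add_mono mult_mono) (auto simp: psz_def)
  then show ?thesis using A by linarith
qed

lemma time_split_aux:
  "\<forall>u\<in>set p. length u \<le> b \<Longrightarrow> time (t_split x p) \<le> length p * (2 * b + 3) + 1 \<and>
   psz (length p) b (fst (result (t_split x p))) \<and> psz (length p) b (snd (result (t_split x p)))"
proof (induction p)
  case (Cons u p)
  then have IH: "time (t_split x p) \<le> length p * (2 * b + 3) + 1"
    "psz (length p) b (fst (result (t_split x p)))" "psz (length p) b (snd (result (t_split x p)))" and u: "length u \<le> b" by auto
  show ?case using IH u time_mem[of x u] time_remove[of x u]
    by (auto simp: algebra_simps psz_def)
qed simp

lemma time_split:
  assumes "psz L b p"
  shows "time (t_split x p) \<le> L * (2 * b + 3) + 1" "psz L b (fst (result (t_split x p)))" "psz L b (snd (result (t_split x p)))"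
proof -
  have A: "time (t_split x p) \<le> length p * (2 * b + 3) + 1 \<and>
     psz (length p) b (fst (result (t_split x p))) \<and> psz (length p) b (snd (result (t_split x p)))"
    using assms by (intro time_split_aux) (simp add: psz_def)
  have l: "length p \<le> L" using assms by (simp add: psz_def)
  then have "length p * (2 * b + 3) \<le> L * (2 * b + 3)" by (rule mult_right_mono) simp
  with A show "time (t_split x p) \<le> L * (2 * b + 3) + 1" by linarith
  show "psz L b (fst (result (t_split x p)))" "psz L b (snd (result (t_split x p)))" using A l by (auto intro: psz_mono)
qed

section \<open>Cost of computing all reducts\<close>

definition c_HH :: "nat \<Rightarrow> nat \<Rightarrow> nat \<Rightarrow> nat" where
  "c_HH M L b = 7 + c_toggle L b + (L + 1) * (b + 2) + 2 * ((L + 1) * b) + M + c_psubst (L + 1) b L b"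

definition c_reducts_at :: "nat \<Rightarrow> nat \<Rightarrow> nat \<Rightarrow> nat" where
  "c_reducts_at M L b = 10 + L * (2 * b + 3) + M + L * (c_HH M L b + 1) + L * 3"

definition c_reducts :: "nat \<Rightarrow> nat \<Rightarrow> nat \<Rightarrow> nat" where
  "c_reducts M L b = 3 + M * (c_reducts_at M L b + 1) + M * (L + 3)"

lemma time_HH:
  assumes A: "length (vars A) \<le> M" "outs A = []" "ins A = []" and D: "psz L b D" and R: "psz L b R" and b: "1 \<le> b"
  shows "time (t_HH A x D R u) \<le> c_HH M L b" "length (result (t_HH A x D R u)) \<le> 1"
proof -
  have "time (t_HH A x D R u) \<le> c_HH M L b \<and> length (result (t_HH A x D R u)) \<le> 1"
  proof (cases "\<exists>y. u = [y]")
    case False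
    then have "time (t_HH A x D R u) = 1 \<and> result (t_HH A x D R u) = []" by (cases u; cases "tl u") (auto simp: t_HH_def)
    then show ?thesis by (simp add: c_HH_def)
  next
    case True
    then obtain y where u: "u = [y]" by blast
    let ?Q = "result (t_toggle [y] D)"
    have Q: "time (t_toggle [y] D) \<le> c_toggle L b" "psz (L + 1) b ?Q" using time_toggle[OF D, of "[y]"] b by auto
    have c: "time (t_concat ?Q) \<le> (L + 1) * (b + 2) + 1"
    proof -
      have "time (t_concat ?Q) \<le> length ?Q * (b + 2) + 1" using Q(2) by (intro time_concat) (simp add: psz_def)
      moreover have "length ?Q * (b + 2) \<le> (L + 1) * (b + 2)" using Q(2) by (intro mult_right_mono) (simp_all add: psz_def)
      ultimately show ?thesis by linarith
    qed
    have l: "length (concat ?Q) \<le> (L + 1) * b"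
    proof -
      have "length (concat ?Q) \<le> length ?Q * b" using Q(2) by (intro length_concat_le) (simp add: psz_def)
      moreover have "length ?Q * b \<le> (L + 1) * b" using Q(2) by (intro mult_right_mono) (simp_all add: psz_def)
      ultimately show ?thesis by linarith
    qed
    have m: "time (t_mem y (concat ?Q)) \<le> (L + 1) * b + 1" using time_mem[of y "concat ?Q"] l by simp
    have e: "time (case concat ?Q of [] \<Rightarrow> ret True | v # vs \<Rightarrow> t_all_eq v vs) \<le> (L + 1) * b + 1"
    proof (cases "concat ?Q")
      case Nil then show ?thesis by (simp only: list.case) simp
    next
      case (Cons v vs)
      then have "length vs \<le> (L + 1) * b" using l by simp
      then show ?thesis unfolding Cons list.case using time_all_eq[of v vs] by simp
    qed
    have s: "time (t_psubst y ?Q R) \<le> c_psubst (L + 1) b L b" by (rule time_psubst[OF Q(2) R])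
    show ?thesis using Q(1) c m e s time_remove(1)[of x "vars A"] A
      unfolding t_HH_def u c_HH_def by (simp add: Let_def)
  qed
  then show "time (t_HH A x D R u) \<le> c_HH M L b" "length (result (t_HH A x D R u)) \<le> 1" by auto
qed

text \<open>Every monomial of the cofactor yields at most one reduct; the summand 1 covers (Elim),
  which yields one from an empty cofactor.\<close>

lemma time_reducts_at:
  assumes A: "length (vars A) \<le> M" "outs A = []" "ins A = []" and P: "psz L b (phase A)" and b: "1 \<le> b"
  shows "time (t_reducts_at A x) \<le> c_reducts_at M L b" "length (result (t_reducts_at A x)) \<le> L + 1"
proof -
  let ?DR = "result (t_split x (phase A))"
  note S = time_split[OF P, of x]
  note H = time_HH[OF A S(2,3) b]
  let ?rss = "t_map (t_HH A x (fst ?DR) (snd ?DR)) (fst ?DR)"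
  have lD: "length (fst ?DR) \<le> L" using S(2) by (simp add: psz_def)
  have m: "time ?rss \<le> L * (c_HH M L b + 1) + 1"
  proof -
    have "time ?rss \<le> length (fst ?DR) * (c_HH M L b + 1) + 1" by (rule time_map) (rule H(1))
    moreover have "length (fst ?DR) * (c_HH M L b + 1) \<le> L * (c_HH M L b + 1)" using lD by (rule mult_right_mono) simp
    ultimately show ?thesis by linarith
  qed
  have r1: "length xs \<le> 1" if "xs \<in> set (result ?rss)" for xs using that H(2) by (auto simp: result_t_map)
  have lr: "length (result ?rss) \<le> L" using lD by (simp add: result_t_map)
  have c: "time (t_concat (result ?rss)) \<le> L * 3 + 1"
  proof -
    have "time (t_concat (result ?rss)) \<le> length (result ?rss) * (1 + 2) + 1" by (rule time_concat) (rule r1)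
    then show ?thesis using lr by simp
  qed
  have lc: "length (concat (result ?rss)) \<le> L"
  proof -
    have "length (concat (result ?rss)) \<le> length (result ?rss) * 1" by (rule length_concat_le) (rule r1)
    then show ?thesis using lr by linarith
  qed
  have "time (t_reducts_at A x) \<le> c_reducts_at M L b \<and> length (result (t_reducts_at A x)) \<le> L + 1"
  proof (cases "fst ?DR")
    case Nil
    then show ?thesis using S(1) A(1) time_remove(1)[of x "vars A"]
      by (simp add: t_reducts_at_def A(2,3) c_reducts_at_def)
  next
    case (Cons u us)
    show ?thesis
    proof (cases "fst ?DR = [[]]")
      case True
      then show ?thesis using S(1) by (simp add: t_reducts_at_def A(2,3) c_reducts_at_def)
    next
      case False
      have pick: "(case fst ?DR of [] \<Rightarrow> r1 | [[]] \<Rightarrow> r2 | _ \<Rightarrow> r) = r" for r1 r2 r :: "lpath_sum list timed"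
        using Cons False by (auto split: list.splits)
      have "time (t_reducts_at A x) = 3 + time (t_split x (phase A)) + time ?rss + time (t_concat (result ?rss))"
        "result (t_reducts_at A x) = concat (result ?rss)"
        unfolding t_reducts_at_def A(2,3) by (simp_all add: pick)
      then show ?thesis using S(1) m c lc by (simp add: c_reducts_at_def)
    qed
  qed
  then show "time (t_reducts_at A x) \<le> c_reducts_at M L b" "length (result (t_reducts_at A x)) \<le> L + 1" by auto
qed

lemma time_reducts:
  assumes A: "length (vars A) \<le> M" "outs A = []" "ins A = []" and P: "psz L b (phase A)" and b: "1 \<le> b"
  shows "time (t_reducts A) \<le> c_reducts M L b"
proof -
  note R = time_reducts_at[OF A P b]
  let ?rss = "t_map (t_reducts_at A) (vars A)"
  have "time ?rss \<le> length (vars A) * (c_reducts_at M L b + 1) + 1" by (rule time_map) (rule R(1))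
  moreover have "length (vars A) * (c_reducts_at M L b + 1) \<le> M * (c_reducts_at M L b + 1)" using A(1) by (rule mult_right_mono) simp
  moreover have "time (t_concat (result ?rss)) \<le> length (result ?rss) * (L + 1 + 2) + 1"
    using R(2) by (intro time_concat) (auto simp: result_t_map)
  moreover have "length (result ?rss) * (L + 1 + 2) \<le> M * (L + 3)" using A(1) by (intro mult_mono) (simp_all add: result_t_map)
  ultimately show ?thesis unfolding t_reducts_def c_reducts_def by simp
qed

text \<open>The brute-force sum has one path per subset of the variables; without variables a single
  evaluation of the phase remains.\<close>

lemma time_eval_no_vars:
  assumes "vars A = []" "psz L b (phase A)"
  shows "time (t_eval A) \<le> 3 + L * (2 * b + 2)"
proof -
  have "time (t_peval [] p) \<le> length p * (2 * b + 2) + 1" if "\<forall>u\<in>set p. length u \<le> b" for p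
    using that
  proof (induction p)
    case (Cons u p)
    then have "time (t_peval [] p) \<le> length p * (2 * b + 2) + 1" "length u \<le> b" by auto
    then show ?case using time_subset[of u "[]"] by (simp add: algebra_simps)
  qed simp
  then have "time (t_peval [] (phase A)) \<le> length (phase A) * (2 * b + 2) + 1" using assms(2) by (simp add: psz_def)
  moreover have "length (phase A) * (2 * b + 2) \<le> L * (2 * b + 2)" using assms(2) by (intro mult_right_mono) (simp_all add: psz_def)
  ultimately show ?thesis by (simp add: t_eval_def assms(1))
qed

section \<open>Cost of composing, tensoring and placing\<close>

definition sized :: "nat \<Rightarrow> lpath_sum \<Rightarrow> bool" where
  "sized B A \<longleftrightarrow> length (vars A) \<le> B \<and> psz B B (phase A) \<and> length (outs A) \<le> B \<and> length (ins A) \<le> B \<and>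
     (\<forall>p\<in>set (outs A). psz B B p) \<and> (\<forall>p\<in>set (ins A). psz B B p)"

definition c_shift :: "nat \<Rightarrow> nat" where
  "c_shift B = (B + 2) + (B * (B + 2) + 2) + 2 * (B * (B * (B + 2) + 3) + 1)"

definition c_compose :: "nat \<Rightarrow> nat" where
  "c_compose B = 10 + 7 * B + c_shift B + (B * (c_padd B B B + 1) + 1) + (B * (c_pmul 1 1 (B + B) B + 1) + 1) +
     c_psum_list B (1 * (B + B)) (1 + B) + c_padd B (B * (1 * (B + B))) (1 + B) + c_padd B (B + B * (1 * (B + B))) (1 + B)"

definition c_tensor :: "nat \<Rightarrow> nat" where
  "c_tensor B = 5 + 4 * B + c_shift B + c_padd B B B"

definition c_place :: "nat \<Rightarrow> nat" where
  "c_place B = 20 + 10 * B + c_tensor B + B * (B + 2) + 2 * (B * (2 * B + 2))"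

lemma time_shift_poly:
  assumes "psz L b p"
  shows "time (t_shift_poly k p) \<le> L * (b + 2) + 2" "psz L b (result (t_shift_poly k p))"
proof -
  have "time (t_map (\<lambda>x. ret (k + x)) u) \<le> b + 1" if "u \<in> set p" for u
    using time_map[of u "\<lambda>x. ret (k + x)" 0] that assms by (auto simp: psz_def)
  then have "time (t_map (t_map (\<lambda>x. ret (k + x))) p) \<le> length p * (b + 1 + 1) + 1" by (rule time_map)
  moreover have "length p * (b + 1 + 1) \<le> L * (b + 2)" using assms by (intro mult_mono) (auto simp: psz_def)
  ultimately show "time (t_shift_poly k p) \<le> L * (b + 2) + 2" by (simp add: t_shift_poly_def)
  show "psz L b (result (t_shift_poly k p))" using assms by (simp add: psz_def result_shift_poly)
qed

lemma time_map_le: "(\<And>x. x \<in> set xs \<Longrightarrow> time (f x) \<le> c) \<Longrightarrow> length xs \<le> B \<Longrightarrow> time (t_map f xs) \<le> B * (c + 1) + 1"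
  using time_map[of xs f c] mult_right_mono[of "length xs" B "c + 1"] by force

lemma time_shift:
  assumes "sized B A"
  shows "time (t_shift k A) \<le> c_shift B" "sized B (result (t_shift k A))"
proof -
  have P: "time (t_shift_poly k p) \<le> B * (B + 2) + 2" "psz B B (result (t_shift_poly k p))" if "psz B B p" for p
    using time_shift_poly[OF that] by auto
  have T: "time (t_map (t_shift_poly k) ps) \<le> B * (B * (B + 2) + 2 + 1) + 1" if "length ps \<le> B" "\<forall>p\<in>set ps. psz B B p" for ps
    using that(1) by (rule time_map_le[rotated]) (rule P(1)[OF bspec[OF that(2)]])
  have "time (t_map (t_shift_poly k) (outs A)) \<le> B * (B * (B + 2) + 2 + 1) + 1"
    "time (t_map (t_shift_poly k) (ins A)) \<le> B * (B * (B + 2) + 2 + 1) + 1"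
    using assms unfolding sized_def by (blast intro: T)+
  moreover have "time (t_map (\<lambda>x. ret (k + x)) (vars A)) \<le> B * (0 + 1) + 1"
    using assms by (intro time_map_le) (auto simp: sized_def)
  moreover have "time (t_shift_poly k (phase A)) \<le> B * (B + 2) + 2" using P(1) assms by (simp add: sized_def)
  ultimately show "time (t_shift k A) \<le> c_shift B" by (simp add: t_shift_def c_shift_def algebra_simps)
  show "sized B (result (t_shift k A))" using assms P(2) by (auto simp: sized_def t_shift_def result_t_map)
qed

lemma time_compose:
  assumes A: "sized B A" and A': "sized B A'"
  shows "time (t_compose A A') \<le> c_compose B"
proof -
  define a where "a = result (t_fresh (vars A))"
  define b where "b = result (t_fresh (vars A'))"
  define S where "S = result (t_shift a A')"
  note Sh = time_shift[OF A', of a, folded S_def]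
  define ys where "ys = result (t_upto (a + b) (length (ins A)))"
  have ly: "length ys = length (ins A)" "length ys \<le> B" using A by (simp_all add: ys_def sized_def)
  define ds where "ds = result (t_map2 t_padd (outs S) (ins A))"
  have po: "psz B B p" if "p \<in> set (outs S)" for p using Sh(2) that by (simp add: sized_def)
  have pi: "psz B B p" if "p \<in> set (ins A)" for p using A that by (simp add: sized_def)
  have lo: "length (outs S) \<le> B" using Sh(2) by (simp add: sized_def)
  have t1: "time (t_map2 t_padd (outs S) (ins A)) \<le> B * (c_padd B B B + 1) + 1"
  proof -
    have "time (t_map2 t_padd (outs S) (ins A)) \<le> length (outs S) * (c_padd B B B + 1) + 1"
      by (rule time_map2) (intro time_padd(1) po pi)
    moreover have "length (outs S) * (c_padd B B B + 1) \<le> B * (c_padd B B B + 1)" using lo by (rule mult_right_mono) simp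
    ultimately show ?thesis by linarith
  qed
  have pd: "psz (B + B) B d" if "d \<in> set ds" for d
    using result_t_map2(1)[of d t_padd "outs S" "ins A"] that time_padd(2)[OF po pi] unfolding ds_def by blast
  define ls where "ls = result (t_map2 (\<lambda>y. t_pmul [[y]]) ys ds)"
  have y1: "psz 1 1 [[y]]" for y :: nat by simp
  have t2: "time (t_map2 (\<lambda>y. t_pmul [[y]]) ys ds) \<le> B * (c_pmul 1 1 (B + B) B + 1) + 1"
  proof -
    have "time (t_map2 (\<lambda>y. t_pmul [[y]]) ys ds) \<le> length ys * (c_pmul 1 1 (B + B) B + 1) + 1"
      by (rule time_map2) (intro time_pmul(1) y1 pd)
    moreover have "length ys * (c_pmul 1 1 (B + B) B + 1) \<le> B * (c_pmul 1 1 (B + B) B + 1)" using ly(2) by (rule mult_right_mono) simp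
    ultimately show ?thesis by linarith
  qed
  have pl: "\<forall>p\<in>set ls. psz (1 * (B + B)) (1 + B) p"
    using result_t_map2(1)[of _ "\<lambda>y. t_pmul [[y]]" ys ds] time_pmul(2)[OF y1 pd] unfolding ls_def by blast
  have ll: "length ls \<le> B" using result_t_map2(2)[of "\<lambda>y. t_pmul [[y]]" ys ds] ly(2) unfolding ls_def by linarith
  note t3 = time_psum_list[OF pl ll]
  have ph: "psz B (1 + B) (phase S)" "psz B (1 + B) (phase A)" using Sh(2) A by (auto simp: sized_def intro: psz_mono)
  note t4 = time_padd[OF ph(1) t3(2)]
  note t5 = time_padd[OF ph(2) t4(2)]
  have v: "length (vars A) \<le> B" "length (vars A') \<le> B" "length (vars S) \<le> B" using A A' Sh(2) by (simp_all add: sized_def)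
  have "time (t_compose A A') = 1 + time (t_fresh (vars A)) + time (t_fresh (vars A')) + time (t_shift a A') + time (t_length (ins A)) +
     time (t_upto (a + b) (length (ins A))) + time (t_map2 t_padd (outs S) (ins A)) + time (t_map2 (\<lambda>y. t_pmul [[y]]) ys ds) +
     time (t_psum_list ls) + time (t_padd (phase S) (result (t_psum_list ls))) +
     time (t_padd (phase A) (result (t_padd (phase S) (result (t_psum_list ls))))) + time (t_append (vars S) ys) +
     time (t_append (vars A) (vars S @ ys)) + time (t_halve (scal A * scal A') ys)"
    unfolding t_compose_def a_def b_def S_def ys_def ds_def ls_def by (simp del: t_pmul.simps)
  then show ?thesis using Sh(1) t1 t2 t3(1) t4(1) t5(1) v ly
    by (simp add: time_fresh time_length time_upto time_append time_halve c_compose_def algebra_simps)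
qed

lemma time_tensor:
  assumes A: "sized B A" and A': "sized B A'"
  shows "time (t_tensor A A') \<le> c_tensor B"
proof -
  define S where "S = result (t_shift (result (t_fresh (vars A))) A')"
  note Sh = time_shift[OF A', of "result (t_fresh (vars A))", folded S_def]
  have ph: "psz B B (phase A)" "psz B B (phase S)" using A Sh(2) by (simp_all add: sized_def)
  have v: "length (vars A) \<le> B" "length (outs A) \<le> B" "length (ins A) \<le> B" using A by (simp_all add: sized_def)
  have "time (t_tensor A A') = 1 + time (t_fresh (vars A)) + time (t_shift (result (t_fresh (vars A))) A') +
     time (t_append (vars A) (vars S)) + time (t_padd (phase A) (phase S)) + time (t_append (outs A) (outs S)) + time (t_append (ins A) (ins S))"
    unfolding t_tensor_def S_def by simp
  then show ?thesis using Sh(1) time_padd(1)[OF ph] v by (simp add: time_fresh time_append c_tensor_def)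
qed

lemma time_ident: "time (t_ident k) \<le> 2 * k + 3"
  using time_map[of "[0..<k]" "\<lambda>x. ret [[x]]" 0] by (simp add: t_ident_def time_upto)

lemma time_ket: "time (t_ket x) \<le> length x + 2"
  using time_map[of x "\<lambda>b. ret (if b = 1 then [[]] else [])" 0] by (simp add: t_ket_def)

lemma time_wires: "time (t_wires g) \<le> length (wires g) + 1"
  by (cases g) (simp_all add: time_append)

lemma time_gate_psum: "time (t_gate_psum g) \<le> 3 * length (wires g) + 3"
proof (cases g)
  case (CZGate cs q)
  then show ?thesis using time_map[of "[0..<Suc (length cs)]" "\<lambda>x. ret [[x]]" 0]
    by (simp add: time_length time_upto del: t_upto.simps upt_Suc)
qed auto

lemma time_arrange: "time (t_arrange N pos ps) \<le> N * (length pos + 2) + N + 3"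
proof -
  have "time (t_map (\<lambda>j. do { r \<leftarrow> t_lookup pos ps j; ret (the r) }) [0..<N]) \<le> length [0..<N] * (length pos + 1 + 1) + 1"
    by (rule time_map) (simp add: time_lookup[simplified])
  then show ?thesis by (simp add: t_arrange_def time_upto)
qed

lemma time_place:
  assumes A: "sized B A" and J: "sized B (result (t_ident (N - length ws)))" and N: "N \<le> B" and ws: "length ws \<le> B"
  shows "time (t_place N ws A) \<le> c_place B"
proof -
  define pos where "pos = ws @ filter (\<lambda>j. j \<notin> set ws) [0..<N]"
  have "length (filter (\<lambda>j. j \<notin> set ws) [0..<N]) \<le> N" using length_filter_le[of "\<lambda>j. j \<notin> set ws" "[0..<N]"] by simp
  then have pos: "length pos \<le> 2 * B" using N ws by (simp add: pos_def)
  let ?T = "result (t_tensor A (result (t_ident (N - length ws))))"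
  have eq: "time (t_place N ws A) = 1 + time (t_length ws) + time (t_ident (N - length ws)) + time (t_tensor A (result (t_ident (N - length ws)))) +
     time (t_upto 0 N) + time (t_diff [0..<N] ws) + time (t_append ws (filter (\<lambda>j. j \<notin> set ws) [0..<N])) +
     time (t_arrange N pos (outs ?T)) + time (t_arrange N pos (ins ?T))"
    unfolding t_place_def pos_def by simp
  have di: "time (t_diff [0..<N] ws) \<le> B * (B + 2) + 1"
  proof -
    have "N * (length ws + 2) \<le> B * (B + 2)" using N ws by (intro mult_mono) auto
    then show ?thesis using time_diff[of "[0..<N]" ws] by simp
  qed
  have ar: "time (t_arrange N pos ps) \<le> B * (2 * B + 2) + B + 3" for ps :: "lpoly list"
  proof -
    have "N * (length pos + 2) \<le> B * (2 * B + 2)" using N pos by (intro mult_mono) auto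
    then show ?thesis using time_arrange[of N pos ps] N by linarith
  qed
  have id: "time (t_ident (N - length ws)) \<le> 2 * B + 3" using time_ident[of "N - length ws"] N by linarith
  show ?thesis unfolding eq time_length time_upto time_append c_place_def
    using time_tensor[OF A J] id di N ws ar[of "outs ?T"] ar[of "ins ?T"] by linarith
qed

section \<open>Size bounds from the number of variables and the degree\<close>

definition bounded_psum :: "nat \<Rightarrow> nat \<Rightarrow> nat \<Rightarrow> path_sum \<Rightarrow> bool" where
  "bounded_psum M d N f \<longleftrightarrow> well_formed f \<and> card (vars f) \<le> M \<and> (\<forall>u\<in>phase f. card u \<le> d) \<and>
     (\<forall>p\<in>set (outs f). \<forall>u\<in>p. card u \<le> 1) \<and> (\<forall>p\<in>set (ins f). \<forall>u\<in>p. card u \<le> 1) \<and> length (outs f) \<le> N \<and> length (ins f) \<le> N"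

lemma bounded_psum_mono: "bounded_psum M d N f \<Longrightarrow> M \<le> M' \<Longrightarrow> N \<le> N' \<Longrightarrow> bounded_psum M' d N' f"
  by (auto simp: bounded_psum_def)

text \<open>A set of at most \<open>d\<close> elements is listed and padded with \<open>None\<close>
  to length \<open>d\<close>, so there are at most as many as lists of length \<open>d\<close> over
  \<open>card V + 1\<close> symbols.\<close>

lemma card_small_subsets:
  assumes "finite V" shows "finite {u. u \<subseteq> V \<and> card u \<le> d}" "card {u. u \<subseteq> V \<and> card u \<le> d} \<le> (card V + 1) ^ d"
proof -
  let ?X = "{u. u \<subseteq> V \<and> card u \<le> d}" and ?L = "{xs. set xs \<subseteq> insert None (Some ` V) \<and> length xs = d}"
  have fin: "finite (insert None (Some ` V))" using assms by simp
  have c: "card (insert None (Some ` V)) = card V + 1" using assms by (simp add: card_image)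
  have "?X \<subseteq> (\<lambda>xs. {x. Some x \<in> set xs}) ` ?L"
  proof
    fix u assume u: "u \<in> ?X"
    then obtain xs where xs: "set xs = u" "distinct xs" using assms finite_distinct_list finite_subset by (metis mem_Collect_eq)
    then have l: "length xs \<le> d" using u distinct_card[OF xs(2)] by simp
    let ?ys = "map Some xs @ replicate (d - length xs) None"
    have "?ys \<in> ?L" "u = {x. Some x \<in> set ?ys}" using xs u l by (auto split: if_splits)
    then show "u \<in> (\<lambda>xs. {x. Some x \<in> set xs}) ` ?L" by blast
  qed
  moreover have fL: "finite ?L" using fin by (rule finite_lists_length_eq)
  ultimately have "card ?X \<le> card ?L" by (rule surj_card_le[rotated])
  then show "card ?X \<le> (card V + 1) ^ d" using card_lists_length_eq[OF fin, of d] c by simp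
  show "finite ?X" using assms by simp
qed

text \<open>Monomials in a representation are distinct, so their number is bounded by that of the
  small subsets of \<open>V\<close>, no matter how the list was computed.\<close>

lemma psz_represents:
  assumes p: "represents_poly p P" and P: "P \<subseteq> Pow V" "finite V" "card V \<le> M" "\<And>u. u \<in> P \<Longrightarrow> card u \<le> d" and d: "d \<le> d'"
  shows "psz ((M + 1) ^ d') d' p"
proof -
  have dist: "distinct (map set p)" "\<forall>u\<in>set p. distinct u" "set ` set p = P" using p by (auto simp: represents_poly_def)
  have "length p = card P" using distinct_card[OF dist(1)] dist(3) by simp
  also have "\<dots> \<le> card {u. u \<subseteq> V \<and> card u \<le> d'}" using P d by (intro card_mono card_small_subsets) (auto intro: order_trans)
  also have "\<dots> \<le> (card V + 1) ^ d'" by (rule card_small_subsets(2)[OF P(2)])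
  also have "\<dots> \<le> (M + 1) ^ d'" using P(3) by (intro power_mono) auto
  finally have "length p \<le> (M + 1) ^ d'" .
  moreover have "length u \<le> d'" if "u \<in> set p" for u
    using distinct_card[of u] dist(2,3) that P(4)[of "set u"] d by auto
  ultimately show ?thesis by (simp add: psz_def)
qed

text \<open>A sum, so that it dominates each of the quantities and one bound serves all cost
  functions.\<close>

definition size_bound :: "nat \<Rightarrow> nat \<Rightarrow> nat \<Rightarrow> nat" where
  "size_bound M d N = (M + 1) ^ d + M + d + N + 1"

lemma sized_represents:
  assumes A: "represents A f" and f: "bounded_psum M d N f" and d: "1 \<le> d"
  shows "sized (size_bound M d N) A"
proof -
  have wf: "well_formed f" and b: "card (vars f) \<le> M" "\<And>u. u \<in> phase f \<Longrightarrow> card u \<le> d"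
    "\<And>p u. p \<in> set (outs f @ ins f) \<Longrightarrow> u \<in> p \<Longrightarrow> card u \<le> 1" "length (outs f) \<le> N" "length (ins f) \<le> N"
    using f by (auto simp: bounded_psum_def)
  have r: "distinct (vars A)" "set (vars A) = vars f" "represents_poly (phase A) (phase f)"
    "list_all2 represents_poly (outs A) (outs f)" "list_all2 represents_poly (ins A) (ins f)"
    using A by (auto simp: represents_iff represents_set_def)
  have le: "(M + 1) ^ d \<le> size_bound M d N" "d \<le> size_bound M d N" by (simp_all add: size_bound_def)
  have q: "psz ((M + 1) ^ d) d p" if h: "list_all2 represents_poly ps Ps" "set Ps \<subseteq> set (outs f @ ins f)" "p \<in> set ps" for p ps Ps
  proof -
    obtain j where j: "j < length ps" "p = ps ! j" using h(3) by (auto simp: in_set_conv_nth)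
    have P: "represents_poly p (Ps ! j)" using list_all2_nthD[OF h(1) j(1)] j(2) by simp
    have "Ps ! j \<in> set Ps" using list_all2_lengthD[OF h(1)] j(1) by simp
    then have o: "Ps ! j \<in> set (outs f @ ins f)" using h(2) by blast
    show ?thesis using P well_formedD(3)[OF wf o] well_formedD(1)[OF wf] b(1) b(3)[OF o] d by (rule psz_represents)
  qed
  have "length (vars A) \<le> M" using distinct_card[OF r(1)] r(2) b(1) by simp
  moreover have "psz ((M + 1) ^ d) d (phase A)"
    using r(3) well_formedD(2,1)[OF wf] b(1,2) order_refl by (rule psz_represents)
  moreover have "psz (size_bound M d N) (size_bound M d N) p" if "psz ((M + 1) ^ d) d p" for p
    using that le by (rule psz_mono)
  moreover have "psz ((M + 1) ^ d) d p" if "p \<in> set (outs A)" for p using r(4) _ that by (rule q) simp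
  moreover have "psz ((M + 1) ^ d) d p" if "p \<in> set (ins A)" for p using r(5) _ that by (rule q) simp
  moreover have "M \<le> size_bound M d N" "N \<le> size_bound M d N" by (simp_all add: size_bound_def)
  ultimately show ?thesis using list_all2_lengthD[OF r(4)] list_all2_lengthD[OF r(5)] b(4,5)
    unfolding sized_def by simp
qed

lemma bounded_dagger: "bounded_psum M d N f \<Longrightarrow> bounded_psum M d N (dagger f)"
  using well_formed_simple(5)[of f] by (auto simp: bounded_psum_def dagger_def)

lemma bounded_ident: "bounded_psum k d k (ident k)"
  using well_formed_simple(1)[of k] by (auto simp: bounded_psum_def ident_def pvar_def)

lemma bounded_ket: "bounded_psum 0 d (length x) (ket x)"
  using well_formed_simple(2)[of x] by (auto simp: bounded_psum_def ket_def pconst_def)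

lemma bounded_proj1: "bounded_psum 0 d 1 proj1"
  using well_formed_simple(3) by (auto simp: bounded_psum_def proj1_def pconst_def)

text \<open>The phase of a Hadamard gate has degree 2, that of a controlled Z as many as it has
  wires; the additional variable is a Hadamard outcome.\<close>

lemma bounded_gate:
  assumes "2 \<le> d" "length (wires g) \<le> d"
  shows "bounded_psum (length (wires g) + 1) d (length (wires g)) (gate_psum g)"
proof (cases g)
  case (HGate q)
  have "pmul (pvar 0) (pvar 1) = {{0, 1}}" by (simp add: pvar_def pmul_single insert_commute)
  then show ?thesis using well_formed_simple(4)[of g] assms HGate by (auto simp: bounded_psum_def pvar_def)
qed (use well_formed_simple(4)[of g] assms in \<open>auto simp: bounded_psum_def pvar_def padd_def pconst_def Let_def\<close>)

lemma shift_bounds: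
  assumes "bounded_psum M d N f"
  shows "card (vars (shift k f)) \<le> M" "u \<in> phase (shift k f) \<Longrightarrow> card u \<le> d"
    "p \<in> set (outs (shift k f) @ ins (shift k f)) \<Longrightarrow> u \<in> p \<Longrightarrow> card u \<le> 1"
    "length (outs (shift k f)) = length (outs f)" "length (ins (shift k f)) = length (ins f)"
  using assms by (auto simp: bounded_psum_def shift_sel shift_polys card_image)

lemma bounded_tensor:
  assumes f: "bounded_psum M1 d N1 f" and g: "bounded_psum M2 d N2 g"
  shows "bounded_psum (M1 + M2) d (N1 + N2) (f \<otimes> g)"
proof -
  let ?g = "shift (fresh (vars f)) g"
  note S = shift_bounds[OF g, where k = "fresh (vars f)"]
  have T: "f \<otimes> g = PSum (vars f \<union> vars ?g) (scal f * scal g) (padd (phase f) (phase ?g)) (outs f @ outs ?g) (ins f @ ins ?g)"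
    by (simp add: tensor_def Let_def)
  have wf: "well_formed (f \<otimes> g)" using f g by (intro well_formed_tensor) (simp_all add: bounded_psum_def)
  have "card (vars f \<union> vars ?g) \<le> M1 + M2" using card_Un_le[of "vars f" "vars ?g"] S(1) f by (simp add: bounded_psum_def)
  moreover have "padd (phase f) (phase ?g) \<subseteq> {u. card u \<le> d}" using S(2) f by (intro padd_subset) (auto simp: bounded_psum_def)
  moreover have "card u \<le> 1" if "p \<in> set (outs f @ ins f) \<or> p \<in> set (outs ?g @ ins ?g)" "u \<in> p" for p u
    using that S(3)[of p u] f by (auto simp: bounded_psum_def)
  ultimately show ?thesis using wf S(4,5) f g by (auto simp: bounded_psum_def T)
qed

text \<open>A link variable multiplies outputs and inputs of degree at most 1, so the new terms have
  degree at most 2. The third summand \<open>N\<close> counts the link variables.\<close>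

lemma bounded_compose:
  assumes f: "bounded_psum M1 d N f" and g: "bounded_psum M2 d N g" and d: "2 \<le> d"
  shows "bounded_psum (M1 + M2 + N) d N (f \<odot> g)"
proof -
  let ?g = "shift (fresh (vars f)) g"
  define ys where "ys = map (\<lambda>i. fresh (vars f) + fresh (vars g) + i) [0..<length (ins f)]"
  note S = shift_bounds[OF g, where k = "fresh (vars f)"]
  let ?L = "map2 (\<lambda>y. pmul (pvar y)) ys (map2 padd (outs ?g) (ins f))"
  have T: "f \<odot> g = PSum (vars f \<union> vars ?g \<union> set ys) (scal f * scal g / 2 ^ length (ins f))
      (padd (phase f) (padd (phase ?g) (psum_list ?L))) (outs f) (ins ?g)"
    by (simp add: compose_def Let_def ys_def shift_sel)
  have wf: "well_formed (f \<odot> g)" using f g by (intro well_formed_compose) (simp_all add: bounded_psum_def)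
  have "card (vars f \<union> vars ?g \<union> set ys) \<le> card (vars f) + card (vars ?g) + card (set ys)"
    using card_Un_le[of "vars f \<union> vars ?g" "set ys"] card_Un_le[of "vars f" "vars ?g"] by linarith
  moreover have "card (set ys) \<le> N" using card_length[of ys] f by (simp add: ys_def bounded_psum_def)
  ultimately have V: "card (vars f \<union> vars ?g \<union> set ys) \<le> M1 + M2 + N" using S(1) f by (simp add: bounded_psum_def)
  have "psum_list ?L \<subseteq> {u. card u \<le> d}"
  proof (rule psum_list_subset)
    fix p assume "p \<in> set ?L"
    then obtain y a b where p: "p = pmul (pvar y) (padd a b)" "a \<in> set (outs ?g)" "b \<in> set (ins f)"
      by (blast dest: in_set_map2)
    show "p \<subseteq> {u. card u \<le> d}"
    proof
      fix u assume "u \<in> p"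
      then obtain w where w: "u = {y} \<union> w" "w \<in> padd a b" using pmul_subset[of "pvar y" "padd a b"] unfolding p(1) by (auto simp: pvar_def)
      then have "w \<in> a \<or> w \<in> b" by (auto simp: padd_def)
      then have "card w \<le> 1" using S(3)[of a w] p(2,3) f by (auto simp: bounded_psum_def)
      then have "card u \<le> 2" using card_Un_le[of "{y}" w] unfolding w(1) by simp
      then show "u \<in> {u. card u \<le> d}" using d by simp
    qed
  qed
  then have "padd (phase f) (padd (phase ?g) (psum_list ?L)) \<subseteq> {u. card u \<le> d}"
    using S(2) f by (intro padd_subset) (auto simp: bounded_psum_def)
  moreover have "card u \<le> 1" if "p \<in> set (outs f @ ins ?g)" "u \<in> p" for p u
    using that S(3)[of p u] f by (auto simp: bounded_psum_def)
  ultimately show ?thesis using wf S(4,5) V f g by (auto simp: bounded_psum_def T)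
qed

lemma bounded_place:
  assumes "2 \<le> d" "length (wires g) \<le> d" "distinct (wires g)" "set (wires g) \<subseteq> {..<N}"
  shows "bounded_psum (N + 1) d N (place N (wires g) (gate_psum g))"
proof -
  let ?ws = "wires g"
  define pos where "pos = ?ws @ filter (\<lambda>j. j \<notin> set ?ws) [0..<N]"
  have pos: "set pos = {..<N}" "distinct pos" using assms by (auto simp: pos_def)
  then have len: "length pos = N" using distinct_card[of pos] by simp
  have wN: "length ?ws \<le> N" using distinct_card[OF assms(3)] card_mono[OF _ assms(4)] by simp
  let ?T = "gate_psum g \<otimes> ident (N - length ?ws)"
  have T: "bounded_psum (length ?ws + 1 + (N - length ?ws)) d (length ?ws + (N - length ?ws)) ?T"
    by (intro bounded_tensor bounded_gate bounded_ident assms)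
  have l: "length (outs ?T) = N" "length (ins ?T) = N"
    using wN length_gate[of g] by (simp_all add: tensor_def Let_def shift_sel ident_def[of "N - length ?ws"])
  have arr: "set (map (\<lambda>j. the (map_of (zip pos Ps) j)) [0..<N]) \<subseteq> set Ps" if "length Ps = N" for Ps :: "mpoly2 list"
  proof
    fix p assume "p \<in> set (map (\<lambda>j. the (map_of (zip pos Ps) j)) [0..<N])"
    then obtain j where j: "j < N" "p = the (map_of (zip pos Ps) j)" by auto
    then have "j \<in> set pos" by (simp add: pos(1))
    then have "map_of (zip pos Ps) j \<noteq> None" using len that by simp
    then obtain q where "map_of (zip pos Ps) j = Some q" by blast
    then show "p \<in> set Ps" using j(2) set_zip_rightD[OF map_of_SomeD] by simp
  qed
  have wf: "well_formed (place N ?ws (gate_psum g))"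
    using assms length_gate[of g] by (intro well_formed_place well_formed_simple) auto
  show ?thesis using T wf arr[OF l(1)] arr[OF l(2)] wN
    unfolding place_def Let_def pos_def[symmetric] bounded_psum_def by (auto simp: subset_iff)
qed

text \<open>Since \<open>Q\<close> has at most one variable, a monomial affected by the substitution
  loses \<open>y\<close> and gains at most one variable.\<close>

lemma rw_degree:
  assumes wf: "well_formed f" and oi: "outs f = []" "ins f = []" and st: "f \<leadsto> f'" and d: "\<forall>u\<in>phase f. card u \<le> d"
  shows "\<forall>u\<in>phase f'. card u \<le> d"
proof -
  obtain V s P where fe: "f = PSum V s P [] []" using oi by (cases f) simp
  have V: "finite V" and PV: "P \<subseteq> Pow V" using wf by (auto simp: well_formed_def fe)
  from st[unfolded fe rw_iff[OF wf[unfolded fe]]] obtain x where c: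
    "f' = PSum (V - {x}) (2 * s) P [] [] \<or> f' = PSum {} 0 {} [] [] \<or>
     (\<exists>y Q. {y} \<in> cofactor x P \<and> Q = padd {{y}} (cofactor x P) \<and> card (Vars [Q]) \<le> 1 \<and>
        f' = PSum (V - {x}) s (psubst y Q (remainder x P)) [] [])" by auto
  have P: "card u \<le> d" if "u \<in> P" for u using d that by (simp add: fe)
  from c show ?thesis
  proof (elim disjE conjE exE)
    fix y Q assume y: "{y} \<in> cofactor x P" and Q: "Q = padd {{y}} (cofactor x P)" "card (Vars [Q]) \<le> 1"
      and f': "f' = PSum (V - {x}) s (psubst y Q (remainder x P)) [] []"
    have "\<Union> Q \<subseteq> V" using PV y unfolding Q(1) by (auto simp: padd_def cofactor_def)
    then have fin: "finite (\<Union> Q)" using V by (rule finite_subset)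
    have cq: "card q \<le> 1" if "q \<in> Q" for q
      using card_mono[OF fin Union_upper[OF that]] Q(2) by (simp add: Vars_def)
    have "card u \<le> d" if u: "u \<in> psubst y Q (remainder x P)" for u
    proof -
      let ?R = "remainder x P"
      have "u \<in> {u \<in> ?R. y \<notin> u} \<or> u \<in> pmul Q ((\<lambda>u. u - {y}) ` {u \<in> ?R. y \<in> u})" using u by (auto simp: psubst_def padd_def)
      then show ?thesis
      proof
        assume "u \<in> {u \<in> ?R. y \<notin> u}" then show ?thesis using P by (auto simp: remainder_def)
      next
        assume "u \<in> pmul Q ((\<lambda>u. u - {y}) ` {u \<in> ?R. y \<in> u})"
        then obtain q w where w: "u = q \<union> (w - {y})" "q \<in> Q" "w \<in> P" "y \<in> w"
          using pmul_subset[of Q "(\<lambda>u. u - {y}) ` {u \<in> ?R. y \<in> u}"] by (auto simp: remainder_def)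
        have "finite w" using w(3) PV V by (auto intro: finite_subset)
        then have "card (w - {y}) = card w - 1" "card w \<ge> 1" using w(4) by (auto simp: Suc_le_eq card_gt_0_iff)
        then show ?thesis using card_Un_le[of q "w - {y}"] cq[OF w(2)] P[OF w(3)] unfolding w(1) by linarith
      qed
    qed
    then show ?thesis by (simp add: f')
  qed (use P in auto)
qed

lemma sized_represents_le:
  assumes "represents A f" "bounded_psum M d N f" "M \<le> Mx" "N \<le> Nx" "1 \<le> d"
  shows "sized (size_bound Mx d Nx) A"
  using assms(1) bounded_psum_mono[OF assms(2-4)] assms(5) by (rule sized_represents)

section \<open>Total cost of the loop and of the construction\<close>

definition c_loop :: "nat \<Rightarrow> nat \<Rightarrow> nat" where
  "c_loop M B = (M + 1) * c_reducts B B B + (3 + B * (2 * B + 2))"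

text \<open>Each rewrite removes a variable, so the loop condition is tested at most
  \<open>card (vars f) + 1\<close> times. All path sums on the way stay within the one size bound
  fixed by \<open>M\<close> and \<open>d\<close>; only the number of remaining tests decreases in
  the induction.\<close>

lemma loop_run_time:
  assumes "loop_run f r t" "closed_form f" "\<forall>u\<in>phase f. card u \<le> d" "card (vars f) \<le> M" "1 \<le> d"
  shows "t \<le> c_loop (card (vars f)) (size_bound M d N)"
  using assms
proof (induction rule: loop_run.induct)
  case (finish A f)
  let ?B = "size_bound M d N"
  have B: "1 \<le> ?B" by (simp add: size_bound_def)
  have cf: "well_formed f" "outs f = []" "ins f = []" using finish.prems(1) by (simp_all add: closed_form_def)
  have bp: "bounded_psum M d 0 f" using cf finish.prems by (simp add: bounded_psum_def)
  have S: "sized ?B A" by (rule sized_represents_le[OF finish.hyps(1) bp]) (use finish.prems in simp_all)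
  have A: "outs A = []" "ins A = []" using finish.hyps(1) cf by (simp_all add: represents_iff)
  have "vars f = {}" using closed_form_normal[OF finish.prems(1) finish.hyps(2)] .
  then have vA: "vars A = []" using finish.hyps(1) by (simp add: represents_iff represents_set_def)
  have "time (t_reducts A) \<le> c_reducts ?B ?B ?B" using S A B by (intro time_reducts) (auto simp: sized_def)
  moreover have "time (t_eval A) \<le> 3 + ?B * (2 * ?B + 2)" using S vA by (intro time_eval_no_vars) (auto simp: sized_def)
  ultimately show ?case unfolding c_loop_def by (simp add: algebra_simps)
next
  case (rewrite A f f' r t)
  let ?B = "size_bound M d N"
  have B: "1 \<le> ?B" by (simp add: size_bound_def)
  have cf: "well_formed f" "outs f = []" "ins f = []" using rewrite.prems(1) by (simp_all add: closed_form_def)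
  have bp: "bounded_psum M d 0 f" using cf rewrite.prems by (simp add: bounded_psum_def)
  have S: "sized ?B A" by (rule sized_represents_le[OF rewrite.hyps(1) bp]) (use rewrite.prems in simp_all)
  have A: "outs A = []" "ins A = []" using rewrite.hyps(1) cf by (simp_all add: represents_iff)
  have 1: "time (t_reducts A) \<le> c_reducts ?B ?B ?B" using S A B by (intro time_reducts) (auto simp: sized_def)
  note c = closed_form_rw[OF rewrite.prems(1) rewrite.hyps(2)]
  have lt: "card (vars f') < card (vars f)" using well_formedD(1)[OF cf(1)] c(3) by (rule psubset_card_mono)
  have "t \<le> c_loop (card (vars f')) ?B"
    using c(1) rw_degree[OF cf rewrite.hyps(2)] rewrite.prems lt by (intro rewrite.IH) auto
  moreover have "(card (vars f') + 1) * c_reducts ?B ?B ?B \<le> card (vars f) * c_reducts ?B ?B ?B"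
    using lt by (intro mult_right_mono) auto
  ultimately show ?case using 1 unfolding c_loop_def by (simp add: algebra_simps)
qed

definition c_step :: "nat \<Rightarrow> nat" where
  "c_step B = 5 + 4 * B + c_place B + c_compose B"

text \<open>A placed gate has at most \<open>N + 1\<close> variables and its composition adds at
  most \<open>N\<close> links, which gives \<open>2 * N + 1\<close> per gate. \<open>Mx\<close>
  bounds the whole construction, so every gate is charged the same cost
  \<open>c_step B\<close>.\<close>

lemma time_interp_from:
  assumes "represents A f" "bounded_psum M d N f" "circuit_on N C" "\<forall>g\<in>set C. length (wires g) \<le> d" "2 \<le> d"
    "M + length C * (2 * N + 1) \<le> Mx" "N \<le> Nx"
  defines "B \<equiv> size_bound Mx d Nx"
  shows "time (t_interp_from N A C) \<le> length C * c_step B + 1"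
    "bounded_psum (M + length C * (2 * N + 1)) d N (foldl (\<lambda>A g. place N (wires g) (gate_psum g) \<odot> A) f C)"
proof -
  have "time (t_interp_from N A C) \<le> length C * c_step B + 1 \<and>
    bounded_psum (M + length C * (2 * N + 1)) d N (foldl (\<lambda>A g. place N (wires g) (gate_psum g) \<odot> A) f C)"
    using assms(1-6)
  proof (induction C arbitrary: A f M)
    case Nil then show ?case by simp
  next
    case (Cons g C)
    let ?G = "result (t_gate_psum g)" and ?ws = "wires g"
    let ?P = "result (t_place N ?ws ?G)"
    let ?p = "place N ?ws (gate_psum g)"
    have g: "distinct ?ws" "set ?ws \<subseteq> {..<N}" and C: "circuit_on N C" and gd: "length ?ws \<le> d" and Cd: "\<forall>g\<in>set C. length (wires g) \<le> d"
      using Cons.prems by (auto simp: circuit_on_def)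
    have lN: "length ?ws \<le> N" using distinct_card[OF g(1)] card_mono[OF _ g(2)] by simp
    have M: "N + 1 \<le> Mx" "M \<le> Mx" "N + 1 + M + N + length C * (2 * N + 1) \<le> Mx" using Cons.prems(6) by simp_all
    have d: "2 \<le> d" "1 \<le> d" using Cons.prems(5) by simp_all
    have NB: "N \<le> B" "d \<le> B" using assms(7) by (simp_all add: B_def size_bound_def)
    have rG: "represents ?G (gate_psum g)" by (rule t_gate_psum_correct)
    have rP: "represents ?P ?p" using rG g length_gate[of g] by (intro t_place_correct) simp_all
    have sG: "sized B ?G" unfolding B_def
      using lN M assms(7) by (intro sized_represents_le[OF rG bounded_gate[OF d(1) gd] _ _ d(2)]) auto
    have sJ: "sized B (result (t_ident (N - length ?ws)))" unfolding B_def
      using lN M assms(7) by (intro sized_represents_le[OF t_ident_correct bounded_ident _ _ d(2)]) auto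
    have bp: "bounded_psum (N + 1) d N ?p" by (rule bounded_place[OF d(1) gd g])
    have sP: "sized B ?P" unfolding B_def using M assms(7) by (intro sized_represents_le[OF rP bp _ _ d(2)]) auto
    have sA: "sized B A" unfolding B_def using M assms(7) by (intro sized_represents_le[OF Cons.prems(1,2) _ _ d(2)]) auto
    have rc: "represents (result (t_compose ?P A)) (?p \<odot> f)" using rP Cons.prems(1) by (rule t_compose_correct)
    have bc: "bounded_psum (N + 1 + M + N) d N (?p \<odot> f)" by (rule bounded_compose[OF bp Cons.prems(2) d(1)])
    note IH = Cons.IH[OF rc bc C Cd d(1) M(3)]
    have "time (t_interp_from N A (g # C)) = 1 + time (t_gate_psum g) + time (t_wires g) + time (t_place N ?ws ?G) + time (t_compose ?P A) +
      time (t_interp_from N (result (t_compose ?P A)) C)" by simp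
    moreover have "time (t_place N ?ws ?G) \<le> c_place B" using sG sJ NB lN by (intro time_place) auto
    ultimately have "time (t_interp_from N A (g # C)) \<le> length (g # C) * c_step B + 1"
      using IH time_gate_psum[of g] time_wires[of g] time_compose[OF sP sA] gd NB by (simp add: c_step_def algebra_simps)
    moreover have eq: "N + 1 + M + N + length C * (2 * N + 1) = M + length (g # C) * (2 * N + 1)" by simp
    have "bounded_psum (M + length (g # C) * (2 * N + 1)) d N (foldl (\<lambda>A g. place N (wires g) (gate_psum g) \<odot> A) f (g # C))"
      using IH[THEN conjunct2, unfolded eq] unfolding foldl.simps .
    ultimately show ?case by (rule conjI)
  qed
  then show "time (t_interp_from N A C) \<le> length C * c_step B + 1"
    "bounded_psum (M + length C * (2 * N + 1)) d N (foldl (\<lambda>A g. place N (wires g) (gate_psum g) \<odot> A) f C)" by auto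
qed

definition c_measure :: "nat \<Rightarrow> nat \<Rightarrow> nat" where
  "c_measure L B = 20 + 10 * B + L * c_step B + 3 * c_compose B + 2 * c_tensor B"

text \<open>The circuit has at most \<open>N + length C * (2 * N + 1)\<close> variables in the bra
  and in the ket. The summand \<open>5 * N\<close> covers the links to the input state in both, the
  variables of the projector and the links of the two outer compositions.\<close>

lemma time_measurement:
  assumes C: "circuit_on N C" "\<forall>g\<in>set C. length (wires g) \<le> d" and d: "2 \<le> d" and i: "i < N"
    and M: "2 * (N + length C * (2 * N + 1)) + 5 * N \<le> Mx" and N: "N \<le> Nx"
  defines "x \<equiv> replicate N 0"
  shows "time (t_measurement_psum N C x i) \<le> c_measure (length C) (size_bound Mx d Nx)" "bounded_psum Mx d N (measurement_psum N C x i)"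
proof -
  let ?B = "size_bound Mx d Nx"
  define M1 where "M1 = N + length C * (2 * N + 1)"
  have d1: "1 \<le> d" using d by simp
  define U where "U = result (t_interp_from N (result (t_ident N)) C)"
  define u where "u = interp N C"
  define k where "k = result (t_ket x)"
  define g where "g = result (t_compose U k)"
  define gs where "gs = output_psum N C x"
  define J1 where "J1 = result (t_ident i)"
  define J2 where "J2 = result (t_ident (N - i - 1))"
  define p :: lpath_sum where "p = PSum [] 1 [] [[[]]] [[[]]]"
  define m2 where "m2 = result (t_tensor p J2)"
  define m where "m = result (t_tensor J1 m2)"
  define mg where "mg = result (t_compose m g)"
  have M1x: "2 * M1 + 5 * N \<le> Mx" using M by (simp add: M1_def)
  have I: "N + length C * (2 * N + 1) \<le> Mx" using M by simp
  note T = time_interp_from[OF t_ident_correct bounded_ident C d I N]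
  have rU: "represents U u" unfolding U_def u_def interp_def by (rule t_interp_from_correct[OF t_ident_correct C(1)])
  have bu: "bounded_psum M1 d N u" using T(2) by (simp add: u_def interp_def M1_def)
  have rk: "represents k (ket x)" unfolding k_def by (rule t_ket_correct)
  have bk: "bounded_psum 0 d N (ket x)" using bounded_ket[of d x] by (simp add: x_def)
  have rg: "represents g gs" unfolding g_def gs_def output_psum_def u_def[symmetric] using rU rk by (rule t_compose_correct)
  have bg: "bounded_psum (M1 + N) d N gs" unfolding gs_def output_psum_def u_def[symmetric]
    using bounded_compose[OF bu bk d] by simp
  have rd: "represents (result (t_dagger g)) (dagger gs)" using rg by (rule t_dagger_correct)
  have bd: "bounded_psum (M1 + N) d N (dagger gs)" using bg by (rule bounded_dagger)
  have rp: "represents p proj1" by (simp add: p_def proj1_def represents_iff represents_set_def represents_poly_def pconst_def)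
  have rm2: "represents m2 (proj1 \<otimes> ident (N - i - 1))" unfolding m2_def J2_def using rp t_ident_correct by (rule t_tensor_correct)
  have bm2: "bounded_psum (0 + (N - i - 1)) d (1 + (N - i - 1)) (proj1 \<otimes> ident (N - i - 1))"
    by (rule bounded_tensor[OF bounded_proj1 bounded_ident])
  have rm: "represents m (ident i \<otimes> proj1 \<otimes> ident (N - i - 1))" unfolding m_def J1_def using t_ident_correct rm2 by (rule t_tensor_correct)
  have bm: "bounded_psum N d N (ident i \<otimes> proj1 \<otimes> ident (N - i - 1))"
    using bounded_psum_mono[OF bounded_tensor[OF bounded_ident bm2, of i], of N N] i by simp
  have rmg: "represents mg ((ident i \<otimes> proj1 \<otimes> ident (N - i - 1)) \<odot> gs)" unfolding mg_def using rm rg by (rule t_compose_correct)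
  have bmg: "bounded_psum (N + (M1 + N) + N) d N ((ident i \<otimes> proj1 \<otimes> ident (N - i - 1)) \<odot> gs)" by (rule bounded_compose[OF bm bg d])
  have "bounded_psum (M1 + N + (N + (M1 + N) + N) + N) d N (dagger gs \<odot> (ident i \<otimes> proj1 \<otimes> ident (N - i - 1)) \<odot> gs)"
    by (rule bounded_compose[OF bd bmg d])
  then show "bounded_psum Mx d N (measurement_psum N C x i)"
    unfolding measurement_psum_def Let_def gs_def[symmetric] by (rule bounded_psum_mono) (use M1x in auto)
  have NB: "N \<le> ?B" using N by (simp add: size_bound_def)
  have sz: "sized ?B U" "sized ?B k" "sized ?B g" "sized ?B (result (t_dagger g))" "sized ?B J1" "sized ?B J2" "sized ?B p" "sized ?B m2" "sized ?B m" "sized ?B mg"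
    subgoal by (rule sized_represents_le[OF rU bu _ N d1]) (use M1x in simp)
    subgoal by (rule sized_represents_le[OF rk bk _ N d1]) simp
    subgoal by (rule sized_represents_le[OF rg bg _ N d1]) (use M1x in simp)
    subgoal by (rule sized_represents_le[OF rd bd _ N d1]) (use M1x in simp)
    subgoal unfolding J1_def by (rule sized_represents_le[OF t_ident_correct bounded_ident _ _ d1]) (use M1x N i in simp_all)
    subgoal unfolding J2_def by (rule sized_represents_le[OF t_ident_correct bounded_ident _ _ d1]) (use M1x N i in simp_all)
    subgoal by (rule sized_represents_le[OF rp bounded_proj1 _ _ d1]) (use N i in simp_all)
    subgoal by (rule sized_represents_le[OF rm2 bm2 _ _ d1]) (use M1x N i in simp_all)
    subgoal by (rule sized_represents_le[OF rm bm _ N d1]) (use M1x in simp)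
    subgoal by (rule sized_represents_le[OF rmg bmg _ N d1]) (use M1x in simp)
    done
  have "time (t_measurement_psum N C x i) = 1 + time (t_ident N) + time (t_interp_from N (result (t_ident N)) C) + time (t_ket x) + time (t_compose U k) +
    time (t_dagger g) + time (t_ident i) + time (t_ident (N - i - 1)) + time (t_tensor p J2) + time (t_tensor J1 m2) + time (t_compose m g) + time (t_compose (result (t_dagger g)) mg)"
    unfolding t_measurement_psum_def U_def k_def g_def J1_def J2_def p_def m2_def m_def mg_def by simp
  moreover have "time (t_dagger g) = 1" by (simp add: t_dagger_def)
  moreover have "time (t_ket x) \<le> N + 2" using time_ket[of x] by (simp add: x_def)
  moreover have "time (t_ident (N - i - 1)) \<le> 2 * N + 3" "time (t_ident i) \<le> 2 * N + 3"
    using time_ident[of "N - i - 1"] time_ident[of i] i by linarith+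
  ultimately show "time (t_measurement_psum N C x i) \<le> c_measure (length C) ?B"
    using time_ident[of N] T(1) time_compose[OF sz(1,2)] time_tensor[OF sz(7,6)] time_tensor[OF sz(5,8)]
      time_compose[OF sz(9,3)] time_compose[OF sz(4,10)] NB
    unfolding c_measure_def by linarith
qed

text \<open>Equality with a polynomial instead of a bound by one: the cost functions are built from
  sums, products and powers, under which this is closed.\<close>

definition poly_bounded :: "(nat \<Rightarrow> nat) \<Rightarrow> bool" where
  "poly_bounded f \<longleftrightarrow> (\<exists>p :: nat poly. \<forall>n. f n = poly p n)"

lemma poly_bounded_const: "poly_bounded (\<lambda>_. c)"
  unfolding poly_bounded_def by (rule exI[of _ "[:c:]"]) simp

lemma poly_bounded_id: "poly_bounded (\<lambda>n. n)"
  unfolding poly_bounded_def by (rule exI[of _ "[:0, 1:]"]) simp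

lemma poly_bounded_add: "poly_bounded f \<Longrightarrow> poly_bounded g \<Longrightarrow> poly_bounded (\<lambda>n. f n + g n)"
  unfolding poly_bounded_def by (metis poly_add)

lemma poly_bounded_mult: "poly_bounded f \<Longrightarrow> poly_bounded g \<Longrightarrow> poly_bounded (\<lambda>n. f n * g n)"
  unfolding poly_bounded_def by (metis poly_mult)

lemma poly_bounded_power: "poly_bounded f \<Longrightarrow> poly_bounded (\<lambda>n. f n ^ k)"
  unfolding poly_bounded_def by (metis poly_power)

lemmas poly_bounded_arith = poly_bounded_add poly_bounded_mult poly_bounded_power poly_bounded_const poly_bounded_id

lemma poly_bounded_costs:
  assumes a: "poly_bounded a" and b: "poly_bounded b" and c: "poly_bounded c" and e: "poly_bounded e"
  shows "poly_bounded (\<lambda>n. c_eq (a n))" "poly_bounded (\<lambda>n. c_toggle (a n) (b n))" "poly_bounded (\<lambda>n. c_padd (a n) (b n) (c n))"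
    "poly_bounded (\<lambda>n. c_psum_list (a n) (b n) (c n))" "poly_bounded (\<lambda>n. c_mono_mul (a n) (b n) (c n))"
    "poly_bounded (\<lambda>n. c_pmul (a n) (b n) (c n) (e n))" "poly_bounded (\<lambda>n. c_psubst (a n) (b n) (c n) (e n))"
    "poly_bounded (\<lambda>n. c_HH (a n) (b n) (c n))" "poly_bounded (\<lambda>n. c_reducts_at (a n) (b n) (c n))" "poly_bounded (\<lambda>n. c_reducts (a n) (b n) (c n))"
    "poly_bounded (\<lambda>n. c_shift (a n))" "poly_bounded (\<lambda>n. c_compose (a n))" "poly_bounded (\<lambda>n. c_tensor (a n))" "poly_bounded (\<lambda>n. c_place (a n))"
    "poly_bounded (\<lambda>n. c_step (a n))" "poly_bounded (\<lambda>n. c_loop (a n) (b n))" "poly_bounded (\<lambda>n. c_measure (a n) (b n))"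
  unfolding c_measure_def c_loop_def c_step_def c_place_def c_tensor_def c_compose_def c_shift_def c_reducts_def c_reducts_at_def c_HH_def
    c_psubst_def c_pmul_def c_mono_mul_def c_psum_list_def c_padd_def c_toggle_def c_eq_def
  by (intro poly_bounded_arith assms)+

text \<open>The first Hadamard layer alone has \<open>2 * n\<close> gates, which lets the volume
  dominate the number of qubits. The bound \<open>m + 1\<close> counts the controls and the
  target.\<close>

lemma hidden_shift_gates:
  assumes "hidden_shift_circuit m n \<pi> f0 s C" "1 \<le> m"
  shows "circuit_on (2 * n) C" "\<forall>g\<in>set C. length (wires g) \<le> m + 1" "2 * n \<le> length C"
proof -
  let ?N = "2 * n"
  obtain L1 CG L2 CF L3 where h: "C = L1 @ CG @ L2 @ CF @ L3" "H_layer ?N L1" "H_layer ?N L2" "H_layer ?N L3"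
    "implements_phase m ?N (G_phase n \<pi> f0 s) CG" "implements_phase m ?N (F_phase n \<pi> f0) CF"
    using assms(1) unfolding hidden_shift_circuit_def by blast
  show "circuit_on ?N C" by (rule presents_layers(1)[OF h(2-6) h(1)])
  have o: "length (wires g) \<le> m + 1" if "oracle_gate m g" for g using that assms(2) by (cases g) auto
  have H: "length (wires g) \<le> m + 1" if "H_layer ?N L" "g \<in> set L" for g L
  proof -
    obtain qs where "L = map HGate qs" using \<open>H_layer ?N L\<close> unfolding H_layer_def by blast
    then obtain q where "g = HGate q" using \<open>g \<in> set L\<close> by (metis in_set_conv_nth nth_map length_map)
    then show ?thesis by simp
  qed
  note O = h(5,6)[unfolded implements_phase_def, THEN conjunct2, THEN conjunct1, rule_format]
  show "\<forall>g\<in>set C. length (wires g) \<le> m + 1"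
  proof
    fix g assume "g \<in> set C"
    then consider "g \<in> set L1" | "g \<in> set L2" | "g \<in> set L3" | "g \<in> set CG" | "g \<in> set CF" unfolding h(1) by auto
    then show "length (wires g) \<le> m + 1"
    proof cases
      case 1 then show ?thesis by (rule H[OF h(2)])
    next
      case 2 then show ?thesis by (rule H[OF h(3)])
    next
      case 3 then show ?thesis by (rule H[OF h(4)])
    next
      case 4 then show ?thesis by (rule o[OF O(1)])
    next
      case 5 then show ?thesis by (rule o[OF O(2)])
    qed
  qed
  have "length (filter is_H L1) = ?N" using H_layer_circuit[OF h(2)] by blast
  then show "?N \<le> length C" using length_filter_le[of is_H L1] unfolding h(1) by simp
qed

text \<open>The polynomial depends on \<open>m\<close> only. The bound is claimed for all choices
  made in the runs; termination and the existence of runs keep this from being vacuous. The times of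
  the \<open>2 * n\<close> runs are added up because the shift is built bit by bit.\<close>

theorem corollary24:
  fixes m :: nat
  assumes "m \<ge> 1"
  shows "\<exists>p :: nat poly. \<forall>n \<pi> f0 s C. hidden_shift_circuit m n \<pi> f0 s C \<longrightarrow>
    (let N = 2 * n; x = replicate N 0 in
      (\<forall>i<N. (\<nexists>F. F 0 = measurement_psum N C x i \<and> (\<forall>k. F k \<leadsto> F (Suc k))) \<and>
             (\<exists>r t. measurement_run N C x i r t)) \<and>
      (\<forall>r t. (\<forall>i<N. measurement_run N C x i (r i) (t i)) \<longrightarrow>
         (\<forall>i<N. r i = (if s ! i = 1 then 1 else 0)) \<and>
         (\<Sum>i<N. t i) \<le> poly p (volume N C)))"
proof -
  \<comment> \<open>For volume \<open>v\<close> the measurement path sum has at most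
    \<open>2 * (N + length C * (2 * N + 1)) + 5 * N\<close> variables, that is
    \<open>7 * N + 4 * v + 2 * length C\<close>. As \<open>N\<close> and \<open>length C\<close> are
    at most \<open>v\<close>, this is at most \<open>13 * v\<close>. The degree \<open>m + 1\<close>
    comes from the largest controlled gate.\<close>
  define B where "B v = size_bound (13 * v) (m + 1) v" for v
  \<comment> \<open>The leading factor \<open>v\<close> bounds the number of qubits, each of which
    takes one run.\<close>
  define T where "T v = v * (c_measure v (B v) + c_loop (13 * v) (B v))" for v
  have "poly_bounded B" unfolding B_def size_bound_def by (intro poly_bounded_arith)
  then have "poly_bounded T" unfolding T_def
    by (intro poly_bounded_arith poly_bounded_costs[where c = "\<lambda>_. 0" and e = "\<lambda>_. 0"])
  then obtain p where p: "T v = poly p v" for v unfolding poly_bounded_def by blast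
  show ?thesis
  proof (intro exI[of _ p] allI impI)
    fix n \<pi> f0 s C assume h: "hidden_shift_circuit m n \<pi> f0 s C"
    define N where "N = 2 * n"
    define x :: "bit list" where "x = replicate N 0"
    let ?f = "measurement_psum N C x"
    let ?v = "volume N C"
    note G = hidden_shift_gates[OF h assms, folded N_def]
    have wf: "well_formed (?f i)" for i using G(1) by (rule well_formed_measurement_psum)
    have cf: "closed_form (?f i)" and amp: "amplitude (?f i) = (if s ! i = 1 then 1 else 0)" if "i < N" for i
      using hidden_shift_measurement[OF h, of i] that wf[of i] by (simp_all add: closed_form_def amplitude_def N_def x_def)
    have t: "t \<le> c_measure ?v (B ?v) + c_loop (13 * ?v) (B ?v)" if i: "i < N" and run: "measurement_run N C x i r t" for i r t
    proof -
      obtain t' where t': "loop_run (?f i) r t'" "t = time (t_measurement_psum N C x i) + t'"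
        using run unfolding measurement_run_def by blast
      \<comment> \<open>Both factors of the volume are positive as \<open>i < N\<close>, hence each
        is at most the volume.\<close>
      have L: "1 \<le> N" "1 \<le> length C" using i G(3) by linarith+
      then have v: "N \<le> ?v" "length C \<le> ?v" by (simp_all add: volume_def)
      have "length C * (2 * N + 1) = 2 * ?v + length C" by (simp add: volume_def algebra_simps)
      moreover have "2 * (N + K) + 5 * N \<le> 13 * ?v" if "K = 2 * ?v + length C" for K
      proof -
        have "7 * N + 2 * length C \<le> 7 * ?v + 2 * ?v" using v by (intro add_mono mult_left_mono) simp_all
        then show ?thesis using that by simp
      qed
      ultimately have Mx: "2 * (N + length C * (2 * N + 1)) + 5 * N \<le> 13 * ?v" by blast
      have d: "2 \<le> m + 1" using assms by simp
      note M = time_measurement[OF G(1,2) d i Mx v(1), folded x_def]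
      have "c_measure (length C) (B ?v) \<le> c_measure ?v (B ?v)"
        unfolding c_measure_def using v(2) by (intro add_mono mult_right_mono) auto
      then have 1: "time (t_measurement_psum N C x i) \<le> c_measure ?v (B ?v)" using M(1) by (simp add: B_def)
      have deg: "\<forall>u\<in>phase (?f i). card u \<le> m + 1" "card (vars (?f i)) \<le> 13 * ?v" using M(2) by (simp_all add: bounded_psum_def)
      have "t' \<le> c_loop (card (vars (?f i))) (B ?v)"
        unfolding B_def by (rule loop_run_time[OF t'(1) cf[OF i] deg]) simp
      also have "\<dots> \<le> c_loop (13 * ?v) (B ?v)"
        unfolding c_loop_def using deg(2) by (intro add_mono mult_right_mono) auto
      finally show ?thesis using 1 t'(2) by simp
    qed
    have run: "\<exists>r t. measurement_run N C x i r t" if "i < N" for i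
      using ex_loop_run[OF cf[OF that]] unfolding measurement_run_def by blast
    have res: "r = (if s ! i = 1 then 1 else 0)" if "i < N" "measurement_run N C x i r t" for i r t
      using loop_run_result[OF _ cf[OF that(1)]] that amp unfolding measurement_run_def by auto
    have stops: "\<nexists>F. F 0 = ?f i \<and> (\<forall>k. F k \<leadsto> F (Suc k))" if "i < N" for i
      using closed_form_terminates cf[OF that] by metis
    have sum: "(\<Sum>i<N. t i) \<le> poly p ?v" if r: "\<forall>i<N. measurement_run N C x i (r i) (t i)" for r t
    proof (cases "N = 0")
      case True then show ?thesis by simp
    next
      case False
      then have "N \<le> ?v" using G(3) by (simp add: volume_def)
      have "(\<Sum>i<N. t i) \<le> (\<Sum>i<N. c_measure ?v (B ?v) + c_loop (13 * ?v) (B ?v))"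
        using t r by (intro sum_mono) blast
      also have "\<dots> \<le> T ?v" unfolding T_def using \<open>N \<le> ?v\<close> by simp
      finally show ?thesis by (simp only: p)
    qed
    show "let N = 2 * n; x = replicate N 0 in
      (\<forall>i<N. (\<nexists>F. F 0 = measurement_psum N C x i \<and> (\<forall>k. F k \<leadsto> F (Suc k))) \<and>
             (\<exists>r t. measurement_run N C x i r t)) \<and>
      (\<forall>r t. (\<forall>i<N. measurement_run N C x i (r i) (t i)) \<longrightarrow>
         (\<forall>i<N. r i = (if s ! i = 1 then 1 else 0)) \<and>
         (\<Sum>i<N. t i) \<le> poly p (volume N C))"
      unfolding Let_def N_def[symmetric] x_def[symmetric] using stops run res sum by blast
  qed
qed

end
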